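(* Let $B$ be an exchange matrix of finite type $D$. The fan $\operatorname{Trop}_{>0}\mathcal{M}_D$ is isomorphic to the cluster fan $\mathcal{N}(B^\vee)$.
   Context: Cluster set-up. $D$ is a connected finite type Dynkin diagram with vertex set $I=\{1,\dots,n\}$ and Cartan matrix $(a_{ij})$. Fix an orientation of the underlying tree of $D$, with edges written $i\to j$; the associated exchange matrix $B$ (of type $D$) has $B_{ij}=-a_{ij}$ if $i\to j$, $B_{ij}=a_{ij}$ if $j\to i$, and $B_{ij}=0$ otherwise. $D^\vee$ is the Dynkin diagram with transposed Cartan matrix and $B^\vee$ is the exchange matrix of type $D^\vee$ for the same orientation. The exchange relation at a seed with (extended) matrix $(b_{ij})$ is $x_kx_k'=\prod_{b_{ik}>0}x_i^{b_{ik}}+\prod_{b_{ik}<0}x_i^{-b_{ik}}$. Indexing. Put $x_{(0,i)}=x_i$ (initial cluster) and, for $t\ge1$, let the cluster $\{x_{(t,i)}\mid i\in I\}$ be obtained from $\{x_{(t-1,i)}\mid i\in I\}$ by mutating exactly once at each $i\in I$, always at a source of the current orientation ($i\to j$ iff $b_{ij}>0$). Let $r_i+1$ be the least positive $t$ such that $x_{(t,i)}$ is an initial variable and write $x_{(r_i+1,i)}=x_{(0,i^* )}$; $i\mapsto i^*$ is an involution of $I$. Set $\Pi=\{(s,i)\mid i\in I,\ 0\le s\le r_i\}$; then $\gamma\mapsto x_\gamma$ is a bijection from $\Pi$ to the set of mutable cluster variables. Put $(-1,i):=(r_{i^*},i^* )$ and let $\tau:\Pi\to\Pi$ be the bijection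 $\tau(t,j)=(t-1,j)$. Compatibility degree. $(\omega\|\gamma)\in\mathbb{Z}_{\ge0}$, for $\omega,\gamma\in\Pi$, is the unique function with $(\tau\omega\|\tau\gamma)=(\omega\|\gamma)$ and such that $((0,i)\|\gamma)$ is $\max(0,d_i)$, where $d_i$ is the exponent of $x_i$ in the denominator of the Laurent expansion of $x_\gamma$ in the initial cluster (so $(\gamma\|\gamma)=0$). Cluster configuration space. $\mathcal{M}_D=\operatorname{Spec}(\mathbb{C}[u_\gamma^{\pm1}\mid\gamma\in\Pi]/I_D)$, where $I_D$ is generated by $R_\gamma=u_\gamma+\prod_{\omega\in\Pi}u_\omega^{(\omega\|\gamma)}-1$, $\gamma\in\Pi$. Positive tropicalization. $\mathcal{R}=\bigcup_{n\ge1}\mathbb{R}((t^{1/n}))$ is the field of real Puiseux series, $\mathrm{val}(x(t))=r$ if the lowest term of $x(t)$ is $\alpha t^r$ with $\alpha\in\mathbb{R}^\times$, and $\mathcal{R}_{>0}$ is the set of nonzero series whose lowest coefficient is positive. $\mathcal{M}_D(\mathcal{R}_{>0})$ is the set of collections $(u_\gamma(t))_{\gamma\in\Pi}\in\mathcal{R}_{>0}^\Pi$ satisfying the relations $R_\gamma=0$. $\operatorname{Trop}_{>0}\mathcal{M}_D\subset\mathbb{R}^\Pi$ is the closure of $\{(\mathrm{val}(u_\gamma(t)))_{\gamma\in\Pi}\mid u(t)\in\mathcal{M}_D(\mathcal{R}_{>0})\}$. Fan structure. The principal coefficient cluster algebra of $B$ has $2n\times n$ extended matrix with top half $B$ and bottom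 half the identity, with frozen variables $y_1,\dots,y_n$; $F_\gamma(\mathbf{y})$ is obtained from the Laurent expansion of $x_\gamma$ in it by setting $x_1=\dots=x_n=1$. On $\mathcal{M}_D$ one has $u_\gamma=f_\gamma(\mathbf{y})$ where, for $\gamma=(t,j)$, $f_\gamma(\mathbf{y})=\dfrac{\varepsilon\prod_{i\to j}F_{(t,i)}^{-a_{ij}}\prod_{j\to i}F_{(t-1,i)}^{-a_{ij}}}{F_{(t-1,j)}F_{(t,j)}}$ with $\varepsilon=y_j$ if $t=0$ and $\varepsilon=1$ otherwise. This gives a bijection $\mathcal{M}_D(\mathcal{R}_{>0})\cong\mathcal{R}_{>0}^n$ and a piecewise-linear homeomorphism $\mathbb{R}^n\to\operatorname{Trop}_{>0}\mathcal{M}_D$ whose components are the tropicalizations $\operatorname{Trop}(f_\gamma)$ (replace $y_i,+,\times,\div$ by $Y_i,\min,+,-$). The maximal cones of the fan $\operatorname{Trop}_{>0}\mathcal{M}_D\subset\mathbb{R}^\Pi$ are the images of the maximal common domains of linearity of these functions. Two fans are isomorphic if there is a homeomorphism between their supports taking cones bijectively to cones and linear on each cone. Cluster fan. Giving $\deg x_i=e_i$, $\deg y_i=-Be_i$ in the principal coefficient cluster algebra, each $x_\gamma$ is homogeneous, of degree its $\mathbf{g}$-vector. $\mathcal{N}(B)$ is the fan in $\mathbb{R}^n$ whose cones are spanned by the $\mathbf{g}$-vectors of sets of cluster variables contained in a common cluster; $\mathcal{N}(B^\vee)$ is the same for $B^\vee$. *)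

theory Defs
  imports
    "HOL-Analysis.Analysis"
    "HOL-Library.Poly_Mapping"
    "HOL-Library.Function_Algebras"
    "HOL-Computational_Algebra.Fraction_Field"
    "HOL-Computational_Algebra.Formal_Laurent_Series"
begin

section \<open>The real vector space structure on functions\<close>

text \<open>For a set \<open>\<Pi>\<close> of labels, the space of real vectors indexed by \<open>\<Pi>\<close> is modelled by the
  real functions that vanish off \<open>\<Pi>\<close>. The topology is the product topology of
  HOL-Analysis.\<close>

instantiation "fun" :: (type, real_vector) real_vector
begin

definition scaleR_fun :: "real \<Rightarrow> ('a \<Rightarrow> 'b) \<Rightarrow> 'a \<Rightarrow> 'b"
  where "scaleR_fun c f = (\<lambda>x. c *\<^sub>R f x)"

instance
  by intro_classes (auto simp: scaleR_fun_def fun_eq_iff scaleR_add_right scaleR_add_left)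

end


section \<open>Real Puiseux series\<close>

text \<open>The pair \<open>(m, f)\<close> with \<open>m > 0\<close> stands for the series \<open>f\<close> evaluated at the \<open>m\<close>-th root of
  \<open>t\<close>. Two pairs are identified when they agree after rewriting both as Laurent series in the
  \<open>m n\<close>-th root of \<open>t\<close>; so the quotient is the union over \<open>m\<close> of the fields of Laurent
  series in the \<open>m\<close>-th root of \<open>t\<close>.\<close>

definition puiseux_rel :: "nat \<times> real fls \<Rightarrow> nat \<times> real fls \<Rightarrow> bool" where
  "puiseux_rel p q \<longleftrightarrow> fst p > 0 \<and> fst q > 0 \<and>
     fls_compose_power (snd p) (fst q) = fls_compose_power (snd q) (fst p)"

lemma fls_compose_power_compose:
  assumes "a > 0" "b > 0"
  shows "fls_compose_power (fls_compose_power f a) b = fls_compose_power f (a * b)"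
proof (rule fls_eqI)
  fix n :: int
  show "fls_nth (fls_compose_power (fls_compose_power f a) b) n = fls_nth (fls_compose_power f (a * b)) n"
  proof (cases "int b dvd n")
    case True
    then obtain k where "n = int b * k" by (auto elim: dvdE)
    then show ?thesis
      using assms by (auto simp: fls_nth_compose_power mult.commute)
  next
    case False
    then have "\<not> int (a * b) dvd n"
      by (metis dvd_mult_right of_nat_mult)
    then show ?thesis
      using assms False by (simp add: fls_nth_compose_power)
  qed
qed

lemma fls_compose_power_inject:
  assumes "d > 0" "fls_compose_power f d = fls_compose_power g d"
  shows "f = g"
proof (rule fls_eqI)
  fix n :: int
  have "fls_nth (fls_compose_power f d) (int d * n) = fls_nth (fls_compose_power g d) (int d * n)"
    using assms by simp
  then show "fls_nth f n = fls_nth g n"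
    using assms(1) by (simp add: fls_nth_compose_power)
qed

lemma fls_compose_power_eq_0_iff:
  "d > 0 \<Longrightarrow> fls_compose_power f d = 0 \<longleftrightarrow> f = 0"
  by (metis fls_compose_power_0_left fls_compose_power_inject)

lemma fls_compose_power_inverse:
  fixes f :: "real fls"
  assumes "d > 0"
  shows "fls_compose_power (inverse f) d = inverse (fls_compose_power f d)"
proof (cases "f = 0")
  case False
  then have "inverse f * f = 1" by simp
  then have "fls_compose_power (inverse f) d * fls_compose_power f d = 1"
    using assms by (metis fls_compose_power_1_left fls_compose_power_mult)
  then show ?thesis
    using inverse_unique mult.commute by metis
qed simp

lemma fls_subdegree_compose_power:
  fixes f :: "real fls"
  assumes "d > 0"
  shows "fls_subdegree (fls_compose_power f d) = int d * fls_subdegree f"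
proof (cases "f = 0")
  case False
  show ?thesis
  proof (rule fls_subdegree_eqI)
    show "fls_nth (fls_compose_power f d) (int d * fls_subdegree f) \<noteq> 0"
      using assms False by (simp add: fls_nth_compose_power)
  next
    fix k assume k: "k < int d * fls_subdegree f"
    show "fls_nth (fls_compose_power f d) k = 0"
    proof (cases "int d dvd k")
      case True
      then obtain l where l: "k = int d * l" by (auto elim: dvdE)
      then have "l < fls_subdegree f" using k assms by simp
      then show ?thesis using l assms by (simp add: fls_nth_compose_power)
    qed (use assms in \<open>simp add: fls_nth_compose_power\<close>)
  qed
qed simp

quotient_type puiseux = "nat \<times> real fls" / partial: puiseux_rel
proof (rule part_equivpI)
  show "\<exists>x. puiseux_rel x x"
    by (rule exI[of _ "(1, 0)"]) (simp add: puiseux_rel_def)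
  show "symp puiseux_rel"
    by (auto simp: symp_def puiseux_rel_def)
  show "transp puiseux_rel"
  proof (rule transpI)
    fix x y z
    assume xy: "puiseux_rel x y" and yz: "puiseux_rel y z"
    obtain m f n g p h where [simp]: "x = (m, f)" "y = (n, g)" "z = (p, h)"
      by (metis surj_pair)
    have pos: "m > 0" "n > 0" "p > 0"
      and e: "fls_compose_power f n = fls_compose_power g m"
             "fls_compose_power g p = fls_compose_power h n"
      using xy yz by (auto simp: puiseux_rel_def)
    have "fls_compose_power (fls_compose_power f p) n = fls_compose_power (fls_compose_power f n) p"
      using pos by (simp add: fls_compose_power_compose mult.commute)
    also have "\<dots> = fls_compose_power (fls_compose_power g p) m"
      using pos by (simp add: e(1) fls_compose_power_compose mult.commute)
    also have "\<dots> = fls_compose_power (fls_compose_power h m) n"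
      using pos by (simp add: e(2) fls_compose_power_compose mult.commute)
    finally show "puiseux_rel x z"
      using pos fls_compose_power_inject by (auto simp: puiseux_rel_def)
  qed
qed

lemma puiseux_rel_Pair:
  "puiseux_rel (m, f) (n, g) \<longleftrightarrow>
     m > 0 \<and> n > 0 \<and> fls_compose_power f n = fls_compose_power g m"
  by (simp add: puiseux_rel_def)

lemma fls_compose_power_swap:
  assumes "a > 0" "b > 0" "c > 0" "d > 0" "fls_compose_power f c = fls_compose_power g a"
  shows "fls_compose_power (fls_compose_power f b) (c * d) =
         fls_compose_power (fls_compose_power g d) (a * b)"
proof -
  have "fls_compose_power (fls_compose_power f b) (c * d) =
        fls_compose_power (fls_compose_power f c) (b * d)"
    using assms(1-4) by (simp add: fls_compose_power_compose ac_simps)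
  also have "\<dots> = fls_compose_power (fls_compose_power g d) (a * b)"
    unfolding assms(5) using assms(1-4) by (simp add: fls_compose_power_compose ac_simps)
  finally show ?thesis .
qed

instantiation puiseux :: field
begin

lift_definition zero_puiseux :: puiseux is "(1, 0)"
  by (simp add: puiseux_rel_def)

lift_definition one_puiseux :: puiseux is "(1, 1)"
  by (simp add: puiseux_rel_def)

lift_definition plus_puiseux :: "puiseux \<Rightarrow> puiseux \<Rightarrow> puiseux" is
  "\<lambda>(m, f) (n, g). (m * n, fls_compose_power f n + fls_compose_power g m)"
proof (clarsimp simp: puiseux_rel_Pair)
  fix m n m' n' :: nat and f g f' g' :: "real fls"
  assume pos: "0 < m" "0 < n" "0 < m'" "0 < n'"
    and e: "fls_compose_power f n = fls_compose_power g m"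
      "fls_compose_power f' n' = fls_compose_power g' m'"
  show "fls_compose_power (fls_compose_power f m') (n * n') +
        fls_compose_power (fls_compose_power f' m) (n * n') =
        fls_compose_power (fls_compose_power g n') (m * m') +
        fls_compose_power (fls_compose_power g' n) (m * m')"
    using fls_compose_power_swap[of m m' n n' f g] fls_compose_power_swap[of m' m n' n f' g']
      pos e by (simp add: mult.commute)
qed

lift_definition uminus_puiseux :: "puiseux \<Rightarrow> puiseux" is "\<lambda>(m, f). (m, - f)"
  by (auto simp: puiseux_rel_Pair)

lift_definition times_puiseux :: "puiseux \<Rightarrow> puiseux \<Rightarrow> puiseux" is
  "\<lambda>(m, f) (n, g). (m * n, fls_compose_power f n * fls_compose_power g m)"
proof (clarsimp simp: puiseux_rel_Pair)
  fix m n m' n' :: nat and f g f' g' :: "real fls"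
  assume pos: "0 < m" "0 < n" "0 < m'" "0 < n'"
    and e: "fls_compose_power f n = fls_compose_power g m"
      "fls_compose_power f' n' = fls_compose_power g' m'"
  show "fls_compose_power (fls_compose_power f m') (n * n') *
        fls_compose_power (fls_compose_power f' m) (n * n') =
        fls_compose_power (fls_compose_power g n') (m * m') *
        fls_compose_power (fls_compose_power g' n) (m * m')"
    using fls_compose_power_swap[of m m' n n' f g] fls_compose_power_swap[of m' m n' n f' g']
      pos e by (simp add: mult.commute)
qed

lift_definition inverse_puiseux :: "puiseux \<Rightarrow> puiseux" is "\<lambda>(m, f). (m, inverse f)"
  by (auto simp: puiseux_rel_Pair fls_compose_power_inverse)

definition minus_puiseux :: "puiseux \<Rightarrow> puiseux \<Rightarrow> puiseux" where
  "minus_puiseux x y = x + - y"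

definition divide_puiseux :: "puiseux \<Rightarrow> puiseux \<Rightarrow> puiseux" where
  "divide_puiseux x y = x * inverse y"

instance
proof
  fix a b c :: puiseux
  show "a + b + c = a + (b + c)"
    by transfer (auto simp: puiseux_rel_Pair fls_compose_power_compose algebra_simps)
  show "a + b = b + a"
    by transfer (auto simp: puiseux_rel_Pair fls_compose_power_compose algebra_simps)
  show "0 + a = a"
    by transfer (auto simp: puiseux_rel_Pair fls_compose_power_compose algebra_simps)
  show "- a + a = 0"
    by transfer (auto simp: puiseux_rel_Pair fls_compose_power_compose algebra_simps)
  show "a - b = a + - b"
    by (simp add: minus_puiseux_def)
  show "a * b * c = a * (b * c)"
    by transfer (auto simp: puiseux_rel_Pair fls_compose_power_compose algebra_simps)
  show "a * b = b * a"
    by transfer (auto simp: puiseux_rel_Pair fls_compose_power_compose algebra_simps)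
  show "1 * a = a"
    by transfer (auto simp: puiseux_rel_Pair fls_compose_power_compose algebra_simps)
  show "(a + b) * c = a * c + b * c"
    by transfer (auto simp: puiseux_rel_Pair fls_compose_power_compose algebra_simps)
  show "(0::puiseux) \<noteq> 1"
    by transfer (auto simp: puiseux_rel_Pair)
  show "a \<noteq> 0 \<Longrightarrow> inverse a * a = 1"
    by transfer (auto simp: puiseux_rel_Pair fls_compose_power_inverse fls_compose_power_eq_0_iff)
  show "a div b = a * inverse b"
    by (simp add: divide_puiseux_def)
  show "inverse (0::puiseux) = 0"
    by transfer (auto simp: puiseux_rel_Pair)
qed

end

lift_definition puiseux_val :: "puiseux \<Rightarrow> real" is
  "\<lambda>(m, f). real_of_int (fls_subdegree f) / real m"
proof (clarsimp simp: puiseux_rel_Pair)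
  fix m n :: nat and f g :: "real fls"
  assume pos: "0 < m" "0 < n" and e: "fls_compose_power f n = fls_compose_power g m"
  have "int n * fls_subdegree f = int m * fls_subdegree g"
    using fls_subdegree_compose_power[of n f] fls_subdegree_compose_power[of m g] pos e by simp
  then have "real n * real_of_int (fls_subdegree f) = real m * real_of_int (fls_subdegree g)"
    by (metis of_int_mult of_int_of_nat_eq)
  then show "real_of_int (fls_subdegree f) / real m = real_of_int (fls_subdegree g) / real n"
    using pos by (simp add: field_simps)
qed

lift_definition puiseux_lead_coeff :: "puiseux \<Rightarrow> real" is
  "\<lambda>(m, f). fls_nth f (fls_subdegree f)"
proof (clarsimp simp: puiseux_rel_Pair)
  fix m n :: nat and f g :: "real fls"
  assume pos: "0 < m" "0 < n" and e: "fls_compose_power f n = fls_compose_power g m"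
  have "fls_nth f (fls_subdegree f) = 
      fls_nth (fls_compose_power f n) (fls_subdegree (fls_compose_power f n))"
    using pos by (simp add: fls_subdegree_compose_power fls_nth_compose_power)
  also have "\<dots> = fls_nth g (fls_subdegree g)"
    using pos e by (simp add: fls_subdegree_compose_power fls_nth_compose_power)
  finally show "fls_nth f (fls_subdegree f) = fls_nth g (fls_subdegree g)" .
qed

text \<open>The lead coefficient of \<open>0\<close> is \<open>0\<close>, so positive series are nonzero.\<close>

definition puiseux_positive :: "puiseux \<Rightarrow> bool" where
  "puiseux_positive x \<longleftrightarrow> puiseux_lead_coeff x > 0"


section \<open>Dynkin diagrams, orientations, exchange matrices\<close>

text \<open>The vertex set is a finite type \<open>'n\<close>; a Dynkin diagram is given by its Cartan matrix. The
  linear order assumed on \<open>'n\<close> from the Laurent polynomials on is only used by the library to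
  show that these form an integral domain.\<close>

definition finite_type_cartan :: "('n::finite \<Rightarrow> 'n \<Rightarrow> int) \<Rightarrow> bool" where
  "finite_type_cartan a \<longleftrightarrow>
     (\<forall>i. a i i = 2) \<and>
     (\<forall>i j. i \<noteq> j \<longrightarrow> a i j \<le> 0) \<and>
     (\<forall>i j. a i j = 0 \<longleftrightarrow> a j i = 0) \<and>
     (\<exists>d :: 'n \<Rightarrow> real. (\<forall>i. d i > 0) \<and>
        (\<forall>i j. d i * of_int (a i j) = d j * of_int (a j i)) \<and>
        (\<forall>v :: real^'n. v \<noteq> 0 \<longrightarrow>
           (\<Sum>i\<in>UNIV. \<Sum>j\<in>UNIV. d i * of_int (a i j) * v $ i * v $ j) > 0))"

definition connected_diagram :: "('n \<Rightarrow> 'n \<Rightarrow> int) \<Rightarrow> bool" where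
  "connected_diagram a \<longleftrightarrow> (\<forall>i j. (i, j) \<in> {(k, l). a k l \<noteq> 0}\<^sup>*)"

definition orientation :: "('n \<Rightarrow> 'n \<Rightarrow> int) \<Rightarrow> ('n \<Rightarrow> 'n \<Rightarrow> bool) \<Rightarrow> bool" where
  "orientation a E \<longleftrightarrow>
     (\<forall>i j. E i j \<longrightarrow> i \<noteq> j \<and> a i j \<noteq> 0) \<and>
     (\<forall>i j. i \<noteq> j \<and> a i j \<noteq> 0 \<longrightarrow> (E i j \<longleftrightarrow> \<not> E j i))"

definition dual_cartan :: "('n \<Rightarrow> 'n \<Rightarrow> int) \<Rightarrow> 'n \<Rightarrow> 'n \<Rightarrow> int" where
  "dual_cartan a = (\<lambda>i j. a j i)"

definition exchange_matrix ::
  "('n \<Rightarrow> 'n \<Rightarrow> int) \<Rightarrow> ('n \<Rightarrow> 'n \<Rightarrow> bool) \<Rightarrow> 'n \<Rightarrow> 'n \<Rightarrow> int" where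
  "exchange_matrix a E = (\<lambda>i j. if E i j then - a i j else if E j i then a i j else 0)"


section \<open>Seeds and mutation\<close>

text \<open>In an extended exchange matrix the columns are indexed by the mutable directions \<open>'n\<close> and
  the rows by all variables \<open>'r\<close>; the map \<open>\<iota> :: 'n \<Rightarrow> 'r\<close> tells which variables are
  mutable.\<close>

type_synonym ('r, 'n, 'f) seed = "('r \<Rightarrow> 'n \<Rightarrow> int) \<times> ('r \<Rightarrow> 'f)"

definition mutate_matrix ::
  "('n \<Rightarrow> 'r) \<Rightarrow> 'n \<Rightarrow> ('r \<Rightarrow> 'n \<Rightarrow> int) \<Rightarrow> 'r \<Rightarrow> 'n \<Rightarrow> int" where
  "mutate_matrix \<iota> k b = (\<lambda>i j. if i = \<iota> k \<or> j = k then - b i j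
     else b i j + sgn (b i k) * max 0 (b i k * b (\<iota> k) j))"

definition mutate ::
  "('n \<Rightarrow> 'r::finite) \<Rightarrow> 'n \<Rightarrow> ('r, 'n, 'f::field) seed \<Rightarrow> ('r, 'n, 'f) seed" where
  "mutate \<iota> k s = (let b = fst s; x = snd s in
     (mutate_matrix \<iota> k b,
      x(\<iota> k := ((\<Prod>i\<in>{i. b i k > 0}. x i ^ nat (b i k)) +
                (\<Prod>i\<in>{i. b i k < 0}. x i ^ nat (- b i k))) / x (\<iota> k))))"

inductive_set reachable_seeds ::
  "('n \<Rightarrow> 'r::finite) \<Rightarrow> ('r, 'n, 'f::field) seed \<Rightarrow> ('r, 'n, 'f) seed set"
  for \<iota> :: "'n \<Rightarrow> 'r" and s :: "('r, 'n, 'f) seed" where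
  initial: "s \<in> reachable_seeds \<iota> s"
| step: "s' \<in> reachable_seeds \<iota> s \<Longrightarrow> mutate \<iota> k s' \<in> reachable_seeds \<iota> s"

text \<open>With \<open>i \<rightarrow> j\<close> iff the entry \<open>(i, j)\<close> is positive, \<open>k\<close> is a source iff no mutable \<open>j\<close> has
  \<open>j \<rightarrow> k\<close>.\<close>

definition is_source :: "('n \<Rightarrow> 'r) \<Rightarrow> ('r \<Rightarrow> 'n \<Rightarrow> int) \<Rightarrow> 'n \<Rightarrow> bool" where
  "is_source \<iota> b k \<longleftrightarrow> (\<forall>j. \<not> b (\<iota> j) k > 0)"

fun source_sequence ::
  "('n \<Rightarrow> 'r::finite) \<Rightarrow> ('r, 'n, 'f::field) seed \<Rightarrow> 'n list \<Rightarrow> bool" where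
  "source_sequence \<iota> s [] \<longleftrightarrow> True"
| "source_sequence \<iota> s (k # ks) \<longleftrightarrow>
     is_source \<iota> (fst s) k \<and> source_sequence \<iota> (mutate \<iota> k s) ks"

text \<open>Mutations at two sources commute, so the seed chosen here does not depend on the order of
  the mutations.\<close>

definition sweep :: "('n \<Rightarrow> 'r::finite) \<Rightarrow> ('r, 'n, 'f::field) seed \<Rightarrow> ('r, 'n, 'f) seed" where
  "sweep \<iota> s = (SOME s'. \<exists>ks. distinct ks \<and> set ks = UNIV \<and> source_sequence \<iota> s ks \<and>
     s' = fold (mutate \<iota>) ks s)"


section \<open>Laurent polynomials\<close>

type_synonym ('v, 'c) laurent = "('v \<Rightarrow>\<^sub>0 int) \<Rightarrow>\<^sub>0 'c"

definition laurent_var :: "'v \<Rightarrow> ('v, 'c::zero_neq_one) laurent" where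
  "laurent_var i = Poly_Mapping.single (Poly_Mapping.single i 1) 1"

definition laurent_const :: "'c \<Rightarrow> ('v, 'c::zero) laurent" where
  "laurent_const c = Poly_Mapping.single 0 c"

text \<open>The field of fractions of the Laurent polynomial ring is the field of rational functions in
  the initial variables.\<close>

definition laurent_expansion ::
  "('v::linorder, 'c::idom) laurent fract \<Rightarrow> ('v, 'c) laurent" where
  "laurent_expansion z = (THE p. Fract p 1 = z)"

definition denominator_exponent ::
  "'v \<Rightarrow> ('v::linorder, 'c::idom) laurent fract \<Rightarrow> int" where
  "denominator_exponent i z =
     - Min ((\<lambda>m. Poly_Mapping.lookup m i) ` Poly_Mapping.keys (laurent_expansion z))"


section \<open>Indexing of the cluster variables and the compatibility degree\<close>

context
  fixes B :: "'n::{finite, linorder} \<Rightarrow> 'n \<Rightarrow> int"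
begin

definition initial_seed :: "('n, 'n, ('n, int) laurent fract) seed" where
  "initial_seed = (B, \<lambda>i. Fract (laurent_var i) 1)"

definition cluster_var :: "nat \<Rightarrow> 'n \<Rightarrow> ('n, int) laurent fract" where
  "cluster_var t i = snd ((sweep id ^^ t) initial_seed) i"

definition return_time :: "'n \<Rightarrow> nat" where
  "return_time i = (LEAST t. t > 0 \<and> (\<exists>j. cluster_var t i = cluster_var 0 j))"

definition r_index :: "'n \<Rightarrow> nat" where
  "r_index i = return_time i - 1"

definition star :: "'n \<Rightarrow> 'n" where
  "star i = (THE j. cluster_var (return_time i) i = cluster_var 0 j)"

definition labels :: "(nat \<times> 'n) set" where
  "labels = {(s, i). s \<le> r_index i}"

fun tau :: "nat \<times> 'n \<Rightarrow> nat \<times> 'n" where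
  "tau (0, i) = (r_index (star i), star i)"
| "tau (Suc t, i) = (t, i)"

text \<open>The first clause only fixes the values outside \<open>labels \<times> labels\<close>.\<close>

definition compatibility_degree :: "nat \<times> 'n \<Rightarrow> nat \<times> 'n \<Rightarrow> nat" where
  "compatibility_degree = (THE c.
     (\<forall>\<omega> \<gamma>. \<omega> \<notin> labels \<or> \<gamma> \<notin> labels \<longrightarrow> c \<omega> \<gamma> = 0) \<and>
     (\<forall>\<omega>\<in>labels. \<forall>\<gamma>\<in>labels. c (tau \<omega>) (tau \<gamma>) = c \<omega> \<gamma>) \<and>
     (\<forall>i. \<forall>\<gamma>\<in>labels. int (c (0, i) \<gamma>) =
        max 0 (denominator_exponent i (cluster_var (fst \<gamma>) (snd \<gamma>)))))"


section \<open>The positive tropicalization of the cluster configuration space\<close>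

definition cluster_relation :: "(nat \<times> 'n \<Rightarrow> 'k::comm_ring_1) \<Rightarrow> nat \<times> 'n \<Rightarrow> 'k" where
  "cluster_relation u \<gamma> = u \<gamma> + (\<Prod>\<omega>\<in>labels. u \<omega> ^ compatibility_degree \<omega> \<gamma>) - 1"

text \<open>The values of \<open>u\<close> off \<open>labels\<close> are irrelevant.\<close>

definition positive_puiseux_points :: "(nat \<times> 'n \<Rightarrow> puiseux) set" where
  "positive_puiseux_points =
     {u. \<forall>\<gamma>\<in>labels. puiseux_positive (u \<gamma>) \<and> cluster_relation u \<gamma> = 0}"

definition positive_tropicalization :: "(nat \<times> 'n \<Rightarrow> real) set" where
  "positive_tropicalization =
     closure ((\<lambda>u \<gamma>. if \<gamma> \<in> labels then puiseux_val (u \<gamma>) else 0) ` positive_puiseux_points)"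


section \<open>Principal coefficients\<close>

text \<open>The rows \<open>Inl i\<close> carry the mutable variables \<open>x\<^sub>i\<close>, the rows \<open>Inr i\<close> the frozen \<open>y\<^sub>i\<close>. The
  ambient ring consists of Laurent polynomials in the \<open>x\<^sub>i\<close> over Laurent polynomials in the
  \<open>y\<^sub>i\<close>.\<close>

definition principal_seed ::
  "('n + 'n, 'n, ('n, ('n, int) laurent) laurent fract) seed" where
  "principal_seed =
     ((\<lambda>r j. case r of Inl i \<Rightarrow> B i j | Inr i \<Rightarrow> if i = j then 1 else 0),
      (\<lambda>r. case r of Inl i \<Rightarrow> Fract (laurent_var i) 1
                   | Inr i \<Rightarrow> Fract (laurent_const (laurent_var i)) 1))"

definition principal_cluster_var :: "nat \<Rightarrow> 'n \<Rightarrow> ('n, ('n, int) laurent) laurent fract" where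
  "principal_cluster_var t i = snd ((sweep Inl ^^ t) principal_seed) (Inl i)"

text \<open>Setting all \<open>x\<^sub>i\<close> to \<open>1\<close> means adding up the coefficients, which are Laurent polynomials in
  the \<open>y\<^sub>i\<close>.\<close>

definition F_polynomial :: "nat \<times> 'n \<Rightarrow> ('n, int) laurent" where
  "F_polynomial \<gamma> = (let p = laurent_expansion (principal_cluster_var (fst \<gamma>) (snd \<gamma>)) in
     \<Sum>m\<in>Poly_Mapping.keys p. Poly_Mapping.lookup p m)"

text \<open>The degree of \<open>x\<^sup>m y\<^sup>l\<close> for \<open>deg x\<^sub>i = e\<^sub>i\<close> and \<open>deg y\<^sub>i = - B e\<^sub>i\<close>.\<close>

definition monomial_degree :: "('n \<Rightarrow>\<^sub>0 int) \<Rightarrow> ('n \<Rightarrow>\<^sub>0 int) \<Rightarrow> (real, 'n) vec" where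
  "monomial_degree m l = (\<chi> j. of_int (Poly_Mapping.lookup m j +
     (\<Sum>i\<in>UNIV. Poly_Mapping.lookup l i * (- B j i))))"

definition homogeneous_of_degree :: "(real, 'n) vec \<Rightarrow> ('n, ('n, int) laurent) laurent \<Rightarrow> bool" where
  "homogeneous_of_degree g p \<longleftrightarrow>
     (\<forall>m\<in>Poly_Mapping.keys p. \<forall>l\<in>Poly_Mapping.keys (Poly_Mapping.lookup p m).
        monomial_degree m l = g)"

definition g_vector :: "('n, ('n, int) laurent) laurent fract \<Rightarrow> (real, 'n) vec" where
  "g_vector z = (THE g. homogeneous_of_degree g (laurent_expansion z))"

definition clusters :: "('n, ('n, int) laurent) laurent fract set set" where
  "clusters = {range (\<lambda>i. snd s (Inl i)) | s. s \<in> reachable_seeds Inl principal_seed}"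

definition cluster_fan :: "((real, 'n) vec) set set" where
  "cluster_fan = {convex_cone hull (g_vector ` S) | S. \<exists>C\<in>clusters. S \<subseteq> C}"

end


section \<open>The fan structure on the positive tropicalization\<close>

text \<open>Replacing \<open>+\<close> and \<open>\<times>\<close> by \<open>min\<close> and \<open>+\<close> in a polynomial with positive coefficients, such as an
  \<open>F\<close>-polynomial.\<close>

definition trop_laurent :: "('n::finite, int) laurent \<Rightarrow> real^'n \<Rightarrow> real" where
  "trop_laurent p Y =
     Min ((\<lambda>m. \<Sum>i\<in>UNIV. of_int (Poly_Mapping.lookup m i) * Y $ i) ` Poly_Mapping.keys p)"

context
  fixes a :: "'n::{finite, linorder} \<Rightarrow> 'n \<Rightarrow> int" and E :: "'n \<Rightarrow> 'n \<Rightarrow> bool"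
begin

text \<open>The tropicalization of \<open>f\<^sub>\<gamma>\<close>; the index \<open>(t - 1, i)\<close> in \<open>f\<^sub>\<gamma>\<close> is \<open>tau (t, i)\<close>, which
  covers the convention for \<open>(-1, i)\<close>.\<close>

definition trop_f :: "nat \<times> 'n \<Rightarrow> (real, 'n) vec \<Rightarrow> real" where
  "trop_f \<gamma> Y = (case \<gamma> of (t, j) \<Rightarrow>
     (if t = 0 then Y $ j else 0)
     + (\<Sum>i\<in>{i. E i j}. of_int (- a i j) * trop_laurent (F_polynomial (exchange_matrix a E) (t, i)) Y)
     + (\<Sum>i\<in>{i. E j i}. of_int (- a i j) * trop_laurent (F_polynomial (exchange_matrix a E) (tau (exchange_matrix a E) (t, i))) Y)
     - trop_laurent (F_polynomial (exchange_matrix a E) (tau (exchange_matrix a E) (t, j))) Y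
     - trop_laurent (F_polynomial (exchange_matrix a E) (t, j)) Y)"

definition trop_map :: "(real, 'n) vec \<Rightarrow> nat \<times> 'n \<Rightarrow> real" where
  "trop_map Y = (\<lambda>\<gamma>. if \<gamma> \<in> labels (exchange_matrix a E) then trop_f \<gamma> Y else 0)"

text \<open>Domains of linearity are full-dimensional; without this requirement a lower-dimensional set
  on which all functions happen to be linear could also be maximal.\<close>

definition common_linearity_domain :: "((real, 'n) vec) set \<Rightarrow> bool" where
  "common_linearity_domain C \<longleftrightarrow> convex C \<and> interior C \<noteq> {} \<and>
     (\<forall>\<gamma>\<in>labels (exchange_matrix a E). \<exists>l. linear l \<and> (\<forall>Y\<in>C. trop_f \<gamma> Y = l Y))"

definition maximal_linearity_domain :: "((real, 'n) vec) set \<Rightarrow> bool" where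
  "maximal_linearity_domain C \<longleftrightarrow> common_linearity_domain C \<and>
     (\<forall>C'. common_linearity_domain C' \<and> C \<subseteq> C' \<longrightarrow> C' = C)"

text \<open>All cones of the fan are the nonempty faces of the maximal ones.\<close>

definition tropical_fan :: "(nat \<times> 'n \<Rightarrow> real) set set" where
  "tropical_fan = {G. G \<noteq> {} \<and>
     (\<exists>C. maximal_linearity_domain C \<and> G face_of (trop_map ` C))}"

end


section \<open>Isomorphism of fans\<close>

text \<open>A fan is given by its set of cones; its support is their union.\<close>

definition fan_isomorphic ::
  "'a::{real_vector, topological_space} set set \<Rightarrow> 'b::{real_vector, topological_space} set set \<Rightarrow> bool"
  where
  "fan_isomorphic \<Sigma> \<Gamma> \<longleftrightarrow>
     (\<exists>h h'. homeomorphism (\<Union>\<Sigma>) (\<Union>\<Gamma>) h h' \<and>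
        bij_betw (\<lambda>C. h ` C) \<Sigma> \<Gamma> \<and>
        (\<forall>C\<in>\<Sigma>. \<exists>l. linear l \<and> (\<forall>x\<in>C. h x = l x)))"

end

theory Submission
 imports Defs
begin

text \<open>The cluster variables of a sweep satisfy the mesh relations: the product of the variables labelled
 \<open>\<tau>\<gamma>\<close> and \<open>\<gamma>\<close> is a binomial in their neighbours, with coefficients \<open>y\<^sup>d\<close> for roots \<open>d\<close> in
 the orbits of the inverse Coxeter element. From the separation formula one reads off denominators, \<open>F\<close>-polynomials and g-vectors; the
 \<open>u\<close>-coordinates show that everything restricts to the links of cluster variables, and by induction
 over links the clusters are exactly the maximal sets of pairwise compatible labels.

 Taking valuations in \<open>u\<^sub>\<gamma> + \<Prod> u\<^sub>\<omega>\<^bsup>(\<omega>||\<gamma>)\<^esup> = 1\<close> shows that a tropical point \<open>v\<close> satisfies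
 \<open>min (v\<^sub>\<gamma>) (\<Sum> (\<omega>||\<gamma>) v\<^sub>\<omega>) = 0\<close>, that is, \<open>v \<ge> 0\<close> and the support of \<open>v\<close> is compatible. Conversely
 all these points occur, because the tropical map inverts a map that is linear on them. So the tropical fan
 consists of the coordinate orthants of compatible sets, and the linear map that sends the unit vector
 of \<open>\<gamma>\<close> to the g-vector of \<open>\<gamma>\<close> for the dual diagram is the isomorphism: it is injective on the tropical
 points by a recursion along the orientation, hence a homeomorphism by invariance of domain.\<close>

text \<open>The dual diagram enters through the asymmetry of the compatibility degree:
  \<open>cc w g\<close> is a coordinate of a root if \<open>w\<close> has the smaller time and of a
  coroot if \<open>g\<close> has. Denominators are the numbers \<open>cc (0, k) g\<close>, whereas
  the relations at \<open>(0, k)\<close> involve \<open>cc g (0, k)\<close>, the denominators of the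
  dual diagram; combined along the orientation they give dual g-vectors. The obstacle is that
  clusters come from arbitrary mutations, while explicit formulas exist only along sweeps. Every
  cluster variable is however initial in some swept seed, and freezing it leads to a smaller diagram
  of the same kind. A general seed is replaced by one with the same cluster inside a link. Both have
  the same exchanges, since almost complete compatible sets have at most two completions, and hence
  the same columns up to sign. Positivity is needed for sums: tropicalization is additive on
  products of nonzero polynomials, but a sum goes to a minimum only if initial forms do not cancel,
  and this has to survive the divisions in the mesh relations.\<close>

abbreviation "lookup \<equiv> Poly_Mapping.lookup"
abbreviation "single \<equiv> Poly_Mapping.single"
abbreviation "keys \<equiv> Poly_Mapping.keys"

section \<open>Finite type forms, oriented diagrams and reflections\<close>

locale dynkin =
 fixes a :: "'n::finite => 'n => int" and E :: "'n => 'n => bool" and d :: "'n => real"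
 assumes diag [simp]: "a i i = 2"
  and offdiag: "i \<noteq> j ==> a i j \<le> 0"
  and zero_sym: "a i j = 0 ==> a j i = 0"
  and d_pos: "d i > 0"
  and symm: "d i * of_int (a i j) = d j * of_int (a j i)"
  and posdef: "(v::real^'n) \<noteq> 0 ==>
   (\<Sum>i\<in>UNIV. \<Sum>j\<in>UNIV. d i * of_int (a i j) * v $ i * v $ j) > 0"
  and orient: "orientation a E"
begin

lemma E_irrefl [simp]: "\<not> E i i"
 using orient by (auto simp: orientation_def)

lemma E_asym: "E i j ==> \<not> E j i"
 using orient unfolding orientation_def by blast

lemma E_neq: "E i j ==> i \<noteq> j"
 by auto

lemma E_nonzero: "E i j ==> a i j \<noteq> 0"
 using orient unfolding orientation_def by blast

lemma E_neg: "E i j ==> a i j < 0"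
 by (metis E_nonzero E_neq offdiag order_le_less)

lemma E_neg': "E i j ==> a j i < 0"
 by (metis E_nonzero E_neq offdiag order_le_less zero_sym)

lemma E_total: "i \<noteq> j ==> a i j \<noteq> 0 ==> E i j \<or> E j i"
 using orient unfolding orientation_def by blast

lemma sum_a_split:
 "(\<Sum>j\<in>UNIV. a i j * x j) = 2 * x i + (\<Sum>j | E j i. a i j * x j) + (\<Sum>j | E i j. a i j * x j)"
proof -
 have "(\<Sum>j\<in>UNIV. a i j * x j) = (\<Sum>j\<in>UNIV. (if i = j then 2 * x j else 0) +
   (if E j i then a i j * x j else 0) + (if E i j then a i j * x j else 0))"
  using E_total[of i] E_asym[of i] by (intro sum.cong) auto
 also have "\<dots> = 2 * x i + (\<Sum>j | E j i. a i j * x j) + (\<Sum>j | E i j. a i j * x j)"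
  by (simp add: sum.distrib sum.If_cases Int_def)
 finally show ?thesis .
qed

text \<open>On a set without sources the form is not positive at \<open>\<Sum> d\<^sub>i\<^sup>-\<^sup>1\<^sup>/\<^sup>2 e\<^sub>i\<close>: there are at least
 as many edges as vertices, and each contributes at most \<open>-2\<close>.\<close>

lemma source_in:
 assumes "S \<noteq> {}"
 shows "\<exists>k\<in>S. \<forall>i\<in>S. \<not> E i k"
proof (rule ccontr)
 assume "\<not> ?thesis"
 hence src: "\<forall>k\<in>S. \<exists>i\<in>S. E i k" by blast
 define v :: "real^'n" where "v = (\<chi> k. if k \<in> S then 1 / sqrt (d k) else 0)"
 define t where "t i j = d i * of_int (a i j) * v $ i * v $ j" for i j
 have t_sym: "t i j = t j i" for i j
  using symm[of i j] by (simp add: t_def algebra_simps)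
 have t_diag: "t k k = (if k \<in> S then 2 else 0)" for k
  using d_pos[of k] by (simp add: t_def v_def field_simps)
 have t_edge: "t i k \<le> (if i \<in> S \<and> k \<in> S then - 1 else 0)" if "E i k" for i k
 proof (cases "i \<in> S \<and> k \<in> S")
  case True
  have pos: "sqrt (d i) > 0" "sqrt (d k) > 0" using d_pos by auto
  have sq: "(t i k)\<^sup>2 = of_int (a i k * a k i)"
  proof -
   have "t i k * t k i = of_int (a i k * a k i) * (d i * d k * (v $ i)\<^sup>2 * (v $ k)\<^sup>2)"
    by (simp add: t_def power2_eq_square algebra_simps)
   also have "d i * d k * (v $ i)\<^sup>2 * (v $ k)\<^sup>2 = 1"
    using True d_pos[of i] d_pos[of k] by (simp add: v_def power_divide)
   finally show ?thesis using t_sym[of i k] by (simp add: power2_eq_square)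
  qed
  have "a i k * a k i \<ge> 1"
   using E_neg[OF that] E_neg'[OF that] by (simp add: mult_neg_neg int_one_le_iff_zero_less)
  hence "(t i k)\<^sup>2 \<ge> 1" unfolding sq by linarith
  moreover have "t i k \<le> 0"
   using True d_pos[of i] pos E_neg[OF that]
   by (simp add: t_def v_def mult_nonneg_nonpos divide_nonpos_pos)
  ultimately show ?thesis using True
   by simp (smt (verit) power2_eq_square mult_le_cancel_left1 mult_minus_left mult_minus_right)
 qed (auto simp: t_def v_def)
 have split: "t i k = (if i = k then t k k else 0) + (if E i k then t i k else 0) + (if E k i then t k i else 0)" for i k
  using E_total[of i k] E_asym[of i k] t_sym by (auto simp: t_def)
 have swap: "(\<Sum>i\<in>UNIV. \<Sum>k\<in>UNIV. if E k i then t k i else 0) = (\<Sum>i\<in>UNIV. \<Sum>k\<in>UNIV. if E i k then t i k else 0)"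
  by (rule sum.swap)
 have "(\<Sum>i\<in>UNIV. \<Sum>k\<in>UNIV. t i k) =
   (\<Sum>k\<in>UNIV. t k k) + 2 * (\<Sum>i\<in>UNIV. \<Sum>k\<in>UNIV. if E i k then t i k else 0)"
  by (subst split) (simp add: sum.distrib swap)
 also have "\<dots> = (\<Sum>k\<in>UNIV. t k k) + 2 * (\<Sum>k\<in>UNIV. \<Sum>i\<in>UNIV. if E i k then t i k else 0)"
  by (subst (2) sum.swap) simp
 also have "\<dots> = (\<Sum>k\<in>UNIV. t k k + 2 * (\<Sum>i\<in>UNIV. if E i k then t i k else 0))"
  by (simp add: sum.distrib sum_distrib_left)
 also have "\<dots> \<le> 0"
 proof (rule sum_nonpos)
  fix k
  show "t k k + 2 * (\<Sum>i\<in>UNIV. if E i k then t i k else 0) \<le> 0"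
  proof (cases "k \<in> S")
   case True
   then obtain i where i: "i \<in> S" "E i k" using src by blast
   have "(\<Sum>l\<in>UNIV. if E l k then t l k else 0) \<le> (\<Sum>l\<in>UNIV. if l = i then - 1 else 0)"
    by (rule sum_mono) (use i True t_edge in \<open>fastforce split: if_splits\<close>)
   thus ?thesis using t_diag[of k] True by simp
  next
   case False
   have "(\<Sum>l\<in>UNIV. if E l k then t l k else 0) \<le> 0"
    by (rule sum_nonpos) (use False t_edge in \<open>fastforce split: if_splits\<close>)
   thus ?thesis using t_diag[of k] False by simp
  qed
 qed
 finally have "(\<Sum>i\<in>UNIV. \<Sum>k\<in>UNIV. d i * of_int (a i k) * v $ i * v $ k) \<le> 0"
  by (simp add: t_def)
 moreover have "v \<noteq> 0"
 proof -
  from assms obtain k where "k \<in> S" by blast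
  hence "v $ k \<noteq> 0" using d_pos[of k] by (simp add: v_def)
  thus ?thesis by auto
 qed
 ultimately show False using posdef[of v] by simp
qed

lemma wf_E: "wf {(i, j). E i j}"
proof (rule wfI_min)
 fix x and Q :: "'n set"
 assume "x \<in> Q"
 then obtain k where "k \<in> Q" "\<forall>i\<in>Q. \<not> E i k" using source_in[of Q] by blast
 thus "\<exists>z\<in>Q. \<forall>y. (y, z) \<in> {(i, j). E i j} \<longrightarrow> y \<notin> Q" by blast
qed

lemma wf_E_converse: "wf {(i, j). E j i}"
proof -
 have "wf ({(i, j). E i j}\<inverse>)"
  by (rule finite_acyclic_wf_converse) (auto intro: wf_acyclic wf_E)
 thus ?thesis by (simp add: converse_unfold)
qed

text \<open>A linear extension of the orientation: arrows run from earlier to later entries.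
  Mutation in this order always happens at a source.\<close>

definition topo :: "'n list => bool" where
 "topo l \<longleftrightarrow> distinct l \<and> sorted_wrt (\<lambda>x y. \<not> E y x) l"

lemma topo_exists: "\<exists>l. topo l \<and> set l = S"
proof -
 have "finite S" by simp
 thus ?thesis
 proof (induction S rule: finite_psubset_induct)
  case (psubset S)
  show ?case
  proof (cases "S = {}")
   case False
   then obtain k where k: "k \<in> S" "\<forall>i\<in>S. \<not> E i k" using source_in by blast
   then obtain l where "topo l" "set l = S - {k}" using psubset.IH[of "S - {k}"] by blast
   hence "topo (k # l) \<and> set (k # l) = S" using k by (auto simp: topo_def)
   thus ?thesis by blast
  qed (auto simp: topo_def intro: exI[of _ "[]"])
 qed
qed

definition ks :: "'n list" where "ks = (SOME l. topo l \<and> set l = UNIV)"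

lemma ks: "topo ks" "set ks = UNIV"
 using someI_ex[OF topo_exists[of UNIV]] by (auto simp: ks_def)

definition rho :: "'n => nat" where "rho k = (THE m. m < length ks \<and> ks ! m = k)"

lemma rho: "rho k < length ks" "ks ! rho k = k"
proof -
 have "\<exists>!m. m < length ks \<and> ks ! m = k"
  using ks by (metis UNIV_I distinct_Ex1 topo_def)
 from theI'[OF this] show "rho k < length ks" "ks ! rho k = k" by (auto simp: rho_def)
qed

lemma rho_inj: "rho i = rho j ==> i = j"
 by (metis rho(2))

lemma rho_less: "E i j ==> rho i < rho j"
proof (rule ccontr)
 assume e: "E i j" and "\<not> rho i < rho j"
 hence "rho j < rho i" using rho_inj E_neq by (metis nat_neq_iff)
 hence "\<not> E i j"
  using ks(1) rho unfolding topo_def by (metis sorted_wrt_iff_nth_less)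
 thus False using e by simp
qed

text \<open>\<open>cinv\<close> is the inverse Coxeter element of the orientation, \<open>UU\<close> and \<open>LL\<close> are the unitriangular
 halves of the Cartan matrix, and \<open>chi\<close> is the Euler form, scaled by \<open>d\<close>.\<close>

definition rfl :: "'n => ('n => int) => 'n => int" where
 "rfl k x = x(k := x k - (\<Sum>j\<in>UNIV. a k j * x j))"

definition cinv :: "('n => int) => 'n => int" where "cinv = foldr rfl ks"

definition UU :: "('n => int) => 'n => int" where
 "UU x k = x k + (\<Sum>i | E i k. a k i * x i)"

definition LL :: "('n => int) => 'n => int" where
 "LL x k = x k + (\<Sum>i | E k i. a k i * x i)"

definition chi :: "('n => int) => ('n => int) => real" where
 "chi x y = (\<Sum>k\<in>UNIV. d k * of_int (x k * UU y k))"

definition ev :: "'n => 'n => int" where "ev k = (\<lambda>i. if i = k then 1 else 0)"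

text \<open>\<open>foldr\<close> reflects at the last entry first. When \<open>k\<close> is reached,
  its successors already carry new coordinates and its predecessors still old ones, which splits the
  Cartan matrix into its two triangular halves.\<close>

lemma foldr_rfl_rel:
 assumes "topo l"
 shows "\<forall>k. k \<notin> set l \<longrightarrow> foldr rfl l x k = x k"
  and "\<forall>k\<in>set l. x k + foldr rfl l x k + (\<Sum>i | E i k. a k i * x i) +
      (\<Sum>i | E k i. a k i * foldr rfl l x i) = 0"
 using assms
proof (induction l)
 case (Cons k l)
 { case 1 thus ?case using Cons by (auto simp: rfl_def topo_def) }
 { case 2
  have l: "topo l" "k \<notin> set l" "\<And>i. i \<in> set l ==> \<not> E i k" using 2 by (auto simp: topo_def)
  define y where "y = foldr rfl l x"
  have y1: "\<And>i. i \<notin> set l ==> y i = x i" using Cons.IH(1)[OF l(1)] by (simp add: y_def)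
  have k: "rfl k y k = - x k - (\<Sum>i | E i k. a k i * x i) - (\<Sum>i | E k i. a k i * rfl k y i)"
  proof -
   have "(\<Sum>i | E i k. a k i * y i) = (\<Sum>i | E i k. a k i * x i)"
    by (rule sum.cong) (use l y1 in auto)
   moreover have "(\<Sum>i | E k i. a k i * y i) = (\<Sum>i | E k i. a k i * rfl k y i)"
    by (rule sum.cong) (auto simp: rfl_def)
   moreover have "rfl k y k = - y k - (\<Sum>i | E i k. a k i * y i) - (\<Sum>i | E k i. a k i * y i)"
    unfolding rfl_def fun_upd_same sum_a_split by simp
   ultimately show ?thesis using y1[OF l(2)] by simp
  qed
  show ?case
  proof
   fix j assume j: "j \<in> set (k # l)"
   show "x j + foldr rfl (k # l) x j + (\<Sum>i | E i j. a j i * x i) +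
      (\<Sum>i | E j i. a j i * foldr rfl (k # l) x i) = 0"
   proof (cases "j = k")
    case True
    thus ?thesis using k by (simp add: y_def)
   next
    case False
    hence jl: "j \<in> set l" using j by simp
    have "(\<Sum>i | E j i. a j i * rfl k y i) = (\<Sum>i | E j i. a j i * y i)"
     by (rule sum.cong) (use l jl in \<open>auto simp: rfl_def\<close>)
    thus ?thesis using Cons.IH(2)[OF l(1)] jl False by (simp add: y_def rfl_def[of k])
   qed
  qed }
qed auto

lemma cinv_rel: "LL (cinv x) k = - UU x k"
proof -
 have "x k + cinv x k + (\<Sum>i | E i k. a k i * x i) + (\<Sum>i | E k i. a k i * cinv x i) = 0"
  using foldr_rfl_rel(2)[OF ks(1), of x] ks(2) by (simp add: cinv_def)
 thus ?thesis by (simp add: LL_def UU_def)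
qed

lemma chi_alt: "chi x y = (\<Sum>k\<in>UNIV. d k * of_int (y k * LL x k))"
proof -
 have s: "d k * of_int (x k * (a k i * y i)) = d i * of_int (y i * (a i k * x k))" for i k
  using symm[of i k] by (simp add: mult_ac)
 have "(\<Sum>k\<in>UNIV. \<Sum>i\<in>UNIV. if E i k then d k * of_int (x k * (a k i * y i)) else 0) =
    (\<Sum>i\<in>UNIV. \<Sum>k\<in>UNIV. if E i k then d i * of_int (y i * (a i k * x k)) else 0)"
  unfolding s by (rule sum.swap)
 hence e: "(\<Sum>k\<in>UNIV. \<Sum>i | E i k. d k * of_int (x k * (a k i * y i))) =
    (\<Sum>i\<in>UNIV. \<Sum>k | E i k. d i * of_int (y i * (a i k * x k)))"
  by (simp add: sum.If_cases Int_def)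
 show ?thesis
  unfolding chi_def UU_def LL_def distrib_left of_int_add sum.distrib sum_distrib_left of_int_sum
   e by (simp add: mult_ac)
qed


definition aa :: "('n => int) => 'n => int" where "aa x k = (\<Sum>j\<in>UNIV. a k j * x j)"

lemma aa_eq: "aa x k = UU x k + LL x k"
 by (simp add: aa_def UU_def LL_def sum_a_split)

lemma UU_lin: "UU (\<lambda>i. x i + c * y i) k = UU x k + c * UU y k"
 by (simp add: UU_def sum.distrib distrib_left sum_distrib_left mult.left_commute)

lemma LL_lin: "LL (\<lambda>i. x i + c * y i) k = LL x k + c * LL y k"
 by (simp add: LL_def sum.distrib distrib_left sum_distrib_left mult.left_commute)

lemma UU_sum: "UU (\<lambda>k. \<Sum>i\<in>S. c i * y i k) k = (\<Sum>i\<in>S. c i * UU (y i) k)"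
proof (induction S rule: infinite_finite_induct)
 case (insert i S)
 thus ?case using UU_lin[of "\<lambda>k. \<Sum>i\<in>S. c i * y i k" "c i" "y i" k] by (simp add: add.commute)
qed (simp_all add: UU_def)

lemma LL_sum: "LL (\<lambda>k. \<Sum>i\<in>S. c i * y i k) k = (\<Sum>i\<in>S. c i * LL (y i) k)"
proof (induction S rule: infinite_finite_induct)
 case (insert i S)
 thus ?case using LL_lin[of "\<lambda>k. \<Sum>i\<in>S. c i * y i k" "c i" "y i" k] by (simp add: add.commute)
qed (simp_all add: LL_def)

lemma chi_lin_right: "chi z (\<lambda>i. x i + c * y i) = chi z x + of_int c * chi z y"
 by (simp add: chi_def UU_lin algebra_simps sum.distrib sum_distrib_left)

lemma chi_lin_left: "chi (\<lambda>i. x i + c * y i) z = chi x z + of_int c * chi y z"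
 by (simp add: chi_def algebra_simps sum.distrib sum_distrib_left)

lemma chi_minus_left: "chi (- x) z = - chi x z"
 by (simp add: chi_def sum_negf)

lemma UU_minus: "UU (- x) k = - UU x k"
 by (simp add: UU_def sum_negf)

lemma LL_minus: "LL (- x) k = - LL x k"
 by (simp add: LL_def sum_negf)

lemma chi_minus_right: "chi z (- x) = - chi z x"
 by (simp add: chi_def UU_minus sum_negf)

lemma chi_0 [simp]: "chi 0 x = 0" "chi x 0 = 0"
 by (simp_all add: chi_def UU_def)

text \<open>For quiver representations this is the Auslander-Reiten formula on dimension vectors,
  with \<open>cinv\<close> as the inverse translate.\<close>

lemma chi_Serre: "chi (cinv x) z = - chi z x"
 unfolding chi_alt[of "cinv x" z] chi_def[of z x] by (simp add: cinv_rel sum_negf)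

lemma chi_cinv: "chi (cinv x) (cinv y) = chi x y"
 by (simp add: chi_Serre)

lemma sum_ev: "(\<Sum>i\<in>S. f i * ev k i) = (if k \<in> S then f k else 0)"
 by (cases "finite S") (auto simp: ev_def if_distrib cong: if_cong)

lemma sum_ev_real: "(\<Sum>i\<in>S. f i * of_int (ev k i)) = (if k \<in> S then f k else (0::real))"
 by (cases "finite S") (auto simp: ev_def if_distrib cong: if_cong)

lemma LL_ev: "LL (ev j) k = ev j k + (if E k j then a k j else 0)"
 by (simp add: LL_def sum_ev)

lemma UU_ev: "UU (ev j) k = ev j k + (if E j k then a k j else 0)"
 by (simp add: UU_def sum_ev)

lemma chi_ev_left: "chi (ev k) x = d k * of_int (UU x k)"
proof -
 have "chi (ev k) x = (\<Sum>i\<in>UNIV. (d i * of_int (UU x i)) * of_int (ev k i))"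
  by (simp add: chi_def mult_ac)
 thus ?thesis by (simp add: sum_ev_real)
qed

lemma chi_ev_right: "chi x (ev k) = d k * of_int (LL x k)"
proof -
 have "chi x (ev k) = (\<Sum>i\<in>UNIV. (d i * of_int (LL x i)) * of_int (ev k i))"
  by (simp add: chi_alt mult_ac)
 thus ?thesis by (simp add: sum_ev_real)
qed

lemma chi_aa: "chi x y + chi y x = (\<Sum>i\<in>UNIV. d i * of_int (x i * aa y i))"
 unfolding chi_def[of x y] chi_alt[of y x] by (simp add: aa_eq algebra_simps sum.distrib)

lemma chi_form: "chi x y + chi y x = (\<Sum>i\<in>UNIV. \<Sum>j\<in>UNIV. d i * of_int (a i j * x i * y j))"
 by (simp add: chi_aa aa_def sum_distrib_left mult_ac)

lemma N_pos: assumes "x \<noteq> 0" shows "chi x x > 0"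
proof -
 define v :: "real^'n" where "v = (\<chi> k. of_int (x k))"
 have "v \<noteq> 0" using assms by (auto simp: v_def vec_eq_iff fun_eq_iff)
 from posdef[OF this] have "chi x x + chi x x > 0"
  unfolding chi_form by (simp add: v_def mult_ac)
 thus ?thesis by simp
qed

lemma rfl_eq: "rfl k x = (\<lambda>i. x i + (- aa x k) * ev k i)"
 by (auto simp: rfl_def aa_def ev_def fun_eq_iff)

lemma chi_add_ev:
 "chi (\<lambda>i. x i + c * ev k i) (\<lambda>i. x i + c * ev k i) = chi x x + of_int c * (d k * of_int (aa x k)) + (of_int c)\<^sup>2 * d k"
proof -
 have "chi x (ev k) + chi (ev k) x = d k * of_int (aa x k)"
  by (simp add: chi_ev_left chi_ev_right aa_eq algebra_simps)
 moreover have "chi (ev k) (ev k) = d k" by (simp add: chi_ev_left UU_ev) (simp add: ev_def)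
 moreover have "chi (\<lambda>i. x i + c * ev k i) (\<lambda>i. x i + c * ev k i) =
   chi x x + of_int c * (chi x (ev k) + chi (ev k) x) + (of_int c)\<^sup>2 * chi (ev k) (ev k)"
  unfolding chi_lin_left chi_lin_right by (simp add: power2_eq_square algebra_simps)
 ultimately show ?thesis by simp
qed

lemma chi_rfl: "chi (rfl k x) (rfl k x) = chi x x"
 unfolding rfl_eq chi_add_ev by (simp add: power2_eq_square)

text \<open>The integral vectors \<open>x\<close> whose coroot \<open>2x/(x,x)\<close> is integral as well. All roots are of this
 kind; working with this class avoids the Weyl group.\<close>

definition RR :: "('n => int) => bool" where
 "RR x \<longleftrightarrow> x \<noteq> 0 \<and> (\<forall>j. \<exists>z::int. d j * of_int (x j) = of_int z * chi x x)"

definition nneg :: "('n => int) => bool" where "nneg x \<longleftrightarrow> (\<forall>k. 0 \<le> x k)"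

lemma RR_rfl: assumes "RR x" shows "RR (rfl k x)"
proof -
 from assms obtain z where z: "\<And>j. d j * of_int (x j) = of_int (z j) * chi x x"
  unfolding RR_def by metis
 have "rfl k x \<noteq> 0"
  using N_pos[of x] chi_rfl[of k x] assms by (auto simp: RR_def)
 moreover have "\<exists>w::int. d j * of_int (rfl k x j) = of_int w * chi x x" for j
 proof (cases "j = k")
  case True
  have "d k * of_int (aa x k) = (\<Sum>j\<in>UNIV. of_int (a j k) * (d j * of_int (x j)))"
   unfolding aa_def of_int_sum sum_distrib_left
   by (rule sum.cong) (simp_all add: symm[of k] flip: mult.assoc)
  also have "\<dots> = of_int (\<Sum>j\<in>UNIV. a j k * z j) * chi x x"
   unfolding z by (simp add: sum_distrib_left mult_ac)
  finally have "d k * of_int (rfl k x k) = of_int (z k - (\<Sum>j\<in>UNIV. a j k * z j)) * chi x x"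
   using z[of k] by (simp add: rfl_eq ev_def algebra_simps)
  thus ?thesis using True by blast
 next
  case False
  thus ?thesis using z[of j] by (auto simp: rfl_def)
 qed
 ultimately show ?thesis by (simp add: RR_def chi_rfl)
qed

lemma RR_fold: "RR x ==> RR (foldr rfl l x)"
 by (induction l) (auto intro: RR_rfl)

lemma RR_cinv: "RR x ==> RR (cinv x)"
 by (simp add: cinv_def RR_fold)

text \<open>The norm of the positive part is a multiple of the norm of \<open>x\<close>, and likewise for the negative
 part; but the norm of \<open>x\<close> is at least their sum.\<close>

lemma RR_coherent:
 assumes "RR x"
 shows "nneg x \<or> nneg (- x)"
proof (rule ccontr)
 assume n: "\<not> ?thesis"
 from assms obtain z where z: "\<And>j. d j * of_int (x j) = of_int (z j) * chi x x" and x0: "x \<noteq> 0"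
  unfolding RR_def by metis
 have part: "chi y y \<ge> chi x x" if y: "y \<noteq> 0" "\<And>j. y j = 0 \<or> y j = s * x j" for y and s :: int
 proof -
  define w where "w j = (if y j = 0 then 0 else s * z j)" for j
  have dy: "d j * of_int (y j) = of_int (w j) * chi x x" for j
   using y(2)[of j] z[of j] by (auto simp: w_def mult.left_commute)
  have "chi y y = (\<Sum>j\<in>UNIV. (d j * of_int (y j)) * of_int (UU y j))"
   by (simp add: chi_def mult_ac)
  also have "\<dots> = of_int (\<Sum>j\<in>UNIV. w j * UU y j) * chi x x"
   unfolding dy by (simp add: sum_distrib_left mult_ac)
  finally have e: "chi y y = of_int (\<Sum>j\<in>UNIV. w j * UU y j) * chi x x" .
  hence "(\<Sum>j\<in>UNIV. w j * UU y j) > 0"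
   using N_pos[OF y(1)] N_pos[OF x0] by (metis of_int_0_less_iff zero_less_mult_pos2)
  hence "real_of_int (\<Sum>j\<in>UNIV. w j * UU y j) \<ge> 1" by linarith
  thus ?thesis unfolding e using N_pos[OF x0]
   by (metis mult_le_cancel_right1 not_less_iff_gr_or_eq)
 qed
 define p where "p j = max 0 (x j)" for j
 define m where "m j = max 0 (- x j)" for j
 have pm: "x = (\<lambda>j. p j + (- 1) * m j)" by (auto simp: p_def m_def)
 obtain k l where "x k < 0" "x l > 0" using n by (auto simp: nneg_def not_le)
 hence "p l \<noteq> 0" "m k \<noteq> 0" by (auto simp: p_def m_def)
 hence "p \<noteq> 0" "m \<noteq> 0" by auto
 hence "chi p p \<ge> chi x x" "chi m m \<ge> chi x x"
  using part[of p 1] part[of m "-1"] by (auto simp: p_def m_def max_def)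
 moreover have "chi p m + chi m p \<le> 0"
  unfolding chi_form
 proof (intro sum_nonpos)
  fix i j
  show "d i * of_int (a i j * p i * m j) \<le> 0"
   using offdiag[of i j] d_pos[of i]
   by (cases "i = j") (auto simp: p_def m_def max_def mult_le_0_iff zero_le_mult_iff)
 qed
 moreover have "chi x x = chi p p + chi m m - (chi p m + chi m p)"
  by (subst (1 2) pm, unfold chi_lin_left chi_lin_right) simp
 ultimately show False using N_pos[OF x0] by linarith
qed

lemma RR_not_both: "RR x ==> nneg x ==> \<not> nneg (- x)"
 unfolding RR_def nneg_def
 by (metis ext neg_0_le_iff_le order_antisym uminus_apply zero_fun_apply)

text \<open>A reflection changes one coordinate only, so by coherence of signs a positive vector can
  leave the positive cone only if it is concentrated at \<open>k\<close>; integrality of the coroot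
  then excludes proper multiples of the simple root.\<close>

lemma rfl_crossing:
 assumes "RR x" "nneg x" "\<not> nneg (rfl k x)"
 shows "x = ev k"
proof -
 have "nneg (- rfl k x)" using RR_coherent[OF RR_rfl[OF assms(1)]] assms(3) by blast
 hence z: "x j = 0" if "j \<noteq> k" for j
 proof -
  have "0 \<le> - rfl k x j" "0 \<le> x j"
   using \<open>nneg (- rfl k x)\<close> assms(2) by (auto simp: nneg_def simp del: neg_0_le_iff_le)
  thus ?thesis using that by (simp add: rfl_def)
 qed
 have x: "x = (\<lambda>i. 0 + x k * ev k i)" using z by (auto simp: ev_def)
 have c: "chi x x = (of_int (x k))\<^sup>2 * d k"
 proof -
  have z0: "(\<lambda>i. 0) = (0 :: 'n => int)" by auto
  have "chi (ev k) (ev k) = d k"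
   by (simp add: chi_ev_left UU_ev) (simp add: ev_def)
  thus ?thesis
   by (subst (1 2) x, unfold chi_lin_left chi_lin_right z0) (simp add: power2_eq_square)
 qed
 obtain w :: int where "d k * of_int (x k) = of_int w * chi x x"
  using assms(1) by (auto simp: RR_def)
 moreover have "x k \<noteq> 0"
 proof
  assume "x k = 0"
  hence "x j = 0" for j using z by (cases "j = k") auto
  hence "x = 0" by auto
  thus False using assms(1) by (simp add: RR_def)
 qed
 ultimately have "1 = w * x k"
  using d_pos[of k] by (simp add: c power2_eq_square)
   (metis of_int_1 of_int_eq_iff of_int_mult)
 hence "x k = 1"
  using assms(2) unfolding nneg_def by (metis dvd_triv_right zdvd1_eq abs_of_nonneg)
 thus ?thesis using x by auto
qed

text \<open>The dimension vectors of the indecomposable projectives.\<close>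

function PP :: "'n => 'n => int" where
 "PP j = (\<lambda>k. ev j k - (\<Sum>i | E i j. a i j * PP i k))"
 by auto
termination
 by (relation "Wellfounded.measure rho") (auto intro: rho_less)

declare PP.simps [simp del]

lemma PP_eq: "PP j = (\<lambda>k. ev j k + (-1) * (\<Sum>i | E i j. a i j * PP i k))"
 by (subst PP.simps) simp

lemma LL_PP: "LL (PP j) k = ev j k"
proof (induction j arbitrary: k rule: measure_induct_rule[where f = rho])
 case (less j)
 have "LL (PP j) k = LL (ev j) k - (\<Sum>i | E i j. a i j * LL (PP i) k)"
  unfolding PP_eq[of j] LL_lin LL_sum by simp
 also have "(\<Sum>i | E i j. a i j * LL (PP i) k) = (\<Sum>i | E i j. a i j * ev k i)"
  using less rho_less by (intro sum.cong) (auto simp: ev_def)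
 finally show ?case by (simp add: LL_ev sum_ev)
qed

lemma PP_nneg: "nneg (PP j)"
proof (induction j rule: measure_induct_rule[where f = rho])
 case (less j)
 have s: "0 \<le> - (\<Sum>i | E i j. a i j * PP i k)" for k
  unfolding sum_negf[symmetric]
  by (rule sum_nonneg) (use less rho_less E_neg in \<open>fastforce simp: nneg_def mult_le_0_iff\<close>)
 have "0 \<le> ev j k + - (\<Sum>i | E i j. a i j * PP i k)" for k
  by (rule add_nonneg_nonneg[OF _ s]) (simp add: ev_def)
 hence "0 \<le> PP j k" for k by (simp add: PP.simps[of j])
 thus ?case by (simp add: nneg_def)
qed

lemma PP_support: "PP j k \<noteq> 0 ==> rho k \<le> rho j"
proof (induction j rule: measure_induct_rule[where f = rho])
 case (less j)
 show ?case
 proof (cases "k = j")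
  case False
  hence "(\<Sum>i | E i j. a i j * PP i k) \<noteq> 0"
   using less.prems by (simp add: PP.simps[of j] ev_def)
  then obtain i where "E i j" "PP i k \<noteq> 0"
   by (metis (mono_tags, lifting) mem_Collect_eq mult_zero_right sum.neutral)
  thus ?thesis using less.IH[of i] rho_less[of i j] by simp
 qed simp
qed

lemma PP_same: "PP j j = 1"
proof -
 have "(\<Sum>i | E i j. a i j * PP i j) = 0"
  by (rule sum.neutral) (use PP_support rho_less in fastforce)
 thus ?thesis by (simp add: PP.simps[of j] ev_def)
qed

lemma PP_edge: assumes "E i j" shows "PP j i > 0"
proof -
 have "(\<Sum>l | E l j. - (a l j * PP l i)) \<ge> - (a i j * PP i i)"
  by (rule member_le_sum) (use assms E_neg PP_nneg in \<open>force simp: nneg_def mult_le_0_iff\<close>)+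
 thus ?thesis using E_neg[OF assms] E_neq[OF assms]
  by (simp add: PP.simps[of j] ev_def PP_same sum_negf)
qed

lemma chi_PP: "chi (PP j) y = d j * of_int (y j)"
proof -
 have "chi (PP j) y = (\<Sum>k\<in>UNIV. (d k * of_int (y k)) * of_int (ev j k))"
  by (simp add: chi_alt LL_PP mult_ac)
 thus ?thesis by (simp add: sum_ev_real)
qed

lemma chi_UU: assumes "\<And>l. UU x l = ev k l" shows "chi z x = d k * of_int (z k)"
proof -
 have "chi z x = (\<Sum>l\<in>UNIV. (d l * of_int (z l)) * of_int (ev k l))"
  by (simp add: chi_def assms mult_ac)
 thus ?thesis by (simp add: sum_ev_real)
qed

lemma chi_PP_self: "chi (PP j) (PP j) = d j"
 by (simp add: chi_PP PP_same)

lemma RR_PP: "RR (PP j)"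
proof -
 have "\<exists>z::int. d k * of_int (PP j k) = of_int z * d j" for k
 proof (induction j rule: measure_induct_rule[where f = rho])
  case (less j)
  hence "\<forall>i. E i j \<longrightarrow> (\<exists>z::int. d k * of_int (PP i k) = of_int z * d i)"
   using rho_less by blast
  then obtain z :: "'n => int" where z: "\<And>i. E i j ==> d k * of_int (PP i k) = of_int (z i) * d i"
   by metis
  have "d k * of_int (\<Sum>i | E i j. a i j * PP i k) = (\<Sum>i | E i j. of_int (a i j) * (d k * of_int (PP i k)))"
   by (simp add: sum_distrib_left mult_ac)
  also have "\<dots> = (\<Sum>i | E i j. of_int (z i) * (d i * of_int (a i j)))"
   by (rule sum.cong) (use z in \<open>auto simp: mult_ac\<close>)
  also have "\<dots> = of_int (\<Sum>i | E i j. z i * a j i) * d j"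
   unfolding symm[of _ j] by (simp add: sum_distrib_left mult_ac)
  finally have "d k * of_int (PP j k) = of_int (ev j k - (\<Sum>i | E i j. z i * a j i)) * d j"
   unfolding PP.simps[of j] by (simp add: algebra_simps) (simp add: ev_def)
  thus ?case by blast
 qed
 moreover have "PP j \<noteq> 0" using PP_same[of j] by auto
 ultimately show ?thesis by (simp add: RR_def chi_PP_self)
qed

text \<open>For \<open>1 \<le> t \<le> rr j\<close> this is the positive root that is the denominator vector of \<open>x\<^sub>(\<^sub>t\<^sub>,\<^sub>j\<^sub>)\<close>.\<close>

definition D :: "nat => 'n => 'n => int" where
 "D t j = (if t = 0 then 0 else (cinv ^^ (t - 1)) (PP j))"

lemma D_1: "D (Suc 0) j = PP j"
 by (simp add: D_def)

lemma D_Suc: "t > 0 ==> D (Suc t) j = cinv (D t j)"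
 by (cases t) (auto simp: D_def)

lemma RR_D: "t > 0 ==> RR (D t j)"
 by (induction t rule: nat_induct_non_zero) (auto simp: D_1 RR_PP D_Suc intro: RR_cinv)

lemma chi_D_shift:
 assumes "s > 0" "t > 0"
 shows "chi (D (s + m) i) (D (t + m) j) = chi (D s i) (D t j)"
 using assms by (induction m) (auto simp: D_Suc chi_cinv)

text \<open>Shifting both arguments back until the earlier one is a projective vector turns the form
  into a coordinate. Many positivity arguments below play this coordinate off against a second
  evaluation of the same number.\<close>

lemma chi_D_le:
 assumes "0 < s" "s \<le> t"
 shows "chi (D s i) (D t j) = d i * of_int (D (t - s + 1) j i)"
 using chi_D_shift[of 1 "t - s + 1" "s - 1" i j] assms by (simp add: D_1 chi_PP)

lemma chi_D_gt:
 assumes "0 < t" "t < s"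
 shows "chi (D s i) (D t j) = - (d j * of_int (D (s - t) i j))"
proof -
 have "chi (D s i) (D t j) = chi (D (s - t + 1) i) (D 1 j)"
  using chi_D_shift[of "s - t + 1" 1 "t - 1" i j] assms by simp
 also have "\<dots> = - chi (PP j) (D (s - t) i)"
  using assms D_Suc[of "s - t" i] by (simp add: D_1 chi_Serre)
 finally show ?thesis by (simp add: chi_PP)
qed

lemma chi_D_self: "t > 0 ==> chi (D t j) (D t j) = d j"
 by (simp add: chi_D_le D_1 PP_same)

text \<open>Positivity of the form at \<open>x\<close> plus and minus a simple root bounds
  \<open>aa x\<close> in terms of the norm, and \<open>aa\<close> is injective because the form is
  definite.\<close>

lemma finite_norm: "finite {x. chi x x = c}"
proof -
 have b: "aa x \<in> PiE UNIV (\<lambda>k. {- \<lceil>1 + c / d k\<rceil>..\<lceil>1 + c / d k\<rceil>})" if c: "chi x x = c" for x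
 proof -
  have "\<bar>of_int (aa x k)\<bar> \<le> 1 + c / d k" for k
  proof -
   have N: "0 \<le> chi y y" for y using N_pos[of y] by (cases "y = 0") auto
   from N[of "\<lambda>i. x i + 1 * ev k i"] N[of "\<lambda>i. x i + (- 1) * ev k i"]
   have "\<bar>d k * of_int (aa x k)\<bar> \<le> d k + c" unfolding chi_add_ev c by simp
   hence "d k * \<bar>of_int (aa x k)\<bar> \<le> d k * (1 + c / d k)" using d_pos[of k] by (simp add: abs_mult distrib_left)
   thus ?thesis using d_pos[of k] by simp
  qed
  hence "aa x k \<le> \<lceil>1 + c / d k\<rceil> \<and> - aa x k \<le> \<lceil>1 + c / d k\<rceil>" for k using abs_le_D1 abs_le_D2 by (smt (verit) le_of_int_ceiling of_int_le_iff of_int_minus)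
  thus ?thesis by (simp add: PiE_iff) (smt (verit))
 qed
 have "inj_on aa {x. chi x x = c}"
 proof (rule inj_onI, rule ccontr)
  fix x y assume e: "aa x = aa y" "x \<noteq> y"
  have "aa (x - y) k = 0" for k using fun_cong[OF e(1), of k] by (simp add: aa_def right_diff_distrib sum_subtractf)
  hence "chi (x - y) (x - y) + chi (x - y) (x - y) = 0" unfolding chi_aa by simp
  thus False using N_pos[of "x - y"] e(2) by simp
 qed
 moreover have "aa ` {x. chi x x = c} \<subseteq> PiE UNIV (\<lambda>k. {- \<lceil>1 + c / d k\<rceil>..\<lceil>1 + c / d k\<rceil>})" using b by blast
 ultimately show ?thesis by (rule inj_on_finite) (simp add: finite_PiE)
qed

lemma cinv_sum: "cinv x = y \<longleftrightarrow> (\<forall>k. LL y k = - UU x k)"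
proof
 assume "\<forall>k. LL y k = - UU x k"
 hence l: "LL y k = LL (cinv x) k" for k by (simp add: cinv_rel)
 have "LL (\<lambda>i. y i + (-1) * cinv x i) k = 0" for k
  unfolding LL_lin using l by simp
 hence "chi (\<lambda>i. y i + (-1) * cinv x i) (\<lambda>i. y i + (-1) * cinv x i) = 0"
  unfolding chi_alt by simp
 hence "(\<lambda>i. y i + (-1) * cinv x i) = 0" using N_pos by fastforce
 hence "y i = cinv x i" for i by (metis add.inverse_inverse add_eq_0_iff mult_minus1 zero_fun_apply)
 thus "cinv x = y" by auto
qed (auto simp: cinv_rel)

text \<open>The sum over a \<open>cinv\<close>-orbit is \<open>cinv\<close>-invariant, hence zero by Serre duality.\<close>

lemma cinv_leaves: assumes "RR x" shows "\<exists>m. \<not> nneg ((cinv ^^ m) x)"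
proof (rule ccontr)
 let ?c = "\<lambda>m. (cinv ^^ m) x"
 assume "\<not> ?thesis"
 hence pos: "\<And>m. nneg (?c m)" by blast
 have c: "chi (?c m) (?c m) = chi x x" for m by (induction m) (simp_all add: chi_cinv)
 have "range ?c \<subseteq> {y. chi y y = chi x x}" by (auto simp: c)
 hence "finite (range ?c)" using finite_norm finite_subset by blast
 hence "\<not> inj ?c" using finite_imageD infinite_UNIV_nat by blast
 then obtain s t where st: "s < t" "?c s = ?c t"
  unfolding inj_def by (metis nat_neq_iff)
 define S where "S k = (\<Sum>m = s..<t. ?c m k)" for k
 have "LL S k = - UU S k" for k
 proof -
  have "LL S k = (\<Sum>m = s..<t. LL (?c m) k)"
   using LL_sum[of "\<lambda>_. 1" ?c "{s..<t}" k] by (simp add: S_def[abs_def])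
  also have "\<dots> = (\<Sum>m = s..<t. LL (?c (Suc m)) k)"
   using st sum_Suc_diff'[of s t "\<lambda>m. LL (?c m) k"] by (simp add: sum_subtractf)
  also have "\<dots> = - (\<Sum>m = s..<t. UU (?c m) k)" by (simp add: cinv_rel sum_negf)
  also have "\<dots> = - UU S k"
   using UU_sum[of "\<lambda>_. 1" ?c "{s..<t}" k] by (simp add: S_def[abs_def])
  finally show ?thesis .
 qed
 hence "cinv S = S" by (simp add: cinv_sum)
 hence "chi S S = 0" using chi_Serre[of S S] by simp
 hence S0: "S = 0" using N_pos by force
 have "?c s k = 0" for k
 proof -
  have "?c s k \<le> S k"
   unfolding S_def by (rule member_le_sum) (use st pos in \<open>auto simp: nneg_def\<close>)
  thus ?thesis using S0 pos[of s] by (simp add: nneg_def) (metis order_antisym)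
 qed
 hence "?c s = 0" by auto
 thus False using N_pos[of x] assms c[of s] by (simp add: RR_def)
qed

text \<open>The orbit is followed up to its first exit from the positive cone. The identification
  with \<open>r_index\<close> needs the separation formula and comes in
  \<open>r_index_eq\<close>.\<close>

definition rr :: "'n => nat" where "rr j = (LEAST t. \<not> nneg (D (Suc t) j))"

lemma rr_neg: "\<not> nneg (D (Suc (rr j)) j)"
proof -
 have "\<exists>t. \<not> nneg (D (Suc t) j)" using cinv_leaves[OF RR_PP[of j]] by (simp add: D_def)
 thus ?thesis unfolding rr_def by (metis (mono_tags, lifting) LeastI_ex)
qed

lemma rr_pos: "0 < t ==> t \<le> rr j ==> nneg (D t j)"
 using not_less_Least[of "t - 1" "\<lambda>t. \<not> nneg (D (Suc t) j)"] by (simp add: rr_def)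

lemma rr_ge_1: "0 < rr j"
 using rr_neg[of j] PP_nneg[of j] by (cases "rr j") (auto simp: D_1)

end

section \<open>How an orbit of roots ends: injective vectors and the star permutation\<close>

context dynkin begin

lemma rfl_lin: "rfl k (\<lambda>i. x i + c * y i) = (\<lambda>i. rfl k x i + c * rfl k y i)"
proof -
 have "aa (\<lambda>i. x i + c * y i) k = aa x k + c * aa y k"
  by (simp add: aa_eq UU_lin LL_lin algebra_simps)
 thus ?thesis by (auto simp: rfl_eq fun_eq_iff algebra_simps)
qed

lemma fold_lin: "foldr rfl l (\<lambda>i. x i + c * y i) = (\<lambda>i. foldr rfl l x i + c * foldr rfl l y i)"
 by (induction l) (auto simp: rfl_lin)

lemma fold_minus: "foldr rfl l (- x) = - foldr rfl l x"
proof -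
 have "foldr rfl l (\<lambda>i. 0 + (-1) * x i) = (\<lambda>i. foldr rfl l (\<lambda>_. 0) i + (-1) * foldr rfl l x i)"
  by (rule fold_lin)
 moreover have "foldr rfl l (\<lambda>_. 0) = (\<lambda>_. 0)"
  by (induction l) (auto simp: rfl_def)
 ultimately show ?thesis by (simp add: fun_Compl_def)
qed

lemma cinv_lin: "cinv (\<lambda>i. x i + c * y i) = (\<lambda>i. cinv x i + c * cinv y i)"
 by (simp add: cinv_def fold_lin)

lemma cinv_minus: "cinv (- x) = - cinv x"
 by (simp add: cinv_def fold_minus)

lemma UU_inj: assumes "\<And>k. UU x k = UU y k" shows "x = y"
proof -
 have "UU (\<lambda>i. x i + (-1) * y i) k = 0" for k
  unfolding UU_lin using assms by simp
 hence "chi (\<lambda>i. x i + (-1) * y i) (\<lambda>i. x i + (-1) * y i) = 0"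
  unfolding chi_def by simp
 hence "(\<lambda>i. x i + (-1) * y i) = 0" using N_pos by fastforce
 hence "x i = y i" for i by (drule_tac fun_cong[of _ _ i]) simp
 thus ?thesis by auto
qed

lemma cinv_inj: assumes "cinv x = cinv y" shows "x = y"
proof (rule UU_inj)
 fix k
 show "UU x k = UU y k" using cinv_rel[of x k] cinv_rel[of y k] assms by simp
qed

lemma fold_crossing:
 assumes "RR x" "nneg x" "\<not> nneg (foldr rfl l x)"
 shows "\<exists>u k v. l = u @ k # v \<and> foldr rfl v x = ev k"
 using assms(3)
proof (induction l)
 case (Cons k l)
 show ?case
 proof (cases "nneg (foldr rfl l x)")
  case True
  hence "foldr rfl l x = ev k"
   using rfl_crossing[OF RR_fold[OF assms(1)] True] Cons.prems by simp
  thus ?thesis by (intro exI[of _ "[]"]) auto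
 next
  case False
  then obtain u k' v where "l = u @ k' # v" "foldr rfl v x = ev k'" using Cons.IH by blast
  thus ?thesis by (intro exI[of _ "k # u"]) auto
 qed
qed (use assms(2) in simp)

text \<open>Cut the word where the sign changes: the reflections to the right of \<open>k\<close>
  turn \<open>x\<close> into the simple root \<open>ev k\<close>. They do not touch the coordinates
  outside \<open>v\<close>, so \<open>x\<close> is \<open>ev k\<close> there, and the triangular
  relations identify it as an injective vector.\<close>

lemma cinv_crossing:
 assumes "RR x" "nneg x" "\<not> nneg (cinv x)"
 shows "\<exists>k. (\<forall>l. UU x l = ev k l) \<and> cinv x = - PP k"
proof -
 obtain u k v where l: "ks = u @ k # v" "foldr rfl v x = ev k"
  using fold_crossing[OF assms(1,2)] assms(3) unfolding cinv_def by blast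
 have tv: "topo v" and before: "\<And>p q. p \<in> set u \<union> {k} ==> q \<in> set v ==> \<not> E q p"
  and uk: "\<And>p. p \<in> set u ==> \<not> E k p" and kv: "k \<notin> set v"
  using ks(1) unfolding l(1) topo_def by (auto simp: sorted_wrt_append)
 have UN: "set u \<union> {k} \<union> set v = UNIV" using ks(2) l(1) by auto
 have out: "\<And>j. j \<notin> set v ==> x j = ev k j" using foldr_rfl_rel(1)[OF tv] l(2) by metis
 have "UU x j = ev k j" for j
 proof (cases "j \<in> set v")
  case True
  hence "x j + ev k j + (\<Sum>i | E i j. a j i * x i) + (\<Sum>i | E j i. a j i * ev k i) = 0"
   using foldr_rfl_rel(2)[OF tv, of x] l(2) by simp
  moreover have "(\<Sum>i | E j i. a j i * ev k i) = 0"
   using before[of k j] True by (simp add: sum_ev)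
  moreover have "ev k j = 0" using True kv by (auto simp: ev_def)
  ultimately show ?thesis by (simp add: UU_def)
 next
  case False
  hence j: "j \<in> set u \<union> {k}" using UN by blast
  have "(\<Sum>i | E i j. a j i * x i) = 0"
  proof (intro sum.neutral ballI)
   fix i assume i: "i \<in> {i. E i j}"
   hence "i \<notin> set v" using before[OF j] by blast
   moreover have "i \<noteq> k" using i j uk by auto
   ultimately show "a j i * x i = 0" using out[of i] by (simp add: ev_def)
  qed
  thus ?thesis using out[OF False] by (simp add: UU_def)
 qed
 moreover from this have "cinv x = - PP k"
  by (simp add: cinv_sum LL_minus LL_PP)
 ultimately show ?thesis by blast
qed

lemma PP_inj: "PP i = PP j ==> i = j"
 using PP_support[of i j] PP_support[of j i] PP_same[of i] PP_same[of j] rho_inj[of i j] by simp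

text \<open>On dimension vectors this is the Nakayama permutation; \<open>star_eq\<close> matches it
  with \<open>star\<close>.\<close>

definition star0 :: "'n => 'n" where "star0 j = (THE k. D (Suc (rr j)) j = - PP k)"

lemma star0_unique: "D (Suc (rr j)) j = - PP k ==> star0 j = k"
 unfolding star0_def by (rule the_equality) (auto dest: PP_inj)

lemma D_star: "D (Suc (rr j)) j = - PP (star0 j)"
 and UU_star: "UU (D (rr j) j) l = ev (star0 j) l"
proof -
 have "nneg (D (rr j) j)" using rr_pos rr_ge_1 by blast
 moreover have e: "D (Suc (rr j)) j = cinv (D (rr j) j)" by (rule D_Suc[OF rr_ge_1])
 ultimately obtain k where k: "\<forall>l. UU (D (rr j) j) l = ev k l" "D (Suc (rr j)) j = - PP k"
  using cinv_crossing[OF RR_D[OF rr_ge_1]] rr_neg[of j] by metis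
 thus "D (Suc (rr j)) j = - PP (star0 j)" "UU (D (rr j) j) l = ev (star0 j) l"
  using star0_unique by auto
qed

lemma d_star: "d (star0 j) = d j"
 using chi_D_self[of "Suc (rr j)" j] by (simp add: D_star chi_minus_left chi_minus_right chi_PP_self)

lemma D_add: "s > 0 ==> D (s + m) i = (cinv ^^ m) (D s i)"
 by (induction m) (auto simp: D_Suc)

lemma cinv_pow_inj: "(cinv ^^ m) x = (cinv ^^ m) y ==> x = y"
 by (induction m) (auto dest: cinv_inj)

text \<open>If two orbits ended alike, they could be run backwards until the shorter one reaches its
  projective vector. Such a vector is not the image under \<open>cinv\<close> of a positive root,
  because the norm of the preimage would be minus a nonnegative coordinate.\<close>

lemma star0_inj_aux:
 assumes "star0 i = star0 j" "rr i \<le> rr j"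
 shows "i = j"
proof -
 define t where "t = rr j - rr i"
 have "D (1 + rr i) i = D (Suc t + rr i) j"
  using D_star[of i] D_star[of j] assms by (simp add: t_def)
 hence e: "PP i = D (Suc t) j"
  using D_add[of 1 "rr i" i] D_add[of "Suc t" "rr i" j] cinv_pow_inj by (metis D_1 One_nat_def zero_less_Suc)
 show ?thesis
 proof (cases "t = 0")
  case True
  thus ?thesis using e PP_inj by (simp add: D_1)
 next
  case False
  hence "cinv (D t j) = PP i" using e D_Suc[of t j] by simp
  hence u: "UU (D t j) l = - ev i l" for l using cinv_rel[of "D t j" l] by (simp add: LL_PP)
  have "chi (D t j) (D t j) = - (\<Sum>l\<in>UNIV. d l * of_int (D t j l) * of_int (ev i l))"
   by (simp add: chi_def u sum_negf mult_ac)
  hence "chi (D t j) (D t j) = - (d i * of_int (D t j i))"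
   by (simp add: sum_ev_real)
  moreover have "D t j i \<ge> 0" using rr_pos[of t j] False by (simp add: t_def nneg_def)
  ultimately have "chi (D t j) (D t j) \<le> 0" using d_pos[of i] by simp
  thus ?thesis using chi_D_self[of t j] False d_pos[of j] by simp
 qed
qed

lemma star0_inj: "star0 i = star0 j ==> i = j"
 using star0_inj_aux[of i j] star0_inj_aux[of j i] by (metis nat_le_linear)

subsection \<open>The star map is an involution\<close>

lemma rfl_rfl: "rfl k (rfl k x) = x"
proof -
 have "aa (rfl k x) k = - aa x k"
  unfolding rfl_eq aa_eq UU_lin LL_lin UU_ev LL_ev by (simp add: ev_def aa_eq)
 thus ?thesis by (auto simp: rfl_eq[of k "rfl k x"]) (auto simp: rfl_eq)
qed

lemma rfl_ev: "rfl k (ev k) = - ev k"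
proof -
 have "aa (ev k) k = 2" unfolding aa_eq by (simp add: UU_ev LL_ev) (simp add: ev_def)
 thus ?thesis by (auto simp: rfl_eq fun_eq_iff)
qed

lemma form_rfl: "chi (rfl k x) (rfl k y) + chi (rfl k y) (rfl k x) = chi x y + chi y x"
proof -
 have p: "chi (\<lambda>i. x i + 1 * y i) (\<lambda>i. x i + 1 * y i) = chi x x + chi y y + (chi x y + chi y x)" for x y
  unfolding chi_lin_left chi_lin_right by simp
 show ?thesis using p[of "rfl k x" "rfl k y"] p[of x y]
  unfolding rfl_lin[symmetric] chi_rfl by simp
qed

lemma form_fold:
 "chi (foldr rfl l x) (foldr rfl l y) + chi (foldr rfl l y) (foldr rfl l x) = chi x y + chi y x"
 by (induction l) (auto simp: form_rfl)

lemma form_ev: "chi x (ev k) + chi (ev k) x = d k * of_int (aa x k)"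
 by (simp add: chi_ev_left chi_ev_right aa_eq algebra_simps)

lemma chi_ev_ev: "chi (ev k) (ev k) = d k"
 by (simp add: chi_ev_left UU_ev) (simp add: ev_def)

lemma RR_ev: "RR (ev k)"
 unfolding RR_def chi_ev_ev
proof (intro conjI allI)
 show "ev k \<noteq> 0" by (auto simp: ev_def fun_eq_iff)
 fix j show "\<exists>z::int. d j * of_int (ev k j) = of_int z * d k"
  by (rule exI[of _ "ev k j"]) (simp add: ev_def)
qed

lemma nneg_ev: "nneg (ev k)" by (simp add: nneg_def ev_def)

text \<open>A word that carries one simple root to another conjugates the corresponding reflections;
  this is the deletion step of the exchange condition.\<close>

lemma fold_conj:
 assumes "foldr rfl v (ev k) = ev j"
 shows "rfl j (foldr rfl v (rfl k x)) = foldr rfl v x"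
proof -
 let ?y = "foldr rfl v x"
 have "d k = d j" using form_fold[of v "ev k" "ev k"] by (simp add: assms chi_ev_ev)
 moreover have "d j * of_int (aa ?y j) = d k * of_int (aa x k)"
  using form_fold[of v x "ev k"] by (simp add: assms form_ev)
 ultimately have aa: "aa ?y j = aa x k" using d_pos[of j] by simp
 have "foldr rfl v (rfl k x) = (\<lambda>i. ?y i + (- aa x k) * ev j i)"
  unfolding rfl_eq fold_lin assms ..
 also have "\<dots> = rfl j ?y" unfolding rfl_eq aa ..
 finally show ?thesis by (simp add: rfl_rfl)
qed

text \<open>Two dominant functionals in one orbit of the Weyl group coincide. A word ending in
  \<open>k\<close> can be shortened: if it makes \<open>ev k\<close> negative, dominance forces
  \<open>f\<close> to vanish on the image and the last reflection is invisible to \<open>f\<close>;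
  otherwise the exchange condition deletes two letters.\<close>

lemma dominant_unique:
 fixes f :: "('n => int) => int"
 assumes lin: "\<And>x c y. f (\<lambda>i. x i + c * y i) = f x + c * f y"
  and dom: "\<And>x. nneg x ==> f x \<ge> 0"
  and dom': "\<And>k. f (foldr rfl l (ev k)) \<ge> 0"
 shows "f (foldr rfl l x) = f x"
 using dom'
proof (induction l arbitrary: x rule: measure_induct_rule[where f = length])
 case (less l)
 show ?case
 proof (cases l rule: rev_cases)
  case (snoc l' k)
  have neg: "f (- y) = - f y" for y
   using lin[of 0 "-1" y] lin[of 0 1 0] by (simp add: fun_Compl_def zero_fun_def)
  consider "nneg (- foldr rfl l (ev k))" | "nneg (foldr rfl l (ev k))"
   using RR_coherent[OF RR_fold[OF RR_ev]] by blast
  thus ?thesis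
  proof cases
   case 1
   hence z: "f (foldr rfl l (ev k)) = 0"
    using dom[OF 1] less.prems[of k] by (simp add: neg)
   have e: "f (foldr rfl l' y) = f (foldr rfl l y)" for y
   proof -
    have "f (foldr rfl l' y) = f (foldr rfl l (rfl k y))" by (simp add: snoc rfl_rfl)
    also have "\<dots> = f (foldr rfl l y)" unfolding rfl_eq fold_lin lin z by simp
    finally show ?thesis .
   qed
   have "f (foldr rfl l' x) = f x"
   proof (rule less.IH)
    show "length l' < length l" by (simp add: snoc)
    show "0 \<le> f (foldr rfl l' (ev m))" for m unfolding e by (rule less.prems)
   qed
   thus ?thesis unfolding e .
  next
   case 2
   have "foldr rfl l (ev k) = - foldr rfl l' (ev k)" by (simp add: snoc rfl_ev fold_minus)
   hence "nneg (- foldr rfl l' (ev k))" using 2 by simp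
   hence "\<not> nneg (foldr rfl l' (ev k))" using RR_not_both[OF RR_fold[OF RR_ev]] by blast
   then obtain u j v where uv: "l' = u @ j # v" "foldr rfl v (ev k) = ev j"
    using fold_crossing[OF RR_ev nneg_ev] by blast
   have e: "foldr rfl l y = foldr rfl (u @ v) y" for y
    using fold_conj[OF uv(2)] by (simp add: snoc uv(1))
   have "f (foldr rfl (u @ v) x) = f x"
   proof (rule less.IH)
    show "length (u @ v) < length l" by (simp add: snoc uv(1))
    show "0 \<le> f (foldr rfl (u @ v) (ev m))" for m unfolding e[symmetric] by (rule less.prems)
   qed
   thus ?thesis unfolding e .
  qed
 qed simp
qed

lemma cinv_pow_fold: "(cinv ^^ m) x = foldr rfl (concat (replicate m ks)) x"
 by (induction m) (auto simp: cinv_def)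

lemma chi_cinv_pow: "chi ((cinv ^^ m) x) ((cinv ^^ m) y) = chi x y"
 by (induction m) (auto simp: chi_cinv)

lemma coord_star: "(cinv ^^ rr i) x (star0 i) = - x i"
proof -
 have "PP (star0 i) = - (cinv ^^ rr i) (PP i)"
  using D_star[of i] D_add[of 1 "rr i" i] by (metis D_1 One_nat_def add.inverse_inverse plus_1_eq_Suc zero_less_one)
 hence "chi (PP (star0 i)) ((cinv ^^ rr i) x) = - chi (PP i) x"
  by (simp add: chi_minus_left chi_cinv_pow)
 hence "d i * of_int ((cinv ^^ rr i) x (star0 i)) = d i * of_int (- x i)"
  by (simp add: chi_PP d_star)
 thus ?thesis using d_pos[of i] by (metis less_numeral_extra(3) mult_cancel_left of_int_eq_iff)
qed

lemma star_star: "star0 (star0 i) = i"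
proof -
 let ?k = "star0 (star0 i)" and ?m = "rr (star0 i) + rr i"
 define f :: "('n => int) => int" where "f x = x ?k" for x
 \<comment> \<open>The two signs of \<open>coord_star\<close> cancel, so the coordinate at
   \<open>?k\<close> is carried to the coordinate at \<open>i\<close>; both are dominant, hence
   equal.\<close>
 have e: "(cinv ^^ ?m) x ?k = x i" for x
  by (simp add: funpow_add coord_star)
 have "f (foldr rfl (concat (replicate ?m ks)) (ev i)) = f (ev i)"
 proof (rule dominant_unique)
  fix k show "0 \<le> f (foldr rfl (concat (replicate ?m ks)) (ev k))"
   unfolding cinv_pow_fold[symmetric] f_def e by (simp add: ev_def)
 qed (auto simp: f_def nneg_def)
 hence "ev i i = ev i ?k" unfolding cinv_pow_fold[symmetric] f_def e .
 thus ?thesis by (simp add: ev_def split: if_splits)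
qed

subsection \<open>Mesh relations\<close>

text \<open>\<open>PP i\<close> is supported at or before \<open>i\<close>. After \<open>i\<close>
  all terms in the relation for \<open>cinv\<close> are therefore nonnegative, by induction from the
  sinks, and at a successor \<open>j\<close> the contribution of \<open>i\<close> itself is
  positive.\<close>

lemma D2_pos: assumes "E i j" shows "D 2 i j > 0"
proof -
 define x where "x = PP i"
 have D2: "D 2 i = cinv x" using D_Suc[of 1 i] by (simp add: x_def D_1 numeral_2_eq_2)
 have eq: "cinv x k = - x k - (\<Sum>l | E l k. a k l * x l) - (\<Sum>l | E k l. a k l * cinv x l)" for k
  using cinv_rel[of x k] by (simp add: LL_def UU_def)
 have xz: "x k = 0" if "rho k > rho i" for k
  using PP_support[of i k] that by (auto simp: x_def)
 have s1: "0 \<le> - (\<Sum>l | E l k. a k l * x l)" for k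
  unfolding sum_negf[symmetric]
  by (rule sum_nonneg) (use E_neg' PP_nneg[of i] in \<open>force simp: nneg_def mult_le_0_iff x_def\<close>)
 have s2: "0 \<le> - (\<Sum>l | E k l. a k l * cinv x l)"
  if "\<And>l. E k l ==> 0 \<le> cinv x l" for k
  unfolding sum_negf[symmetric]
  by (rule sum_nonneg) (use E_neg that in \<open>force simp: mult_le_0_iff\<close>)
 have nn: "0 \<le> cinv x k" if "rho k > rho i" for k
  using that
 proof (induction k rule: wf_induct_rule[OF wf_E_converse])
  case (1 k)
  have "0 \<le> - (\<Sum>l | E k l. a k l * cinv x l)"
   by (rule s2) (use 1 rho_less in \<open>fastforce\<close>)
  thus ?case using eq[of k] s1[of k] xz[OF 1(2)] by linarith
 qed
 have "- (\<Sum>l | E l j. a j l * x l) \<ge> - (a j i * x i)"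
  unfolding sum_negf[symmetric]
  by (rule member_le_sum) (use assms E_neg' PP_nneg[of i] in \<open>force simp: nneg_def mult_le_0_iff x_def\<close>)+
 moreover have "x i = 1" by (simp add: x_def PP_same)
 moreover have "0 \<le> - (\<Sum>l | E j l. a j l * cinv x l)"
  by (rule s2) (use assms nn rho_less in \<open>meson less_trans\<close>)
 ultimately show ?thesis
  using eq[of j] xz[of j] rho_less[OF assms] E_neg'[OF assms] by (simp add: D2)
qed

text \<open>At the end of one orbit stands minus a projective vector, so its form with a still
  positive root of the other orbit is at most zero; by \<open>chi_D_le\<close> the same number is a
  positive coordinate. This interlacing keeps mesh neighbours inside the set of labels.\<close>

lemma rr_edge: assumes "E i j" shows "rr j \<le> rr i" "rr i \<le> Suc (rr j)"
proof -
 show "rr j \<le> rr i"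
 proof (rule ccontr)
  assume "\<not> rr j \<le> rr i"
  hence t: "Suc (rr i) \<le> rr j" by simp
  have "chi (D (Suc (rr i)) i) (D (Suc (rr i)) j) = d i * of_int (PP j i)"
   by (simp add: chi_D_le D_1)
  moreover have "chi (D (Suc (rr i)) i) (D (Suc (rr i)) j) = - (d i * of_int (D (Suc (rr i)) j (star0 i)))"
   by (simp add: D_star chi_minus_left chi_PP d_star)
  moreover have "D (Suc (rr i)) j (star0 i) \<ge> 0"
   using rr_pos[of "Suc (rr i)" j] t by (simp add: nneg_def)
  ultimately have "d i * of_int (PP j i) \<le> 0" using d_pos[of i]
   by (metis mult_nonneg_nonneg neg_le_0_iff_le of_int_0_le_iff order_less_imp_le)
  thus False using PP_edge[OF assms] d_pos[of i] by (simp add: mult_le_0_iff)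
 qed
 show "rr i \<le> Suc (rr j)"
 proof (rule ccontr)
  assume "\<not> rr i \<le> Suc (rr j)"
  hence t: "Suc (Suc (rr j)) \<le> rr i" by simp
  have "chi (D (Suc (rr j)) j) (D (Suc (Suc (rr j))) i) = d j * of_int (D 2 i j)"
   by (simp add: chi_D_le numeral_2_eq_2)
  moreover have "chi (D (Suc (rr j)) j) (D (Suc (Suc (rr j))) i) = - (d j * of_int (D (Suc (Suc (rr j))) i (star0 j)))"
   by (simp add: D_star chi_minus_left chi_PP d_star)
  moreover have "D (Suc (Suc (rr j))) i (star0 j) \<ge> 0"
   using rr_pos[of "Suc (Suc (rr j))" i] t by (simp add: nneg_def)
  ultimately have "d j * of_int (D 2 i j) \<le> 0" using d_pos[of j]
   by (metis mult_nonneg_nonneg neg_le_0_iff_le of_int_0_le_iff order_less_imp_le)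
  thus False using D2_pos[OF assms] d_pos[of j] by (simp add: mult_le_0_iff)
 qed
qed

text \<open>Dimension vectors of the indecomposable injectives: the orbit that ends at
  \<open>j\<close> starts at \<open>star0 j\<close>.\<close>

definition II :: "'n => 'n => int" where "II j = D (rr (star0 j)) (star0 j)"

lemma II_star: "II (star0 j) = D (rr j) j"
 by (simp add: II_def star_star)

lemma UU_II: "UU (II j) l = ev j l"
 using UU_star[of "star0 j" l] by (simp add: II_def star_star)

lemma chi_II: "chi z (II k) = d k * of_int (z k)"
 by (rule chi_UU) (rule UU_II)

lemma II_PP: "d l * of_int (II j l) = d j * of_int (PP l j)"
 using chi_PP[of l "II j"] chi_II[of "PP l" j] by simp

lemma II_support: "II j l \<noteq> 0 ==> rho j \<le> rho l"
 using II_PP[of l j] d_pos[of l] PP_support[of l j] by (cases "PP l j = 0") auto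

lemma II_same: "II j j = 1"
 using II_PP[of j j] d_pos[of j] by (simp add: PP_same)

lemma II_nneg: "nneg (II j)"
 unfolding II_def by (rule rr_pos[OF rr_ge_1]) simp

lemma II_eq: "II j l = ev j l - (\<Sum>i | E j i. a i j * II i l)"
proof -
 have "II j = (\<lambda>l. ev j l + (-1) * (\<Sum>i | E j i. a i j * II i l))"
 proof (rule UU_inj)
  fix k
  have "(\<Sum>i | E j i. a i j * ev i k) = (if E j k then a k j else 0)"
   using sum_ev[of "\<lambda>i. a i j" k "{i. E j i}"] by (simp add: ev_def eq_commute)
  thus "UU (II j) k = UU (\<lambda>l. ev j l + (-1) * (\<Sum>i | E j i. a i j * II i l)) k"
   unfolding UU_lin UU_sum UU_II UU_ev by simp
 qed
 from fun_cong[OF this, of l] show ?thesis by simp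
qed

lemma PP_eq': "PP j l = ev j l - (\<Sum>i | E i j. a i j * PP i l)"
 by (simp add: PP.simps[of j])

text \<open>Additivity on almost split sequences. Both combinations \<open>X\<close> and
  \<open>Y\<close> are moved by \<open>cinv\<close>, so the relation need only be checked at
  \<open>t = 1\<close>, where \<open>Y\<close> is a simple root.\<close>

lemma D_mesh:
 assumes "t > 0"
 shows "D t j k + D (Suc t) j k = - (\<Sum>i | E i j. a i j * D (Suc t) i k) - (\<Sum>i | E j i. a i j * D t i k)"
proof -
 define X where "X t = (\<lambda>k. D t j k + 1 * (\<Sum>i | E j i. a i j * D t i k))" for t
 define Y where "Y t = (\<lambda>k. D t j k + 1 * (\<Sum>i | E i j. a i j * D t i k))" for t
 have cs: "cinv (\<lambda>k. \<Sum>i\<in>S. c i * y i k) = (\<lambda>k. \<Sum>i\<in>S. c i * cinv (y i) k)"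
  for S :: "'n set" and c y
  by (simp add: cinv_sum LL_sum UU_sum cinv_rel sum_negf)
 have XS: "X (Suc t) = cinv (X t)" if "t > 0" for t
  unfolding X_def cinv_lin cs using that by (simp add: D_Suc)
 have YS: "Y (Suc t) = cinv (Y t)" if "t > 0" for t
  unfolding Y_def cinv_lin cs using that by (simp add: D_Suc)
 have "Y (Suc t) = - X t"
  using assms
 proof (induction t rule: nat_induct_non_zero)
  case 1
  have "Y 1 k = ev j k" for k
   using PP_eq'[of j k] by (simp add: Y_def D_1)
  hence Y1: "Y 1 = ev j" by auto
  have "LL (X 1) k = UU (ev j) k" for k
   unfolding X_def LL_lin LL_sum
   by (simp add: D_1 LL_PP UU_ev) (auto simp: ev_def sum.If_cases Int_def if_distrib cong: if_cong)
  hence "cinv (ev j) = - X 1" unfolding cinv_sum by (simp add: LL_minus)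
  thus ?case using YS[of 1] Y1 by simp
 next
  case (Suc t)
  thus ?case using XS[of t] YS[of "Suc t"] by (simp only: cinv_minus zero_less_Suc)
 qed
 from fun_cong[OF this, of k] show ?thesis by (simp add: X_def Y_def algebra_simps)
qed

lemma D_nonneg: "t \<le> rr j ==> 0 \<le> D t j k"
 using rr_pos[of t j] by (cases "t = 0") (auto simp: nneg_def D_def)


text \<open>The two ways in which the neighbour \<open>i\<close> of \<open>k\<close> can enter the mesh relation after the last
 positive root of \<open>k\<close>: with an injective or with a negative projective vector. Comparing supports
 separates the two kinds.\<close>

definition late :: "'n => 'n => bool" where
 "late k i \<longleftrightarrow> (E i k \<and> rr i = Suc (rr k)) \<or> (E k i \<and> rr i = rr k)"

definition early :: "'n => 'n => bool" where
 "early k i \<longleftrightarrow> (E i k \<and> rr i = rr k) \<or> (E k i \<and> Suc (rr i) = rr k)"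

lemma late_or_early: "E i k \<or> E k i ==> late k i \<or> early k i"
 using rr_edge[of i k] rr_edge[of k i] by (auto simp: late_def early_def)

text \<open>The form between the two final roots is a positive coordinate, so \<open>star0 i\<close>
  lies in the support of the injective vector at \<open>star0 k\<close>, and these supports are
  triangular.\<close>

lemma late_rho: assumes "late k i" shows "rho (star0 k) < rho (star0 i)"
proof -
 have "II (star0 k) (star0 i) > 0"
 proof (cases "E k i")
  case True
  hence r: "rr i = rr k" using assms E_asym by (auto simp: late_def)
  have "chi (II (star0 k)) (II (star0 i)) = d k * of_int (PP i k)"
   using chi_D_le[of "rr k" "rr k" k i] rr_ge_1[of k] by (simp add: II_star r[symmetric] D_1)
  hence "d i * of_int (II (star0 k) (star0 i)) > 0"
   using PP_edge[OF True] d_pos[of k] by (simp add: chi_II d_star)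
  thus ?thesis using d_pos[of i] by (simp add: zero_less_mult_iff)
 next
  case False
  hence r: "E i k" "rr i = Suc (rr k)" using assms by (auto simp: late_def)
  have "chi (II (star0 k)) (II (star0 i)) = d k * of_int (D 2 i k)"
   using chi_D_le[of "rr k" "Suc (rr k)" k i] rr_ge_1[of k]
   by (simp add: II_star r(2) numeral_2_eq_2)
  hence "d i * of_int (II (star0 k) (star0 i)) > 0"
   using D2_pos[OF r(1)] d_pos[of k] by (simp add: chi_II d_star)
  thus ?thesis using d_pos[of i] by (simp add: zero_less_mult_iff)
 qed
 hence "rho (star0 k) \<le> rho (star0 i)" using II_support by force
 moreover have "i \<noteq> k" using assms by (auto simp: late_def)
 ultimately show ?thesis using rho_inj star0_inj by (metis le_neq_implies_less)
qed

lemma early_rho: assumes "early k i" shows "rho (star0 i) < rho (star0 k)"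
proof -
 have PPs: "PP (star0 j) = - D (Suc (rr j)) j" for j by (simp add: D_star)
 have "PP (star0 k) (star0 i) > 0"
 proof (cases "E i k")
  case True
  hence r: "rr i = rr k" using assms E_asym by (auto simp: early_def)
  have "chi (PP (star0 i)) (PP (star0 k)) = d i * of_int (PP k i)"
   unfolding PPs chi_minus_left chi_minus_right r by (simp add: chi_D_le D_1)
  hence "d i * of_int (PP (star0 k) (star0 i)) > 0"
   using PP_edge[OF True] d_pos[of i] by (simp add: chi_PP d_star)
  thus ?thesis using d_pos[of i] by (simp add: zero_less_mult_iff)
 next
  case False
  hence r: "E k i" "rr k = Suc (rr i)" using assms by (auto simp: early_def)
  have "chi (PP (star0 i)) (PP (star0 k)) = d i * of_int (D 2 k i)"
   unfolding PPs chi_minus_left chi_minus_right r by (simp add: chi_D_le numeral_2_eq_2)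
  hence "d i * of_int (PP (star0 k) (star0 i)) > 0"
   using D2_pos[OF r(1)] d_pos[of i] by (simp add: chi_PP d_star)
  thus ?thesis using d_pos[of i] by (simp add: zero_less_mult_iff)
 qed
 hence "rho (star0 i) \<le> rho (star0 k)" using PP_support by force
 moreover have "i \<noteq> k" using assms by (auto simp: early_def)
 ultimately show ?thesis using rho_inj star0_inj by (metis le_neq_implies_less)
qed

lemma mesh_last:
 "II (star0 k) l + (\<Sum>i | late k i. a i k * II (star0 i) l) =
  PP (star0 k) l + (\<Sum>i | early k i. a i k * PP (star0 i) l)"
proof -
 have m: "D (rr k) k l + D (Suc (rr k)) k l =
   - (\<Sum>i | E i k. a i k * D (Suc (rr k)) i l) - (\<Sum>i | E k i. a i k * D (rr k) i l)"
  by (rule D_mesh[OF rr_ge_1])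
 have 1: "(\<Sum>i | E i k. a i k * D (Suc (rr k)) i l) =
   (\<Sum>i | E i k \<and> rr i = Suc (rr k). a i k * II (star0 i) l) -
   (\<Sum>i | E i k \<and> rr i = rr k. a i k * PP (star0 i) l)"
 proof -
  have "{i. E i k} = {i. E i k \<and> rr i = Suc (rr k)} \<union> {i. E i k \<and> rr i = rr k}"
   using rr_edge[of _ k] by force
  hence "(\<Sum>i | E i k. a i k * D (Suc (rr k)) i l) =
   (\<Sum>i | E i k \<and> rr i = Suc (rr k). a i k * D (Suc (rr k)) i l) +
   (\<Sum>i | E i k \<and> rr i = rr k. a i k * D (Suc (rr k)) i l)"
   by (simp only:) (rule sum.union_disjoint, auto)
  also have "(\<Sum>i | E i k \<and> rr i = Suc (rr k). a i k * D (Suc (rr k)) i l) =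
   (\<Sum>i | E i k \<and> rr i = Suc (rr k). a i k * II (star0 i) l)"
   by (rule sum.cong) (auto simp: II_star)
  also have "(\<Sum>i | E i k \<and> rr i = rr k. a i k * D (Suc (rr k)) i l) =
   (\<Sum>i | E i k \<and> rr i = rr k. - (a i k * PP (star0 i) l))"
   by (rule sum.cong) (auto simp: D_star dest: sym)
  finally show ?thesis by (simp add: sum_negf)
 qed
 have 2: "(\<Sum>i | E k i. a i k * D (rr k) i l) =
   (\<Sum>i | E k i \<and> rr i = rr k. a i k * II (star0 i) l) -
   (\<Sum>i | E k i \<and> Suc (rr i) = rr k. a i k * PP (star0 i) l)"
 proof -
  have "{i. E k i} = {i. E k i \<and> rr i = rr k} \<union> {i. E k i \<and> Suc (rr i) = rr k}"
   using rr_edge[of k] by force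
  hence "(\<Sum>i | E k i. a i k * D (rr k) i l) =
   (\<Sum>i | E k i \<and> rr i = rr k. a i k * D (rr k) i l) +
   (\<Sum>i | E k i \<and> Suc (rr i) = rr k. a i k * D (rr k) i l)"
   by (simp only:) (rule sum.union_disjoint, auto)
  also have "(\<Sum>i | E k i \<and> rr i = rr k. a i k * D (rr k) i l) =
   (\<Sum>i | E k i \<and> rr i = rr k. a i k * II (star0 i) l)"
   by (rule sum.cong) (auto simp: II_star dest: sym)
  also have "(\<Sum>i | E k i \<and> Suc (rr i) = rr k. a i k * D (rr k) i l) =
   (\<Sum>i | E k i \<and> Suc (rr i) = rr k. - (a i k * PP (star0 i) l))"
   by (rule sum.cong) (auto simp: D_star dest: sym)
  finally show ?thesis by (simp add: sum_negf)
 qed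
 have 3: "(\<Sum>i | late k i. f i) = (\<Sum>i | E i k \<and> rr i = Suc (rr k). f i) + (\<Sum>i | E k i \<and> rr i = rr k. f i)"
  for f :: "'n => int"
  unfolding late_def Collect_disj_eq by (rule sum.union_disjoint) auto
 have 4: "(\<Sum>i | early k i. f i) = (\<Sum>i | E i k \<and> rr i = rr k. f i) + (\<Sum>i | E k i \<and> Suc (rr i) = rr k. f i)"
  for f :: "'n => int"
  unfolding early_def Collect_disj_eq by (rule sum.union_disjoint) auto
 show ?thesis using m unfolding 1 2 3 4 by (simp add: II_star D_star)
qed

text \<open>In \<open>mesh_last\<close> the injective side can differ from the simple root only
  after \<open>star0 k\<close> and the projective side only before it. As the sides are equal, each
  is the simple root.\<close>

lemma mesh_last_split:
 "II (star0 k) l + (\<Sum>i | late k i. a i k * II (star0 i) l) = ev (star0 k) l"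
 "PP (star0 k) l + (\<Sum>i | early k i. a i k * PP (star0 i) l) = ev (star0 k) l"
proof -
 have "II (star0 k) l + (\<Sum>i | late k i. a i k * II (star0 i) l) = ev (star0 k) l \<or>
  PP (star0 k) l + (\<Sum>i | early k i. a i k * PP (star0 i) l) = ev (star0 k) l"
 proof (cases "rho l \<le> rho (star0 k)")
  case True
  have "II (star0 k) l = ev (star0 k) l"
   using True II_support[of "star0 k" l] II_same rho_inj[of l "star0 k"]
   by (auto simp: ev_def) (metis le_antisym)
  moreover have "II (star0 i) l = 0" if "late k i" for i
   using late_rho[OF that] II_support[of "star0 i" l] True by auto
  ultimately show ?thesis by simp
 next
  case False
  hence "PP (star0 k) l = ev (star0 k) l"
   using PP_support[of "star0 k" l] by (auto simp: ev_def)
  moreover have "PP (star0 i) l = 0" if "early k i" for i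
   using early_rho[OF that] PP_support[of "star0 i" l] False by auto
  ultimately show ?thesis by simp
 qed
 thus "II (star0 k) l + (\<Sum>i | late k i. a i k * II (star0 i) l) = ev (star0 k) l"
  "PP (star0 k) l + (\<Sum>i | early k i. a i k * PP (star0 i) l) = ev (star0 k) l"
  using mesh_last[of k l] by auto
qed

lemma sum_ev_star: "(\<Sum>i\<in>S. f i * ev (star0 i) l) = (if star0 l \<in> S then f (star0 l) else (0::int))"
proof -
 have "(\<Sum>i\<in>S. f i * ev (star0 i) l) = (\<Sum>i\<in>S. f i * ev (star0 l) i)"
  by (rule sum.cong) (auto simp: ev_def star_star)
 thus ?thesis by (simp add: sum_ev)
qed

text \<open>\<open>UU\<close> turns injective vectors into unit vectors; applied to the first half
  of the split it lists the edges that leave \<open>star0 k\<close>.\<close>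

lemma late_star: "(if E (star0 k) l then a l (star0 k) else 0) = (if late k (star0 l) then a (star0 l) k else 0)"
proof -
 have e: "(\<lambda>l. II (star0 k) l + 1 * (\<Sum>i | late k i. a i k * II (star0 i) l)) = ev (star0 k)"
  using mesh_last_split(1) by auto
 have "UU (\<lambda>l. II (star0 k) l + 1 * (\<Sum>i | late k i. a i k * II (star0 i) l)) l = UU (ev (star0 k)) l"
  unfolding e ..
 thus ?thesis unfolding UU_lin UU_sum UU_II UU_ev sum_ev_star by simp
qed

lemma early_star: "(if E l (star0 k) then a l (star0 k) else 0) = (if early k (star0 l) then a (star0 l) k else 0)"
proof -
 have e: "(\<lambda>l. PP (star0 k) l + 1 * (\<Sum>i | early k i. a i k * PP (star0 i) l)) = ev (star0 k)"
  using mesh_last_split(2) by auto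
 have "LL (\<lambda>l. PP (star0 k) l + 1 * (\<Sum>i | early k i. a i k * PP (star0 i) l)) l = LL (ev (star0 k)) l"
  unfolding e ..
 thus ?thesis unfolding LL_lin LL_sum LL_PP LL_ev sum_ev_star by simp
qed

lemma late_iff: "late k i \<longleftrightarrow> E (star0 k) (star0 i)"
proof -
 have "late k i ==> a i k \<noteq> 0" using E_neg E_neg' by (force simp: late_def)
 moreover have "E (star0 k) (star0 i) ==> a (star0 i) (star0 k) \<noteq> 0" using E_neg' by force
 ultimately show ?thesis using late_star[of k "star0 i"] by (auto simp: star_star split: if_splits)
qed

lemma early_iff: "early k i \<longleftrightarrow> E (star0 i) (star0 k)"
proof -
 have "early k i ==> a i k \<noteq> 0" using E_neg E_neg' by (force simp: early_def)
 moreover have "E (star0 i) (star0 k) ==> a (star0 i) (star0 k) \<noteq> 0" using E_neg by force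
 ultimately show ?thesis using early_star[of "star0 i" k] by (auto simp: star_star split: if_splits)
qed

lemma a_star: "a (star0 i) (star0 k) = a i k"
proof (cases "E i k \<or> E k i")
 case True
 thus ?thesis
  using late_or_early[OF True] late_star[of k "star0 i"] early_star[of "star0 i" k] late_iff early_iff
  by (auto simp: star_star)
next
 case False
 show ?thesis
 proof (cases "i = k")
  case False
  hence "a i k = 0" using E_total \<open>\<not> (E i k \<or> E k i)\<close> by blast
  moreover have "\<not> late k i" "\<not> early k i" using \<open>\<not> (E i k \<or> E k i)\<close> by (auto simp: late_def early_def)
  hence "a (star0 i) (star0 k) = 0"
   using late_iff early_iff E_total False star0_inj by metis
  ultimately show ?thesis by simp
 qed simp
qed

end

lemma dual_dual [simp]: "dual_cartan (dual_cartan a) = a"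
 by (simp add: dual_cartan_def)

section \<open>The dual diagram: coroots, with the same orbit lengths and the same star\<close>

context dynkin begin

lemma dual: "dynkin (dual_cartan a) E (\<lambda>i. 1 / d i)"
proof
 fix v :: "real^'n"
 assume "v \<noteq> 0"
 define w :: "real^'n" where "w = (\<chi> i. v $ i / d i)"
 have dn: "d i \<noteq> 0" for i using d_pos[of i] by simp
 have "w \<noteq> 0" using \<open>v \<noteq> 0\<close> dn by (auto simp: w_def vec_eq_iff)
 hence "(\<Sum>i\<in>UNIV. \<Sum>j\<in>UNIV. d i * of_int (a i j) * w $ i * w $ j) > 0" by (rule posdef)
 also have "(\<Sum>i\<in>UNIV. \<Sum>j\<in>UNIV. d i * of_int (a i j) * w $ i * w $ j) =
  (\<Sum>i\<in>UNIV. \<Sum>j\<in>UNIV. 1 / d i * of_int (dual_cartan a i j) * v $ i * v $ j)"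
 proof (intro sum.cong refl)
  fix i j
  have "of_int (a i j) / d j = of_int (a j i) / d i"
   using symm[of i j] dn by (simp add: field_simps)
  hence "(of_int (a i j) / d j) * (v $ i * v $ j) = (of_int (a j i) / d i) * (v $ i * v $ j)" by simp
  thus "d i * of_int (a i j) * w $ i * w $ j = 1 / d i * of_int (dual_cartan a i j) * v $ i * v $ j"
   using dn by (simp add: w_def dual_cartan_def)
 qed
 finally show "(\<Sum>i\<in>UNIV. \<Sum>j\<in>UNIV. 1 / d i * of_int (dual_cartan a i j) * v $ i * v $ j) > 0" .
next
 fix i j
 have dn: "d i \<noteq> 0" for i using d_pos[of i] by simp
 show "1 / d i * of_int (dual_cartan a i j) = 1 / d j * of_int (dual_cartan a j i)"
  using symm[of i j] dn by (simp add: dual_cartan_def field_simps)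
 show "orientation (dual_cartan a) E"
  using orient zero_sym unfolding orientation_def dual_cartan_def by metis
qed (use d_pos diag offdiag zero_sym in \<open>auto simp: dual_cartan_def\<close>)

interpretation dl: dynkin "dual_cartan a" E "\<lambda>i. 1 / d i" by (rule dual)

lemma dual_PP: "d i * of_int (dl.PP i j) = d j * of_int (PP i j)"
proof (induction i rule: measure_induct_rule[where f = rho])
 case (less i)
 have "d i * of_int (\<Sum>l | E l i. dual_cartan a l i * dl.PP l j) =
   (\<Sum>l | E l i. (d i * of_int (a i l)) * of_int (dl.PP l j))"
  by (simp add: dual_cartan_def sum_distrib_left mult_ac)
 also have "\<dots> = (\<Sum>l | E l i. of_int (a l i) * (d l * of_int (dl.PP l j)))"
  unfolding symm[of i] by (simp add: mult_ac)
 also have "\<dots> = (\<Sum>l | E l i. of_int (a l i) * (d j * of_int (PP l j)))"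
  by (rule sum.cong) (use less rho_less in auto)
 also have "\<dots> = d j * of_int (\<Sum>l | E l i. a l i * PP l j)"
  by (simp add: sum_distrib_left mult_ac)
 finally show ?case
  unfolding dl.PP_eq'[of i j] PP_eq'[of i j] by (simp add: algebra_simps) (simp add: ev_def dl.ev_def)
qed

lemma dual_rfl:
 assumes "\<And>j. c * of_int (y j) = d j * of_int (x j)"
 shows "c * of_int (dl.rfl k y j) = d j * of_int (rfl k x j)"
proof (cases "j = k")
 case True
 have "c * of_int (\<Sum>l\<in>UNIV. dual_cartan a k l * y l) = (\<Sum>l\<in>UNIV. of_int (a l k) * (c * of_int (y l)))"
  by (simp add: dual_cartan_def sum_distrib_left mult_ac)
 also have "\<dots> = (\<Sum>l\<in>UNIV. (d l * of_int (a l k)) * of_int (x l))"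
  unfolding assms by (simp add: mult_ac)
 also have "\<dots> = d k * of_int (\<Sum>l\<in>UNIV. a k l * x l)"
  unfolding symm[of _ k] by (simp add: sum_distrib_left mult_ac)
 finally show ?thesis using True assms[of k] by (simp add: dl.rfl_def rfl_def algebra_simps)
qed (use assms in \<open>simp add: dl.rfl_def rfl_def\<close>)

lemma dual_fold:
 assumes "\<And>j. c * of_int (y j) = d j * of_int (x j)"
 shows "c * of_int (foldr dl.rfl l y j) = d j * of_int (foldr rfl l x j)"
 by (induction l arbitrary: j) (auto simp: assms intro: dual_rfl)

text \<open>The vectors of the dual diagram are coroots. Since the rescaling is by positive factors,
  signs agree and both diagrams have the same labels.\<close>

lemma dual_D: "d i * of_int (dl.D t i j) = d j * of_int (D t i j)"
proof (cases "t = 0")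
 case False
 hence "t > 0" by simp
 thus ?thesis
 proof (induction t arbitrary: j rule: nat_induct_non_zero)
  case 1
  thus ?case by (simp add: dl.D_1 D_1 dual_PP)
 next
  case (Suc t)
  have "foldr dl.rfl ks (dl.D t i) = dl.D (Suc t) i" "foldr rfl ks (D t i) = D (Suc t) i"
   using Suc by (simp_all add: dl.D_Suc D_Suc dl.cinv_def cinv_def)
  thus ?case using dual_fold[of "d i" "dl.D t i" "D t i" ks j] Suc.IH by simp
 qed
qed (simp add: D_def dl.D_def)

lemma scale_sign: "0 < c ==> 0 < c' ==> c * of_int x = c' * (of_int y :: real) ==> 0 \<le> x \<longleftrightarrow> 0 \<le> y"
 by (metis mult_less_cancel_left_pos mult_zero_right not_less of_int_0 of_int_0_le_iff zero_le_mult_iff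
   less_le_not_le)

lemma dual_nneg: "dl.nneg (dl.D t i) \<longleftrightarrow> nneg (D t i)"
 unfolding nneg_def dl.nneg_def using scale_sign[OF d_pos d_pos dual_D] by blast

lemma dual_rr: "dl.rr i = rr i"
 by (simp add: dl.rr_def rr_def dual_nneg)

lemma dual_star0: "dl.star0 i = star0 i"
proof (rule dl.star0_unique)
 have "dl.D (Suc (rr i)) i j = - dl.PP (star0 i) j" for j
 proof -
  have "d i * of_int (dl.D (Suc (rr i)) i j) = d i * of_int (- dl.PP (star0 i) j)"
   using dual_D[of i "Suc (rr i)" j] dual_PP[of "star0 i" j] by (simp add: D_star d_star)
  thus ?thesis using d_pos[of i] by (metis less_numeral_extra(3) mult_cancel_left of_int_eq_iff)
 qed
 thus "dl.D (Suc (dl.rr i)) i = - dl.PP (star0 i)" by (auto simp: dual_rr)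
qed

section \<open>Labels\<close>

text \<open>\<open>lab\<close>, \<open>tu\<close> and \<open>cc\<close> are \<open>\<Pi>\<close>, \<open>\<tau>\<close> and the compatibility degree; \<open>nb g i\<close>, taken with multiplicity
 \<open>wt i j\<close>, runs through the middle terms of the mesh from \<open>tu g\<close> to \<open>g = (t, j)\<close>.\<close>

definition lab :: "(nat \<times> 'n) set" where "lab = {(s, i). s \<le> rr i}"

fun tu :: "nat \<times> 'n => nat \<times> 'n" where
 "tu (0, i) = (rr (star0 i), star0 i)"
| "tu (Suc t, i) = (t, i)"

definition nb :: "nat \<times> 'n => 'n => nat \<times> 'n" where
 "nb g i = (if E i (snd g) then (fst g, i) else tu (fst g, i))"

definition wt :: "'n => 'n => nat" where "wt i j = nat (- a i j)"

definition cc :: "nat \<times> 'n => nat \<times> 'n => nat" where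
 "cc w g = (if fst w < fst g then nat (D (fst g - fst w) (snd g) (snd w))
   else if fst g < fst w then nat (dynkin.D (dual_cartan a) E (fst w - fst g) (snd w) (snd g))
   else 0)"


end

context dynkin begin

interpretation dl: dynkin "dual_cartan a" E "\<lambda>i. 1 / d i" by (rule dual)

lemma dual_lab: "dl.lab = lab" by (simp add: dl.lab_def lab_def dual_rr)

lemma dual_tu: "dl.tu g = tu g"
 by (cases g rule: tu.cases) (auto simp: dual_rr dual_star0)

lemma dual_nb: "dl.nb g i = nb g i" by (simp add: dl.nb_def nb_def dual_tu)

lemma dual_wt: "dl.wt i j = wt j i" unfolding dl.wt_def wt_def by (simp add: dual_cartan_def)

text \<open>Exchanging the arguments is duality, so a statement on one argument in the dual diagram
  gives one on the other argument here.\<close>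

lemma cc_swap: "cc w g = dl.cc g w" by (auto simp: cc_def dl.cc_def)

lemma wt_pos_iff: "wt i j > 0 \<longleftrightarrow> E i j \<or> E j i"
proof (cases "i = j")
 case False
 thus ?thesis using E_total[of i j] E_neg[of i j] E_neg'[of j i] offdiag[OF False]
  by (auto simp: wt_def)
qed (simp add: wt_def)

lemma wt_self [simp]: "wt i i = 0" by (simp add: wt_def)

lemma wt_eq_0: "\<not> E i j ==> \<not> E j i ==> wt i j = 0"
 using wt_pos_iff[of i j] by simp

lemma int_wt: "E i j \<or> E j i ==> int (wt i j) = - a i j"
 using E_neg[of i j] E_neg'[of j i] by (auto simp: wt_def)

lemma wt_star: "wt (star0 i) (star0 j) = wt i j"
 by (simp add: wt_def a_star)

lemma finite_lab: "finite lab"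
proof -
 have "lab = (\<Union>i. (\<lambda>s. (s, i)) ` {..rr i})" by (auto simp: lab_def)
 thus ?thesis by simp
qed

lemma lab0 [simp]: "(0, i) \<in> lab" by (simp add: lab_def)

lemma tu_lab: "g \<in> lab ==> tu g \<in> lab"
 by (cases g rule: tu.cases) (auto simp: lab_def)

definition ti :: "nat \<times> 'n => nat \<times> 'n" where
 "ti g = (if fst g < rr (snd g) then (Suc (fst g), snd g) else (0, star0 (snd g)))"

lemma ti_lab: "g \<in> lab ==> ti g \<in> lab"
 by (auto simp: ti_def lab_def)

lemma tu_ti: "g \<in> lab ==> tu (ti g) = g"
 by (auto simp: ti_def lab_def star_star)

lemma ti_tu: "g \<in> lab ==> ti (tu g) = g"
 by (cases g rule: tu.cases) (auto simp: ti_def lab_def star_star)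

lemma tu_inj: "g \<in> lab ==> h \<in> lab ==> tu g = tu h \<longleftrightarrow> g = h"
 by (metis ti_tu)

lemma nb_lab:
 assumes "h \<in> lab" "E i (snd h) \<or> E (snd h) i"
 shows "nb h i \<in> lab"
proof -
 obtain t j where g: "h = (t, j)" by force
 show ?thesis
 proof (cases "E i j")
  case True
  thus ?thesis using assms rr_edge[OF True] by (auto simp: nb_def g lab_def)
 next
  case False
  hence "E j i" using assms g by simp
  thus ?thesis using assms rr_edge[of j i] False
   by (cases t) (auto simp: nb_def g lab_def)
 qed
qed

text \<open>Stepping from time \<open>0\<close> back to the end of the orbits relabels the vertices
  by the star.\<close>

definition sg :: "nat \<times> 'n => 'n => 'n" where "sg g i = (if fst g = 0 then star0 i else i)"

lemma bij_sg: "bij (sg g)"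
 by (rule o_bij[of "sg g"]) (auto simp: sg_def fun_eq_iff star_star)

lemma snd_tu: "snd (tu g) = sg g (snd g)"
 by (cases g rule: tu.cases) (auto simp: sg_def)

lemma wt_sg: "wt (sg g i) (snd (tu g)) = wt i (snd g)"
 unfolding snd_tu by (simp add: sg_def wt_star)

lemma E_star_iff: "E i j \<longleftrightarrow> early (star0 j) (star0 i)" "E i j \<longleftrightarrow> late (star0 i) (star0 j)"
 using early_iff[of "star0 j" "star0 i"] late_iff[of "star0 i" "star0 j"] by (auto simp: star_star)

text \<open>Away from time \<open>0\<close> this is a shift of time. At time \<open>0\<close> the
  last meshes of the orbits have to fit onto the first ones; \<open>early\<close> and
  \<open>late\<close> tell at which of the two final times each neighbour lands.\<close>

lemma tu_nb:
 assumes "E i (snd h) \<or> E (snd h) i"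
 shows "tu (nb h i) = nb (tu h) (sg h i)"
proof -
 obtain t j where g: "h = (t, j)" by force
 have pos: "rr k = Suc (rr k - 1)" for k using rr_ge_1[of k] by simp
 have tus: "tu (rr k, l) = (rr k - 1, l)" for k l
  using pos[of k] by (metis tu.simps(2) diff_Suc_1)
 show ?thesis
 proof (cases t)
  case 0
  show ?thesis
  proof (cases "E i j")
   case True
   hence "early (star0 j) (star0 i)" using E_star_iff by blast
   thus ?thesis using True E_asym
    by (auto simp: nb_def g 0 sg_def early_def tus)
  next
   case False
   hence "E j i" using assms g by simp
   hence "late (star0 j) (star0 i)" using E_star_iff by blast
   thus ?thesis using False E_asym
    by (auto simp: nb_def g 0 sg_def late_def tus)
  qed
 qed (auto simp: nb_def g sg_def)
qed

lemma nb_inj: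
 assumes "wt i (snd h) > 0" "wt i' (snd h) > 0" "nb h i = nb h i'"
 shows "i = i'"
proof -
 obtain t j where g: "h = (t, j)" by force
 show ?thesis
  using assms rr_ge_1[of "star0 i"] rr_ge_1[of "star0 i'"]
  by (cases t) (auto simp: nb_def g split: if_splits dest: star0_inj)
qed

text \<open>The vertex through which \<open>tu h\<close> is again a neighbour of
  \<open>nb h i\<close>.\<close>

definition lx :: "nat \<times> 'n => 'n => 'n" where
 "lx g i = (if fst g = 0 \<and> E (snd g) i then star0 (snd g) else snd g)"

lemma nb_nb:
 assumes "E i (snd h) \<or> E (snd h) i"
 shows "nb (nb h i) (lx h i) = tu h" "wt (lx h i) (snd (nb h i)) = wt (snd h) i"
proof -
 obtain t j where g: "h = (t, j)" by force
 have pos: "rr k = Suc (rr k - 1)" for k using rr_ge_1[of k] by simp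
 have tus: "tu (rr k, l) = (rr k - 1, l)" for k l
  using pos[of k] by (metis tu.simps(2) diff_Suc_1)
 have "nb (nb h i) (lx h i) = tu h \<and> wt (lx h i) (snd (nb h i)) = wt (snd h) i"
 proof (cases "E i j")
  case True
  thus ?thesis using E_asym[OF True] by (auto simp: nb_def g lx_def)
 next
  case False
  hence e: "E j i" using assms g by simp
  show ?thesis
  proof (cases t)
   case 0
   have l: "late (star0 j) (star0 i)" using e E_star_iff by blast
   thus ?thesis using False e E_asym
    by (auto simp: nb_def g lx_def 0 wt_star late_def tus)
  qed (use e False in \<open>auto simp: nb_def g lx_def\<close>)
 qed
 thus "nb (nb h i) (lx h i) = tu h" "wt (lx h i) (snd (nb h i)) = wt (snd h) i" by auto
qed

text \<open>The arrows ending in \<open>tu q\<close> are the reversed arrows starting in \<open>q\<close>.\<close>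

lemma sum_nb_reverse:
 fixes g :: "nat \<times> 'n => 'b::comm_semiring_1"
 assumes "q \<in> lab"
 shows "(\<Sum>v\<in>lab. \<Sum>i\<in>UNIV. if nb v i = tu q then of_nat (wt i (snd v)) * g v else 0) =
  (\<Sum>i\<in>UNIV. of_nat (wt (snd q) i) * g (nb q i))"
proof -
 let ?S = "{(v, i). v \<in> lab \<and> wt i (snd v) > 0 \<and> nb v i = tu q}"
 let ?h = "\<lambda>i. (nb q i, lx q i)"
 let ?A = "{i. wt (snd q) i > 0}"
 have adj: "i \<in> ?A ==> E i (snd q) \<or> E (snd q) i" for i using wt_pos_iff by auto
 have inj: "inj_on ?h ?A"
 proof (rule inj_onI)
  fix x y assume "x \<in> ?A" "y \<in> ?A" "?h x = ?h y"
  thus "x = y" using nb_inj[of x q y] wt_pos_iff by (metis mem_Collect_eq prod.inject)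
 qed
 have im: "?h ` ?A = ?S"
 proof (intro equalityI subsetI)
  fix x assume "x \<in> ?h ` ?A"
  then obtain i where i: "i \<in> ?A" "x = ?h i" by blast
  thus "x \<in> ?S" using nb_nb[OF adj[OF i(1)]] nb_lab[OF assms adj[OF i(1)]] by auto
 next
  fix x assume "x \<in> ?S"
  then obtain v i where x: "x = (v, i)" "v \<in> lab" "wt i (snd v) > 0" "nb v i = tu q" by blast
  have e: "E i (snd v) \<or> E (snd v) i" using x(3) wt_pos_iff by blast
  obtain k where k: "lx v i = sg q k" using bij_sg[of q] by (metis bij_pointE)
  have "wt (sg q k) (snd (tu q)) > 0"
   using nb_nb(2)[OF e] x(3,4) k wt_pos_iff by (metis)
  hence kw: "wt k (snd q) > 0" by (simp add: wt_sg)
  hence ke: "E k (snd q) \<or> E (snd q) k" using wt_pos_iff by blast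
  have "tu v = tu (nb q k)" using nb_nb(1)[OF e] tu_nb[OF ke] x(4) k by simp
  hence w: "v = nb q k" using tu_inj x(2) nb_lab[OF assms ke] by blast
  have "i = lx q k"
   by (rule nb_inj[of _ v]) (use x nb_nb[OF ke] kw wt_pos_iff in \<open>auto simp: w\<close>)
  thus "x \<in> ?h ` ?A" using x(1) w kw wt_pos_iff by auto
 qed
 have "(\<Sum>v\<in>lab. \<Sum>i\<in>UNIV. if nb v i = tu q then of_nat (wt i (snd v)) * g v else 0) =
   (\<Sum>(v, i)\<in>lab \<times> UNIV. if nb v i = tu q then of_nat (wt i (snd v)) * g v else 0)"
  by (rule sum.cartesian_product)
 also have "\<dots> = (\<Sum>(v, i)\<in>?S. of_nat (wt i (snd v)) * g v)"
  by (rule sum.mono_neutral_cong_right) (auto simp: finite_lab split: if_splits intro!: gr0I)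
 also have "\<dots> = (\<Sum>i\<in>?A. of_nat (wt (snd q) i) * g (nb q i))"
  unfolding im[symmetric] by (subst sum.reindex[OF inj]) (auto intro!: sum.cong simp: nb_nb(2)[OF adj])
 also have "\<dots> = (\<Sum>i\<in>UNIV. of_nat (wt (snd q) i) * g (nb q i))"
  by (rule sum.mono_neutral_left) auto
 finally show ?thesis .
qed

lemma chi_II_left: "t > 0 ==> chi (II i) (D t j) = - (d i * of_int (D (Suc t) j i))"
 using chi_Serre[of "D t j" "II i"] by (simp add: D_Suc chi_II)

lemma nat_scale:
 assumes "c > 0" "c * of_int x = c * (of_int y :: real)" shows "nat x = nat y"
 using assms by simp

lemma nat_le_0: "c > 0 ==> c * of_int x \<le> (0::real) ==> nat x = 0"
 by (simp add: mult_le_0_iff)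

text \<open>The case in which \<open>tu\<close> is not a shift of time: \<open>(0, i)\<close> goes
  to the last root of an orbit, an injective vector. Its form with another root is a coordinate in
  either order (\<open>chi_II\<close>, \<open>chi_II_left\<close>), and comparison with
  \<open>chi_D_le\<close> and \<open>chi_D_gt\<close> shows that the truncations at zero
  agree.\<close>

lemma cc_tu_aux:
 assumes "h \<in> lab"
 shows "cc (tu (0, i)) (tu h) = cc (0, i) h"
proof -
 obtain t j where g: "h = (t, j)" by force
 let ?k = "star0 i" and ?s = "rr (star0 i)"
 have s: "?s > 0" by (rule rr_ge_1)
 have t: "t \<le> rr j" using assms g by (simp add: lab_def)
 have dk: "d ?k = d i" by (rule d_star)
 consider "t = 0" | "t = 1" | "t > 1" by linarith
 thus ?thesis
 proof cases
  case 1
  let ?l = "star0 j" and ?t = "rr (star0 j)"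
  have n: "chi (II p) (II q) \<ge> 0" for p q
   using II_nneg[of p] d_pos[of q] by (simp add: chi_II nneg_def)
  have "cc (?s, ?k) (?t, ?l) = 0"
  proof (cases ?s ?t rule: linorder_cases)
   case less
   hence "chi (D ?t ?l) (D ?s ?k) = - (d ?k * of_int (D (?t - ?s) ?l ?k))"
    using chi_D_gt[of ?s ?t ?l ?k] s by simp
   thus ?thesis using n[of j i] less nat_le_0[OF d_pos[of ?k]] by (simp add: cc_def II_def)
  next
   case greater
   hence "chi (D ?s ?k) (D ?t ?l) = - (d ?l * of_int (D (?s - ?t) ?k ?l))"
    using chi_D_gt[of ?t ?s ?k ?l] rr_ge_1 by simp
   hence "d ?k * of_int (dl.D (?s - ?t) ?k ?l) \<le> 0" using n[of i j] by (simp add: II_def dual_D)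
   thus ?thesis using greater nat_le_0[OF d_pos[of ?k]] by (simp add: cc_def)
  qed (simp add: cc_def)
  thus ?thesis using 1 by (simp add: g cc_def)
 next
  case 2
  have "d i * of_int (dl.D ?s ?k j) = d i * of_int (PP j i)"
   using dual_D[of ?k ?s j] II_PP[of j i] by (simp add: dk II_def)
  from nat_scale[OF d_pos this] show ?thesis using s 2 by (simp add: g cc_def D_1)
 next
  case 3
  define u where "u = t - 1"
  have u: "t = Suc u" "u > 0" "u \<le> rr j" using 3 t by (auto simp: u_def)
  have K1: "chi (D ?s ?k) (D u j) = - (d i * of_int (D t j i))"
   using chi_II_left[OF u(2), of i j] by (simp add: II_def u(1))
  have K2: "chi (D u j) (D ?s ?k) = d i * of_int (D u j i)"
   using chi_II[of "D u j" i] by (simp add: II_def)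
  have Dn: "0 \<le> D u j i" using D_nonneg[OF u(3)] .
  have R: "cc (0, i) h = nat (D t j i)" using 3 by (simp add: g cc_def)
  have L: "cc (tu (0, i)) (tu h) = cc (?s, ?k) (u, j)" by (simp add: g u(1))
  show ?thesis
  proof (cases ?s u rule: linorder_cases)
   case less
   have "0 \<le> chi (D ?s ?k) (D u j)"
    using chi_D_le[of ?s u ?k j] s less u D_nonneg[of "u - ?s + 1" j ?k] d_pos[of ?k] by simp
   hence "nat (D t j i) = 0" using K1 nat_le_0[OF d_pos[of i]] by simp
   moreover have "d ?k * of_int (D (u - ?s) j ?k) \<le> 0"
    using chi_D_gt[of ?s u j ?k] s less K2 mult_nonneg_nonneg[of "d i" "of_int (D u j i)"] Dn d_pos[of i]
    by simp
   hence "nat (D (u - ?s) j ?k) = 0" using nat_le_0[OF d_pos[of ?k]] by simp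
   ultimately show ?thesis unfolding L R using less by (simp add: cc_def)
  next
   case equal
   have "0 \<le> chi (D ?s ?k) (D u j)"
    using chi_D_le[of ?s u ?k j] s equal PP_nneg[of j] d_pos[of ?k] by (simp add: D_1 nneg_def)
   hence "nat (D t j i) = 0" using K1 nat_le_0[OF d_pos[of i]] by simp
   thus ?thesis unfolding L R using equal by (simp add: cc_def)
  next
   case greater
   have "d i * of_int (dl.D (?s - u) ?k j) = d i * of_int (D t j i)"
    using chi_D_gt[of u ?s ?k j] u greater K1 dual_D[of ?k "?s - u" j] by (simp add: dk)
   from nat_scale[OF d_pos this] show ?thesis unfolding L R using greater by (simp add: cc_def)
  qed
 qed
qed

end

section \<open>Mesh relations of the compatibility degree\<close>

context dynkin begin

interpretation dl: dynkin "dual_cartan a" E "\<lambda>i. 1 / d i" by (rule dual)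

lemma cc_tu:
 assumes "w \<in> lab" "h \<in> lab"
 shows "cc (tu w) (tu h) = cc w h"
proof -
 obtain s i t j where g: "w = (s, i)" "h = (t, j)" by force
 consider "s = 0" | "t = 0" | s' t' where "s = Suc s'" "t = Suc t'" by (cases s; cases t) auto
 thus ?thesis
 proof cases
  case 1
  thus ?thesis using cc_tu_aux[OF assms(2)] g by simp
 next
  case 2
  thus ?thesis using dl.cc_tu_aux[of w j] assms(1) g by (simp add: cc_swap dual_tu dual_lab)
 qed (auto simp: g cc_def)
qed

lemma sum_wt:
 "(\<Sum>i\<in>UNIV. int (wt i j) * f i) = - (\<Sum>i | E i j. a i j * f i) - (\<Sum>i | E j i. a i j * f i)"
proof -
 have "(\<Sum>i\<in>UNIV. int (wt i j) * f i) =
   (\<Sum>i\<in>UNIV. (if E i j then - (a i j * f i) else 0) + (if E j i then - (a i j * f i) else 0))"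
  by (rule sum.cong) (use E_asym wt_eq_0 int_wt in auto)
 thus ?thesis by (simp add: sum.distrib sum.If_cases Int_def sum_negf)
qed

lemma int_cc0: "(t, j) \<in> lab ==> int (cc (0, k) (t, j)) = D t j k"
 using D_nonneg[of t j k] by (cases "t = 0") (simp_all add: cc_def lab_def, simp add: D_def)

lemma cc_mesh0:
 assumes "h \<in> lab"
 shows "int (cc (0, k) h) + int (cc (0, k) (tu h)) =
  of_bool ((0, k) = h) + of_bool ((0, k) = tu h) +
  (\<Sum>i\<in>UNIV. int (wt i (snd h)) * int (cc (0, k) (nb h i)))"
proof -
 obtain t j where g: "h = (t, j)" by force
 have nl: "E i j \<or> E j i ==> nb h i \<in> lab" for i using nb_lab[OF assms, of i] g by simp
 have S1: "(\<Sum>i | E i j. a i j * int (cc (0, k) (nb h i))) = (\<Sum>i | E i j. a i j * D t i k)"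
 proof (rule sum.cong)
  fix i assume "i \<in> {i. E i j}"
  hence e: "E i j" by simp
  hence "(t, i) \<in> lab" using nl[of i] by (simp add: nb_def g)
  thus "a i j * int (cc (0, k) (nb h i)) = a i j * D t i k"
   using e by (simp add: nb_def g int_cc0)
 qed simp
 have tl: "tu h \<in> lab" by (rule tu_lab[OF assms])
 have S2: "(\<Sum>i | E j i. a i j * int (cc (0, k) (nb h i))) =
   (\<Sum>i | E j i. a i j * (if t = 0 then II i k else D (t - 1) i k))"
 proof (rule sum.cong)
  fix i assume "i \<in> {i. E j i}"
  hence e: "E j i" "\<not> E i j" using E_asym by auto
  have "tu (t, i) \<in> lab" using nl[of i] e by (simp add: nb_def g)
  thus "a i j * int (cc (0, k) (nb h i)) = a i j * (if t = 0 then II i k else D (t - 1) i k)"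
   using e by (cases t) (auto simp: nb_def g int_cc0 II_def)
 qed simp
 consider "t = 0" | "t = 1" | u where "t = Suc u" "u > 0" by (cases t) auto
 thus ?thesis
 proof cases
  case 1
  have "int (cc (0, k) (tu h)) = II j k" using tl by (simp add: g 1 int_cc0 II_def)
  moreover have "(0, k) \<noteq> tu h" using rr_ge_1[of "star0 j"] by (simp add: g 1)
  moreover have c0: "cc (0, k) (0, j) = 0" by (simp add: cc_def)
  ultimately show ?thesis
   unfolding sum_wt g snd_conv using S1 S2 II_eq[of j k] c0 rr_ge_1[of "star0 j"]
   by (simp add: g 1) (simp add: ev_def D_def)
 next
  case 2
  have "int (cc (0, k) (tu h)) = 0" by (simp add: g 2 cc_def)
  thus ?thesis
   unfolding sum_wt g snd_conv using S1 S2 PP_eq'[of j k] int_cc0[of t j k] assms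
   by (simp add: g 2 D_1) (simp add: ev_def D_def)
 next
  case 3
  have "int (cc (0, k) (tu h)) = D u j k" using tl by (simp add: g 3 int_cc0)
  thus ?thesis
   unfolding sum_wt g snd_conv using S1 S2 D_mesh[OF 3(2), of j k] int_cc0[of t j k] assms 3
   by (auto simp: g 3(1))
 qed
qed

text \<open>For \<open>v\<close> at time \<open>0\<close> these are the mesh relations of root
  coordinates; invariance under \<open>tu\<close> carries them to all \<open>v\<close>.\<close>

lemma cc_mesh:
 assumes "v \<in> lab" "g \<in> lab"
 shows "int (cc v g) + int (cc v (tu g)) = of_bool (v = g) + of_bool (v = tu g) +
  (\<Sum>i\<in>UNIV. int (wt i (snd g)) * int (cc v (nb g i)))"
proof -
 obtain s k where w: "v = (s, k)" by force
 show ?thesis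
  using assms unfolding w
 proof (induction s arbitrary: g)
  case 0
  thus ?case using cc_mesh0 by blast
 next
  case (Suc s)
  let ?w = "(Suc s, k)" and ?w' = "(s, k)"
  have w': "?w' \<in> lab" "tu ?w = ?w'" using Suc.prems(1) by (auto simp: lab_def)
  have cct: "cc ?w h = cc ?w' (tu h)" if "h \<in> lab" for h
   using cc_tu[OF Suc.prems(1) that] w' by simp
  have "(\<Sum>i\<in>UNIV. int (wt i (snd g)) * int (cc ?w (nb g i))) =
    (\<Sum>i\<in>UNIV. int (wt (sg g i) (snd (tu g))) * int (cc ?w' (nb (tu g) (sg g i))))"
  proof (rule sum.cong)
   fix i
   show "int (wt i (snd g)) * int (cc ?w (nb g i)) =
     int (wt (sg g i) (snd (tu g))) * int (cc ?w' (nb (tu g) (sg g i)))"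
   proof (cases "E i (snd g) \<or> E (snd g) i")
    case True
    thus ?thesis using cct[OF nb_lab[OF Suc.prems(2) True]] tu_nb[OF True] by (simp add: wt_sg)
   next
    case False
    thus ?thesis using wt_eq_0 by (simp add: wt_sg)
   qed
  qed simp
  also have "\<dots> = (\<Sum>i\<in>UNIV. int (wt i (snd (tu g))) * int (cc ?w' (nb (tu g) i)))"
   by (rule sum.reindex_bij_betw) (use bij_sg in simp)
  finally show ?case
   using Suc.IH[OF w'(1) tu_lab[OF Suc.prems(2)]] cct[OF Suc.prems(2)] cct[OF tu_lab[OF Suc.prems(2)]]
    tu_inj[OF Suc.prems(1) Suc.prems(2)] tu_inj[OF Suc.prems(1) tu_lab[OF Suc.prems(2)]] w'(2)
   by simp
 qed
qed

end

context dynkin begin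

interpretation dl: dynkin "dual_cartan a" E "\<lambda>i. 1 / d i" by (rule dual)

lemma cc_mesh_left:
 assumes "w \<in> lab" "g \<in> lab"
 shows "int (cc w g) + int (cc (tu w) g) = of_bool (g = w) + of_bool (g = tu w) +
  (\<Sum>i\<in>UNIV. int (wt (snd w) i) * int (cc (nb w i) g))"
 using dl.cc_mesh[of g w] assms by (simp add: cc_swap dual_tu dual_lab dual_nb dual_wt)

text \<open>The exponent of \<open>F h\<close> in \<open>f w\<close>.\<close>

definition mm :: "nat \<times> 'n => nat \<times> 'n => int" where
 "mm w h = (\<Sum>i\<in>UNIV. if nb w i = h then int (wt i (snd w)) else 0) - of_bool (h = w) - of_bool (h = tu w)"

text \<open>By \<open>sum_nb_reverse\<close> the sum reassembles \<open>cc_mesh_left\<close> at the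
  label \<open>ti h\<close>. In \<open>prod_cc\<close> it makes all factors cancel except those at
  \<open>g\<close> and \<open>tu g\<close>.\<close>

lemma cc_mm:
 assumes "h \<in> lab" "g \<in> lab"
 shows "(\<Sum>w\<in>lab. int (cc w g) * mm w h) = - of_bool (h = g) - of_bool (h = tu g)"
proof -
 define q where "q = ti h"
 have e: "q \<in> lab" "tu q = h" using assms ti_lab tu_ti by (auto simp: q_def)
 have "(\<Sum>w\<in>lab. int (cc w g) * mm w h) =
   (\<Sum>w\<in>lab. \<Sum>i\<in>UNIV. if nb w i = h then int (wt i (snd w)) * int (cc w g) else 0)
   - (\<Sum>w\<in>lab. int (cc w g) * of_bool (h = w)) - (\<Sum>w\<in>lab. int (cc w g) * of_bool (h = tu w))"
  unfolding mm_def right_diff_distrib sum_subtractf sum_distrib_left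
  by (intro arg_cong2[where f = minus] sum.cong refl) (auto simp: mult.commute)
 also have "(\<Sum>w\<in>lab. \<Sum>i\<in>UNIV. if nb w i = h then int (wt i (snd w)) * int (cc w g) else 0) =
   (\<Sum>i\<in>UNIV. int (wt (snd q) i) * int (cc (nb q i) g))"
  using sum_nb_reverse[OF e(1), of "\<lambda>w. int (cc w g)"] e(2) by simp
 also have "(\<Sum>w\<in>lab. int (cc w g) * of_bool (h = w)) = int (cc h g)"
  using assms(1) finite_lab by (simp add: of_bool_def if_distrib cong: if_cong)
 also have "(\<Sum>w\<in>lab. int (cc w g) * of_bool (h = tu w)) = int (cc q g)"
 proof -
  have "(\<Sum>w\<in>lab. int (cc w g) * of_bool (h = tu w)) = (\<Sum>w\<in>lab. int (cc w g) * of_bool (q = w))"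
  proof (rule sum.cong)
   fix w assume "w \<in> lab"
   thus "int (cc w g) * of_bool (h = tu w) = int (cc w g) * of_bool (q = w)"
    using tu_inj[OF e(1)] by (simp add: e(2)[symmetric])
  qed simp
  thus ?thesis using e(1) finite_lab by (simp add: of_bool_def if_distrib cong: if_cong)
 qed
 finally show ?thesis
  using cc_mesh_left[OF e(1) assms(2)] e tu_inj[OF e(1), of "tu g"] tu_inj[OF e(1) assms(2)]
  by (auto simp: of_bool_def split: if_splits)
qed

lemma cc_self [simp]: "cc g g = 0" by (simp add: cc_def)

lemma cc_zero_sym: "cc w g = 0 \<longleftrightarrow> cc g w = 0"
proof -
 have "nat (dl.D m i j) = 0 \<longleftrightarrow> nat (D m i j) = 0" for m i j
 proof -
  have "d i * of_int (- dl.D m i j) = d j * of_int (- D m i j)"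
   using dual_D[of i m j] by simp
  from scale_sign[OF d_pos d_pos this] show ?thesis by simp
 qed
 thus ?thesis by (auto simp: cc_def)
qed

end

section \<open>Laurent polynomials\<close>

definition lsum :: "('k => 'c => 'b) => ('k \<Rightarrow>\<^sub>0 'c::zero) => 'b::comm_monoid_add" where
 "lsum \<phi> p = (\<Sum>m\<in>keys p. \<phi> m (lookup p m))"

lemma lsum_superset:
 assumes "finite S" "keys p \<subseteq> S" "\<And>m. \<phi> m 0 = 0"
 shows "lsum \<phi> p = (\<Sum>m\<in>S. \<phi> m (lookup p m))"
 unfolding lsum_def by (rule sum.mono_neutral_left) (use assms in \<open>auto simp: in_keys_iff\<close>)

lemma lsum_add:
 assumes "\<And>m. \<phi> m 0 = 0" "\<And>m x y. \<phi> m (x + y) = \<phi> m x + \<phi> m y"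
 shows "lsum \<phi> (p + q) = lsum \<phi> p + lsum \<phi> (q :: 'k \<Rightarrow>\<^sub>0 'c::comm_monoid_add)"
proof -
 let ?S = "keys p \<union> keys q"
 have "keys (p + q) \<subseteq> ?S" by (rule Poly_Mapping.keys_add)
 thus ?thesis
  using lsum_superset[of ?S "p + q" \<phi>] lsum_superset[of ?S p \<phi>] lsum_superset[of ?S q \<phi>] assms
  by (simp add: lookup_add sum.distrib)
qed

lemma lsum_single: "\<phi> m 0 = 0 ==> lsum \<phi> (single m c) = \<phi> m c"
 by (cases "c = 0") (auto simp: lsum_def)

lemma lsum_0 [simp]: "lsum \<phi> 0 = 0" by (simp add: lsum_def)

lemma lsum_sum:
 assumes "\<And>m. \<phi> m 0 = 0" "\<And>m x y. \<phi> m (x + y) = \<phi> m x + \<phi> m y"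
 shows "lsum \<phi> (\<Sum>i\<in>S. f i) = (\<Sum>i\<in>S. lsum \<phi> (f i :: 'k \<Rightarrow>\<^sub>0 'c::comm_monoid_add))"
 by (induction S rule: infinite_finite_induct) (simp_all add: lsum_add[of \<phi>] assms)

lemma lookup_sum_single:
 "finite S ==> lookup (\<Sum>m\<in>S. single m (f m)) k = (if k \<in> S then f k else 0)"
 by (simp add: lookup_sum lookup_single when_def)

lemma sum_monomials: "(\<Sum>m\<in>keys p. single m (lookup p m)) = p"
 by (rule poly_mapping_eqI) (simp add: lookup_sum_single in_keys_iff)

lemma mult_as_sum:
 fixes p q :: "'k::comm_monoid_add \<Rightarrow>\<^sub>0 'c::comm_semiring_0"
 shows "p * q = (\<Sum>m\<in>keys p. \<Sum>m'\<in>keys q.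
  single (m + m') (lookup p m * lookup q m'))"
proof -
 have "p * q = (\<Sum>m\<in>keys p. single m (lookup p m)) *
   (\<Sum>m'\<in>keys q. single m' (lookup q m'))"
  by (simp add: sum_monomials)
 thus ?thesis by (simp add: sum_product mult_single)
qed

lemma lsum_mult:
 fixes p q :: "'k::comm_monoid_add \<Rightarrow>\<^sub>0 'c::comm_semiring_0" and \<phi> :: "'k => 'c => 'b::comm_semiring_0"
 assumes "\<And>m. \<phi> m 0 = 0" "\<And>m x y. \<phi> m (x + y) = \<phi> m x + \<phi> m y"
  and "\<And>m m' x y. m \<in> keys p ==> m' \<in> keys q ==>
   \<phi> (m + m') (x * y) = \<phi> m x * \<phi> m' y"
 shows "lsum \<phi> (p * q) = lsum \<phi> p * lsum \<phi> q"
proof -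
 have "lsum \<phi> (p * q) = (\<Sum>m\<in>keys p. \<Sum>m'\<in>keys q.
   \<phi> (m + m') (lookup p m * lookup q m'))"
  unfolding mult_as_sum lsum_sum[of \<phi>, OF assms(1,2)] by (simp add: lsum_single assms(1))
 also have "\<dots> = lsum \<phi> p * lsum \<phi> q"
  unfolding lsum_def sum_product by (intro sum.cong refl) (simp add: assms(3))
 finally show ?thesis .
qed

definition mon :: "('n::finite => 'f::field) => ('n \<Rightarrow>\<^sub>0 int) => 'f" where
 "mon y m = (\<Prod>i\<in>UNIV. y i powi lookup m i)"

definition leval :: "('n::finite => 'f::field) => ('n, int) laurent => 'f" where
 "leval y = lsum (\<lambda>m c. of_int c * mon y m)"

text \<open>Evaluation is needed also at points with a zero coordinate; it is multiplicative there
  for polynomials without negative powers of that variable.\<close>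

definition nonneg_at :: "'n => ('n, 'c::zero) laurent => bool" where
 "nonneg_at i p \<longleftrightarrow> (\<forall>m\<in>keys p. 0 \<le> lookup m i)"

lemma mon_add:
 assumes "\<And>i. y i \<noteq> 0 \<or> (0 \<le> lookup m i \<and> 0 \<le> lookup m' i)"
 shows "mon y (m + m') = mon y m * mon y m'"
 unfolding mon_def prod.distrib[symmetric]
proof (rule prod.cong[OF refl])
 fix i
 show "y i powi lookup (m + m') i = y i powi lookup m i * y i powi lookup m' i"
  using assms[of i] by (cases "y i = 0") (auto simp: lookup_add power_int_add power_int_0_left_if add_nonneg_eq_0_iff)
qed

lemma leval_add: "leval y (p + q) = leval y p + leval y q"
 unfolding leval_def by (rule lsum_add) (auto simp: algebra_simps)

lemma leval_mult:
 assumes "\<And>i. y i \<noteq> 0 \<or> (nonneg_at i p \<and> nonneg_at i q)"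
 shows "leval y (p * q) = leval y p * leval y q"
 unfolding leval_def
proof (rule lsum_mult)
 fix m m' x z assume "m \<in> keys p" "m' \<in> keys q"
 hence "mon y (m + m') = mon y m * mon y m'"
  using assms by (intro mon_add) (auto simp: nonneg_at_def)
 thus "of_int (x * z) * mon y (m + m') = of_int x * mon y m * (of_int z * mon y m')" by simp
qed (auto simp: algebra_simps)

lemma leval_single [simp]: "leval y (single m c) = of_int c * mon y m"
 unfolding leval_def by (rule lsum_single) simp

lemma mon_0 [simp]: "mon y 0 = 1" by (simp add: mon_def)

lemma leval_1 [simp]: "leval y 1 = 1"
 using leval_single[of y 0 1] by simp

lemma leval_0 [simp]: "leval y 0 = 0" by (simp add: leval_def)

lemma nonneg_at_mult: "nonneg_at i p ==> nonneg_at i q ==> nonneg_at i (p * q :: ('n, int) laurent)"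
 unfolding nonneg_at_def using keys_mult[of p q] by (force simp: lookup_add)

lemma nonneg_at_1: "nonneg_at i (1 :: ('n, int) laurent)"
 by (simp add: nonneg_at_def)

lemma nonneg_at_prod: "(\<And>x. x \<in> S ==> nonneg_at i (f x)) ==> nonneg_at i (\<Prod>x\<in>S. f x :: ('n, int) laurent)"
 by (induction S rule: infinite_finite_induct) (auto simp: nonneg_at_1 intro: nonneg_at_mult)

lemma nonneg_at_power: "nonneg_at i p ==> nonneg_at i (p ^ e :: ('n, int) laurent)"
 by (induction e) (auto simp: nonneg_at_1 intro: nonneg_at_mult)

lemma leval_power:
 assumes "\<And>i. y i \<noteq> 0 \<or> nonneg_at i p"
 shows "leval y (p ^ e) = leval y p ^ e"
proof (induction e)
 case (Suc e)
 have "leval y (p * p ^ e) = leval y p * leval y (p ^ e)"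
  by (rule leval_mult) (metis assms nonneg_at_power)
 thus ?case using Suc by simp
qed simp

lemma leval_prod:
 assumes "\<And>i x. x \<in> S ==> y i \<noteq> 0 \<or> nonneg_at i (f x)"
 shows "leval y (\<Prod>x\<in>S. f x) = (\<Prod>x\<in>S. leval y (f x))"
 using assms
proof (induction S rule: infinite_finite_induct)
 case (insert x S)
 have "leval y (f x * prod f S) = leval y (f x) * leval y (prod f S)"
 proof (rule leval_mult)
  fix i
  show "y i \<noteq> 0 \<or> (nonneg_at i (f x) \<and> nonneg_at i (prod f S))"
  proof (cases "y i = 0")
   case True
   thus ?thesis using insert.prems[of x i] insert.prems[of _ i] nonneg_at_prod[of S i f] by auto
  qed simp
 qed
 thus ?case using insert by simp
qed auto

lemma const_mult:
 fixes p q :: "('n::finite, int) laurent"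
 assumes "\<And>i. nonneg_at i p" "\<And>i. nonneg_at i q"
 shows "lookup (p * q) 0 = lookup p 0 * lookup q 0"
proof -
 define \<phi> where "\<phi> m c = (if m = 0 then c else 0)" for m :: "'n \<Rightarrow>\<^sub>0 int" and c :: int
 have l: "lsum \<phi> r = lookup r 0" for r
  using lsum_superset[of "insert 0 (keys r)" r \<phi>] by (auto simp: \<phi>_def sum.delta cong: if_cong)
 have "lsum \<phi> (p * q) = lsum \<phi> p * lsum \<phi> q"
 proof (rule lsum_mult)
  fix m m' x y assume m: "m \<in> keys p" "m' \<in> keys q"
  have "m + m' = 0 \<longleftrightarrow> m = 0 \<and> m' = 0"
  proof
   assume "m + m' = 0"
   hence "lookup m i + lookup m' i = 0" for i
    by (metis lookup_add lookup_zero)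
   moreover have "lookup m i \<ge> 0" "lookup m' i \<ge> 0" for i
    using assms m by (auto simp: nonneg_at_def)
   ultimately have "lookup m i = 0 \<and> lookup m' i = 0" for i
    by (metis add_nonneg_eq_0_iff)
   thus "m = 0 \<and> m' = 0" by (auto intro: poly_mapping_eqI)
  qed simp
  thus "\<phi> (m + m') (x * y) = \<phi> m x * \<phi> m' y" by (auto simp: \<phi>_def)
 qed (auto simp: \<phi>_def)
 thus ?thesis by (simp add: l)
qed

subsection \<open>Initial forms and tropicalization\<close>

definition pr :: "('n::finite \<Rightarrow>\<^sub>0 int) => real^'n => real" where
 "pr m Y = (\<Sum>i\<in>UNIV. of_int (lookup m i) * Y $ i)"

lemma pr_add: "pr (m + m') Y = pr m Y + pr m' Y"
 by (simp add: pr_def lookup_add algebra_simps sum.distrib)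

lemma pr_0 [simp]: "pr 0 Y = 0" by (simp add: pr_def)

definition part :: "real^'n => real => ('n::finite, int) laurent => ('n, int) laurent" where
 "part Y c p = (\<Sum>m \<in> {m \<in> keys p. pr m Y = c}. single m (lookup p m))"

lemma lookup_part: "lookup (part Y c p) m = (if pr m Y = c then lookup p m else 0)"
 unfolding part_def by (subst lookup_sum_single) (auto simp: in_keys_iff)

lemma part_add: "part Y c (p + q) = part Y c p + part Y c q"
 by (rule poly_mapping_eqI) (simp add: lookup_part lookup_add)

definition low :: "real^'n => real => ('n::finite, int) laurent => bool" where
 "low Y c p \<longleftrightarrow> (\<forall>m\<in>keys p. c \<le> pr m Y)"

lemma low_mult: "low Y c p ==> low Y c' q ==> low Y (c + c') (p * q)"
 unfolding low_def using keys_mult[of p q] by (force simp: pr_add add_mono)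

lemma low_add: "low Y c p ==> low Y c q ==> low Y c (p + q)"
 unfolding low_def using Poly_Mapping.keys_add[of p q] by blast

lemma part_0: assumes "\<And>m. m \<in> keys p ==> c < pr m Y" shows "part Y c p = 0"
 by (rule poly_mapping_eqI) (use assms in \<open>force simp: lookup_part in_keys_iff\<close>)

lemma part_mult:
 assumes "low Y c p" "low Y c' q"
 shows "part Y (c + c') (p * q) = part Y c p * part Y c' q"
proof -
 define p' where "p' = p - part Y c p"
 define q' where "q' = q - part Y c' q"
 have pk: "c < pr m Y" if "m \<in> keys p'" for m
  using that assms(1) by (force simp: p'_def in_keys_iff lookup_minus lookup_part low_def split: if_splits)
 have qk: "c' < pr m Y" if "m \<in> keys q'" for m
  using that assms(2) by (force simp: q'_def in_keys_iff lookup_minus lookup_part low_def split: if_splits)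
 have e1: "part Y (c + c') (p' * q) = 0"
  by (rule part_0) (use pk assms(2) keys_mult[of p' q] in \<open>force simp: low_def pr_add add_less_le_mono\<close>)
 have pe: "pr m Y = c" if "m \<in> keys (part Y c p)" for m
  using that by (auto simp: in_keys_iff lookup_part split: if_splits)
 have qe: "pr m Y = c'" if "m \<in> keys (part Y c' q)" for m
  using that by (auto simp: in_keys_iff lookup_part split: if_splits)
 have e2: "part Y (c + c') (part Y c p * q') = 0"
  by (rule part_0) (use pe qk keys_mult[of "part Y c p" q'] in \<open>force simp: pr_add\<close>)
 have e3: "part Y (c + c') (part Y c p * part Y c' q) = part Y c p * part Y c' q"
 proof (rule poly_mapping_eqI)
  fix m
  show "lookup (part Y (c + c') (part Y c p * part Y c' q)) m = lookup (part Y c p * part Y c' q) m"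
  proof (cases "m \<in> keys (part Y c p * part Y c' q)")
   case True
   hence "pr m Y = c + c'"
    using keys_mult[of "part Y c p" "part Y c' q"] pe qe by (force simp: pr_add)
   thus ?thesis by (simp add: lookup_part)
  qed (simp add: lookup_part in_keys_iff)
 qed
 have "p * q = part Y c p * part Y c' q + part Y c p * q' + p' * q"
  by (simp add: p'_def q'_def algebra_simps)
 thus ?thesis by (simp add: part_add e1 e2 e3)
qed

lemma trop_eqI: assumes "low Y c p" "part Y c p \<noteq> 0" shows "trop_laurent p Y = c"
proof -
 from assms(2) obtain m where "lookup (part Y c p) m \<noteq> 0" by (metis lookup_zero poly_mapping_eqI)
 hence m: "m \<in> keys p" "pr m Y = c" by (auto simp: lookup_part in_keys_iff split: if_splits)
 thus ?thesis
  unfolding trop_laurent_def pr_def[symmetric]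
  by (intro Min_eqI) (use assms(1) in \<open>auto simp: low_def\<close>)
qed

lemma trop_low: assumes "p \<noteq> 0" shows "low Y (trop_laurent p Y) p" "part Y (trop_laurent p Y) p \<noteq> 0"
proof -
 let ?c = "trop_laurent p Y"
 have k: "keys p \<noteq> {}" using assms by simp
 show "low Y ?c p" unfolding low_def trop_laurent_def pr_def[symmetric] by auto
 have "?c \<in> (\<lambda>m. pr m Y) ` keys p"
  unfolding trop_laurent_def pr_def[symmetric] by (rule Min_in) (use k in auto)
 then obtain m where m: "m \<in> keys p" "pr m Y = ?c" by auto
 hence "lookup (part Y ?c p) m \<noteq> 0" by (simp add: lookup_part in_keys_iff)
 thus "part Y ?c p \<noteq> 0" by (metis lookup_zero)
qed

definition aug :: "('n::finite, int) laurent => int" where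
 "aug = lsum (\<lambda>m c. c)"

lemma aug_add: "aug (p + q) = aug p + aug q"
 unfolding aug_def by (rule lsum_add) auto

lemma aug_mult: "aug (p * q) = aug p * aug q"
 unfolding aug_def by (rule lsum_mult) auto

lemma aug_0 [simp]: "aug 0 = 0" by (simp add: aug_def)

text \<open>All initial forms are positive at \<open>(1,\<dots>,1)\<close>. This holds for every polynomial with a subtraction-free
 expression, and rules out cancellation of initial forms.\<close>

definition sfree :: "('n::finite, int) laurent => bool" where
 "sfree p \<longleftrightarrow> p \<noteq> 0 \<and> (\<forall>Y. aug (part Y (trop_laurent p Y) p) > 0)"

lemma sfree_nz: "sfree p ==> p \<noteq> 0" by (simp add: sfree_def)

lemma trop_mult:
 fixes p q :: "('n::{finite,linorder}, int) laurent"
 assumes "p \<noteq> 0" "q \<noteq> 0"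
 shows "trop_laurent (p * q) Y = trop_laurent p Y + trop_laurent q Y"
  "part Y (trop_laurent (p * q) Y) (p * q) = part Y (trop_laurent p Y) p * part Y (trop_laurent q Y) q"
proof -
 note l = trop_low[OF assms(1), of Y] trop_low[OF assms(2), of Y]
 have pm: "part Y (trop_laurent p Y + trop_laurent q Y) (p * q) = part Y (trop_laurent p Y) p * part Y (trop_laurent q Y) q"
  by (rule part_mult) (use l in auto)
 show 1: "trop_laurent (p * q) Y = trop_laurent p Y + trop_laurent q Y"
  by (rule trop_eqI) (use l low_mult pm in auto)
 show "part Y (trop_laurent (p * q) Y) (p * q) = part Y (trop_laurent p Y) p * part Y (trop_laurent q Y) q"
  unfolding 1 by (rule pm)
qed

lemma sfree_mult:
 fixes p q :: "('n::{finite,linorder}, int) laurent"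
 assumes "sfree p" "sfree q" shows "sfree (p * q)"
 using assms trop_mult(2)[of p q] by (auto simp: sfree_def aug_mult)

text \<open>Initial forms and their values at \<open>(1,...,1)\<close> are multiplicative, and a
  cofactor of a positive integer in a positive integer is positive. This is how positivity passes
  through the divisions that define the \<open>F\<close>-polynomials.\<close>

lemma sfree_cancel:
 fixes p q :: "('n::{finite,linorder}, int) laurent"
 assumes "sfree p" "sfree (p * q)" shows "sfree q"
 using assms trop_mult(2)[of p q] by (auto simp: sfree_def aug_mult zero_less_mult_iff) (metis less_asym)

text \<open>At the lower of the two weights the values at \<open>(1,...,1)\<close> add a positive
  and a nonnegative integer, so the initial form of the sum survives.\<close>

lemma sfree_add_aux:
 assumes "sfree p" "sfree q" "trop_laurent p Y \<le> trop_laurent q Y"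
 shows "trop_laurent (p + q) Y = trop_laurent p Y \<and> aug (part Y (trop_laurent p Y) (p + q)) > 0"
proof -
 let ?c = "trop_laurent p Y"
 note l = trop_low[OF sfree_nz[OF assms(1)], of Y] trop_low[OF sfree_nz[OF assms(2)], of Y]
 have lq: "low Y ?c q" using l(3) assms(3) by (auto simp: low_def)
 have "aug (part Y ?c q) \<ge> 0"
 proof (cases "?c = trop_laurent q Y")
  case True
  thus ?thesis using assms(2) unfolding sfree_def by (metis order_less_imp_le)
 next
  case False
  hence "part Y ?c q = 0"
   by (intro part_0) (use l(3) assms(3) in \<open>force simp: low_def\<close>)
  thus ?thesis by simp
 qed
 moreover have "aug (part Y ?c p) > 0" using assms(1) by (simp add: sfree_def)
 ultimately have pos: "aug (part Y ?c (p + q)) > 0" by (simp add: part_add aug_add)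
 hence "part Y ?c (p + q) \<noteq> 0" by auto
 hence "trop_laurent (p + q) Y = ?c" by (intro trop_eqI low_add l(1) lq)
 thus ?thesis using pos by simp
qed

lemma trop_add:
 assumes "sfree p" "sfree q"
 shows "trop_laurent (p + q) Y = min (trop_laurent p Y) (trop_laurent q Y)"
 using sfree_add_aux[OF assms, of Y] sfree_add_aux[OF assms(2,1), of Y]
 by (cases "trop_laurent p Y \<le> trop_laurent q Y") (auto simp: add.commute min_def)

lemma sfree_add:
 assumes "sfree p" "sfree q" shows "sfree (p + q)"
proof -
 have "aug (part Y (trop_laurent (p + q) Y) (p + q)) > 0" for Y
  using sfree_add_aux[OF assms, of Y] sfree_add_aux[OF assms(2,1), of Y]
  by (cases "trop_laurent p Y \<le> trop_laurent q Y") (auto simp: add.commute)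
 moreover from this[of 0] have "p + q \<noteq> 0" by (auto simp: part_def)
 ultimately show ?thesis by (simp add: sfree_def)
qed

lemma trop_single: "c \<noteq> 0 ==> trop_laurent (single m c) Y = pr m Y"
 by (simp add: trop_laurent_def pr_def)

lemma sfree_single: "c > 0 ==> sfree (single m c)"
proof -
 assume c: "c > 0"
 have p: "part Y (pr m Y) (single m c) = single m c" for Y
  by (rule poly_mapping_eqI) (simp add: lookup_part lookup_single when_def)
 have "single m c \<noteq> 0" using c by (metis less_irrefl lookup_single_eq lookup_zero)
 thus ?thesis using c by (simp add: sfree_def trop_single p) (simp add: aug_def lsum_single)
qed

lemma trop_1 [simp]: "trop_laurent 1 Y = 0"
 using trop_single[of 1 0 Y] by simp

lemma sfree_1: "sfree 1"
 using sfree_single[of 1 0] by simp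

lemma sfree_power: "sfree p ==> sfree (p ^ e :: ('n::{finite,linorder}, int) laurent)"
 by (induction e) (auto simp: sfree_1 intro: sfree_mult)

lemma sfree_prod: "(\<And>x. x \<in> S ==> sfree (f x)) ==> sfree (\<Prod>x\<in>S. f x :: ('n::{finite,linorder}, int) laurent)"
 by (induction S rule: infinite_finite_induct) (auto simp: sfree_1 intro: sfree_mult)

lemma trop_power: "p \<noteq> 0 ==> trop_laurent (p ^ e :: ('n::{finite,linorder}, int) laurent) Y = of_nat e * trop_laurent p Y"
 by (induction e) (auto simp: trop_mult(1) algebra_simps)

lemma trop_prod:
 "(\<And>x. x \<in> S ==> f x \<noteq> 0) ==>
  trop_laurent (\<Prod>x\<in>S. f x :: ('n::{finite,linorder}, int) laurent) Y = (\<Sum>x\<in>S. trop_laurent (f x) Y)"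
 by (induction S rule: infinite_finite_induct) (auto simp: trop_mult(1))

definition ymon :: "('n::finite => int) => ('n, int) laurent" where
 "ymon x = single (Abs_poly_mapping x) 1"

lemma lookup_vec [simp]: "lookup (Abs_poly_mapping x) = (x :: 'n::finite => int)"
 by (rule Abs_poly_mapping_inverse) simp

lemma ymon_add: "ymon (x + y) = ymon x * ymon y"
proof -
 have "Abs_poly_mapping (x + y) = Abs_poly_mapping x + Abs_poly_mapping y"
  by (rule poly_mapping_eqI) (simp add: lookup_add)
 thus ?thesis by (simp add: ymon_def mult_single)
qed

lemma ymon_0 [simp]: "ymon (0 :: 'n::finite => int) = 1"
proof -
 have "Abs_poly_mapping (0 :: 'n => int) = 0" by (rule poly_mapping_eqI) simp
 thus ?thesis by (simp add: ymon_def)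
qed

lemma ymon_unit: "ymon x * ymon (- x) = 1"
 by (simp flip: ymon_add)

lemma ymon_power: "ymon x ^ e = ymon (\<lambda>i. int e * x i)"
proof (induction e)
 case 0
 have "(\<lambda>i. int 0 * x i) = 0" by auto
 thus ?case by simp
next
 case (Suc e)
 have "(\<lambda>i. int (Suc e) * x i) = x + (\<lambda>i. int e * x i)" by (auto simp: algebra_simps)
 thus ?case using Suc by (simp add: ymon_add)
qed

lemma ymon_prod: "(\<Prod>j\<in>S. ymon (x j)) = ymon (\<lambda>i. \<Sum>j\<in>S. x j i)"
proof (induction S rule: infinite_finite_induct)
 case (insert j S)
 have "(\<lambda>i. \<Sum>j\<in>insert j S. x j i) = x j + (\<lambda>i. \<Sum>j\<in>S. x j i)" using insert by auto
 thus ?case using insert by (simp add: ymon_add)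
qed (simp_all add: ymon_0[unfolded zero_fun_def])

lemma dvd_ymon: "p dvd ymon x * q \<longleftrightarrow> p dvd (q :: ('n::finite, int) laurent)"
proof
 assume "p dvd ymon x * q"
 hence "p dvd ymon (- x) * (ymon x * q)" by (rule dvd_mult)
 thus "p dvd q" using ymon_unit[of "- x"] by (simp flip: mult.assoc)
qed simp

lemma sfree_ymon: "sfree (ymon x)" by (simp add: ymon_def sfree_single)

lemma trop_ymon: "trop_laurent (ymon x) Y = (\<Sum>i\<in>UNIV. of_int (x i) * Y $ i)"
 by (simp add: ymon_def trop_single pr_def)

lemma nonneg_at_ymon: "nonneg_at i (ymon x) \<longleftrightarrow> 0 \<le> x i"
 by (simp add: ymon_def nonneg_at_def)

lemma leval_ymon: "leval y (ymon x) = (\<Prod>i\<in>UNIV. y i powi x i)"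
 by (simp add: ymon_def mon_def)

lemma dvd_prod_diff:
 fixes p :: "'c::comm_ring_1"
 assumes "\<And>i. i \<in> S ==> p dvd f i - g i"
 shows "p dvd (\<Prod>i\<in>S. f i) - (\<Prod>i\<in>S. g i)"
 using assms
proof (induction S rule: infinite_finite_induct)
 case (insert i S)
 have "prod f (insert i S) - prod g (insert i S) = (f i - g i) * prod f S + g i * (prod f S - prod g S)"
  using insert by (simp add: algebra_simps)
 thus ?case using insert by simp
qed auto

lemma dvd_power_diff:
 fixes p :: "'c::comm_ring_1"
 assumes "p dvd x - y" shows "p dvd x ^ e - y ^ e"
 using dvd_prod_diff[of "{..<e}" p "\<lambda>_. x" "\<lambda>_. y"] assms by simp

section \<open>\<open>F\<close>-polynomials from the mesh relations\<close>

locale ldynkin = dynkin a E d for a :: "'n::{finite,linorder} => 'n => int" and E d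
begin

text \<open>The \<open>F\<close>-polynomials are defined by division in the mesh relations; that the quotients exist is
 part of \<open>mesh_ok\<close> below.\<close>

function FF :: "nat => 'n => ('n, int) laurent" where
 "FF t j = (if t = 0 then 1 else
   (THE q. FF (t - 1) j * q =
    (\<Prod>i | E i j. FF t i ^ wt i j) * (\<Prod>i | E j i. FF (t - 1) i ^ wt i j) + ymon (D t j)))"
 by auto
termination
 by (relation "inv_image (less_than <*lex*> Wellfounded.measure rho) id") (auto intro: rho_less)

declare FF.simps [simp del]

definition Fp :: "nat \<times> 'n => ('n, int) laurent" where "Fp g = FF (fst g) (snd g)"

definition dv :: "nat \<times> 'n => 'n => int" where "dv g = (\<lambda>k. int (cc (0, k) g))"

text \<open>The exponent of the coefficient that enters the mesh relations at time \<open>0\<close>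
  only.\<close>

definition yb :: "nat \<times> 'n => 'n => int" where
 "yb g = (\<lambda>k. of_bool ((0, k) = g))"

definition NN :: "nat \<times> 'n => ('n, int) laurent" where
 "NN g = (\<Prod>i\<in>UNIV. Fp (nb g i) ^ wt i (snd g))"

lemma Fp_0 [simp]: "Fp (0, j) = 1" by (simp add: Fp_def FF.simps)

lemma dv_0 [simp]: "dv (0, j) = 0" by (auto simp: dv_def cc_def)

lemma dv_mesh:
 assumes "g \<in> lab"
 shows "dv g + dv (tu g) = (\<lambda>k. yb g k + yb (tu g) k + (\<Sum>i\<in>UNIV. int (wt i (snd g)) * dv (nb g i) k))"
 using cc_mesh0[OF assms] by (auto simp: dv_def yb_def fun_eq_iff)

lemma dv_D: "(t, j) \<in> lab ==> dv (t, j) = D t j"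
 by (auto simp: dv_def int_cc0)

lemma NN_split: "NN (t, j) = (\<Prod>i | E i j. Fp (t, i) ^ wt i j) * (\<Prod>i | E j i. Fp (tu (t, i)) ^ wt i j)"
proof -
 have "NN (t, j) = (\<Prod>i\<in>UNIV. (if E i j then Fp (t, i) ^ wt i j else 1) * (if E j i then Fp (tu (t, i)) ^ wt i j else 1))"
  unfolding NN_def by (rule prod.cong) (use E_asym wt_eq_0 in \<open>auto simp: nb_def\<close>)
 thus ?thesis by (simp add: prod.distrib prod.If_cases Int_def)
qed

lemma prod_nb_tu:
 "(\<Prod>i\<in>UNIV. f (tu (nb g i)) ^ wt i (snd g)) = (\<Prod>i\<in>UNIV. (f (nb (tu g) i) :: 'b::comm_monoid_mult) ^ wt i (snd (tu g)))"
proof -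
 have "(\<Prod>i\<in>UNIV. f (tu (nb g i)) ^ wt i (snd g)) = (\<Prod>i\<in>UNIV. f (nb (tu g) (sg g i)) ^ wt (sg g i) (snd (tu g)))"
 proof (rule prod.cong[OF refl])
  fix i show "f (tu (nb g i)) ^ wt i (snd g) = f (nb (tu g) (sg g i)) ^ wt (sg g i) (snd (tu g))"
   using tu_nb[of i g] wt_eq_0[of i "snd g"] wt_sg[of g i] by (cases "E i (snd g) \<or> E (snd g) i") auto
 qed
 also have "\<dots> = (\<Prod>i\<in>UNIV. f (nb (tu g) i) ^ wt i (snd (tu g)))"
  by (rule prod.reindex_bij_betw) (use bij_sg in simp)
 finally show ?thesis .
qed

definition mesh_ok :: "nat \<times> 'n => bool" where
 "mesh_ok g \<longleftrightarrow> Fp (tu g) * Fp g = ymon (yb g) * NN g + ymon (dv g)"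

text \<open>Modulo \<open>F (tu h)\<close> the product of the mesh monomials of \<open>h\<close> and \<open>tu h\<close> is a monomial in the
 \<open>y\<close>'s, which are units.\<close>

lemma mesh_dvd:
 assumes g: "h \<in> lab" and t: "mesh_ok (tu h)" and n: "yb (tu h) = 0"
  and nbs: "\<And>i. E i (snd h) \<or> E (snd h) i ==> mesh_ok (nb h i)"
 shows "Fp (tu h) dvd ymon (yb h) * NN h + ymon (dv h)"
proof -
 let ?p = "Fp (tu h)" and ?j = "snd h"
 have 1: "?p dvd Fp (tu (nb h i)) * Fp (nb h i) - ymon (dv (nb h i))" if e: "E i ?j \<or> E ?j i" for i
 proof -
  let ?l = "lx h i"
  have "wt ?l (snd (nb h i)) > 0" using nb_nb(2)[OF e] wt_pos_iff e by auto
  hence "?p dvd Fp (nb (nb h i) ?l) ^ wt ?l (snd (nb h i))"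
   unfolding nb_nb(1)[OF e] by (simp add: dvd_power)
  hence "?p dvd NN (nb h i)"
   unfolding NN_def by (rule dvd_trans) (rule dvd_prodI, auto)
  thus ?thesis using nbs[OF e] by (simp add: mesh_ok_def)
 qed
 have 2: "?p dvd (\<Prod>i\<in>UNIV. (Fp (tu (nb h i)) * Fp (nb h i)) ^ wt i ?j) - (\<Prod>i\<in>UNIV. ymon (dv (nb h i)) ^ wt i ?j)"
 proof (rule dvd_prod_diff)
  fix i
  show "?p dvd (Fp (tu (nb h i)) * Fp (nb h i)) ^ wt i ?j - ymon (dv (nb h i)) ^ wt i ?j"
   using dvd_power_diff[OF 1, of i "wt i ?j"] wt_eq_0[of i ?j]
   by (cases "E i ?j \<or> E ?j i") auto
 qed
 have "(\<Prod>i\<in>UNIV. ymon (dv (nb h i)) ^ wt i ?j) = ymon (\<lambda>k. \<Sum>i\<in>UNIV. int (wt i ?j) * dv (nb h i) k)"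
  unfolding ymon_power ymon_prod ..
 moreover have "(\<lambda>k. \<Sum>i\<in>UNIV. int (wt i ?j) * dv (nb h i) k) = dv h + dv (tu h) - yb h"
  using dv_mesh[OF g] n by (auto simp: fun_eq_iff)
 moreover have "(\<Prod>i\<in>UNIV. (Fp (tu (nb h i)) * Fp (nb h i)) ^ wt i ?j) = NN (tu h) * NN h"
  unfolding power_mult_distrib prod.distrib prod_nb_tu[of Fp] by (simp add: NN_def)
 ultimately have 3: "?p dvd NN (tu h) * NN h - ymon (dv h + dv (tu h) - yb h)"
  using 2 by simp
 have "NN (tu h) = Fp (tu (tu h)) * ?p - ymon (dv (tu h))"
  using t n by (simp add: mesh_ok_def)
 hence e: "NN (tu h) * NN h - ymon (dv h + dv (tu h) - yb h) =
   ?p * (Fp (tu (tu h)) * NN h) - ymon (dv (tu h)) * (NN h + ymon (dv h - yb h))"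
  by (simp only:) (simp add: algebra_simps flip: ymon_add)
 have "?p dvd ymon (dv (tu h)) * (NN h + ymon (dv h - yb h))"
  using dvd_diff[OF dvd_triv_left[of ?p "Fp (tu (tu h)) * NN h"] 3] unfolding e by simp
 hence "?p dvd ymon (yb h) * (NN h + ymon (dv h - yb h))"
  unfolding dvd_ymon .
 thus ?thesis by (simp add: algebra_simps flip: ymon_add)
qed

text \<open>The last clause says that the degree in \<open>y_k\<close> is the denominator exponent.
  It is phrased by tropical evaluation because this is additive on products and can be divided out
  of a mesh relation.\<close>

definition good :: "nat \<times> 'n => bool" where
 "good g \<longleftrightarrow> sfree (Fp g) \<and> (\<forall>k. nonneg_at k (Fp g)) \<and> lookup (Fp g) 0 = 1 \<and>
   (\<forall>k. trop_laurent (Fp g) (- axis k 1) = - of_int (dv g k))"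

lemma trop_axis: "nonneg_at k p ==> lookup p 0 \<noteq> 0 ==> trop_laurent p (axis k 1) = 0"
proof (rule trop_eqI)
 assume "nonneg_at k p"
 thus "low (axis k 1) 0 p" by (auto simp: low_def nonneg_at_def pr_def axis_def if_distrib cong: if_cong)
 assume "lookup p 0 \<noteq> 0"
 hence "lookup (part (axis k 1) 0 p) 0 \<noteq> 0" by (simp add: lookup_part)
 thus "part (axis k 1) 0 p \<noteq> 0" by auto
qed

lemma nonneg_trop_axis: "p \<noteq> 0 ==> trop_laurent p (axis k 1) = 0 ==> nonneg_at k p"
 using trop_low(1)[of p "axis k 1"]
 by (auto simp: low_def nonneg_at_def pr_def axis_def if_distrib cong: if_cong)

lemma trop_ymon_neg_axis: "trop_laurent (ymon x) (- axis k 1) = - of_int (x k)"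
 by (simp add: trop_ymon axis_def if_distrib cong: if_cong)

lemma good_0: "good (0, j)"
 by (simp add: good_def sfree_1 nonneg_at_1 lookup_one)

lemma sfree_rhs:
 assumes "\<And>i. E i (snd g) \<or> E (snd g) i ==> sfree (Fp (nb g i))"
 shows "sfree (NN g)"
 unfolding NN_def
proof (rule sfree_prod)
 fix i
 show "sfree (Fp (nb g i) ^ wt i (snd g))"
  using assms[of i] wt_eq_0[of i "snd g"] sfree_power sfree_1
  by (cases "E i (snd g) \<or> E (snd g) i") auto
qed

lemma trop_NN:
 assumes "\<And>i. E i (snd g) \<or> E (snd g) i ==> sfree (Fp (nb g i))"
 shows "trop_laurent (NN g) Y = (\<Sum>i\<in>UNIV. of_nat (wt i (snd g)) * trop_laurent (Fp (nb g i)) Y)"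
proof -
 have nz: "Fp (nb g i) ^ wt i (snd g) \<noteq> 0" for i
  using assms[of i] wt_eq_0[of i "snd g"] sfree_nz by (cases "E i (snd g) \<or> E (snd g) i") auto
 have "trop_laurent (Fp (nb g i) ^ wt i (snd g)) Y = of_nat (wt i (snd g)) * trop_laurent (Fp (nb g i)) Y" for i
  using assms[of i] wt_eq_0[of i "snd g"] trop_power[OF sfree_nz] by (cases "E i (snd g) \<or> E (snd g) i") auto
 thus ?thesis unfolding NN_def by (subst trop_prod) (use nz in auto)
qed

text \<open>The hypothesis on \<open>yb h\<close> and \<open>dv h\<close> makes sure that exactly
  one of the two summands has a constant term.\<close>

lemma rhs_props:
 assumes g: "h \<in> lab" and nbs: "\<And>i. E i (snd h) \<or> E (snd h) i ==> good (nb h i)"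
  and z: "yb h = 0 \<and> dv h \<noteq> 0 \<or> dv h = 0 \<and> yb h \<noteq> 0"
 defines "W \<equiv> ymon (yb h) * NN h + ymon (dv h)"
 shows "sfree W" "nonneg_at k W" "lookup W 0 = 1"
  "trop_laurent W (- axis k 1) = - of_int (dv h k + dv (tu h) k)"
proof -
 have sN: "sfree (NN h)" by (rule sfree_rhs) (use nbs good_def in blast)
 have s1: "sfree (ymon (yb h) * NN h)" by (intro sfree_mult sfree_ymon sN)
 show "sfree W" unfolding W_def by (intro sfree_add s1 sfree_ymon)
 have nN: "nonneg_at k (NN h)" for k
  unfolding NN_def
 proof (rule nonneg_at_prod)
  fix i
  show "nonneg_at k (Fp (nb h i) ^ wt i (snd h))"
   using nbs[of i] wt_eq_0[of i "snd h"] nonneg_at_1 unfolding good_def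
   by (cases "E i (snd h) \<or> E (snd h) i") (auto intro: nonneg_at_power)
 qed
 have n1: "nonneg_at k (ymon (yb h) * NN h)" for k
  by (intro nonneg_at_mult nN) (simp add: nonneg_at_ymon yb_def)
 have n2: "nonneg_at k (ymon (dv h))" for k by (simp add: nonneg_at_ymon dv_def)
 show "nonneg_at k W"
  unfolding W_def nonneg_at_def
  using n1[of k] n2[of k] keys_add[of "ymon (yb h) * NN h" "ymon (dv h)"] unfolding nonneg_at_def by blast
 have cN: "lookup (NN h) 0 = 1"
 proof -
  have "lookup (\<Prod>i\<in>S. Fp (nb h i) ^ wt i (snd h)) 0 = 1 \<and>
    (\<forall>k. nonneg_at k (\<Prod>i\<in>S. Fp (nb h i) ^ wt i (snd h)))" for S
  proof (induction S rule: infinite_finite_induct)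
   case (insert i S)
   have p: "lookup (p ^ e) 0 = 1 \<and> (\<forall>k. nonneg_at k (p ^ e))"
    if "lookup p 0 = 1" "\<forall>k. nonneg_at k p" for p :: "('n, int) laurent" and e
   proof (induction e)
    case (Suc e)
    thus ?case using const_mult[of p "p ^ e"] that nonneg_at_mult[of _ p "p ^ e"] by simp
   qed (auto simp: lookup_one nonneg_at_1)
   have "lookup (Fp (nb h i) ^ wt i (snd h)) 0 = 1 \<and> (\<forall>k. nonneg_at k (Fp (nb h i) ^ wt i (snd h)))"
    using nbs[of i] wt_eq_0[of i "snd h"] p[of "Fp (nb h i)"] nonneg_at_1 unfolding good_def
    by (cases "E i (snd h) \<or> E (snd h) i") auto
   thus ?case using insert by (auto simp: const_mult nonneg_at_mult)
  qed (auto simp: lookup_one nonneg_at_1)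
  thus ?thesis unfolding NN_def by blast
 qed
 have cy: "lookup (ymon x) 0 = (if x = 0 then 1 else 0)" for x :: "'n => int"
 proof -
  have "Abs_poly_mapping x = 0 \<longleftrightarrow> x = 0" by (metis lookup_vec lookup_zero poly_mapping_eqI zero_fun_apply ext)
  thus ?thesis by (simp add: ymon_def lookup_single when_def)
 qed
 have "lookup (ymon (yb h) * NN h) 0 = lookup (ymon (yb h)) 0"
  by (subst const_mult) (use nN cN in \<open>auto simp: nonneg_at_ymon yb_def\<close>)
 thus "lookup W 0 = 1" using z by (auto simp: W_def lookup_add cy)
 have "trop_laurent W (- axis k 1) = min (trop_laurent (ymon (yb h) * NN h) (- axis k 1)) (trop_laurent (ymon (dv h)) (- axis k 1))"
  unfolding W_def by (rule trop_add[OF s1 sfree_ymon])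
 moreover have "trop_laurent (NN h) (- axis k 1) = - of_int (\<Sum>i\<in>UNIV. int (wt i (snd h)) * dv (nb h i) k)"
 proof -
  have "trop_laurent (NN h) (- axis k 1) = (\<Sum>i\<in>UNIV. of_nat (wt i (snd h)) * trop_laurent (Fp (nb h i)) (- axis k 1))"
   by (rule trop_NN) (use nbs good_def in blast)
  also have "\<dots> = (\<Sum>i\<in>UNIV. - (of_nat (wt i (snd h)) * of_int (dv (nb h i) k)))"
  proof (rule sum.cong[OF refl])
   fix i
   show "real (wt i (snd h)) * trop_laurent (Fp (nb h i)) (- axis k 1) = - (real (wt i (snd h)) * of_int (dv (nb h i) k))"
    using nbs[of i] wt_eq_0[of i "snd h"] unfolding good_def by (cases "E i (snd h) \<or> E (snd h) i") auto
  qed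
  finally show ?thesis by (simp add: sum_negf)
 qed
 moreover have "trop_laurent (ymon (yb h) * NN h) (- axis k 1) =
   trop_laurent (ymon (yb h)) (- axis k 1) + trop_laurent (NN h) (- axis k 1)"
  by (rule trop_mult(1)) (use sfree_nz sfree_ymon sN in auto)
 \<comment> \<open>The linear relation for \<open>dv\<close> contains the extra term
   \<open>yb (tu h)\<close>. It is nonzero only where \<open>dv (tu h)\<close> vanishes, and there
   the minimum is attained by the second summand.\<close>
 moreover have "yb (tu h) k = 0 \<or> dv (tu h) k = 0" "yb (tu h) k \<ge> 0"
  by (auto simp: yb_def dv_def)
 moreover have "dv h k \<ge> 0" "dv (tu h) k \<ge> 0" by (auto simp: dv_def)
 moreover have "dv h k + dv (tu h) k = yb h k + yb (tu h) k + (\<Sum>i\<in>UNIV. int (wt i (snd h)) * dv (nb h i) k)"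
  using fun_cong[OF dv_mesh[OF g], of k] by simp
 ultimately show "trop_laurent W (- axis k 1) = - of_int (dv h k + dv (tu h) k)"
  unfolding trop_ymon_neg_axis by linarith
qed


text \<open>Every property in \<open>good\<close> is expressed by initial forms, tropical values or
  constant terms, all of which are multiplicative or additive, so it passes to the second
  factor.\<close>

lemma good_cancel:
 assumes g: "good (tu h)" and m: "mesh_ok h" and gl: "h \<in> lab"
  and nbs: "\<And>i. E i (snd h) \<or> E (snd h) i ==> good (nb h i)"
  and z: "yb h = 0 \<and> dv h \<noteq> 0 \<or> dv h = 0 \<and> yb h \<noteq> 0"
 shows "good h"
proof -
 note W = rhs_props[OF gl nbs z, folded m[unfolded mesh_ok_def]]
 have g': "sfree (Fp (tu h))" "\<And>k. nonneg_at k (Fp (tu h))" "lookup (Fp (tu h)) 0 = 1"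
  "\<And>k. trop_laurent (Fp (tu h)) (- axis k 1) = - of_int (dv (tu h) k)"
  using g by (auto simp: good_def)
 have s: "sfree (Fp h)" by (rule sfree_cancel[OF g'(1) W(1)])
 note tm = trop_mult(1)[OF sfree_nz[OF g'(1)] sfree_nz[OF s]]
 have "trop_laurent (Fp h) (axis k 1) = 0" for k
  using tm[of "axis k 1"] trop_axis[OF W(2), of k] trop_axis[OF g'(2), of k] W(3) g'(3) by simp
 hence n: "\<And>k. nonneg_at k (Fp h)" using nonneg_trop_axis sfree_nz[OF s] by blast
 have "lookup (Fp h) 0 = 1"
  using const_mult[of "Fp (tu h)" "Fp h"] g'(2,3) n W(3) by simp
 moreover have "trop_laurent (Fp h) (- axis k 1) = - of_int (dv h k)" for k
  using tm[of "- axis k 1"] W(4)[of k] g'(4)[of k] by simp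
 ultimately show ?thesis using s n by (simp add: good_def)
qed

lemma Fp_THE:
 assumes "(t, j) \<in> lab" "t > 0"
 shows "Fp (t, j) = (THE q. Fp (tu (t, j)) * q = ymon (yb (t, j)) * NN (t, j) + ymon (dv (t, j)))"
proof -
 have tt: "tu (t, i) = (t - 1, i)" for i using assms(2) by (cases t) auto
 have "yb (t, j) = 0" using assms(2) by (auto simp: yb_def)
 thus ?thesis
  using assms unfolding NN_split dv_D[OF assms(1)] tt
  by (simp add: Fp_def FF.simps[of t j])
qed

lemma mesh_from_dvd:
 assumes "(t, j) \<in> lab" "t > 0" "Fp (tu (t, j)) \<noteq> 0"
  "Fp (tu (t, j)) dvd ymon (yb (t, j)) * NN (t, j) + ymon (dv (t, j))"
 shows "mesh_ok (t, j)"
proof -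
 obtain q where q: "Fp (tu (t, j)) * q = ymon (yb (t, j)) * NN (t, j) + ymon (dv (t, j))"
  using assms(4) by (metis dvd_def)
 have "Fp (t, j) = q"
  unfolding Fp_THE[OF assms(1,2)]
  by (rule the_equality, rule q) (use q assms(3) in \<open>metis mult_left_cancel\<close>)
 thus ?thesis using q by (simp add: mesh_ok_def)
qed

lemma mesh_good_pos:
 assumes "(t, j) \<in> lab" "t > 0"
 shows "mesh_ok (t, j) \<and> good (t, j)"
 using assms
proof (induction t arbitrary: j rule: less_induct)
 case (less t)
 note outer = this
 show ?case
  using outer(2,3)
 proof (induction j rule: measure_induct_rule[where f = rho])
 case 1: (less j)
 let ?g = "(t, j)"
 have IH: "mesh_ok (t', j') \<and> good (t', j')" if "t' < t \<or> t' = t \<and> rho j' < rho j" "(t', j') \<in> lab" "t' > 0" for t' j'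
  using 1(1)[of j'] outer(1)[of t' j'] that by blast
 have tt: "tu (t, i) = (t - 1, i)" for i using 1(3) by (cases t) auto
 have nbt: "nb ?g i = (t, i) \<and> rho i < rho j \<or> nb ?g i = (t - 1, i)" if "E i j \<or> E j i" for i
  using that tt rho_less by (auto simp: nb_def)
 have nbs: "good (nb ?g i)" if "E i (snd ?g) \<or> E (snd ?g) i" for i
  using nbt[of i] that nb_lab[OF 1(2) that] IH[of "t - 1" i] IH[of t i] good_0[of i] 1(3)
  by (cases "t = 1") auto
 have tl: "(t - 1, j) \<in> lab" using 1(2) by (simp add: lab_def)
 have gt: "good (tu ?g)" unfolding tt using IH[of "t - 1" j] good_0[of j] tl 1(3) by (cases "t = 1") auto
 \<comment> \<open>At \<open>t = 1\<close> the divisor is \<open>Fp (0, j) = 1\<close>; later times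
   use the relations around the previous label.\<close>
 have dvd: "Fp (tu ?g) dvd ymon (yb ?g) * NN ?g + ymon (dv ?g)"
 proof (cases "t = 1")
  case False
  hence t1: "t - 1 > 0" "t - 1 < t" using 1(3) by auto
  show ?thesis
  proof (rule mesh_dvd[OF 1(2)])
   show "mesh_ok (tu ?g)" unfolding tt using IH[of "t - 1" j] tl t1 by simp
   show "yb (tu ?g) = 0" unfolding tt using t1 by (auto simp: yb_def)
   fix i assume e: "E i (snd ?g) \<or> E (snd ?g) i"
   show "mesh_ok (nb ?g i)"
    using nbt[of i] e nb_lab[OF 1(2) e] IH[of "t - 1" i] IH[of t i] t1 1(3) by auto
  qed
 qed (simp add: tt)
 have m: "mesh_ok ?g" by (rule mesh_from_dvd[OF 1(2,3) _ dvd]) (use gt sfree_nz good_def in blast)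
 have "dv ?g \<noteq> 0" unfolding dv_D[OF 1(2)] using RR_D[OF 1(3)] by (simp add: RR_def)
 moreover have "yb ?g = 0" using 1(3) by (auto simp: yb_def)
 ultimately have "good ?g" by (intro good_cancel[OF gt m 1(2) nbs]) auto
 thus ?case using m by simp
 qed
qed

lemma good: "g \<in> lab ==> good g"
 using mesh_good_pos[of "fst g" "snd g"] good_0[of "snd g"] by (cases "fst g = 0") (auto, metis prod.collapse)

text \<open>At \<open>(0, j)\<close> the quotient of the mesh relation has degree zero in each variable, so it is \<open>1\<close>:
 the sequence of \<open>F\<close>-polynomials closes up.\<close>

lemma mesh_wrap: "mesh_ok (0, j)"
proof (induction j rule: wf_induct_rule[OF wf_E])
 case (1 j)
 let ?g = "(0, j)"
 have tl: "tu ?g \<in> lab" by (rule tu_lab) simp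
 have nbs: "good (nb ?g i)" if "E i (snd ?g) \<or> E (snd ?g) i" for i
  by (rule good, rule nb_lab) (use that in auto)
 have y: "yb ?g j = 1" by (simp add: yb_def)
 hence z: "yb ?g = 0 \<and> dv ?g \<noteq> 0 \<or> dv ?g = 0 \<and> yb ?g \<noteq> 0" by auto
 note W = rhs_props[OF lab0 nbs z]
 let ?W = "ymon (yb ?g) * NN ?g + ymon (dv ?g)"
 have "Fp (tu ?g) dvd ?W"
 proof (rule mesh_dvd[OF lab0])
  show "mesh_ok (tu ?g)" using mesh_good_pos[of "rr (star0 j)" "star0 j"] tl rr_ge_1 by simp
  show "yb (tu ?g) = 0" using rr_ge_1[of "star0 j"] by (auto simp: yb_def)
  fix i assume e: "E i (snd ?g) \<or> E (snd ?g) i"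
  show "mesh_ok (nb ?g i)"
  proof (cases "E i j")
   case True
   thus ?thesis using 1 by (simp add: nb_def)
  next
   case False
   thus ?thesis
    using nb_lab[of ?g i] e mesh_good_pos[of "rr (star0 i)" "star0 i"] rr_ge_1[of "star0 i"]
    by (simp add: nb_def)
  qed
 qed
 then obtain q where q: "?W = Fp (tu ?g) * q" by (rule dvdE)
 have g': "sfree (Fp (tu ?g))" "\<And>k. nonneg_at k (Fp (tu ?g))" "lookup (Fp (tu ?g)) 0 = 1"
  "\<And>k. trop_laurent (Fp (tu ?g)) (- axis k 1) = - of_int (dv (tu ?g) k)"
  using good[OF tl] by (auto simp: good_def)
 have s: "sfree q" by (rule sfree_cancel[OF g'(1)]) (use W(1) q in simp)
 note tm = trop_mult(1)[OF sfree_nz[OF g'(1)] sfree_nz[OF s], folded q]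
 have a: "trop_laurent q (axis k 1) = 0" for k
  using tm[of "axis k 1"] trop_axis[OF W(2), of k] trop_axis[OF g'(2), of k] W(3) g'(3) by simp
 hence n: "\<And>k. nonneg_at k q" using nonneg_trop_axis sfree_nz[OF s] by blast
 have c: "lookup q 0 = 1"
  using const_mult[of "Fp (tu ?g)" q] g'(2,3) n W(3) q by simp
 have b: "trop_laurent q (- axis k 1) = 0" for k
  using tm[of "- axis k 1"] W(4)[of k] g'(4)[of k] by simp
 have "m = 0" if "m \<in> keys q" for m
 proof (rule poly_mapping_eqI)
  fix k
  have "0 \<le> pr m (- axis k 1)" using trop_low(1)[OF sfree_nz[OF s], of "- axis k 1"] that b[of k] by (auto simp: low_def)
  hence "lookup m k \<le> 0" by (simp add: pr_def axis_def if_distrib cong: if_cong)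
  moreover have "0 \<le> lookup m k" using n[of k] that by (auto simp: nonneg_at_def)
  ultimately show "lookup m k = lookup 0 k" by simp
 qed
 hence "q = 1" using c
  by (intro poly_mapping_eqI) (auto simp: lookup_one when_def in_keys_iff)
 thus ?case using q by (simp add: mesh_ok_def)
qed

lemma mesh: "g \<in> lab ==> Fp (tu g) * Fp g = ymon (yb g) * NN g + ymon (dv g)"
 using mesh_good_pos[of "fst g" "snd g"] mesh_wrap[of "snd g"] mesh_ok_def[of g]
 by (cases "fst g = 0") (auto, metis prod.collapse)

lemma sfree_Fp: "g \<in> lab ==> sfree (Fp g)" and nonneg_Fp: "g \<in> lab ==> nonneg_at k (Fp g)"
 and const_Fp: "g \<in> lab ==> lookup (Fp g) 0 = 1"
 and deg_Fp: "g \<in> lab ==> trop_laurent (Fp g) (- axis k 1) = - of_int (dv g k)"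
 using good[of g] by (auto simp: good_def)

definition Phi :: "nat \<times> 'n => (real, 'n) vec => real" where "Phi g Y = trop_laurent (Fp g) Y"

definition ip :: "('n => int) => (real, 'n) vec => real" where "ip x Y = (\<Sum>i\<in>UNIV. of_int (x i) * Y $ i)"

definition al :: "nat \<times> 'n => (real, 'n) vec => real" where
 "al g Y = ip (yb g) Y + (\<Sum>i\<in>UNIV. of_nat (wt i (snd g)) * Phi (nb g i) Y)"

lemma Phi_0 [simp]: "Phi (0, j) Y = 0" by (simp add: Phi_def)

lemma Phi_mesh:
 assumes "g \<in> lab"
 shows "Phi (tu g) Y + Phi g Y = min (al g Y) (ip (dv g) Y)"
proof -
 have nbs: "E i (snd g) \<or> E (snd g) i ==> sfree (Fp (nb g i))" for i
  using sfree_Fp nb_lab[OF assms] by blast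
 have s: "sfree (NN g)" by (rule sfree_rhs[OF nbs])
 have s1: "sfree (ymon (yb g) * NN g)" by (intro sfree_mult sfree_ymon s)
 have "Phi (tu g) Y + Phi g Y = trop_laurent (ymon (yb g) * NN g + ymon (dv g)) Y"
  unfolding mesh[OF assms, symmetric] Phi_def
  by (rule trop_mult(1)[symmetric]) (use sfree_nz[OF sfree_Fp[OF assms]] sfree_nz[OF sfree_Fp[OF tu_lab[OF assms]]] in auto)
 also have "\<dots> = min (trop_laurent (ymon (yb g) * NN g) Y) (trop_laurent (ymon (dv g)) Y)"
  by (rule trop_add[OF s1 sfree_ymon])
 also have "trop_laurent (ymon (yb g) * NN g) Y = al g Y"
  unfolding al_def Phi_def
  by (subst trop_mult(1)) (use sfree_nz sfree_ymon s trop_NN[OF nbs] in \<open>auto simp: trop_ymon ip_def\<close>)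
 finally show ?thesis by (simp add: trop_ymon ip_def)
qed

end

section \<open>Sweeps\<close>

text \<open>Only the directions in \<open>J\<close> are mutated; the remaining vertices are isolated. This lets one pass to
 the link of a cluster variable without changing the vertex type.\<close>

locale jseed = ldynkin a E d for a :: "'n::{finite,linorder} => 'n => int" and E d +
 fixes em :: "'n => 'r::{finite,linorder}" and J :: "'n set"
 assumes inj: "inj em" and iso: "i \<notin> J ==> i \<noteq> j ==> a i j = 0"
begin

lemma E_J: "E i j ==> i \<in> J \<and> j \<in> J"
 using E_nonzero[of i j] E_neq[of i j] iso[of i j] iso[of j i] zero_sym[of j i] by metis

lemma em_eq [simp]: "em i = em j \<longleftrightarrow> i = j"
 using inj by (auto dest: injD)

text \<open>Rows of vertices outside \<open>J\<close> count as frozen, together with the rows that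
  belong to no vertex.\<close>

definition frz :: "'r set" where "frz = - em ` J"

definition BB :: "'n => 'n => int" where "BB = exchange_matrix a E"

definition acyc :: "('r, 'n, 'f) seed => bool" where
 "acyc s \<longleftrightarrow> (\<forall>i\<in>J. \<forall>j\<in>J. fst s (em i) j = BB i j)"

definition rowJ :: "('r => 'n => int) => 'r => 'n => int" where
 "rowJ b r = (\<lambda>j. if j \<in> J then b r j else 0)"

text \<open>For a row \<open>w\<close> of frozen exponents, \<open>bet w j\<close> is its entry in column \<open>j\<close> at the moment when the sweep
 mutates at \<open>j\<close>, and \<open>nxt w\<close> is the row after the sweep; \<open>nv\<close> gives the new variables.\<close>

function bet :: "('n => int) => 'n => int" where
 "bet w j = w j + (\<Sum>i | E i j. int (wt i j) * max 0 (bet w i))"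
 by auto
termination
 by (relation "Wellfounded.measure (\<lambda>(w, j). rho j)") (auto intro: rho_less)

declare bet.simps [simp del]

definition nxt :: "('n => int) => 'n => int" where
 "nxt w j = - bet w j + (\<Sum>i | E j i. int (wt i j) * max 0 (bet w i))"

function nv :: "('r => 'n => int) => ('r => 'f::field) => 'n => 'f" where
 "nv w x j = ((\<Prod>r\<in>frz. x r ^ nat (bet (w r) j)) + (\<Prod>r\<in>frz. x r ^ nat (- bet (w r) j)) *
   ((\<Prod>i | E i j. nv w x i ^ wt i j) * (\<Prod>i | E j i. x (em i) ^ wt i j))) / x (em j)"
 by auto
termination
 by (relation "Wellfounded.measure (\<lambda>(w, x, j). rho j)") (auto intro: rho_less)

declare nv.simps [simp del]

lemma BB_eq: "E i j ==> BB i j = int (wt i j)" "E j i ==> BB i j = - int (wt i j)"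
 "\<not> E i j ==> \<not> E j i ==> BB i j = 0"
 using int_wt[of i j] E_asym[of i j] E_asym[of j i] by (auto simp: BB_def exchange_matrix_def)

lemma prod_frz_J:
 "(\<Prod>r\<in>UNIV. f r) = (\<Prod>r\<in>frz. f r) * (\<Prod>i\<in>J. (f (em i) :: 'b::comm_monoid_mult))"
proof -
 have "(\<Prod>r\<in>UNIV. f r) = (\<Prod>r\<in>frz. f r) * (\<Prod>r\<in>em ` J. f r)"
  by (subst prod.union_disjoint[symmetric]) (auto simp: frz_def intro!: prod.cong)
 also have "(\<Prod>r\<in>em ` J. f r) = (\<Prod>i\<in>J. f (em i))"
  by (subst prod.reindex) (auto simp: inj_on_def)
 finally show ?thesis .
qed

lemma sgn_max: "0 \<le> (w::int) ==> sgn c * max 0 (c * w) = w * max 0 c"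
 by (cases c "0::int" rule: linorder_cases) (auto simp: max_def zero_le_mult_iff mult.commute)

definition swept :: "('r, 'n, 'f::field) seed => 'n set => ('r, 'n, 'f) seed => bool" where
 "swept s A s' \<longleftrightarrow>
  (\<forall>i\<in>J. \<forall>j\<in>J. fst s' (em i) j = BB i j * (if i \<in> A then -1 else 1) * (if j \<in> A then -1 else 1)) \<and>
  (\<forall>r\<in>frz. \<forall>j\<in>J. fst s' r j = (if j \<in> A
   then - bet (rowJ (fst s) r) j + (\<Sum>i | E j i \<and> i \<in> A. int (wt i j) * max 0 (bet (rowJ (fst s) r) i))
   else fst s r j + (\<Sum>i | E i j \<and> i \<in> A. int (wt i j) * max 0 (bet (rowJ (fst s) r) i)))) \<and>
  (\<forall>j\<in>J. snd s' (em j) = (if j \<in> A then nv (rowJ (fst s)) (snd s) j else snd s (em j))) \<and>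
  (\<forall>r\<in>frz. snd s' r = snd s r)"

text \<open>All predecessors of \<open>k\<close> have been mutated and no successor has, so
  \<open>k\<close> is a source. The products of entries from its column and its row are then
  nonpositive: the mutable block changes by signs only, and each frozen row gains the truncated term
  that occurs in \<open>bet\<close> and \<open>nxt\<close>.\<close>

lemma swept_step:
 fixes s t :: "('r, 'n, 'f::field) seed"
 assumes "swept s A t" and A: "A \<subseteq> J" "k \<in> J" "k \<notin> A" and after: "\<And>i. i \<in> A ==> \<not> E k i"
  and before: "\<And>i. E i k ==> i \<in> A"
 shows "swept s (insert k A) (mutate em k t)"
proof -
 let ?w = "rowJ (fst s)" and ?b = "fst t" and ?x = "snd t"
 note IH = assms(1)[unfolded swept_def, THEN conjunct1] assms(1)[unfolded swept_def, THEN conjunct2, THEN conjunct1]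
  assms(1)[unfolded swept_def, THEN conjunct2, THEN conjunct2]
 have col: "?b (em i) k = - int (wt i k)" if "i \<in> J" for i
 proof -
  consider "E i k" | "E k i" | "\<not> E i k" "\<not> E k i" by blast
  thus ?thesis
   using IH(1) that A before[of i] after[of i] BB_eq(1,3)[of i k] BB_eq(2)[of k i] wt_eq_0[of i k] by cases auto
 qed
 have row: "?b (em k) j = int (wt k j)" if "j \<in> J" for j
 proof -
  consider "E k j" | "E j k" | "\<not> E k j" "\<not> E j k" by blast
  thus ?thesis
   using IH(1) that A before[of j] after[of j] BB_eq(1,3)[of k j] BB_eq(2)[of j k] wt_eq_0[of k j] by cases auto
 qed
 have fcol: "?b r k = bet (?w r) k" if "r \<in> frz" for r
 proof -
  have "{i. E i k \<and> i \<in> A} = {i. E i k}" using before by auto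
  thus ?thesis using IH(2) that A by (simp add: bet.simps[of _ k] rowJ_def)
 qed
 have xr: "?x r = snd s r" if "r \<in> frz" for r using IH(3) that by blast
 have xJ: "?x (em j) = (if j \<in> A then nv ?w (snd s) j else snd s (em j))" if "j \<in> J" for j using IH(3) that by blast
 have mm: "fst (mutate em k t) = mutate_matrix em k ?b" by (simp add: mutate_def Let_def)
 have xo: "snd (mutate em k t) r = ?x r" if "r \<noteq> em k" for r using that by (simp add: mutate_def Let_def)
 have c1: "fst (mutate em k t) (em i) j = BB i j * (if i \<in> insert k A then -1 else 1) * (if j \<in> insert k A then -1 else 1)"
  if ij: "i \<in> J" "j \<in> J" for i j
 proof -
  have "max 0 (?b (em i) k * ?b (em k) j) = 0" unfolding col[OF ij(1)] row[OF ij(2)] by simp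
  moreover have "BB k k = 0" by (rule BB_eq(3)) auto
  ultimately show ?thesis unfolding mm mutate_matrix_def using IH(1) ij A by auto
 qed
 have c2: "fst (mutate em k t) r j = (if j \<in> insert k A
   then - bet (?w r) j + (\<Sum>i | E j i \<and> i \<in> insert k A. int (wt i j) * max 0 (bet (?w r) i))
   else fst s r j + (\<Sum>i | E i j \<and> i \<in> insert k A. int (wt i j) * max 0 (bet (?w r) i)))"
  if rj: "r \<in> frz" "j \<in> J" for r j
 proof -
  let ?m = "\<lambda>i. int (wt i j) * max 0 (bet (?w r) i)"
  have rk: "r \<noteq> em k" using rj(1) A(2) by (auto simp: frz_def)
  have "{i. P i \<and> i \<in> insert k A} = (if P k then insert k {i. P i \<and> i \<in> A} else {i. P i \<and> i \<in> A})" for P by auto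
  hence add: "(\<Sum>i | P i \<and> i \<in> insert k A. ?m i) = (\<Sum>i | P i \<and> i \<in> A. ?m i) + (if P k then ?m k else 0)"
   for P using A(3) by simp
  show ?thesis
  proof (cases "j = k")
   case True
   have "(\<Sum>i | E k i \<and> i \<in> insert k A. int (wt i k) * max 0 (bet (?w r) i)) = 0"
    by (rule sum.neutral) (use after in auto)
   thus ?thesis using True fcol[OF rj(1)] by (simp add: mm mutate_matrix_def)
  next
   case False
   have "sgn (?b r k) * max 0 (?b r k * ?b (em k) j) = ?m k"
    unfolding row[OF rj(2)] fcol[OF rj(1)] using sgn_max[of "int (wt k j)"] by simp
   hence "fst (mutate em k t) r j = ?b r j + ?m k" using False rk by (simp add: mm mutate_matrix_def)
   thus ?thesis
    using IH(2) rj False A(3) E_asym[of k j] after[of j] before[of j] wt_eq_0[of k j] unfolding add by auto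
  qed
 qed
 have pos: "(\<Prod>r | 0 < ?b r k. ?x r ^ nat (?b r k)) = (\<Prod>r\<in>frz. snd s r ^ nat (bet (?w r) k))"
 proof -
  have "(\<Prod>r | 0 < ?b r k. ?x r ^ nat (?b r k)) = (\<Prod>r\<in>UNIV. ?x r ^ nat (?b r k))"
   by (rule prod.mono_neutral_left) auto
  thus ?thesis by (simp add: prod_frz_J col xr fcol)
 qed
 have neg: "(\<Prod>r | ?b r k < 0. ?x r ^ nat (- ?b r k)) = (\<Prod>r\<in>frz. snd s r ^ nat (- bet (?w r) k)) *
   ((\<Prod>i | E i k. nv ?w (snd s) i ^ wt i k) * (\<Prod>i | E k i. snd s (em i) ^ wt i k))"
 proof -
  have "(\<Prod>r | ?b r k < 0. ?x r ^ nat (- ?b r k)) = (\<Prod>r\<in>UNIV. ?x r ^ nat (- ?b r k))"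
   by (rule prod.mono_neutral_left) auto
  also have "\<dots> = (\<Prod>r\<in>frz. snd s r ^ nat (- bet (?w r) k)) * (\<Prod>i\<in>J. ?x (em i) ^ nat (- ?b (em i) k))"
   by (simp add: prod_frz_J xr fcol)
  also have "(\<Prod>i\<in>J. ?x (em i) ^ nat (- ?b (em i) k)) =
    (\<Prod>i\<in>J. (if E i k then nv ?w (snd s) i ^ wt i k else 1) * (if E k i then snd s (em i) ^ wt i k else 1))"
  proof (rule prod.cong[OF refl])
   fix i assume i: "i \<in> J"
   consider "E i k" "i \<in> A" | "E k i" "i \<notin> A" | "\<not> E i k" "\<not> E k i" using before after by blast
   thus "?x (em i) ^ nat (- ?b (em i) k) = (if E i k then nv ?w (snd s) i ^ wt i k else 1) * (if E k i then snd s (em i) ^ wt i k else 1)"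
    using col[OF i] xJ[OF i] E_asym[of i k] E_asym[of k i] wt_eq_0[of i k] by cases auto
  qed
  also have "\<dots> = (\<Prod>i | E i k. nv ?w (snd s) i ^ wt i k) * (\<Prod>i | E k i. snd s (em i) ^ wt i k)"
  proof -
   have "J \<inter> {i. E i k} = {i. E i k}" "J \<inter> {i. E k i} = {i. E k i}" using E_J by auto
   thus ?thesis by (simp add: prod.distrib prod.If_cases)
  qed
  finally show ?thesis .
 qed
 have "snd (mutate em k t) (em k) = ((\<Prod>r | 0 < ?b r k. ?x r ^ nat (?b r k)) + (\<Prod>r | ?b r k < 0. ?x r ^ nat (- ?b r k))) / ?x (em k)"
  by (simp add: mutate_def Let_def)
 hence "snd (mutate em k t) (em k) = nv ?w (snd s) k"
  unfolding nv.simps[of ?w _ k] pos neg xJ[OF A(2)] using A(3) by simp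
 hence c3: "snd (mutate em k t) (em j) = (if j \<in> insert k A then nv ?w (snd s) j else snd s (em j))" if "j \<in> J" for j
  using xo[of "em j"] xJ[OF that] by (cases "j = k") auto
 have "snd (mutate em k t) r = snd s r" if "r \<in> frz" for r
  using xo[of r] xr[OF that] that A(2) by (auto simp: frz_def)
 thus ?thesis unfolding swept_def using c1 c2 c3 by blast
qed

lemma swept:
 fixes s :: "('r, 'n, 'f::field) seed"
 assumes "acyc s" "topo (l @ l')" "set (l @ l') = J"
 shows "swept s (set l) (fold (mutate em) l s)"
 using assms(2,3)
proof (induction l arbitrary: l' rule: rev_induct)
 case Nil
 show ?case using assms(1) by (simp add: swept_def acyc_def)
next
 case (snoc k l)
 have p: "topo (l @ k # l')" "set (l @ k # l') = J" using snoc.prems by auto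
 have "swept s (insert k (set l)) (mutate em k (fold (mutate em) l s))"
 proof (rule swept_step[OF snoc.IH[OF p]])
  fix i assume "E i k"
  thus "i \<in> set l" using p E_J[of i k] by (auto simp: topo_def sorted_wrt_append)
 qed (use p in \<open>auto simp: topo_def sorted_wrt_append\<close>)
 thus ?case by simp
qed

lemma sweep:
 fixes s :: "('r, 'n, 'f::field) seed"
 assumes "acyc s" "topo l" "set l = J"
 defines "s' \<equiv> fold (mutate em) l s"
 shows "acyc s'" "r \<in> frz ==> rowJ (fst s') r = nxt (rowJ (fst s) r)"
  "j \<in> J ==> snd s' (em j) = nv (rowJ (fst s)) (snd s) j" "r \<in> frz ==> snd s' r = snd s r"
proof -
 have t: "topo (l @ [])" "set (l @ []) = J" using assms by auto
 note p = swept[OF assms(1) t, folded s'_def, unfolded swept_def]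
 show "acyc s'" using p assms(3) by (simp add: acyc_def)
 show "j \<in> J ==> snd s' (em j) = nv (rowJ (fst s)) (snd s) j" using p assms(3) by simp
 show "r \<in> frz ==> snd s' r = snd s r" using p by blast
 assume r: "r \<in> frz"
 show "rowJ (fst s') r = nxt (rowJ (fst s) r)"
 proof
  fix j
  show "rowJ (fst s') r j = nxt (rowJ (fst s) r) j"
  proof (cases "j \<in> J")
   case True
   have "{i. E j i \<and> i \<in> set l} = {i. E j i}" using E_J assms(3) by auto
   thus ?thesis using p r True assms(3) by (simp add: rowJ_def[of "fst s'"] nxt_def)
  next
   case False
   hence "{i. E j i} = {}" "{i. E i j} = {}" using E_J by auto
   thus ?thesis using False by (simp add: rowJ_def nxt_def bet.simps[of _ j])
  qed
 qed
qed

end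

section \<open>Tropical mesh relations, labels along a sweep, and g-vectors\<close>

context ldynkin begin

lemma sum_nb_tu:
 "(\<Sum>i\<in>UNIV. of_nat (wt i (snd g)) * f (tu (nb g i))) =
  (\<Sum>i\<in>UNIV. of_nat (wt i (snd (tu g))) * (f (nb (tu g) i) :: 'b::comm_semiring_1))"
proof -
 have "(\<Sum>i\<in>UNIV. of_nat (wt i (snd g)) * f (tu (nb g i))) =
   (\<Sum>i\<in>UNIV. of_nat (wt (sg g i) (snd (tu g))) * f (nb (tu g) (sg g i)))"
 proof (rule sum.cong[OF refl])
  fix i show "of_nat (wt i (snd g)) * f (tu (nb g i)) = of_nat (wt (sg g i) (snd (tu g))) * f (nb (tu g) (sg g i))"
   using tu_nb[of i g] wt_eq_0[of i "snd g"] wt_sg[of g i] by (cases "E i (snd g) \<or> E (snd g) i") auto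
 qed
 also have "\<dots> = (\<Sum>i\<in>UNIV. of_nat (wt i (snd (tu g))) * f (nb (tu g) i))"
  by (rule sum.reindex_bij_betw) (use bij_sg in simp)
 finally show ?thesis .
qed

lemma sum_nb_cong:
 assumes "\<And>i. E i (snd h) \<or> E (snd h) i ==> f (nb h i) = g (nb h i)"
 shows "(\<Sum>i\<in>UNIV. of_nat (wt i (snd h)) * f (nb h i)) = (\<Sum>i\<in>UNIV. of_nat (wt i (snd h)) * (g (nb h i) :: 'b::semiring_1))"
proof (rule sum.cong[OF refl])
 fix i show "of_nat (wt i (snd h)) * f (nb h i) = of_nat (wt i (snd h)) * g (nb h i)"
  using assms[of i] wt_eq_0[of i "snd h"] by (cases "E i (snd h) \<or> E (snd h) i") auto
qed

definition rv :: "('n => int) => (real, 'n) vec" where "rv w = (\<chi> j. of_int (w j))"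

definition phz :: "('n => int) => nat \<times> 'n => int" where "phz w g = \<lfloor>Phi g (rv w)\<rfloor>"

definition ipz :: "('n => int) => ('n => int) => int" where "ipz x w = (\<Sum>j\<in>UNIV. x j * w j)"

definition alz :: "('n => int) => nat \<times> 'n => int" where
 "alz w g = ipz (yb g) w + (\<Sum>i\<in>UNIV. int (wt i (snd g)) * phz w (nb g i))"

text \<open>The tropical difference of the two terms in the mesh at \<open>g\<close> for the
  coefficient row \<open>w\<close>. By \<open>bet_label\<close> it is the entry of a frozen row at
  the moment when the variable of \<open>g\<close> is created.\<close>

definition betaz :: "('n => int) => nat \<times> 'n => int" where
 "betaz w g = ipz (dv g) w - alz w g"

lemma pr_rv: "pr m (rv w) = of_int (\<Sum>j\<in>UNIV. lookup m j * w j)"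
 by (simp add: pr_def rv_def)

lemma trop_rv: assumes "p \<noteq> 0" shows "\<exists>z::int. trop_laurent p (rv w) = of_int z"
proof -
 have "part (rv w) (trop_laurent p (rv w)) p \<noteq> 0" by (rule trop_low(2)[OF assms])
 then obtain m where "lookup (part (rv w) (trop_laurent p (rv w)) p) m \<noteq> 0"
  by (metis lookup_zero poly_mapping_eqI)
 hence "pr m (rv w) = trop_laurent p (rv w)" by (auto simp: lookup_part split: if_splits)
 thus ?thesis unfolding pr_rv by metis
qed

lemma phz: "g \<in> lab ==> of_int (phz w g) = Phi g (rv w)"
 using trop_rv[OF sfree_nz[OF sfree_Fp], of g w] by (auto simp: phz_def Phi_def)

lemma phz_0 [simp]: "phz w (0, j) = 0" by (simp add: phz_def)

lemma ip_rv: "ip x (rv w) = of_int (ipz x w)" by (simp add: ip_def ipz_def rv_def)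

lemma alz: assumes "g \<in> lab" shows "al g (rv w) = of_int (alz w g)"
proof -
 have "(\<Sum>i\<in>UNIV. of_nat (wt i (snd g)) * Phi (nb g i) (rv w)) =
   (\<Sum>i\<in>UNIV. of_nat (wt i (snd g)) * real_of_int (phz w (nb g i)))"
  by (rule sum_nb_cong) (use phz nb_lab[OF assms] in simp)
 thus ?thesis by (simp add: al_def alz_def ip_rv)
qed

lemma phz_mesh:
 assumes "g \<in> lab"
 shows "phz w (tu g) + phz w g = min (alz w g) (ipz (dv g) w)"
proof -
 have "real_of_int (phz w (tu g) + phz w g) = real_of_int (min (alz w g) (ipz (dv g) w))"
  using Phi_mesh[OF assms, of "rv w"] phz[OF assms] phz[OF tu_lab[OF assms]] alz[OF assms] ip_rv
  by (simp add: of_int_min)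
 thus ?thesis by (simp only: of_int_eq_iff)
qed

lemma ipz_add: "ipz (x + x') w = ipz x w + ipz x' w"
 by (simp add: ipz_def sum.distrib algebra_simps)

lemma ipz_0 [simp]: "ipz 0 w = 0" by (simp add: ipz_def)

lemma ipz_yb0: "ipz (yb (0, j)) w = w j"
proof -
 have "yb (0, j) i * w i = (if i = j then w i else 0)" for i by (auto simp: yb_def)
 thus ?thesis by (simp add: ipz_def)
qed

lemma yb_pos: "t > 0 ==> yb (t, j) = 0" by (auto simp: yb_def)

lemma ipz_dv_mesh:
 assumes "g \<in> lab"
 shows "ipz (dv g) w + ipz (dv (tu g)) w = ipz (yb g) w + ipz (yb (tu g)) w +
  (\<Sum>i\<in>UNIV. int (wt i (snd g)) * ipz (dv (nb g i)) w)"
proof -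
 have "ipz (dv g) w + ipz (dv (tu g)) w = ipz (dv g + dv (tu g)) w" by (simp add: ipz_add)
 also have "\<dots> = ipz (yb g) w + ipz (yb (tu g)) w +
   (\<Sum>j\<in>UNIV. \<Sum>i\<in>UNIV. int (wt i (snd g)) * (dv (nb g i) j * w j))"
  unfolding dv_mesh[OF assms] by (simp add: ipz_def algebra_simps sum.distrib sum_distrib_left)
 also have "(\<Sum>j\<in>UNIV. \<Sum>i\<in>UNIV. int (wt i (snd g)) * (dv (nb g i) j * w j)) =
   (\<Sum>i\<in>UNIV. int (wt i (snd g)) * ipz (dv (nb g i)) w)"
  by (subst sum.swap) (simp add: ipz_def sum_distrib_left)
 finally show ?thesis .
qed

lemma max_betaz: "g \<in> lab ==> max 0 (betaz w g) = ipz (dv g) w - phz w (tu g) - phz w g"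
 using phz_mesh[of g w] unfolding betaz_def by linarith

text \<open>The tropical \<open>Y\<close>-system. The tropical mesh relation expresses
  \<open>max 0 (betaz w g)\<close> by \<open>phz\<close>; after the linear relation for
  \<open>dv\<close> has been inserted, the remaining terms match.\<close>

lemma betaz_mesh:
 assumes "g \<in> lab"
 shows "betaz w (tu g) + betaz w g = (\<Sum>i\<in>UNIV. int (wt i (snd g)) * max 0 (betaz w (nb g i)))"
proof -
 have "(\<Sum>i\<in>UNIV. int (wt i (snd g)) * max 0 (betaz w (nb g i))) =
   (\<Sum>i\<in>UNIV. int (wt i (snd g)) * (ipz (dv (nb g i)) w - phz w (tu (nb g i)) - phz w (nb g i)))"
  using sum_nb_cong[of g "\<lambda>h. max 0 (betaz w h)" "\<lambda>h. ipz (dv h) w - phz w (tu h) - phz w h"]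
   max_betaz nb_lab[OF assms] by simp
 also have "\<dots> = (\<Sum>i\<in>UNIV. int (wt i (snd g)) * ipz (dv (nb g i)) w)
   - (\<Sum>i\<in>UNIV. int (wt i (snd g)) * phz w (tu (nb g i))) - (\<Sum>i\<in>UNIV. int (wt i (snd g)) * phz w (nb g i))"
  by (simp add: right_diff_distrib sum_subtractf)
 also have "(\<Sum>i\<in>UNIV. int (wt i (snd g)) * phz w (tu (nb g i))) = (\<Sum>i\<in>UNIV. int (wt i (snd (tu g))) * phz w (nb (tu g) i))"
  using sum_nb_tu[of g "phz w"] by simp
 finally show ?thesis using ipz_dv_mesh[OF assms, of w] by (simp add: betaz_def alz_def)
qed

text \<open>Sweeps are followed up to time \<open>Suc (rr j)\<close>, when the variable at
  \<open>j\<close> is an initial one again.\<close>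

definition lbl :: "nat => 'n => nat \<times> 'n" where
 "lbl t j = (if t \<le> rr j then (t, j) else (0, star0 j))"

lemma lbl_lab: "lbl t j \<in> lab" by (simp add: lbl_def lab_def)

lemma tu_lbl: "0 < t ==> t \<le> Suc (rr j) ==> tu (lbl t j) = lbl (t - 1) j"
 by (cases t) (auto simp: lbl_def star_star not_le le_Suc_eq)

definition hh :: "nat => 'n => 'n => 'n" where "hh t j i = (if t \<le> rr j then i else star0 i)"

lemma bij_hh: "bij (hh t j)"
 by (rule o_bij[of "hh t j"]) (auto simp: hh_def fun_eq_iff star_star)

lemma wt_hh: "wt (hh t j i) (snd (lbl t j)) = wt i j"
 by (simp add: hh_def lbl_def wt_star)

lemma lbl_nb:
 assumes "0 < t" "t \<le> Suc (rr j)" "E i j \<or> E j i"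
 shows "nb (lbl t j) (hh t j i) = (if E i j then lbl t i else lbl (t - 1) i)"
proof -
 obtain u where u: "t = Suc u" using assms(1) by (cases t) auto
 show ?thesis
 proof (cases "t \<le> rr j")
  case True
  thus ?thesis using assms(3) rr_edge[of i j] rr_edge[of j i]
   by (auto simp: nb_def lbl_def hh_def u)
 next
  case False
  hence t: "t = Suc (rr j)" "u = rr j" using assms(2) u by auto
  show ?thesis
  proof (cases "E i j")
   case True
   hence ne: "\<not> E j i" using E_asym by blast
   consider "late j i" | "early j i" using late_or_early True by blast
   thus ?thesis
   proof cases
    case 1
    hence "E (star0 j) (star0 i)" "\<not> E (star0 i) (star0 j)" using late_iff E_asym by blast+
    moreover have "rr i = Suc (rr j)" using 1 ne by (auto simp: late_def)
    ultimately show ?thesis using True t by (simp add: nb_def lbl_def hh_def star_star)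
   next
    case 2
    hence "E (star0 i) (star0 j)" using early_iff by blast
    moreover have "rr i = rr j" using 2 ne by (auto simp: early_def)
    ultimately show ?thesis using True t by (simp add: nb_def lbl_def hh_def)
   qed
  next
   case False
   hence e: "E j i" using assms(3) by blast
   consider "late j i" | "early j i" using late_or_early e by blast
   thus ?thesis
   proof cases
    case 1
    hence "E (star0 j) (star0 i)" "\<not> E (star0 i) (star0 j)" using late_iff E_asym by blast+
    moreover have "rr i = rr j" using 1 False by (auto simp: late_def)
    ultimately show ?thesis using False t by (simp add: nb_def lbl_def hh_def star_star)
   next
    case 2
    hence "E (star0 i) (star0 j)" using early_iff by blast
    moreover have "rr j = Suc (rr i)" using 2 False by (auto simp: early_def)
    ultimately show ?thesis using False t by (simp add: nb_def lbl_def hh_def)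
   qed
  qed
 qed
qed

lemma sum_lbl:
 assumes "0 < t" "t \<le> Suc (rr j)"
 shows "(\<Sum>i\<in>UNIV. of_nat (wt i (snd (lbl t j))) * f (nb (lbl t j) i)) =
  (\<Sum>i | E i j. of_nat (wt i j) * f (lbl t i)) + (\<Sum>i | E j i. of_nat (wt i j) * (f (lbl (t - 1) i) :: 'b::comm_ring_1))"
proof -
 have "(\<Sum>i\<in>UNIV. of_nat (wt i (snd (lbl t j))) * f (nb (lbl t j) i)) =
   (\<Sum>i\<in>UNIV. of_nat (wt (hh t j i) (snd (lbl t j))) * f (nb (lbl t j) (hh t j i)))"
  by (rule sum.reindex_bij_betw[symmetric]) (use bij_hh in simp)
 also have "\<dots> = (\<Sum>i\<in>UNIV. (if E i j then of_nat (wt i j) * f (lbl t i) else 0) + (if E j i then of_nat (wt i j) * f (lbl (t - 1) i) else 0))"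
 proof (rule sum.cong[OF refl])
  fix i
  show "of_nat (wt (hh t j i) (snd (lbl t j))) * f (nb (lbl t j) (hh t j i)) =
    (if E i j then of_nat (wt i j) * f (lbl t i) else 0) + (if E j i then of_nat (wt i j) * f (lbl (t - 1) i) else 0)"
   using lbl_nb[OF assms, of i] wt_eq_0[of i j] E_asym[of i j] E_asym[of j i]
   by (cases "E i j \<or> E j i") (auto simp: wt_hh)
 qed
 finally show ?thesis by (simp add: sum.distrib sum.If_cases Int_def)
qed

lemma prod_lbl:
 assumes "0 < t" "t \<le> Suc (rr j)"
 shows "(\<Prod>i\<in>UNIV. f (nb (lbl t j) i) ^ wt i (snd (lbl t j))) =
  (\<Prod>i | E i j. f (lbl t i) ^ wt i j) * (\<Prod>i | E j i. (f (lbl (t - 1) i) :: 'b::comm_ring_1) ^ wt i j)"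
proof -
 have "(\<Prod>i\<in>UNIV. f (nb (lbl t j) i) ^ wt i (snd (lbl t j))) =
   (\<Prod>i\<in>UNIV. f (nb (lbl t j) (hh t j i)) ^ wt (hh t j i) (snd (lbl t j)))"
  by (rule prod.reindex_bij_betw[symmetric]) (use bij_hh in simp)
 also have "\<dots> = (\<Prod>i\<in>UNIV. (if E i j then f (lbl t i) ^ wt i j else 1) * (if E j i then f (lbl (t - 1) i) ^ wt i j else 1))"
 proof (rule prod.cong[OF refl])
  fix i
  show "f (nb (lbl t j) (hh t j i)) ^ wt (hh t j i) (snd (lbl t j)) =
    (if E i j then f (lbl t i) ^ wt i j else 1) * (if E j i then f (lbl (t - 1) i) ^ wt i j else 1)"
   using lbl_nb[OF assms, of i] wt_eq_0[of i j] E_asym[of i j] E_asym[of j i]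
   by (cases "E i j \<or> E j i") (auto simp: wt_hh)
 qed
 finally show ?thesis by (simp add: prod.distrib prod.If_cases Int_def)
qed

text \<open>The g-vector, as \<open>g_vector_eq\<close> confirms. With this choice both terms of
  each mesh relation get the exponents required by an exchange relation (\<open>gg_1\<close>,
  \<open>gg_2\<close>).\<close>

definition gg :: "'n => nat \<times> 'n => int" where "gg k g = yb g k - UU (dv g) k"

lemma UU_0 [simp]: "UU 0 k = 0" and LL_0 [simp]: "LL 0 k = 0" by (simp_all add: UU_def LL_def)

lemma UU_add: "UU (x + y) k = UU x k + UU y k"
 by (simp add: UU_def sum.distrib distrib_left)

text \<open>This is \<open>cinv_rel\<close> along an orbit; the unit vectors on the right account
  for its two ends, where \<open>dv\<close> is zero.\<close>

lemma LL_UU_dv: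
 assumes "h \<in> lab"
 shows "LL (dv h) k + UU (dv (tu h)) k = yb h k + yb (tu h) k"
proof -
 obtain t j where g: "h = (t, j)" by force
 have tl: "tu h \<in> lab" by (rule tu_lab[OF assms])
 consider "t = 0" | "t = 1" | u where "t = Suc u" "u > 0" by (cases t) auto
 thus ?thesis
 proof cases
  case 1
  have "dv (tu h) = II j" using tl by (simp add: g 1 dv_D II_def)
  moreover have "yb (tu h) = 0" using rr_ge_1 by (simp add: g 1 yb_pos)
  ultimately show ?thesis by (simp add: g 1 UU_II) (auto simp: yb_def ev_def)
 next
  case 2
  have "dv h = PP j" using assms by (simp add: g 2 dv_D D_1)
  thus ?thesis by (simp add: g 2 LL_PP yb_pos) (auto simp: yb_def ev_def)
 next
  case 3
  have "dv h = cinv (D u j)" "dv (tu h) = D u j" using assms tl 3 by (auto simp: g dv_D D_Suc)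
  thus ?thesis using 3 by (simp add: cinv_rel g yb_pos)
 qed
qed

lemma ipz_BB: "ipz v (exchange_matrix a E k) = UU v k - LL v k"
proof -
 have "ipz v (exchange_matrix a E k) = (\<Sum>j\<in>UNIV. (if E j k then a k j * v j else 0) - (if E k j then a k j * v j else 0))"
  unfolding ipz_def by (rule sum.cong) (use E_asym in \<open>auto simp: exchange_matrix_def\<close>)
 thus ?thesis by (simp add: sum_subtractf sum.If_cases Int_def UU_def LL_def)
qed

lemma gg_1:
 assumes "g \<in> lab"
 shows "gg k (tu g) + gg k g + ipz (dv g) (exchange_matrix a E k) = 0"
 using LL_UU_dv[OF assms, of k] by (simp add: gg_def ipz_BB)

lemma yb_nb:
 "(\<Sum>i\<in>UNIV. int (wt i (snd h)) * yb (nb h i) k) + UU (yb h) k + UU (yb (tu h)) k =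
  yb h k + yb (tu h) k + ipz (yb h) (exchange_matrix a E k)"
proof -
 obtain t j where g: "h = (t, j)" by force
 have y0: "yb (0, j) = ev j" for j by (auto simp: yb_def ev_def)
 have U: "UU (ev j) k = ev j k + (if E j k then a k j else 0)" by (rule UU_ev)
 have L: "LL (ev j) k = ev j k + (if E k j then a k j else 0)" by (rule LL_ev)
 have pos: "rr i \<noteq> 0" for i using rr_ge_1[of i] by simp
 have S: "(\<Sum>i\<in>UNIV. int (wt i j) * yb (nb h i) k) = (if t = 0 \<and> E k j \<or> t = 1 \<and> E j k then - a k j else 0)"
 proof -
  have "(\<Sum>i\<in>UNIV. int (wt i j) * yb (nb h i) k) =
    (\<Sum>i\<in>UNIV. if i = k then (if t = 0 \<and> E k j \<or> t = 1 \<and> E j k then - a k j else 0) else 0)"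
  proof (rule sum.cong[OF refl])
   fix i
   show "int (wt i j) * yb (nb h i) k = (if i = k then (if t = 0 \<and> E k j \<or> t = 1 \<and> E j k then - a k j else 0) else 0)"
    using int_wt[of i j] wt_eq_0[of i j] E_asym[of i j] E_asym[of j i] pos
    by (cases "E i j \<or> E j i"; cases "t = 0"; cases "t = 1"; cases t) (auto simp: nb_def g yb_def)
  qed
  thus ?thesis by simp
 qed
 consider "t = 0" | "t = 1" | u where "t = Suc (Suc u)" by (metis One_nat_def not0_implies_Suc)
 thus ?thesis
 proof cases
  case 1
  have "yb (tu h) = 0" using rr_ge_1 by (simp add: g 1 yb_pos)
  thus ?thesis using S E_asym[of k j] by (simp add: g 1 y0 ipz_BB U L)
 next
  case 2
  thus ?thesis using S E_asym[of k j] by (simp add: g y0 ipz_BB U L yb_pos)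
 next
  case 3
  thus ?thesis using S by (simp add: g yb_pos)
 qed
qed

lemma gg_2:
 assumes "g \<in> lab"
 shows "gg k (tu g) + gg k g + ipz (yb g) (exchange_matrix a E k) = (\<Sum>i\<in>UNIV. int (wt i (snd g)) * gg k (nb g i))"
proof -
 have "(\<Sum>i\<in>UNIV. int (wt i (snd g)) * gg k (nb g i)) = (\<Sum>i\<in>UNIV. int (wt i (snd g)) * yb (nb g i) k)
   - (\<Sum>i\<in>UNIV. int (wt i (snd g)) * UU (dv (nb g i)) k)"
  by (simp add: gg_def right_diff_distrib sum_subtractf)
 also have "(\<Sum>i\<in>UNIV. int (wt i (snd g)) * UU (dv (nb g i)) k) = UU (\<lambda>k. \<Sum>i\<in>UNIV. int (wt i (snd g)) * dv (nb g i) k) k"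
  by (simp add: UU_sum)
 also have "UU (dv g + dv (tu g)) k = UU (yb g) k + UU (yb (tu g)) k + UU (\<lambda>k. \<Sum>i\<in>UNIV. int (wt i (snd g)) * dv (nb g i) k) k"
 proof -
  have "dv g + dv (tu g) = yb g + yb (tu g) + (\<lambda>k. \<Sum>i\<in>UNIV. int (wt i (snd g)) * dv (nb g i) k)"
   unfolding dv_mesh[OF assms] by auto
  thus ?thesis by (simp add: UU_add)
 qed
 hence "UU (\<lambda>k. \<Sum>i\<in>UNIV. int (wt i (snd g)) * dv (nb g i) k) k = UU (dv g) k + UU (dv (tu g)) k - UU (yb g) k - UU (yb (tu g)) k"
  by (simp add: UU_add)
 finally show ?thesis using yb_nb[of g k] by (simp add: gg_def)
qed

end

context jseed begin

text \<open>Frozen rows along sweeps satisfy the recursion of the tropical \<open>Y\<close>-system.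
  The interlacing \<open>rr_edge\<close> is needed because each vertex wraps at its own
  time.\<close>

lemma bet_label:
 assumes "0 < t" "t \<le> Suc (rr j)"
 shows "bet ((nxt ^^ (t - 1)) w) j = betaz w (lbl t j)"
 using assms
proof (induction t arbitrary: j rule: less_induct)
 case (less t)
 note outer = this
 show ?case using less.prems
 proof (induction j rule: measure_induct_rule[where f = rho])
  case inner: (less j)
  obtain u where u: "t = Suc u" using outer(2) by (cases t) auto
  have m: "betaz w (lbl u j) + betaz w (lbl t j) =
   (\<Sum>i | E i j. int (wt i j) * max 0 (betaz w (lbl t i))) + (\<Sum>i | E j i. int (wt i j) * max 0 (betaz w (lbl u i)))"
   using betaz_mesh[OF lbl_lab[of t j], of w] tu_lbl[OF inner(2,3)]
    sum_lbl[OF inner(2,3), of "\<lambda>h. max 0 (betaz w h)"] u by simp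
  have S: "(\<Sum>i | E i j. int (wt i j) * max 0 (bet ((nxt ^^ u) w) i)) = (\<Sum>i | E i j. int (wt i j) * max 0 (betaz w (lbl t i)))"
  proof (rule sum.cong[OF refl])
   fix i assume "i \<in> {i. E i j}"
   hence e: "E i j" by simp
   have "t \<le> Suc (rr i)" using rr_edge(1)[OF e] inner(3) by simp
   thus "int (wt i j) * max 0 (bet ((nxt ^^ u) w) i) = int (wt i j) * max 0 (betaz w (lbl t i))"
    using inner(1)[of i] rho_less[OF e] inner(2) u by simp
  qed
  have b: "bet ((nxt ^^ u) w) j = (nxt ^^ u) w j + (\<Sum>i | E i j. int (wt i j) * max 0 (betaz w (lbl t i)))"
   unfolding bet.simps[of "(nxt ^^ u) w" j] S ..
  show ?case
  proof (cases "u = 0")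
   case True
   have l0: "lbl 0 i = (0, i)" for i by (simp add: lbl_def)
   have "(\<Sum>i\<in>UNIV. int (wt i j) * phz w (nb (0, j) i)) = (\<Sum>i | E j i. int (wt i j) * phz w (tu (0, i)))"
   proof -
    have "(\<Sum>i\<in>UNIV. int (wt i j) * phz w (nb (0, j) i)) = (\<Sum>i\<in>UNIV. if E j i then int (wt i j) * phz w (tu (0, i)) else 0)"
     by (rule sum.cong) (use wt_eq_0 E_asym in \<open>auto simp: nb_def simp del: tu.simps\<close>)
    thus ?thesis by (simp add: sum.If_cases Int_def)
   qed
   hence "betaz w (0, j) = - w j - (\<Sum>i | E j i. int (wt i j) * phz w (tu (0, i)))"
    by (simp add: betaz_def alz_def ipz_yb0)
   moreover have "max 0 (betaz w (0, i)) = - phz w (tu (0, i))" for i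
    using max_betaz[OF lab0, of w i] by simp
   ultimately show ?thesis using m b by (simp add: u True l0 sum_negf del: tu.simps)
  next
   case False
   have uj: "u \<le> Suc (rr j)" using inner(3) u by simp
   have n: "(nxt ^^ u) w j = - bet ((nxt ^^ (u - 1)) w) j + (\<Sum>i | E j i. int (wt i j) * max 0 (bet ((nxt ^^ (u - 1)) w) i))"
    using False by (cases u) (auto simp: nxt_def)
   have "(\<Sum>i | E j i. int (wt i j) * max 0 (bet ((nxt ^^ (u - 1)) w) i)) = (\<Sum>i | E j i. int (wt i j) * max 0 (betaz w (lbl u i)))"
   proof (rule sum.cong[OF refl])
    fix i assume "i \<in> {i. E j i}"
    hence e: "E j i" by simp
    have "u \<le> Suc (rr i)" using rr_edge(2)[OF e] inner(3) u by simp
    thus "int (wt i j) * max 0 (bet ((nxt ^^ (u - 1)) w) i) = int (wt i j) * max 0 (betaz w (lbl u i))"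
     using outer(1)[of u i] False u by simp
   qed
   moreover have "bet ((nxt ^^ (u - 1)) w) j = betaz w (lbl u j)" using outer(1)[of u j] False u uj by simp
   ultimately show ?thesis using m b n u by simp
  qed
 qed
qed

subsection \<open>The separation formula\<close>

definition pw :: "('r => 'f::field) => ('r => int) => 'f" where "pw x e = (\<Prod>r\<in>UNIV. x r powi e r)"

definition yh :: "('r => 'n => int) => ('r => 'f::field) => 'n => 'f" where "yh w x j = pw x (\<lambda>r. w r j)"

text \<open>Exponents of the separation formula: g-vector coordinates at mutable rows, and at a
  frozen row minus the tropical value of the \<open>F\<close>-polynomial, which stands in the
  denominator.\<close>

definition hx :: "('r => 'n => int) => 'r => nat \<times> 'n => int" where
 "hx w r g = (if r \<in> frz then - phz (w r) g else gg (inv em r) g)"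

definition XX :: "('r => 'n => int) => ('r => 'f::field) => nat \<times> 'n => 'f" where
 "XX w x g = pw x (\<lambda>r. hx w r g) * leval (yh w x) (Fp g)"

lemma pw_add: "(\<And>r. x r \<noteq> 0) ==> pw x (\<lambda>r. e r + e' r) = pw x e * pw x e'"
 by (simp add: pw_def power_int_add prod.distrib)

lemma pw_power: "pw x (\<lambda>r. int m * e r) = pw x e ^ m"
 by (simp add: pw_def power_int_mult mult.commute[of "int m"] prod_power_distrib)

lemma pw_powi:
 fixes x :: "'r => 'f::field"
 shows "pw x (\<lambda>r. m * e r) = pw x e powi m"
proof -
 have "pw x (\<lambda>r. m * e r) = (\<Prod>r\<in>UNIV. (x r powi e r) powi m)"
  unfolding pw_def by (rule prod.cong) (auto simp: power_int_mult mult.commute[of m])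
 also have "\<dots> = (\<Prod>r\<in>UNIV. x r powi e r) powi m"
 proof -
  have "(\<Prod>r\<in>S. f r powi m) = (\<Prod>r\<in>S. f r) powi m" for S and f :: "'r => 'f"
   by (induction S rule: infinite_finite_induct) (auto simp: power_int_mult_distrib)
  thus ?thesis .
 qed
 finally show ?thesis by (simp add: pw_def)
qed

lemma pw_0: "pw x (\<lambda>r. 0) = 1" by (simp add: pw_def)

lemma pw_sum:
 assumes "\<And>r. x r \<noteq> 0"
 shows "pw x (\<lambda>r. \<Sum>i\<in>S. e i r) = (\<Prod>i\<in>S. pw x (e i))"
 by (induction S rule: infinite_finite_induct) (simp_all add: pw_0 pw_add assms)

lemma leval_yh_ymon:
 assumes "\<And>r. x r \<noteq> 0"
 shows "leval (yh w x) (ymon v) = pw x (\<lambda>r. ipz v (w r))"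
proof -
 have "leval (yh w x) (ymon v) = (\<Prod>j\<in>UNIV. pw x (\<lambda>r. v j * w r j))"
  unfolding leval_ymon yh_def pw_powi ..
 thus ?thesis unfolding ipz_def pw_sum[OF assms] .
qed

lemma yh_nz: "(\<And>r. x r \<noteq> 0) ==> yh w x j \<noteq> 0"
 by (simp add: yh_def pw_def)

lemma pw_frz: "(\<Prod>r\<in>frz. x r ^ nat (e r)) = pw x (\<lambda>r. if r \<in> frz then int (nat (e r)) else 0)"
proof -
 have "pw x (\<lambda>r. if r \<in> frz then int (nat (e r)) else 0) = (\<Prod>r\<in>UNIV. if r \<in> frz then x r ^ nat (e r) else 1)"
  unfolding pw_def by (rule prod.cong) (auto simp del: int_nat_eq)
 thus ?thesis by (simp add: prod.If_cases)
qed

lemma hx_rows: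
 assumes g: "h \<in> lab" and w: "\<And>k. k \<in> J ==> w (em k) = BB k"
 shows "hx w r (tu h) + hx w r h + ipz (dv h) (w r) = (if r \<in> frz then int (nat (betaz (w r) h)) else 0)"
  and "hx w r (tu h) + hx w r h + ipz (yb h) (w r) = (if r \<in> frz then int (nat (- betaz (w r) h)) else 0)
   + (\<Sum>i\<in>UNIV. int (wt i (snd h)) * hx w r (nb h i))"
proof -
 have "hx w r (tu h) + hx w r h + ipz (dv h) (w r) = (if r \<in> frz then int (nat (betaz (w r) h)) else 0) \<and>
  hx w r (tu h) + hx w r h + ipz (yb h) (w r) = (if r \<in> frz then int (nat (- betaz (w r) h)) else 0)
   + (\<Sum>i\<in>UNIV. int (wt i (snd h)) * hx w r (nb h i))"
 proof (cases "r \<in> frz")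
  case True
  thus ?thesis using phz_mesh[OF g, of "w r"]
   by (auto simp: hx_def betaz_def alz_def sum_negf)
 next
  case False
  then obtain k where k: "k \<in> J" "r = em k" by (auto simp: frz_def)
  hence "inv em r = k" using inj by simp
  thus ?thesis using False gg_1[OF g, of k] gg_2[OF g, of k] w[OF k(1)] k
   by (simp add: hx_def BB_def)
 qed
 thus "hx w r (tu h) + hx w r h + ipz (dv h) (w r) = (if r \<in> frz then int (nat (betaz (w r) h)) else 0)"
  "hx w r (tu h) + hx w r h + ipz (yb h) (w r) = (if r \<in> frz then int (nat (- betaz (w r) h)) else 0)
   + (\<Sum>i\<in>UNIV. int (wt i (snd h)) * hx w r (nb h i))" by auto
qed

text \<open>The mesh relation of \<open>F\<close>-polynomials, evaluated at \<open>yh\<close> and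
  multiplied by the monomial prefactors. At mutable rows \<open>gg_1\<close> and \<open>gg_2\<close>
  give the exponents; at frozen rows the two truncations of \<open>betaz\<close> remain.\<close>

lemma XX_mesh:
 assumes g: "h \<in> lab" and w: "\<And>k. k \<in> J ==> w (em k) = BB k" and x: "\<And>r. x r \<noteq> 0"
 shows "XX w x (tu h) * XX w x h = (\<Prod>r\<in>frz. x r ^ nat (betaz (w r) h)) +
  (\<Prod>r\<in>frz. x r ^ nat (- betaz (w r) h)) * (\<Prod>i\<in>UNIV. XX w x (nb h i) ^ wt i (snd h))"
proof -
 let ?e = "leval (yh w x)" and ?H = "\<lambda>r. hx w r (tu h) + hx w r h"
 let ?N = "\<Prod>i\<in>UNIV. ?e (Fp (nb h i)) ^ wt i (snd h)"
 have em: "?e (p * q) = ?e p * ?e q" for p q by (rule leval_mult) (use yh_nz x in blast)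
 have ep: "?e (NN h) = ?N"
 proof -
  have "?e (p ^ e) = ?e p ^ e" for p e by (rule leval_power) (use yh_nz x in blast)
  moreover have "?e (NN h) = (\<Prod>i\<in>UNIV. ?e (Fp (nb h i) ^ wt i (snd h)))"
   unfolding NN_def by (rule leval_prod) (use yh_nz x in blast)
  ultimately show ?thesis by simp
 qed
 have "XX w x (tu h) * XX w x h = pw x ?H * ?e (Fp (tu h) * Fp h)"
  by (simp add: XX_def pw_add[OF x] em)
 also have "?e (Fp (tu h) * Fp h) = pw x (\<lambda>r. ipz (yb h) (w r)) * ?N + pw x (\<lambda>r. ipz (dv h) (w r))"
  unfolding mesh[OF g] by (simp add: leval_add em ep leval_yh_ymon[OF x])
 also have "pw x ?H * (pw x (\<lambda>r. ipz (yb h) (w r)) * ?N + pw x (\<lambda>r. ipz (dv h) (w r))) =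
   pw x (\<lambda>r. ?H r + ipz (dv h) (w r)) + pw x (\<lambda>r. ?H r + ipz (yb h) (w r)) * ?N"
  unfolding pw_add[OF x] by (simp add: algebra_simps)
 also have "pw x (\<lambda>r. ?H r + ipz (dv h) (w r)) = (\<Prod>r\<in>frz. x r ^ nat (betaz (w r) h))"
  using hx_rows(1)[OF g w] unfolding pw_frz by simp
 also have "pw x (\<lambda>r. ?H r + ipz (yb h) (w r)) = (\<Prod>r\<in>frz. x r ^ nat (- betaz (w r) h)) *
   (\<Prod>i\<in>UNIV. pw x (\<lambda>r. hx w r (nb h i)) ^ wt i (snd h))"
  using hx_rows(2)[OF g w] unfolding pw_frz pw_power[symmetric] pw_sum[OF x, symmetric] pw_add[OF x, symmetric] by simp
 finally show ?thesis
  by (simp add: XX_def power_mult_distrib prod.distrib mult.assoc)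
qed

lemma frz_J: "j \<in> J ==> em j \<notin> frz" by (simp add: frz_def)

lemma XX_0: assumes "j \<in> J" shows "XX w x (0, j) = x (em j)"
proof -
 have "hx w r (0, j) = (if r = em j then 1 else 0)" for r
 proof (cases "r \<in> frz")
  case True
  thus ?thesis using assms by (auto simp: hx_def frz_def)
 next
  case False
  then obtain k where k: "k \<in> J" "r = em k" by (auto simp: frz_def)
  hence "inv em r = k" using inj by simp
  thus ?thesis using k False by (auto simp: hx_def gg_def yb_def)
 qed
 hence "pw x (\<lambda>r. hx w r (0, j)) = (\<Prod>r\<in>UNIV. if r = em j then x r else 1)"
  unfolding pw_def by (intro prod.cong) auto
 thus ?thesis by (simp add: XX_def)
qed

text \<open>An isolated vertex is a component of type A1, where \<open>cinv\<close> is
  negation.\<close>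

lemma star_iso: assumes "i \<notin> J" shows "star0 i = i" "rr i = 1"
proof -
 have no: "{k. E k i} = {}" "{k. E i k} = {}" using E_J assms by auto
 have P: "PP i = ev i" using no by (auto simp: PP.simps[of i])
 have "cinv (ev i) = - ev i"
  using assms E_J unfolding cinv_sum by (auto simp: LL_minus LL_ev UU_ev)
 hence D2: "D 2 i = - PP i" using D_Suc[of 1 i] by (simp add: D_1 numeral_2_eq_2 P)
 have "\<not> nneg (D (Suc 1) i)" using D2 RR_not_both[OF RR_PP PP_nneg] by (simp add: numeral_2_eq_2)
 hence "rr i \<le> 1" unfolding rr_def by (rule Least_le)
 thus r: "rr i = 1" using rr_ge_1[of i] by simp
 show "star0 i = i" by (rule star0_unique) (use D2 r in \<open>simp add: numeral_2_eq_2\<close>)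
qed

lemma star_J: "j \<in> J ==> star0 j \<in> J"
 using star_iso(1)[of "star0 j"] star_star[of j] by metis

definition nonvan :: "('r => 'n => int) => ('r => 'f::field) => bool" where
 "nonvan w x \<longleftrightarrow> (\<forall>r. x r \<noteq> 0) \<and> (\<forall>g\<in>lab. leval (yh w x) (Fp g) \<noteq> 0)"

lemma XX_nz: "nonvan w x ==> g \<in> lab ==> XX w x g \<noteq> 0"
 by (simp add: XX_def nonvan_def pw_def)

lemma rowJ_acyc: "acyc s ==> k \<in> J ==> rowJ (fst s) (em k) = BB k"
proof
 fix j assume "acyc s" "k \<in> J"
 moreover have "j \<notin> J ==> BB k j = 0" using E_J[of k j] E_J[of j k] BB_eq(3)[of k j] by blast
 ultimately show "rowJ (fst s) (em k) j = BB k j" by (simp add: acyc_def rowJ_def)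
qed

text \<open>The order of mutations may differ from sweep to sweep, since \<open>sweep\<close>
  chooses it anew each time.\<close>

theorem sweeps:
 fixes s :: "('r, 'n, 'f::field) seed"
 assumes ac: "acyc s" and nv: "nonvan (rowJ (fst s)) (snd s)"
  and S0: "S 0 = s" and SS': "\<And>t. \<exists>l. topo l \<and> set l = J \<and> S (Suc t) = fold (mutate em) l (S t)"
 shows "acyc (S t)" "r \<in> frz ==> rowJ (fst (S t)) r = (nxt ^^ t) (rowJ (fst s) r)"
  "r \<in> frz ==> snd (S t) r = snd s r"
  "j \<in> J ==> t \<le> Suc (rr j) ==> snd (S t) (em j) = XX (rowJ (fst s)) (snd s) (lbl t j)"
proof -
 let ?w = "rowJ (fst s)" and ?x = "snd s"
 obtain l where l: "topo (l t)" "set (l t) = J" and SS: "S (Suc t) = fold (mutate em) (l t) (S t)" for t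
  using SS' by metis
 have a: "acyc (S t)" for t
  by (induction t) (simp_all add: S0 SS ac sweep(1)[OF _ l])
 show "acyc (S t)" by (rule a)
 have b: "rowJ (fst (S t)) r = (nxt ^^ t) (?w r) \<and> snd (S t) r = ?x r" if "r \<in> frz" for t r
  by (induction t) (simp_all add: S0 SS sweep(2,4)[OF a l] that)
 show "r \<in> frz ==> rowJ (fst (S t)) r = (nxt ^^ t) (?w r)" "r \<in> frz ==> snd (S t) r = ?x r"
  using b by auto
 have xz: "\<And>r. ?x r \<noteq> 0" using nv by (simp add: nonvan_def)
 have wB: "\<And>k. k \<in> J ==> ?w (em k) = BB k" by (rule rowJ_acyc[OF ac])
 have "j \<in> J ==> t \<le> Suc (rr j) ==> snd (S t) (em j) = XX ?w ?x (lbl t j)" for j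
 proof (induction t arbitrary: j)
  case 0
  thus ?case by (simp add: S0 lbl_def XX_0)
 next
  case (Suc t)
  have "nv (rowJ (fst (S t))) (snd (S t)) j = XX ?w ?x (lbl (Suc t) j)"
   using Suc.prems
  proof (induction j rule: measure_induct_rule[where f = rho])
   case (less j)
   have bt: "bet (rowJ (fst (S t)) r) j = betaz (?w r) (lbl (Suc t) j)" if "r \<in> frz" for r
    using b[OF that, of t] bet_label[of "Suc t" j "?w r"] less.prems by simp
   have p1: "(\<Prod>i | E i j. nv (rowJ (fst (S t))) (snd (S t)) i ^ wt i j) = (\<Prod>i | E i j. XX ?w ?x (lbl (Suc t) i) ^ wt i j)"
   proof (rule prod.cong[OF refl])
    fix i assume "i \<in> {i. E i j}"
    hence e: "E i j" by simp
    have "Suc t \<le> Suc (rr i)" using rr_edge(1)[OF e] less.prems by simp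
    thus "nv (rowJ (fst (S t))) (snd (S t)) i ^ wt i j = XX ?w ?x (lbl (Suc t) i) ^ wt i j"
     using less.IH[of i] rho_less[OF e] E_J[OF e] by simp
   qed
   have p2: "(\<Prod>i | E j i. snd (S t) (em i) ^ wt i j) = (\<Prod>i | E j i. XX ?w ?x (lbl t i) ^ wt i j)"
   proof (rule prod.cong[OF refl])
    fix i assume "i \<in> {i. E j i}"
    hence e: "E j i" by simp
    have "t \<le> Suc (rr i)" using rr_edge(2)[OF e] less.prems by simp
    thus "snd (S t) (em i) ^ wt i j = XX ?w ?x (lbl t i) ^ wt i j"
     using Suc.IH[of i] E_J[OF e] by simp
   qed
   have f: "(\<Prod>r\<in>frz. snd (S t) r ^ nat (bet (rowJ (fst (S t)) r) j)) = (\<Prod>r\<in>frz. ?x r ^ nat (betaz (?w r) (lbl (Suc t) j)))"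
    "(\<Prod>r\<in>frz. snd (S t) r ^ nat (- bet (rowJ (fst (S t)) r) j)) = (\<Prod>r\<in>frz. ?x r ^ nat (- betaz (?w r) (lbl (Suc t) j)))"
    by (auto intro!: prod.cong simp: bt b[THEN conjunct2])
   have tl: "tu (lbl (Suc t) j) = lbl t j" using tu_lbl[of "Suc t" j] less.prems by simp
   have m: "XX ?w ?x (lbl t j) * XX ?w ?x (lbl (Suc t) j) = (\<Prod>r\<in>frz. ?x r ^ nat (betaz (?w r) (lbl (Suc t) j))) +
    (\<Prod>r\<in>frz. ?x r ^ nat (- betaz (?w r) (lbl (Suc t) j))) *
    ((\<Prod>i | E i j. XX ?w ?x (lbl (Suc t) i) ^ wt i j) * (\<Prod>i | E j i. XX ?w ?x (lbl t i) ^ wt i j))"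
    using XX_mesh[where h = "lbl (Suc t) j" and w = "?w" and x = "?x", OF lbl_lab wB xz] prod_lbl[of "Suc t" j "XX ?w ?x"] less.prems by (simp add: tl)
   have "snd (S t) (em j) = XX ?w ?x (lbl t j)" using Suc.IH[of j] less.prems by simp
   thus ?case
    unfolding nv.simps[of _ _ j] p1 p2 f m[symmetric] using XX_nz[OF nv lbl_lab, of t j] by simp
  qed
  thus ?case using sweep(3)[OF a l Suc.prems(1)] by (simp add: SS)
 qed
 thus "j \<in> J ==> t \<le> Suc (rr j) ==> snd (S t) (em j) = XX ?w ?x (lbl t j)" .
qed

end

section \<open>Independence and injectivity\<close>

lemma leval_sum: "leval y (\<Sum>i\<in>S. f i) = (\<Sum>i\<in>S. leval y (f i))"
 by (induction S rule: infinite_finite_induct) (simp_all add: leval_add)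

definition indep :: "('r::finite => 'f::field) => bool" where
 "indep x \<longleftrightarrow> (\<forall>p. leval x p = 0 \<longrightarrow> p = 0)"

lemma indep_nz: assumes "indep x" shows "x r \<noteq> 0"
proof
 assume "x r = 0"
 let ?m = "single r (1::int)"
 have "mon x ?m = 0"
  unfolding mon_def by (rule prod_zero) (auto intro!: bexI[of _ r] simp: \<open>x r = 0\<close>)
 hence "leval x (single ?m 1) = 0" using leval_single[of x ?m 1] by (simp only: mult_zero_right)
 hence "single ?m (1::int) = 0" using assms unfolding indep_def by blast
 thus False by (metis lookup_single_eq lookup_zero zero_neq_one)
qed

lemma leval_mult': "(\<And>i. y i \<noteq> 0) ==> leval y (p * q) = leval y p * leval y q"
 by (rule leval_mult) blast

lemma leval_diff: "leval y (p - q) = leval y p - leval y q"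
 using leval_add[of y "p - q" q] by simp

lemma indep_eq: "indep x ==> leval x p = leval x q ==> p = q"
 unfolding indep_def by (metis leval_diff eq_iff_diff_eq_0)

definition lsub :: "('r::finite => 'n => int) => ('n::finite, int) laurent => ('r, int) laurent" where
 "lsub R = lsum (\<lambda>m c. single (Abs_poly_mapping (\<lambda>r. \<Sum>j\<in>UNIV. lookup m j * R r j)) c)"

lemma lsub_add: "lsub R (p + q) = lsub R p + lsub R q"
 unfolding lsub_def by (rule lsum_add) (auto simp: single_add)

lemma aug_sum: "aug (\<Sum>i\<in>S. f i) = (\<Sum>i\<in>S. aug (f i))"
 by (induction S rule: infinite_finite_induct) (simp_all add: aug_add)

lemma aug_single [simp]: "aug (single m c) = c"
 by (simp add: aug_def lsum_single)

lemma aug_lsub: "aug (lsub R p) = aug p"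
 unfolding lsub_def lsum_def aug_sum unfolding aug_single by (simp add: aug_def lsum_def)

lemma leval_lsub:
 fixes x :: "'a::finite => 'b::field" and p :: "('c::finite, int) laurent"
 assumes "\<And>r. x r \<noteq> 0"
 shows "leval x (lsub R p) = leval (\<lambda>j. \<Prod>r\<in>UNIV. x r powi R r j) p"
proof -
 have e: "mon x (Abs_poly_mapping (\<lambda>r. \<Sum>j\<in>UNIV. lookup m j * R r j)) =
   mon (\<lambda>j. \<Prod>r\<in>UNIV. x r powi R r j) m" for m
 proof -
  have pp: "x r powi (\<Sum>j\<in>S. f j) = (\<Prod>j\<in>S. x r powi f j)" for r S and f :: "'c => int"
   by (induction S rule: infinite_finite_induct) (auto simp: power_int_add assms)
  have pq: "(\<Prod>r\<in>S. f r) powi k = (\<Prod>r\<in>S. f r powi k)" for S k and f :: "'a => 'b"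
   by (induction S rule: infinite_finite_induct) (auto simp: power_int_mult_distrib)
  have "mon x (Abs_poly_mapping (\<lambda>r. \<Sum>j\<in>UNIV. lookup m j * R r j)) =
    (\<Prod>r\<in>UNIV. \<Prod>j\<in>UNIV. (x r powi R r j) powi lookup m j)"
   by (simp add: mon_def pp power_int_mult mult.commute[of "lookup m _"])
  also have "\<dots> = (\<Prod>j\<in>UNIV. \<Prod>r\<in>UNIV. (x r powi R r j) powi lookup m j)"
   by (rule prod.swap)
  finally show ?thesis by (simp add: mon_def pq)
 qed
 show ?thesis
  unfolding lsub_def lsum_def leval_sum by (simp add: e) (simp add: leval_def lsum_def)
qed

lemma pr_image:
 "pr (Abs_poly_mapping (\<lambda>r. \<Sum>j\<in>UNIV. lookup m j * R r j)) Y = pr m (\<chi> j. \<Sum>r\<in>UNIV. of_int (R r j) * Y $ r)"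
proof -
 have "pr (Abs_poly_mapping (\<lambda>r. \<Sum>j\<in>UNIV. lookup m j * R r j)) Y =
   (\<Sum>r\<in>UNIV. \<Sum>j\<in>UNIV. of_int (lookup m j) * (of_int (R r j) * Y $ r))"
  by (simp add: pr_def sum_distrib_right mult.assoc)
 also have "\<dots> = (\<Sum>j\<in>UNIV. \<Sum>r\<in>UNIV. of_int (lookup m j) * (of_int (R r j) * Y $ r))"
  by (rule sum.swap)
 finally show ?thesis by (simp add: pr_def sum_distrib_left)
qed

lemma keys_lsub:
 "keys (lsub R p) \<subseteq> (\<lambda>m. Abs_poly_mapping (\<lambda>r. \<Sum>j\<in>UNIV. lookup m j * R r j)) ` keys p"
proof -
 let ?f = "\<lambda>m. Abs_poly_mapping (\<lambda>r. \<Sum>j\<in>UNIV. lookup m j * R r j)"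
 have "keys (lsub R p) \<subseteq> (\<Union>m\<in>keys p. keys (single (?f m) (lookup p m)))"
  unfolding lsub_def lsum_def by (rule keys_sum)
 also have "\<dots> \<subseteq> ?f ` keys p"
 proof (rule UN_least)
  fix m assume m: "m \<in> keys p"
  have "keys (single (?f m) (lookup p m)) \<subseteq> {?f m}" by simp
  also have "\<dots> \<subseteq> ?f ` keys p" using m by blast
  finally show "keys (single (?f m) (lookup p m)) \<subseteq> ?f ` keys p" .
 qed
 finally show ?thesis .
qed

text \<open>Monomials may collide under the substitution, but the value of the initial form at
  \<open>(1,...,1)\<close> is unchanged and positive, so the form cannot disappear.\<close>

lemma trop_lsub:
 assumes "sfree p"
 shows "trop_laurent (lsub R p) Y = trop_laurent p (\<chi> j. \<Sum>r\<in>UNIV. of_int (R r j) * Y $ r)" "lsub R p \<noteq> 0"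
proof -
 let ?Y = "\<chi> j. \<Sum>r\<in>UNIV. of_int (R r j) * Y $ r"
 let ?c = "trop_laurent p ?Y"
 let ?q = "part ?Y ?c p"
 have l: "low ?Y ?c p" by (rule trop_low(1)[OF sfree_nz[OF assms]])
 have l': "low Y ?c (lsub R p)"
  unfolding low_def
 proof
  fix k assume "k \<in> keys (lsub R p)"
  then obtain m where m: "m \<in> keys p" "k = Abs_poly_mapping (\<lambda>r. \<Sum>j\<in>UNIV. lookup m j * R r j)"
   using keys_lsub[of R p] by blast
  thus "?c \<le> pr k Y" using l by (simp only: pr_image low_def)
 qed
 have "part Y ?c (lsub R ?q) = lsub R ?q"
 proof (rule poly_mapping_eqI)
  fix k
  have "pr k Y = ?c" if "k \<in> keys (lsub R ?q)"
  proof -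
   obtain m where m: "m \<in> keys ?q" "k = Abs_poly_mapping (\<lambda>r. \<Sum>j\<in>UNIV. lookup m j * R r j)"
    using subsetD[OF keys_lsub \<open>k \<in> keys (lsub R ?q)\<close>] by (rule imageE)
   have "pr m ?Y = ?c" using m(1) by (auto simp: in_keys_iff lookup_part split: if_splits)
   thus ?thesis using m(2) by (simp only: pr_image)
  qed
  thus "lookup (part Y ?c (lsub R ?q)) k = lookup (lsub R ?q) k"
   by (auto simp: lookup_part in_keys_iff)
 qed
 moreover have "part Y ?c (lsub R (p - ?q)) = 0"
 proof (rule part_0)
  fix k assume "k \<in> keys (lsub R (p - ?q))"
  then obtain m where m: "m \<in> keys (p - ?q)" "k = Abs_poly_mapping (\<lambda>r. \<Sum>j\<in>UNIV. lookup m j * R r j)"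
   using keys_lsub[of R "p - ?q"] by blast
  have "?c < pr m ?Y" using m(1) l by (force simp: in_keys_iff lookup_minus lookup_part low_def split: if_splits)
  thus "?c < pr k Y" using m(2) by (simp only: pr_image)
 qed
 moreover have "lsub R p = lsub R ?q + lsub R (p - ?q)" by (simp flip: lsub_add)
 ultimately have "part Y ?c (lsub R p) = lsub R ?q" by (simp add: part_add)
 moreover have "aug (lsub R ?q) > 0" using assms by (simp add: aug_lsub sfree_def)
 ultimately have nz: "part Y ?c (lsub R p) \<noteq> 0" by auto
 show "trop_laurent (lsub R p) Y = ?c" by (rule trop_eqI[OF l' nz])
 show "lsub R p \<noteq> 0" using nz by (auto simp: part_def)
qed

section \<open>Denominators and the injectivity of the labelling\<close>

context ldynkin begin

lemma D_inj_aux: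
 assumes "PP i = D (Suc t) j" "t \<le> rr j"
 shows "t = 0 \<and> i = j"
proof (cases "t = 0")
 case True
 thus ?thesis using assms PP_inj by (simp add: D_1)
next
 case False
 hence "cinv (D t j) = PP i" using assms(1) D_Suc[of t j] by simp
 hence u: "UU (D t j) l = - ev i l" for l using cinv_rel[of "D t j" l] by (simp add: LL_PP)
 have "chi (D t j) (D t j) = - (\<Sum>l\<in>UNIV. d l * of_int (D t j l) * of_int (ev i l))"
  by (simp add: chi_def u sum_negf mult_ac)
 hence "chi (D t j) (D t j) = - (d i * of_int (D t j i))" by (simp add: sum_ev_real)
 moreover have "D t j i \<ge> 0" using D_nonneg[OF assms(2)] .
 ultimately have "chi (D t j) (D t j) \<le> 0" using d_pos[of i] by simp
 thus ?thesis using chi_D_self[of t j] False d_pos[of j] by simp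
qed

lemma D_inj:
 assumes "0 < s" "s \<le> rr i" "0 < t" "t \<le> rr j" "D s i = D t j"
 shows "s = t \<and> i = j"
proof -
 have *: "s = t \<and> i = j" if "0 < s" "s \<le> t" "t \<le> rr j" "D s i = D t j" for s i t j
 proof -
  have "(cinv ^^ (s - 1)) (PP i) = (cinv ^^ (s - 1)) (D (Suc (t - s)) j)"
   using D_add[of 1 "s - 1" i] D_add[of "Suc (t - s)" "s - 1" j] that by (simp add: D_1)
  hence "PP i = D (Suc (t - s)) j" by (rule cinv_pow_inj)
  moreover have "t - s \<le> rr j" using that by simp
  ultimately have "t - s = 0 \<and> i = j" by (rule D_inj_aux)
  thus ?thesis using that by simp
 qed
 show ?thesis using *[of s t j i] *[of t s i j] assms by (metis nat_le_linear)
qed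

text \<open>The left-hand side is the least exponent of \<open>x\<^sub>k\<close> in the expansion of a cluster variable.\<close>

lemma gg_phz:
 assumes "h \<in> lab"
 shows "gg k h + phz (exchange_matrix a E k) h = yb h k - dv h k"
proof -
 let ?u = "\<lambda>h. gg k h + phz (exchange_matrix a E k) h"
 have um: "?u (tu h) + ?u h = min (\<Sum>i\<in>UNIV. int (wt i (snd h)) * ?u (nb h i)) 0" if "h \<in> lab" for h
 proof -
  have "(\<Sum>i\<in>UNIV. int (wt i (snd h)) * ?u (nb h i)) = alz (exchange_matrix a E k) h - ipz (dv h) (exchange_matrix a E k)"
   using gg_1[OF that, of k] gg_2[OF that, of k] by (simp add: alz_def distrib_left sum.distrib)
  thus ?thesis using phz_mesh[OF that, of "exchange_matrix a E k"] gg_1[OF that, of k] by linarith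
 qed
 obtain t j where g: "h = (t, j)" by force
 show ?thesis
  using assms unfolding g
 proof (induction t arbitrary: j rule: less_induct)
  case outer: (less t)
  show ?case using outer(2)
  proof (induction j rule: measure_induct_rule[where f = rho])
   case inner: (less j)
   show ?case
   proof (cases t)
    case 0
    thus ?thesis by (simp add: gg_def)
   next
    case (Suc u)
    let ?g = "(t, j)"
    have tg: "tu ?g = (u, j)" by (simp add: Suc)
    have tl: "(u, j) \<in> lab" using inner(2) Suc by (simp add: lab_def)
    have nbs: "?u (nb ?g i) = yb (nb ?g i) k - dv (nb ?g i) k" if e: "E i j \<or> E j i" for i
    proof (cases "E i j")
     case True
     thus ?thesis using inner(1)[of i] rho_less[OF True] nb_lab[OF inner(2), of i] by (simp add: nb_def)
    next
     case False
     thus ?thesis using outer(1)[of u i] nb_lab[OF inner(2), of i] e by (simp add: nb_def Suc)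
    qed
    have tu': "?u (u, j) = yb (u, j) k - dv (u, j) k" using outer(1)[of u j] tl Suc by simp
    have S: "(\<Sum>i\<in>UNIV. int (wt i j) * ?u (nb ?g i)) = (\<Sum>i\<in>UNIV. int (wt i j) * yb (nb ?g i) k) - (\<Sum>i\<in>UNIV. int (wt i j) * dv (nb ?g i) k)"
     using sum_nb_cong[of ?g ?u "\<lambda>q. yb q k - dv q k"] nbs by (simp add: right_diff_distrib sum_subtractf)
    have yg: "yb ?g = 0" using Suc by (simp add: yb_pos)
    have dm: "dv ?g k + dv (u, j) k = yb (u, j) k + (\<Sum>i\<in>UNIV. int (wt i j) * dv (nb ?g i) k)"
     using fun_cong[OF dv_mesh[OF inner(2)], of k] by (simp add: yg tg)
    have m: "?u (u, j) + ?u ?g = min (\<Sum>i\<in>UNIV. int (wt i j) * ?u (nb ?g i)) 0"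
     using um[OF inner(2)] by (simp add: tg)
    have dvn: "0 \<le> dv q k" for q by (simp add: dv_def)
    show ?thesis
    proof (cases "(\<Sum>i\<in>UNIV. int (wt i j) * yb (nb ?g i) k) = 0")
     case True
     have "0 \<le> (\<Sum>i\<in>UNIV. int (wt i j) * dv (nb ?g i) k)" by (intro sum_nonneg) (simp add: dvn)
     thus ?thesis using m S True tu' dm yg by simp
    next
     case False
     then obtain i where i: "int (wt i j) * yb (nb ?g i) k \<noteq> 0" by (meson sum.not_neutral_contains_not_neutral)
     hence "nb ?g i = (0, k)" "E i j \<or> E j i"
      using wt_eq_0[of i j] by (auto simp: yb_def split: if_splits)
     hence e: "E j k" "u = 0" using Suc by (auto simp: nb_def split: if_splits)
     have "D (Suc 0) j k = 0" using PP_support[of j k] rho_less[OF e(1)] by (cases "PP j k = 0") (auto simp: D_1)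
     hence "dv ?g k = 0" using inner(2) by (simp add: dv_D Suc e(2))
     moreover have "dv (u, j) k = 0" by (simp add: e(2))
     moreover have "yb (u, j) k = 0" using E_neq[OF e(1)] by (simp add: yb_def)
     moreover have "0 \<le> (\<Sum>i\<in>UNIV. int (wt i j) * yb (nb ?g i) k)" by (intro sum_nonneg) (simp add: yb_def)
     ultimately show ?thesis using m S tu' dm yg by simp
    qed
   qed
  qed
 qed
qed

end

context jseed begin

definition PX :: "('r => 'n => int) => nat \<times> 'n => ('r, int) laurent" where
 "PX w g = ymon (\<lambda>r. hx w r g) * lsub w (Fp g)"

lemma XX_PX: assumes "indep x" shows "XX w x g = leval x (PX w g)"
proof -
 note nz = indep_nz[OF assms]
 show ?thesis
  unfolding XX_def PX_def leval_mult'[OF nz] leval_ymon leval_lsub[OF nz] by (simp add: pw_def yh_def[abs_def])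
qed

lemma indep_nonvan: assumes "indep x" shows "nonvan w x"
 unfolding nonvan_def
proof (intro conjI allI ballI)
 note nz = indep_nz[OF assms]
 show "x r \<noteq> 0" for r by (rule nz)
 fix g assume "g \<in> lab"
 hence "lsub w (Fp g) \<noteq> 0" by (intro trop_lsub(2) sfree_Fp)
 hence "leval x (lsub w (Fp g)) \<noteq> 0" using assms by (auto simp: indep_def)
 thus "leval (yh w x) (Fp g) \<noteq> 0" by (simp add: leval_lsub[OF nz] yh_def[abs_def] pw_def)
qed

text \<open>Tropical evaluation along a coordinate axis is the least exponent of that variable.
  Since row \<open>em k\<close> is a row of the exchange matrix, \<open>gg_phz\<close> computes
  it.\<close>

lemma trop_PX:
 assumes g: "h \<in> lab" and k: "k \<in> J" and w: "w (em k) = BB k"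
 shows "trop_laurent (PX w h) (axis (em k) 1) = of_int (yb h k - dv h k)"
proof -
 have "(\<chi> j. \<Sum>r\<in>UNIV. of_int (w r j) * axis (em k) 1 $ r) = rv (BB k)"
  by (simp add: vec_eq_iff rv_def axis_def if_distrib w[symmetric] cong: if_cong)
 moreover have "trop_laurent (ymon (\<lambda>r. hx w r h)) (axis (em k) 1) = of_int (hx w (em k) h)"
  by (simp add: trop_ymon axis_def if_distrib cong: if_cong)
 moreover have "hx w (em k) h = gg k h" using frz_J[OF k] inj by (simp add: hx_def)
 moreover have "ymon (\<lambda>r. hx w r h) \<noteq> 0" by (rule sfree_nz[OF sfree_ymon])
 ultimately have "trop_laurent (PX w h) (axis (em k) 1) = of_int (gg k h) + Phi h (rv (BB k))"
  unfolding PX_def by (subst trop_mult(1)) (simp_all add: trop_lsub[OF sfree_Fp[OF g]] Phi_def)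
 thus ?thesis
  using phz[OF g, of "BB k"] gg_phz[OF g, of k] by (simp add: BB_def flip: of_int_add)
qed

lemma dv_outside:
 assumes "g \<in> lab" "snd g \<in> J" "k \<notin> J"
 shows "dv g k = 0"
proof -
 have no: "{i. E k i} = {}" "{i. E i k} = {}" using E_J assms(3) by auto
 have P: "PP j k = 0" if "j \<in> J" for j
  using that
 proof (induction j rule: measure_induct_rule[where f = rho])
  case (less j)
  have "(\<Sum>i | E i j. a i j * PP i k) = 0"
   by (rule sum.neutral) (use less E_J rho_less in auto)
  thus ?case using less.prems assms(3) by (auto simp: PP.simps[of j] ev_def)
 qed
 have c: "cinv x k = - x k" for x
  using cinv_rel[of x k] no by (simp add: LL_def UU_def)
 have "D t j k = 0" if "j \<in> J" for t j
 proof (cases "t = 0")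
  case False
  hence "t > 0" by simp
  thus ?thesis
   by (induction t rule: nat_induct_non_zero) (simp_all add: D_1 D_Suc c P that)
 qed (simp add: D_def)
 thus ?thesis using assms dv_D[of "fst g" "snd g"] by simp
qed

definition labJ :: "(nat \<times> 'n) set" where "labJ = {g \<in> lab. snd g \<in> J}"

lemma dv_inj:
 assumes "h \<in> labJ" "h' \<in> labJ" "\<And>k. k \<in> J ==> yb h k - dv h k = yb h' k - dv h' k"
 shows "h = h'"
proof -
 obtain s i t j where g: "h = (s, i)" "h' = (t, j)" by force
 have l: "(s, i) \<in> lab" "(t, j) \<in> lab" "i \<in> J" "j \<in> J" using assms by (auto simp: labJ_def g)
 have out: "yb (s, i) k = 0" "yb (t, j) k = 0" if "k \<notin> J" for k using that l by (auto simp: yb_def)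
 have all: "yb (s, i) k - dv (s, i) k = yb (t, j) k - dv (t, j) k" for k
  using assms(3)[of k] dv_outside[OF l(1), of k] dv_outside[OF l(2), of k] out[of k] l by (cases "k \<in> J") (auto simp: g)
 have zero: "\<exists>k. yb (t, j) k - dv (t, j) k < 0" "\<forall>k. yb (t, j) k - dv (t, j) k \<le> 0" if "t > 0" "(t, j) \<in> lab" for t j
 proof -
  have e: "yb (t, j) k - dv (t, j) k = - D t j k" for k using that by (simp add: yb_pos dv_D)
  have n: "\<And>k. 0 \<le> D t j k" using that D_nonneg by (simp add: lab_def)
  have "D t j \<noteq> 0" using RR_D[OF that(1)] by (simp add: RR_def)
  then obtain k where "D t j k \<noteq> 0" by (auto simp: fun_eq_iff)
  thus "\<exists>k. yb (t, j) k - dv (t, j) k < 0" using n[of k] by (auto simp: e intro!: exI[of _ k])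
  show "\<forall>k. yb (t, j) k - dv (t, j) k \<le> 0" using n by (simp add: e)
 qed
 have pos: "yb (0, j) k - dv (0, j) k = (if j = k then 1 else 0)" for j k by (simp add: yb_def)
 consider "s = 0" "t = 0" | "s = 0" "t > 0" | "s > 0" "t = 0" | "s > 0" "t > 0" by blast
 thus ?thesis
 proof cases
  case 1
  thus ?thesis using all[of i] pos[of i i] pos[of j i] by (auto simp: g split: if_splits)
 next
  case 2
  have "yb (t, j) i - dv (t, j) i \<le> 0" using zero(2)[OF 2(2) l(2)] by blast
  thus ?thesis using all[of i] pos[of i i] 2(1) by simp
 next
  case 3
  have "yb (s, i) j - dv (s, i) j \<le> 0" using zero(2)[OF 3(1) l(1)] by blast
  thus ?thesis using all[of j] pos[of j j] 3(2) by simp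
 next
  case 4
  hence "D s i = D t j" using all l by (auto simp: yb_pos dv_D fun_eq_iff)
  thus ?thesis using D_inj[of s i t j] 4 l by (auto simp: lab_def g)
 qed
qed

text \<open>Independence turns equal values into equal Laurent polynomials, and these have the same
  denominator vectors, which separate labels because different labels belong to different
  roots.\<close>

lemma XX_inj:
 assumes "indep x" "\<And>k. k \<in> J ==> w (em k) = BB k" "g \<in> labJ" "g' \<in> labJ" "XX w x g = XX w x g'"
 shows "g = g'"
proof (rule dv_inj[OF assms(3,4)])
 fix k assume k: "k \<in> J"
 have "PX w g = PX w g'"
  by (rule indep_eq[OF assms(1)]) (use assms(5) XX_PX[OF assms(1)] in simp)
 hence "real_of_int (yb g k - dv g k) = real_of_int (yb g' k - dv g' k)"
  using trop_PX[OF _ k, of g w] trop_PX[OF _ k, of g' w] assms k by (simp add: labJ_def)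
 thus "yb g k - dv g k = yb g' k - dv g' k" by (simp only: of_int_eq_iff)
qed

end

section \<open>The \<open>u\<close>-coordinates\<close>

lemma leval_hom:
 fixes \<phi> :: "('r::finite, int) laurent => 'f::field"
 assumes add: "\<And>p q. \<phi> (p + q) = \<phi> p + \<phi> q" and mult: "\<And>p q. \<phi> (p * q) = \<phi> p * \<phi> q" and one: "\<phi> 1 = 1"
 shows "leval (\<lambda>r. \<phi> (laurent_var r)) p = \<phi> p"
proof -
 let ?x = "\<lambda>r. \<phi> (laurent_var r)"
 have z: "\<phi> 0 = 0" using add[of 0 0] by (metis add.right_neutral add_left_cancel)
 have phi_neg: "\<phi> (- p) = - \<phi> p" for p using add[of p "- p"] z by (simp add: add_eq_0_iff)
 have ni: "\<phi> (single 0 (int n)) = of_nat n" for n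
 proof (induction n)
  case (Suc n)
  have "single 0 (int (Suc n)) = 1 + (single 0 (int n) :: ('r, int) laurent)"
   by (simp add: single_add flip: single_one)
  thus ?case using Suc by (simp add: add one)
 qed (simp add: z)
 have ci: "\<phi> (single 0 c) = of_int c" for c :: int
 proof (cases c)
  case (neg n)
  hence "single 0 c = - (single 0 (int (Suc n)) :: ('r, int) laurent)"
   by (simp only: single_uminus)
  thus ?thesis using ni[of "Suc n"] phi_neg neg by (simp only: of_int_minus of_int_of_nat_eq)
 next
  case (nonneg n)
  thus ?thesis using ni[of n] by (simp only: of_int_of_nat_eq)
 qed
 have e: "\<phi> (single (single r (int n)) 1) = ?x r ^ n" for r n
 proof (induction n)
  case (Suc n)
  have "single (single r (int (Suc n))) (1::int) =
    single (single r 1) 1 * single (single r (int n)) 1"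
   unfolding mult_single single_add[symmetric] by simp
  thus ?case using Suc by (simp only: mult power_Suc laurent_var_def)
 qed (simp add: one)
 have e': "\<phi> (single (single r k) 1) = ?x r powi k" for r k
 proof (cases k)
  case (nonneg n)
  thus ?thesis using e[of r n] by simp
 next
  case (neg n)
  let ?s = "\<lambda>k. single (single r k) (1::int)"
  have "?s k * ?s (int (Suc n)) = 1" unfolding neg mult_single single_add[symmetric] by simp
  hence "\<phi> (?s k) * \<phi> (?s (int (Suc n))) = 1" by (metis mult one)
  hence "\<phi> (?s k) * ?x r ^ Suc n = 1" by (simp only: e)
  hence "\<phi> (?s k) = inverse (?x r ^ Suc n)" by (metis inverse_unique mult.commute)
  thus ?thesis unfolding neg by (simp add: power_int_minus del: power_Suc of_nat_Suc)
 qed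
 have m: "\<phi> (single m 1) = mon ?x m" for m
 proof -
  have *: "\<phi> (single (\<Sum>r\<in>S. single r (f r)) 1) = (\<Prod>r\<in>S. ?x r powi f r)" for S and f :: "'r => int"
  proof (induction S rule: infinite_finite_induct)
   case (insert r S)
   have "single (\<Sum>r\<in>insert r S. single r (f r)) (1::int) =
     single (single r (f r)) 1 * single (\<Sum>r\<in>S. single r (f r)) 1"
    using insert by (simp add: mult_single)
   thus ?case unfolding prod.insert[OF insert(1,2)] by (simp only: mult e' insert(3))
  qed (simp_all add: one)
  have "(\<Sum>r\<in>UNIV. single r (lookup m r)) = m"
   by (rule poly_mapping_eqI) (simp only: lookup_sum_single finite UNIV_I if_True)
  thus ?thesis using *[of "lookup m" UNIV] by (simp only: mon_def)
 qed
 have s: "\<phi> (single m c) = of_int c * mon ?x m" for m c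
  using mult[of "single 0 c" "single m 1"] by (simp add: mult_single ci m)
 have su: "\<phi> (\<Sum>m\<in>S. f m) = (\<Sum>m\<in>S. \<phi> (f m))" for S and f :: "('r \<Rightarrow>\<^sub>0 int) => ('r, int) laurent"
  by (induction S rule: infinite_finite_induct) (simp_all add: add z)
 have "\<phi> p = \<phi> (\<Sum>m\<in>keys p. single m (lookup p m))"
  by (simp only: sum_monomials)
 also have "\<dots> = leval ?x p" unfolding su s leval_def lsum_def ..
 finally show ?thesis ..
qed

context dynkin begin

lemma lab_induct [consumes 1, case_names 0 Suc]:
 assumes "g \<in> lab" and "\<And>j. P (0, j)"
  and "\<And>t j. (Suc t, j) \<in> lab ==> P (t, j) ==> (\<And>i. E i j \<or> E j i ==> P (nb (Suc t, j) i)) ==> P (Suc t, j)"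
 shows "P g"
proof -
 have "(t, j) \<in> lab ==> P (t, j)" for t j
 proof (induction t arbitrary: j)
  case outer: (Suc t)
  show ?case using outer(2)
  proof (induction j rule: measure_induct_rule[where f = rho])
   case inner: (less j)
   have "P (nb (Suc t, j) i)" if "E i j \<or> E j i" for i
    using that nb_lab[OF inner(2), of i] inner(1)[of i] outer(1)[of i] rho_less[of i j]
    by (auto simp: nb_def split: if_splits)
   moreover have "P (t, j)" using outer(1)[of j] inner(2) by (simp add: lab_def)
   ultimately show ?case using assms(3) inner(2) by blast
  qed
 qed (simp add: assms)
 thus ?thesis using assms(1) by (cases g) blast
qed

text \<open>Follow \<open>cinv\<close> to the last positive vector. By \<open>cinv_crossing\<close>
  it is injective, hence the end of an orbit, and that orbit is traced back. Tracing stops before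
  its projective vector is passed, because the preimage of a projective vector is minus an injective
  one.\<close>

lemma RR_D_ex:
 assumes "RR x" "nneg x"
 shows "\<exists>t j. 0 < t \<and> t \<le> rr j \<and> x = D t j"
proof -
 define m where "m = (LEAST m. \<not> nneg ((cinv ^^ m) x))"
 have m: "\<not> nneg ((cinv ^^ m) x)" unfolding m_def using LeastI_ex[OF cinv_leaves[OF assms(1)]] .
 have lt: "nneg ((cinv ^^ k) x)" if "k < m" for k using not_less_Least[of k] that unfolding m_def by blast
 obtain q where q: "m = Suc q" using m assms(2) by (cases m) auto
 let ?y = "(cinv ^^ q) x"
 have Ry: "RR ((cinv ^^ k) x)" for k by (induction k) (simp_all add: assms RR_cinv)
 obtain k where k: "\<And>l. UU ?y l = ev k l" using cinv_crossing[OF Ry[of q] lt[of q]] m q by auto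
 have y: "?y = D (rr (star0 k)) (star0 k)" using UU_inj[of ?y "II k"] k UU_II II_def by simp
 let ?j = "star0 k" let ?R = "rr ?j"
 have R: "?R > 0" by (rule rr_ge_1)
 have "q < ?R"
 proof (rule ccontr)
  assume c: "\<not> q < ?R"
  have "(cinv ^^ (?R - 1)) ((cinv ^^ (q - (?R - 1))) x) = ?y"
   using c by (simp flip: funpow_add comp_apply[of "cinv ^^ _"])
  also have "\<dots> = (cinv ^^ (?R - 1)) (PP ?j)" using R by (simp add: y D_def)
  finally have e: "(cinv ^^ (q - (?R - 1))) x = PP ?j" by (rule cinv_pow_inj)
  have "q - (?R - 1) = Suc (q - ?R)" using c R by simp
  hence e': "cinv ((cinv ^^ (q - ?R)) x) = PP ?j" using e by simp
  let ?z = "(cinv ^^ (q - ?R)) x"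
  have "UU (- ?z) l = UU (II ?j) l" for l
   using cinv_rel[of ?z l] by (simp add: e' LL_PP UU_II UU_minus)
  hence "- ?z = II ?j" by (rule UU_inj)
  hence "nneg (- ?z)" using II_nneg by simp
  thus False using RR_not_both[OF Ry lt] q by simp
 qed
 hence "(cinv ^^ q) x = (cinv ^^ q) (D (?R - q) ?j)"
  using D_add[of "?R - q" q ?j] y by simp
 hence "x = D (?R - q) ?j" by (rule cinv_pow_inj)
 thus ?thesis using \<open>q < ?R\<close> by (intro exI[of _ "?R - q"] exI[of _ ?j]) auto
qed

definition uok :: "(nat \<times> 'n => 'f::field) => bool" where
 "uok u \<longleftrightarrow> (\<forall>g\<in>lab. u g \<noteq> 0 \<and> u g + (\<Prod>w\<in>lab. u w ^ cc w g) = 1)"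

lemma prod_powi: "(x::'f::field) \<noteq> 0 ==> x powi (\<Sum>i\<in>S. f i) = (\<Prod>i\<in>S. x powi f i)"
 by (induction S rule: infinite_finite_induct) (simp_all add: power_int_add)

text \<open>In terms of \<open>Y\<^sub>h = u\<^sub>h / (1 - u\<^sub>h)\<close> this is the \<open>Y\<close>-system \<open>Y\<^sub>\<tau>\<^sub>h Y\<^sub>h = \<Prod>(1 + Y\<^sub>q)\<close>.\<close>

lemma uok_mesh:
 fixes u :: "nat \<times> 'n => 'f::field"
 assumes u: "uok u" and g: "h \<in> lab"
 shows "(1 - u h) * (1 - u (tu h)) = u h * u (tu h) * (\<Prod>i\<in>UNIV. (1 - u (nb h i)) ^ wt i (snd h))"
proof -
 have nz: "u v \<noteq> 0" if "v \<in> lab" for v using u that by (simp add: uok_def)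
 have P: "1 - u q = (\<Prod>v\<in>lab. u v powi int (cc v q))" if "q \<in> lab" for q
  using u that unfolding uok_def by (simp add: algebra_simps flip: eq_diff_eq)
 have o: "(\<Prod>v\<in>lab. u v powi of_bool (v = q)) = u q" if "q \<in> lab" for q
 proof -
  have "(\<Prod>v\<in>lab. u v powi of_bool (v = q)) = (\<Prod>v\<in>lab. if v = q then u v else 1)"
   by (rule prod.cong) auto
  thus ?thesis using that by (simp add: finite_lab)
 qed
 have "(1 - u h) * (1 - u (tu h)) = (\<Prod>v\<in>lab. u v powi (int (cc v h) + int (cc v (tu h))))"
  unfolding P[OF g] P[OF tu_lab[OF g]] prod.distrib[symmetric] by (rule prod.cong) (auto simp: power_int_add nz)
 also have "\<dots> = (\<Prod>v\<in>lab. u v powi of_bool (v = h) * u v powi of_bool (v = tu h) *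
   (\<Prod>i\<in>UNIV. (u v powi int (cc v (nb h i))) ^ wt i (snd h)))"
 proof (rule prod.cong[OF refl])
  fix v assume w: "v \<in> lab"
  show "u v powi (int (cc v h) + int (cc v (tu h))) = u v powi of_bool (v = h) * u v powi of_bool (v = tu h) *
   (\<Prod>i\<in>UNIV. (u v powi int (cc v (nb h i))) ^ wt i (snd h))"
   unfolding cc_mesh[OF w g] using nz[OF w]
   by (simp add: power_int_add prod_powi power_mult mult.commute[of "wt _ _"] flip: of_nat_mult)
 qed
 also have "\<dots> = u h * u (tu h) * (\<Prod>i\<in>UNIV. (\<Prod>v\<in>lab. u v powi int (cc v (nb h i))) ^ wt i (snd h))"
  unfolding prod.distrib o[OF g] o[OF tu_lab[OF g]] prod_power_distrib by (subst (2) prod.swap) simp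
 also have "(\<Prod>i\<in>UNIV. (\<Prod>v\<in>lab. u v powi int (cc v (nb h i))) ^ wt i (snd h)) = (\<Prod>i\<in>UNIV. (1 - u (nb h i)) ^ wt i (snd h))"
 proof (rule prod.cong[OF refl])
  fix i
  show "(\<Prod>v\<in>lab. u v powi int (cc v (nb h i))) ^ wt i (snd h) = (1 - u (nb h i)) ^ wt i (snd h)"
   using P[OF nb_lab[OF g, of i]] wt_eq_0[of i "snd h"] by (cases "E i (snd h) \<or> E (snd h) i") auto
 qed
 finally show ?thesis .
qed

lemma uok_1: assumes "uok u" "g \<in> lab" shows "u g \<noteq> 1"
proof -
 have "(\<Prod>w\<in>lab. u w ^ cc w g) \<noteq> 0" using assms by (auto simp: uok_def finite_lab)
 thus ?thesis using assms by (auto simp: uok_def)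
qed

text \<open>Once the earlier coordinates are known, the mesh relation is linear in the next one. It
  has at most one solution because no \<open>u\<close>-coordinate equals \<open>1\<close>.\<close>

lemma uok_unique:
 fixes u v :: "nat \<times> 'n => 'f::field"
 assumes u: "uok u" and v: "uok v" and i: "\<And>j. u (0, j) = v (0, j)" and g: "h \<in> lab"
 shows "u h = v h"
 using g
proof (induction rule: lab_induct)
 case (Suc t j)
 let ?g = "(Suc t, j)"
 let ?N = "\<lambda>u. u (t, j) * (\<Prod>i\<in>UNIV. (1 - u (nb ?g i)) ^ wt i j)"
 have tl: "(t, j) \<in> lab" using Suc(1) by (simp add: lab_def)
 have "(\<Prod>i\<in>UNIV. (1 - u (nb ?g i)) ^ wt i j) = (\<Prod>i\<in>UNIV. (1 - v (nb ?g i)) ^ wt i j)"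
 proof (rule prod.cong[OF refl])
  fix i show "(1 - u (nb ?g i)) ^ wt i j = (1 - v (nb ?g i)) ^ wt i j"
   using Suc(3)[of i] wt_eq_0[of i j] by (cases "E i j \<or> E j i") auto
 qed
 hence N: "?N v = ?N u" using Suc(2) by simp
 have e: "(1 - u ?g) * (1 - u (t, j)) = u ?g * ?N u" "(1 - v ?g) * (1 - u (t, j)) = v ?g * ?N u"
  using uok_mesh[OF u Suc(1)] uok_mesh[OF v Suc(1)] Suc(2) N by (simp_all add: mult.assoc)
 have *: "a = b" if "(1 - a) * x = a * y" "(1 - b) * x = b * y" "x \<noteq> 0" for a b x y :: 'f
 proof -
  have "x = a * (x + y)" "x = b * (x + y)" using that by (simp_all add: algebra_simps)
  thus ?thesis using that(3) by (metis mult_right_cancel mult_zero_right)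
 qed
 have "1 - u (t, j) \<noteq> 0" using uok_1[OF u tl] by simp
 thus ?case by (rule *[OF e])
qed (rule i)

end

section \<open>The \<open>u\<close>-coordinates as functions of the coefficients\<close>

context ldynkin begin

definition ub :: "('n => 'f::field) => nat \<times> 'n => 'f" where
 "ub y g = leval y (ymon (yb g)) * leval y (NN g) / (leval y (Fp (tu g)) * leval y (Fp g))"

definition gen :: "('n => 'f::field) => bool" where "gen y \<longleftrightarrow> (\<forall>g\<in>lab. leval y (Fp g) \<noteq> 0)"

lemma leval_NN:
 assumes "g \<in> lab"
 shows "leval y (NN g) = (\<Prod>i\<in>UNIV. leval y (Fp (nb g i)) ^ wt i (snd g))" "nonneg_at k (NN g)"
proof -
 have n: "wt i (snd g) = 0 \<or> nonneg_at k (Fp (nb g i))" for i k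
  using wt_eq_0[of i "snd g"] nonneg_Fp[OF nb_lab[OF assms, of i]] by blast
 hence n': "nonneg_at k (Fp (nb g i) ^ wt i (snd g))" for i k
  using nonneg_at_power[of k "Fp (nb g i)" "wt i (snd g)"] nonneg_at_1[of k] by (metis power_0)
 thus "nonneg_at k (NN g)" unfolding NN_def by (rule nonneg_at_prod)
 have "leval y (NN g) = (\<Prod>i\<in>UNIV. leval y (Fp (nb g i) ^ wt i (snd g)))"
  unfolding NN_def by (rule leval_prod) (use n' in blast)
 also have "\<dots> = (\<Prod>i\<in>UNIV. leval y (Fp (nb g i)) ^ wt i (snd g))"
 proof (rule prod.cong[OF refl])
  fix i show "leval y (Fp (nb g i) ^ wt i (snd g)) = leval y (Fp (nb g i)) ^ wt i (snd g)"
  proof (cases "wt i (snd g) = 0")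
   case False
   hence "\<forall>k. nonneg_at k (Fp (nb g i))" using n by metis
   thus ?thesis by (intro leval_power) blast
  qed simp
 qed
 finally show "leval y (NN g) = (\<Prod>i\<in>UNIV. leval y (Fp (nb g i)) ^ wt i (snd g))" .
qed

lemma leval_mesh:
 assumes "g \<in> lab"
 shows "leval y (Fp (tu g)) * leval y (Fp g) = leval y (ymon (yb g)) * leval y (NN g) + leval y (ymon (dv g))"
proof -
 have "leval y (Fp (tu g) * Fp g) = leval y (Fp (tu g)) * leval y (Fp g)"
  by (rule leval_mult) (use nonneg_Fp assms tu_lab in blast)
 moreover have "leval y (ymon (yb g) * NN g) = leval y (ymon (yb g)) * leval y (NN g)"
  by (rule leval_mult) (use leval_NN(2)[OF assms] in \<open>auto simp: nonneg_at_ymon yb_def\<close>)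
 ultimately show ?thesis using mesh[OF assms] by (simp add: leval_add)
qed

text \<open>Stated for arbitrary \<open>F\<close> and \<open>V\<close>, so that it applies to the \<open>u\<close>-coordinates and, through the
 exponential function, to their tropicalizations.\<close>

lemma prod_cc:
 fixes F V :: "nat \<times> 'n => 'f::field"
 assumes nz: "\<And>q. q \<in> lab ==> F q \<noteq> 0" and V: "\<And>t j. t > 0 ==> V (t, j) = 1" and g: "h \<in> lab"
 shows "(\<Prod>v\<in>lab. (V v * (\<Prod>i\<in>UNIV. F (nb v i) ^ wt i (snd v)) / (F (tu v) * F v)) ^ cc v h) =
  (\<Prod>j\<in>UNIV. V (0, j) ^ cc (0, j) h) / (F (tu h) * F h)"
proof -
 have o: "(\<Prod>q\<in>lab. F q powi - of_bool (q = p)) = inverse (F p)" if "p \<in> lab" for p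
 proof -
  have "(\<Prod>q\<in>lab. F q powi - of_bool (q = p)) = (\<Prod>q\<in>lab. if q = p then inverse (F q) else 1)"
   by (rule prod.cong) (auto simp: power_int_minus)
  thus ?thesis using that by (simp add: finite_lab)
 qed
 have U: "(\<Prod>i\<in>UNIV. F (nb v i) ^ wt i (snd v)) / (F (tu v) * F v) = (\<Prod>q\<in>lab. F q powi mm v q)" if w: "v \<in> lab" for v
 proof -
  let ?e = "\<lambda>i q. if nb v i = q then int (wt i (snd v)) else 0"
  have n: "(\<Prod>q\<in>lab. F q powi ?e i q) = F (nb v i) ^ wt i (snd v)" for i
  proof (cases "E i (snd v) \<or> E (snd v) i")
   case True
   have "(\<Prod>q\<in>lab. F q powi ?e i q) = (\<Prod>q\<in>lab. if q = nb v i then F q ^ wt i (snd v) else 1)"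
    by (rule prod.cong) auto
   thus ?thesis using nb_lab[OF w True] by (simp add: finite_lab)
  qed (use wt_eq_0[of i "snd v"] in \<open>simp cong: if_cong\<close>)
  have "(\<Prod>q\<in>lab. F q powi mm v q) =
    (\<Prod>q\<in>lab. (\<Prod>i\<in>UNIV. F q powi ?e i q) * F q powi - of_bool (q = v) * F q powi - of_bool (q = tu v))"
  proof (rule prod.cong[OF refl])
   fix q assume d: "q \<in> lab"
   have "mm v q = (\<Sum>i\<in>UNIV. ?e i q) + - of_bool (q = v) + - of_bool (q = tu v)" by (simp add: mm_def)
   thus "F q powi mm v q = (\<Prod>i\<in>UNIV. F q powi ?e i q) * F q powi - of_bool (q = v) * F q powi - of_bool (q = tu v)"
    using nz[OF d] by (simp only: power_int_add prod_powi simp_thms)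
  qed
  also have "\<dots> = (\<Prod>i\<in>UNIV. F (nb v i) ^ wt i (snd v)) * inverse (F v) * inverse (F (tu v))"
   unfolding prod.distrib o[OF w] o[OF tu_lab[OF w]] prod.swap[of _ UNIV] n ..
  finally show ?thesis by (simp add: divide_inverse mult_ac)
 qed
 have "(\<Prod>v\<in>lab. (\<Prod>q\<in>lab. F q powi mm v q) ^ cc v h) = (\<Prod>v\<in>lab. \<Prod>q\<in>lab. F q powi (int (cc v h) * mm v q))"
  by (simp add: prod_power_distrib power_int_mult mult.commute[of "int _"])
 also have "\<dots> = (\<Prod>q\<in>lab. \<Prod>v\<in>lab. F q powi (int (cc v h) * mm v q))" by (rule prod.swap)
 also have "\<dots> = (\<Prod>q\<in>lab. F q powi - of_bool (q = h) * F q powi - of_bool (q = tu h))"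
 proof (rule prod.cong[OF refl])
  fix q assume d: "q \<in> lab"
  have "(\<Sum>v\<in>lab. int (cc v h) * mm v q) = - of_bool (q = h) + - of_bool (q = tu h)" using cc_mm[OF d g] by simp
  thus "(\<Prod>v\<in>lab. F q powi (int (cc v h) * mm v q)) = F q powi - of_bool (q = h) * F q powi - of_bool (q = tu h)"
   unfolding prod_powi[OF nz[OF d], symmetric] using nz[OF d] by (simp only: power_int_add simp_thms)
 qed
 also have "\<dots> = inverse (F h) * inverse (F (tu h))" unfolding prod.distrib o[OF g] o[OF tu_lab[OF g]] ..
 finally have F: "(\<Prod>v\<in>lab. (\<Prod>q\<in>lab. F q powi mm v q) ^ cc v h) = inverse (F h) * inverse (F (tu h))" .
 have "V v = 1" if "v \<notin> range (\<lambda>j. (0, j))" for v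
  using that V[of "fst v" "snd v"] by (cases "fst v = 0") (auto simp: image_iff prod_eq_iff)
 hence "(\<Prod>v\<in>lab. V v ^ cc v h) = (\<Prod>v\<in>range (\<lambda>j. (0, j)). V v ^ cc v h)"
  by (intro prod.mono_neutral_right finite_lab) auto
 hence Y: "(\<Prod>v\<in>lab. V v ^ cc v h) = (\<Prod>j\<in>UNIV. V (0, j) ^ cc (0, j) h)"
  by (simp add: prod.reindex inj_on_def)
 have "(\<Prod>v\<in>lab. (V v * (\<Prod>i\<in>UNIV. F (nb v i) ^ wt i (snd v)) / (F (tu v) * F v)) ^ cc v h) =
   (\<Prod>v\<in>lab. V v ^ cc v h * (\<Prod>q\<in>lab. F q powi mm v q) ^ cc v h)"
  by (rule prod.cong) (simp_all only: power_mult_distrib U times_divide_eq_right[symmetric])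
 thus ?thesis unfolding prod.distrib F Y by (simp add: divide_inverse mult_ac)
qed

lemma leval_yb: "leval y (ymon (yb (t, j))) = (if t = 0 then y j else 1)"
proof -
 have "leval y (ymon (yb (t, j))) = (\<Prod>i\<in>UNIV. if i = j then (if t = 0 then y i else 1) else 1)"
  unfolding leval_ymon yb_def by (rule prod.cong) auto
 thus ?thesis by simp
qed

lemma ub_prod:
 assumes "gen y" "g \<in> lab"
 shows "(\<Prod>w\<in>lab. ub y w ^ cc w g) = leval y (ymon (dv g)) / (leval y (Fp (tu g)) * leval y (Fp g))"
proof -
 have "(\<Prod>w\<in>lab. ub y w ^ cc w g) = (\<Prod>w\<in>lab. (leval y (ymon (yb w)) *
   (\<Prod>i\<in>UNIV. leval y (Fp (nb w i)) ^ wt i (snd w)) / (leval y (Fp (tu w)) * leval y (Fp w))) ^ cc w g)"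
  by (rule prod.cong) (simp_all add: ub_def leval_NN)
 also have "\<dots> = (\<Prod>j\<in>UNIV. leval y (ymon (yb (0, j))) ^ cc (0, j) g) / (leval y (Fp (tu g)) * leval y (Fp g))"
  by (rule prod_cc) (use assms in \<open>auto simp: gen_def leval_yb\<close>)
 finally show ?thesis by (simp add: leval_yb) (simp add: leval_ymon dv_def)
qed

text \<open>By \<open>ub_prod\<close> this is the mesh relation divided by its left-hand
  side.\<close>

lemma ub_rel:
 assumes "gen y" "g \<in> lab"
 shows "ub y g + (\<Prod>w\<in>lab. ub y w ^ cc w g) = 1"
proof -
 have "leval y (Fp (tu g)) * leval y (Fp g) \<noteq> 0" using assms tu_lab by (auto simp: gen_def)
 thus ?thesis
  unfolding ub_prod[OF assms] unfolding ub_def add_divide_distrib[symmetric] leval_mesh[OF assms(2), symmetric] by simp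
qed

lemma leval_NN_nz: assumes "gen y" "g \<in> lab" shows "leval y (NN g) \<noteq> 0"
proof -
 have "leval y (Fp (nb g i)) ^ wt i (snd g) \<noteq> 0" for i
  using assms(1) nb_lab[OF assms(2), of i] wt_eq_0[of i "snd g"] by (cases "E i (snd g) \<or> E (snd g) i") (auto simp: gen_def)
 thus ?thesis by (simp add: leval_NN[OF assms(2)])
qed

lemma ub_nz: assumes "gen y" "g \<in> lab" "fst g = 0 \<longrightarrow> y (snd g) \<noteq> 0" shows "ub y g \<noteq> 0"
proof -
 have "leval y (ymon (yb g)) \<noteq> 0"
  unfolding leval_ymon using assms(3) by (cases g) (auto simp: yb_def)
 thus ?thesis using leval_NN_nz[OF assms(1,2)] assms tu_lab by (auto simp: ub_def gen_def)
qed

text \<open>Exponents that invert the formula for the \<open>u\<close>-coordinates: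
  \<open>Fp_ub\<close> writes each \<open>F\<close>-polynomial as an inverse monomial in the
  \<open>u\<close>-coordinates at positive times.\<close>

definition ee :: "nat \<times> 'n => nat \<times> 'n => nat" where
 "ee w g = (if 0 < fst w \<and> fst w \<le> fst g then cc (tu w) g else 0)"

lemma ee_mesh:
 assumes w: "v \<in> lab" "0 < fst v" and g: "(Suc t, j) \<in> lab"
 shows "ee v (Suc t, j) + ee v (t, j) = of_bool (v = (Suc t, j)) + (\<Sum>i\<in>UNIV. wt i j * ee v (nb (Suc t, j) i))"
proof -
 obtain s k where sk: "v = (Suc s, k)" using w(2) by (cases v; cases "fst v") auto
 have m: "int (cc (s, k) (Suc t, j)) + int (cc (s, k) (t, j)) = of_bool ((s, k) = (t, j)) + (of_bool ((s, k) = (Suc t, j)) +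
   (\<Sum>i\<in>UNIV. int (wt i j) * int (cc (s, k) (nb (Suc t, j) i))))"
  using cc_mesh[OF tu_lab[OF w(1)] g] by (simp add: sk)
 have nbt: "E i j \<or> E j i ==> fst (nb (Suc t, j) i) = Suc t \<or> nb (Suc t, j) i = (t, i)" for i by (auto simp: nb_def)
 show ?thesis
 proof (cases "s \<le> t")
  case True
  have e: "wt i j * ee v (nb (Suc t, j) i) = wt i j * cc (s, k) (nb (Suc t, j) i)" for i
   using nbt[of i] wt_eq_0[of i j] True by (cases "E i j \<or> E j i") (auto simp: ee_def sk cc_def)
  have "int (ee v (Suc t, j) + ee v (t, j)) = int (cc (s, k) (Suc t, j)) + int (cc (s, k) (t, j))"
   using True by (auto simp: ee_def sk cc_def)
  also have "\<dots> = int (of_bool (v = (Suc t, j)) + (\<Sum>i\<in>UNIV. wt i j * ee v (nb (Suc t, j) i)))"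
   using m True unfolding e by (simp add: sk)
  finally show ?thesis by (simp only: of_nat_eq_iff)
 next
  case False
  have e: "wt i j * ee v (nb (Suc t, j) i) = 0" for i
   using nbt[of i] wt_eq_0[of i j] False by (cases "E i j \<or> E j i") (auto simp: ee_def sk)
  show ?thesis unfolding e using False by (simp add: ee_def sk)
 qed
qed

text \<open>Solving the definition of \<open>ub\<close> for the newest \<open>F\<close>-polynomial
  gives a recursion; \<open>ee_mesh\<close> is the same recursion for exponents.\<close>

lemma Fp_ub:
 assumes y: "gen y" and g: "h \<in> lab"
 shows "leval y (Fp h) * (\<Prod>v\<in>{v \<in> lab. 0 < fst v}. ub y v ^ ee v h) = 1"
 using g
proof (induction rule: lab_induct)
 case (0 j)
 thus ?case by (simp add: ee_def)
next
 case (Suc t j)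
 let ?g = "(Suc t, j)" and ?L = "{v \<in> lab. 0 < fst v}"
 let ?G = "\<lambda>h. \<Prod>v\<in>?L. ub y v ^ ee v h" and ?F = "\<lambda>h. leval y (Fp h)"
 have fin: "finite ?L" using finite_lab by simp
 have FF: "?F ?g * ?F (t, j) * ub y ?g = leval y (NN ?g)"
 proof -
  have "?F (t, j) \<noteq> 0" "?F ?g \<noteq> 0" using y Suc(1) by (auto simp: gen_def lab_def)
  thus ?thesis by (simp add: ub_def yb_pos)
 qed
 have "?G ?g * ?G (t, j) = (\<Prod>v\<in>?L. (if v = ?g then ub y v else 1) * (\<Prod>i\<in>UNIV. (ub y v ^ ee v (nb ?g i)) ^ wt i j))"
  unfolding prod.distrib[symmetric]
 proof (rule prod.cong[OF refl])
  fix v assume w: "v \<in> ?L"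
  have "ub y v ^ ee v ?g * ub y v ^ ee v (t, j) = ub y v ^ (of_bool (v = ?g) + (\<Sum>i\<in>UNIV. wt i j * ee v (nb ?g i)))"
   using ee_mesh[of v t j] w Suc(1) by (simp flip: power_add)
  thus "ub y v ^ ee v ?g * ub y v ^ ee v (t, j) = (if v = ?g then ub y v else 1) * (\<Prod>i\<in>UNIV. (ub y v ^ ee v (nb ?g i)) ^ wt i j)"
   by (simp add: power_add power_sum power_mult mult.commute[of "wt _ _"])
 qed
 also have "\<dots> = ub y ?g * (\<Prod>i\<in>UNIV. ?G (nb ?g i) ^ wt i j)"
 proof -
  have "(\<Prod>v\<in>?L. if v = ?g then ub y v else 1) = ub y ?g" using Suc(1) fin by simp
  moreover have "(\<Prod>v\<in>?L. \<Prod>i\<in>UNIV. (ub y v ^ ee v (nb ?g i)) ^ wt i j) = (\<Prod>i\<in>UNIV. \<Prod>v\<in>?L. (ub y v ^ ee v (nb ?g i)) ^ wt i j)"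
   by (rule prod.swap)
  ultimately show ?thesis unfolding prod.distrib prod_power_distrib by (simp only:)
 qed
 finally have G: "?G ?g * ?G (t, j) = ub y ?g * (\<Prod>i\<in>UNIV. ?G (nb ?g i) ^ wt i j)" .
 have "leval y (NN ?g) * (\<Prod>i\<in>UNIV. ?G (nb ?g i) ^ wt i j) = (\<Prod>i\<in>UNIV. (?F (nb ?g i) * ?G (nb ?g i)) ^ wt i j)"
  unfolding leval_NN[OF Suc(1)] by (simp add: power_mult_distrib prod.distrib)
 also have "\<dots> = 1"
 proof (rule prod.neutral, rule ballI)
  fix i show "(?F (nb ?g i) * ?G (nb ?g i)) ^ wt i j = 1"
   using Suc(3)[of i] wt_eq_0[of i j] by (cases "E i j \<or> E j i") auto
 qed
 finally have "?F ?g * ?F (t, j) * ub y ?g * (\<Prod>i\<in>UNIV. ?G (nb ?g i) ^ wt i j) = 1" unfolding FF .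
 hence "?F ?g * ?G ?g * (?F (t, j) * ?G (t, j)) = 1" using G by (simp add: mult_ac)
 thus ?case using Suc(2) by simp
qed

end

section \<open>Links of initial variables\<close>

context ldynkin begin

lemma uu_seed: "jseed a E d id UNIV" by unfold_locales auto

text \<open>The almost positive root, with initial variables as negative simple roots. It names a
  cluster variable independently of the diagram in which times are counted.\<close>

definition rt :: "nat \<times> 'n => 'n => int" where "rt g = (\<lambda>k. dv g k - yb g k)"

lemma rt_0: "rt (0, j) = - ev j" by (auto simp: rt_def yb_def ev_def)

lemma rt_pos: "(t, j) \<in> lab ==> t > 0 ==> rt (t, j) = D t j"
 by (auto simp: rt_def yb_pos dv_D)

lemma rt_inj: assumes "g \<in> lab" "g' \<in> lab" "rt g = rt g'" shows "g = g'"
proof (rule jseed.dv_inj[OF uu_seed])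
 show "yb g k - dv g k = yb g' k - dv g' k" for k
  using fun_cong[OF assms(3), of k] by (simp add: rt_def)
qed (use assms in \<open>auto simp: jseed.labJ_def[OF uu_seed]\<close>)

lemma rt_dv: "0 < fst g ==> dv g = rt g" "0 < fst g ==> yb g = 0"
 by (cases g; simp add: rt_def yb_pos)+

lemma chi_rt: "w \<in> lab ==> 0 < fst w ==> chi (rt w) (rt w) = d (snd w)"
 by (cases w) (simp add: rt_pos chi_D_self)

text \<open>Both exponents depend on the roots and the Euler form alone and not on the times. This
  makes them comparable between a diagram and its links, whose \<open>cinv\<close>-orbits
  differ.\<close>

lemma rt_cc:
 assumes "w \<in> lab" "g \<in> lab" "0 < fst w" "0 < fst g"
 shows "chi (rt w) (rt w) * of_nat (cc w g) = max 0 (max (- chi (rt w) (rt g)) (- chi (rt g) (rt w)))"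
  and "chi (rt w) (rt w) * of_nat (ee w g) = max 0 (chi (rt w) (rt g))"
proof -
 obtain s i t j where wg: "w = (s, i)" "g = (t, j)" by force
 have l: "(s, i) \<in> lab" "(t, j) \<in> lab" "0 < s" "0 < t" "s \<le> rr i" "t \<le> rr j" using assms by (auto simp: wg lab_def)
 have dp: "0 < d i" "0 < d j" using d_pos by auto
 have R: "rt w = D s i" "rt g = D t j" using l by (simp_all add: wg rt_pos)
 have nn: "0 \<le> D m k k'" if "m \<le> rr k" for m k k' using D_nonneg[OF that] .
 have pos: "0 \<le> d k * of_int (D m k' k)" if "m \<le> rr k'" for m k k'
  using nn[OF that, of k] d_pos[of k] by simp
 consider "s < t" | "s = t" | "t < s" by linarith
 hence "chi (rt w) (rt w) * of_nat (cc w g) = max 0 (max (- chi (rt w) (rt g)) (- chi (rt g) (rt w))) \<and>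
   chi (rt w) (rt w) * of_nat (ee w g) = max 0 (chi (rt w) (rt g))"
 proof cases
  case 1
  have c: "chi (D t j) (D s i) = - (d i * of_int (D (t - s) j i))" by (rule chi_D_gt[OF l(3) 1])
  have c': "chi (D s i) (D t j) = d i * of_int (D (t - s + 1) j i)" using chi_D_le[of s t i j] 1 l by simp
  have n: "0 \<le> D (t - s) j i" "0 \<le> D (t - s + 1) j i" using 1 l by (auto intro!: nn)
  have e: "ee w g = nat (D (t - s + 1) j i)"
  proof -
   obtain q where "s = Suc q" using l(3) by (cases s) auto
   moreover from this have "t - q = Suc (t - s)" using 1 by simp
   ultimately show ?thesis using 1 by (simp add: ee_def wg cc_def)
  qed
  have p: "0 \<le> d i * of_int (D (t - s) j i)" "0 \<le> d i * of_int (D (t - s + 1) j i)" using 1 l by (auto intro!: pos)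
  show ?thesis unfolding R c c' chi_D_self[OF l(3)] e using 1 n p by (simp add: wg cc_def)
 next
  case 2
  have c: "chi (D s i) (D s j) = d i * of_int (D 1 j i)" "chi (D s j) (D s i) = d j * of_int (D 1 i j)"
   using chi_D_le[of s s] l by simp_all
  have n: "0 \<le> D 1 j i" "0 \<le> D 1 i j" using 2 l by (auto intro!: nn)
  have p: "0 \<le> d i * of_int (D 1 j i)" "0 \<le> d j * of_int (D 1 i j)" using 2 l by (auto intro!: pos)
  have e: "ee w g = nat (D 1 j i)"
  proof -
   obtain q where "s = Suc q" using l(3) by (cases s) auto
   thus ?thesis using 2[symmetric] by (simp add: ee_def wg cc_def)
  qed
  show ?thesis unfolding R 2[symmetric] c chi_D_self[OF l(3)] e using 2 n p by (simp add: wg cc_def)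
 next
  case 3
  have c: "chi (D s i) (D t j) = - (d j * of_int (D (s - t) i j))" by (rule chi_D_gt[OF l(4) 3])
  have c': "chi (D t j) (D s i) = d j * of_int (D (s - t + 1) i j)" using chi_D_le[of t s j i] 3 l by simp
  have p: "0 \<le> d j * of_int (D (s - t) i j)" "0 \<le> d j * of_int (D (s - t + 1) i j)" using 3 l by (auto intro!: pos)
  have dd: "d i * of_int (dynkin.D (dual_cartan a) E (s - t) i j) = d j * of_int (D (s - t) i j)" by (rule dual_D)
  have n: "0 \<le> dynkin.D (dual_cartan a) E (s - t) i j"
   using p(1) dp unfolding dd[symmetric] by (simp add: zero_le_mult_iff)
  show ?thesis unfolding R c c' chi_D_self[OF l(3)] using 3 p dd n by (simp add: wg cc_def ee_def)
 qed
 thus "chi (rt w) (rt w) * of_nat (cc w g) = max 0 (max (- chi (rt w) (rt g)) (- chi (rt g) (rt w)))"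
  "chi (rt w) (rt w) * of_nat (ee w g) = max 0 (chi (rt w) (rt g))" by auto
qed

lemma rt_cc0:
 assumes "v \<in> lab" "0 < fst v"
 shows "chi (rt v) (rt v) * of_nat (cc v (0, j)) = d j * of_int (rt v j)"
proof -
 obtain s i where w: "v = (s, i)" by force
 have dd: "d i * of_int (dynkin.D (dual_cartan a) E s i j) = d j * of_int (D s i j)" by (rule dual_D)
 have p: "0 \<le> d j * of_int (D s i j)" using assms D_nonneg[of s i j] d_pos[of j] by (simp add: w lab_def)
 have n: "0 \<le> dynkin.D (dual_cartan a) E s i j"
  using p d_pos[of i] unfolding dd[symmetric] by (simp add: zero_le_mult_iff)
 show ?thesis using assms n dd by (simp add: w rt_pos chi_D_self cc_def)
qed

text \<open>The last \<open>F\<close>-polynomials of the orbits involve only one another, ordered by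
  the orientation, and can therefore be compared directly with those of a link.\<close>

lemma Fp_tu0_rec: "leval x (Fp (tu (0, j))) = 1 + x j * (\<Prod>i | E j i. leval x (Fp (tu (0, i))) ^ wt i j)"
proof -
 have m: "leval x (Fp (tu (0, j))) = x j * leval x (NN (0, j)) + 1"
  using leval_mesh[of "(0, j)" x] by (simp add: leval_yb del: tu.simps)
 have "leval x (NN (0, j)) = (\<Prod>i\<in>UNIV. if E j i then leval x (Fp (tu (0, i))) ^ wt i j else 1)"
  unfolding leval_NN[OF lab0]
  by (rule prod.cong) (use wt_eq_0[of _ j] E_asym[of _ j] in \<open>auto simp: nb_def simp del: tu.simps\<close>)
 thus ?thesis using m by (simp add: prod.If_cases Int_def)
qed

lemma Fp_no_var:
 assumes "g \<in> lab" "dv g k = 0" "m \<in> keys (Fp g)"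
 shows "lookup m k = 0"
proof -
 have "low (- axis k 1) 0 (Fp g)"
  using trop_low(1)[OF sfree_nz[OF sfree_Fp[OF assms(1)]], of "- axis k 1"] deg_Fp[OF assms(1), of k] assms(2) by simp
 hence "0 \<le> pr m (- axis k 1)" using assms(3) by (simp add: low_def)
 hence "lookup m k \<le> 0"
  by (simp add: pr_def axis_def if_distrib sum_negf cong: if_cong)
 moreover have "0 \<le> lookup m k" using nonneg_Fp[OF assms(1), of k] assms(3) by (simp add: nonneg_at_def)
 ultimately show ?thesis by simp
qed

end

lemma leval_cong:
 assumes "\<And>m k. m \<in> keys p ==> x k = y k \<or> lookup m k = 0"
 shows "leval x p = leval y p"
 unfolding leval_def lsum_def mon_def
proof (intro sum.cong[OF refl] arg_cong2[where f = "(*)"] refl prod.cong)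
 fix m k assume "m \<in> keys p"
 thus "x k powi lookup m k = y k powi lookup m k" using assms[of m k] by auto
qed

definition gy :: "'n => ('n::{finite,linorder}, int) laurent fract" where "gy i = Fract (laurent_var i) 1"

lemma leval_gy: "leval gy p = Fract p 1"
 unfolding gy_def[abs_def] by (rule leval_hom[where \<phi> = "\<lambda>p. Fract p 1"]) (simp_all add: One_fract_def)

lemma Fract_1_eq: "Fract p 1 = Fract q 1 \<longleftrightarrow> p = (q :: 'a::idom)" by (simp add: eq_fract)

lemma indep_gy: "indep gy"
 unfolding indep_def leval_gy by (metis Fract_1_eq Zero_fract_def)

text \<open>Setting \<open>y_l\<close> to zero keeps the terms free of \<open>y_l\<close>, that is,
  the initial form along axis \<open>l\<close>.\<close>

lemma leval_gy_0:
 assumes "nonneg_at l p" "lookup p 0 \<noteq> 0"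
 shows "leval (gy(l := 0)) p \<noteq> 0"
proof -
 let ?q = "part (axis l 1) 0 p"
 have pr: "pr m (axis l 1) = of_int (lookup m l)" for m :: "'a \<Rightarrow>\<^sub>0 int"
  by (simp add: pr_def axis_def if_distrib cong: if_cong)
 have m0: "mon (gy(l := 0)) m = (if pr m (axis l 1) = 0 then mon gy m else 0)" if "m \<in> keys p" for m
 proof (cases "lookup m l = 0")
  case True
  thus ?thesis unfolding pr mon_def by (auto intro!: prod.cong)
 next
  case False
  thus ?thesis unfolding pr mon_def using assms(1) that by (auto simp: nonneg_at_def intro!: bexI[of _ l])
 qed
 have "leval (gy(l := 0)) p = (\<Sum>m\<in>keys p. if pr m (axis l 1) = 0 then of_int (lookup p m) * mon gy m else 0)"
  unfolding leval_def lsum_def by (rule sum.cong) (simp_all add: m0)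
 also have "\<dots> = leval gy ?q"
  unfolding part_def leval_sum by (simp add: sum.If_cases Int_def conj_commute)
 finally have "leval (gy(l := 0)) p = leval gy ?q" .
 moreover have "?q \<noteq> 0" using assms(2) lookup_part[of "axis l 1" 0 p 0] by auto
 ultimately show ?thesis using indep_gy by (auto simp: indep_def)
qed

locale llink = ldynkin a E d for a :: "'n::{finite,linorder} => 'n => int" and E d +
 fixes l :: 'n
begin

text \<open>The vertex \<open>l\<close> remains as an isolated component, so that diagram and link
  share the vertex type.\<close>

definition ak :: "'n => 'n => int" where "ak i j = (if i \<noteq> j \<and> (i = l \<or> j = l) then 0 else a i j)"

definition Ek :: "'n => 'n => bool" where "Ek i j \<longleftrightarrow> E i j \<and> i \<noteq> l \<and> j \<noteq> l"

lemma dk: "ldynkin ak Ek d"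
proof
 fix v :: "(real, 'n) vec" assume v: "v \<noteq> 0"
 define v' :: "(real, 'n) vec" where "v' = (\<chi> i. if i = l then 0 else v $ i)"
 have "(\<Sum>i\<in>UNIV. \<Sum>j\<in>UNIV. d i * of_int (ak i j) * v $ i * v $ j) =
   (\<Sum>i\<in>UNIV. \<Sum>j\<in>UNIV. d i * of_int (a i j) * v' $ i * v' $ j + (if i = l then if j = l then 2 * d l * (v $ l)\<^sup>2 else 0 else 0))"
  by (intro sum.cong refl) (auto simp: ak_def v'_def power2_eq_square)
 also have "\<dots> = (\<Sum>i\<in>UNIV. \<Sum>j\<in>UNIV. d i * of_int (a i j) * v' $ i * v' $ j) + 2 * d l * (v $ l)\<^sup>2"
 proof -
  have "(\<Sum>i\<in>UNIV. \<Sum>j\<in>UNIV. if i = l then if j = l then 2 * d l * (v $ l)\<^sup>2 else 0 else 0) =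
    (\<Sum>i\<in>UNIV. if i = l then 2 * d l * (v $ l)\<^sup>2 else 0)"
   by (rule sum.cong) auto
  thus ?thesis by (simp add: sum.distrib)
 qed
 finally have e: "(\<Sum>i\<in>UNIV. \<Sum>j\<in>UNIV. d i * of_int (ak i j) * v $ i * v $ j) =
   (\<Sum>i\<in>UNIV. \<Sum>j\<in>UNIV. d i * of_int (a i j) * v' $ i * v' $ j) + 2 * d l * (v $ l)\<^sup>2" .
 show "0 < (\<Sum>i\<in>UNIV. \<Sum>j\<in>UNIV. d i * of_int (ak i j) * v $ i * v $ j)"
 proof (cases "v' = 0")
  case True
  hence "v $ l \<noteq> 0" using v by (auto simp: v'_def vec_eq_iff split: if_splits)
  thus ?thesis using d_pos[of l] True unfolding e by simp
 next
  case False
  thus ?thesis using posdef[OF False] d_pos[of l] unfolding e by (simp add: add_pos_nonneg)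
 qed
next
 show "d i * of_int (ak i j) = d j * of_int (ak j i)" for i j using symm[of i j] by (auto simp: ak_def)
 show "orientation ak Ek" unfolding orientation_def
 proof (intro conjI allI impI)
  fix i j
  show "i \<noteq> j" "ak i j \<noteq> 0" if "Ek i j" using that E_neq E_nonzero by (auto simp: Ek_def ak_def)
  assume "i \<noteq> j \<and> ak i j \<noteq> 0"
  hence "i \<noteq> j" "a i j \<noteq> 0" "i \<noteq> l" "j \<noteq> l" by (auto simp: ak_def split: if_splits)
  thus "Ek i j \<longleftrightarrow> \<not> Ek j i" using E_total[of i j] E_asym[of i j] by (auto simp: Ek_def)
 qed
 show "ak i j = 0 ==> ak j i = 0" for i j using zero_sym[of i j] by (auto simp: ak_def split: if_splits)
 show "i \<noteq> j ==> ak i j \<le> 0" for i j using offdiag[of i j] by (auto simp: ak_def)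
qed (auto simp: ak_def d_pos)

sublocale dk: ldynkin ak Ek d by (rule dk)

lemma kseed: "jseed ak Ek d id (- {l})" by unfold_locales (auto simp: ak_def)

lemma kout: "g \<in> dk.lab ==> snd g \<noteq> l ==> dk.dv g l = 0"
 by (rule jseed.dv_outside[OF kseed]) auto

lemma dk_rr_l: "dk.rr l = 1" and dk_star_l: "dk.star0 l = l"
 using jseed.star_iso[OF kseed, of l] by auto

lemma dk_PP_l: "dk.PP l = ev l"
 using dk.PP.simps[of l] by (auto simp: Ek_def dk.ev_def ev_def)

lemma dk_UU: "x l = 0 ==> k \<noteq> l ==> dk.UU x k = UU x k"
 unfolding dk.UU_def UU_def by (auto intro!: sum.mono_neutral_cong_left simp: Ek_def ak_def)

lemma dk_chi: "x l = 0 ==> y l = 0 ==> dk.chi x y = chi x y"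
 unfolding dk.chi_def chi_def by (intro sum.cong refl) (metis dk_UU mult_zero_left)

lemma dk_RR: "x l = 0 ==> dk.RR x \<longleftrightarrow> RR x"
 by (simp add: dk.RR_def RR_def dk_chi)

text \<open>The labels other than \<open>(0, l)\<close> compatible with \<open>(0, l)\<close>. They
  are to be matched with \<open>LK'\<close>, the labels of the cut diagram away from its isolated
  vertex.\<close>

definition LK :: "(nat \<times> 'n) set" where "LK = {w \<in> lab. w \<noteq> (0, l) \<and> dv w l = 0}"

definition LK' :: "(nat \<times> 'n) set" where "LK' = {g \<in> dk.lab. snd g \<noteq> l}"

lemma io_ex: assumes "h \<in> LK'" shows "\<exists>w\<in>LK. rt w = dk.rt h \<and> (0 < fst w \<longleftrightarrow> 0 < fst h)"
proof -
 obtain t j where g: "h = (t, j)" by force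
 have tj: "(t, j) \<in> dk.lab" "j \<noteq> l" using assms by (auto simp: LK'_def g)
 show ?thesis
 proof (cases "t = 0")
  case True
  thus ?thesis using tj by (intro bexI[of _ "(0, j)"]) (auto simp: g rt_0 dk.rt_0 LK_def dk.ev_def ev_def)
 next
  case False
  let ?x = "dk.D t j"
  have x: "?x l = 0" using kout[OF tj(1)] tj dk.dv_D[OF tj(1)] by simp
  have "RR ?x" using dk.RR_D[of t j] False dk_RR[of ?x] x by simp
  moreover have "nneg ?x" using dk.rr_pos[of t j] False tj by (simp add: dk.lab_def)
  ultimately obtain s i where si: "0 < s" "s \<le> rr i" "?x = D s i" using RR_D_ex by blast
  hence sl: "(s, i) \<in> lab" by (simp add: lab_def)
  show ?thesis
   using False si sl x by (intro bexI[of _ "(s, i)"]) (simp_all add: g rt_pos dk.rt_pos[OF tj(1)] LK_def dv_D)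
 qed
qed

lemma io_ex': assumes "v \<in> LK" shows "\<exists>g\<in>LK'. rt v = dk.rt g"
proof -
 obtain s i where w: "v = (s, i)" by force
 have si: "(s, i) \<in> lab" "(s, i) \<noteq> (0, l)" "dv (s, i) l = 0" using assms by (auto simp: LK_def w)
 show ?thesis
 proof (cases "s = 0")
  case True
  thus ?thesis using si by (intro bexI[of _ "(0, i)"]) (auto simp: w rt_0 dk.rt_0 LK'_def dk.ev_def ev_def)
 next
  case False
  let ?x = "D s i"
  have x: "?x l = 0" using dv_D[OF si(1)] si by simp
  have "dk.RR ?x" using RR_D[of s i] False dk_RR[of ?x] x by simp
  moreover have "nneg ?x" using rr_pos[of s i] False si by (simp add: lab_def)
  ultimately obtain t j where tj: "0 < t" "t \<le> dk.rr j" "?x = dk.D t j" using dk.RR_D_ex by blast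
  hence tl: "(t, j) \<in> dk.lab" by (simp add: dk.lab_def)
  have "j \<noteq> l"
  proof
   assume "j = l"
   hence "t = 1" using tj dk_rr_l by simp
   thus False using x tj(3) \<open>j = l\<close> by (simp add: dk.D_1 dk_PP_l ev_def)
  qed
  thus ?thesis
   using False si tl tj by (intro bexI[of _ "(t, j)"]) (simp_all add: w rt_pos dk.rt_pos LK'_def)
 qed
qed

text \<open>Labels are matched by their roots, since orbits and times change when \<open>l\<close>
  is cut off.\<close>

definition io :: "nat \<times> 'n => nat \<times> 'n" where "io g = (THE w. w \<in> LK \<and> rt w = dk.rt g)"

lemma io: assumes "g \<in> LK'" shows "io g \<in> LK" "rt (io g) = dk.rt g" "0 < fst (io g) \<longleftrightarrow> 0 < fst g"
proof -
 obtain v where w: "v \<in> LK" "rt v = dk.rt g" "0 < fst v \<longleftrightarrow> 0 < fst g"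
  using io_ex[OF assms] by (elim bexE conjE) (rule that)
 have "io g = v" unfolding io_def
 proof (rule the_equality)
  show "v \<in> LK \<and> rt v = dk.rt g" using w by simp
  fix h assume "h \<in> LK \<and> rt h = dk.rt g"
  thus "h = v" using w rt_inj[of h v] by (simp add: LK_def)
 qed
 thus "io g \<in> LK" "rt (io g) = dk.rt g" "0 < fst (io g) \<longleftrightarrow> 0 < fst g" using w by simp_all
qed

lemma io_bij: "bij_betw io LK' LK"
 unfolding bij_betw_def
proof
 show "inj_on io LK'"
 proof (rule inj_onI)
  fix h q assume "h \<in> LK'" "q \<in> LK'" "io h = io q"
  thus "h = q" using io(2)[of h] io(2)[of q] dk.rt_inj[of h q] by (simp add: LK'_def)
 qed
 show "io ` LK' = LK"
 proof
  show "io ` LK' \<subseteq> LK" using io(1) by blast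
  show "LK \<subseteq> io ` LK'"
  proof
   fix v assume w: "v \<in> LK"
   then obtain h where g: "h \<in> LK'" "rt v = dk.rt h" using io_ex' by blast
   hence "io h = v" using io[OF g(1)] w rt_inj[of "io h" v] by (simp add: LK_def)
   thus "v \<in> io ` LK'" using g by blast
  qed
 qed
qed

lemma io_0: assumes "j \<noteq> l" shows "io (0, j) = (0, j)"
proof -
 have g: "(0, j) \<in> LK'" using assms by (simp add: LK'_def)
 have "rt (io (0, j)) = rt (0, j)" using io(2)[OF g] by (simp add: rt_0 dk.rt_0 dk.ev_def ev_def)
 thus ?thesis using io(1)[OF g] rt_inj[of "io (0, j)" "(0, j)"] by (simp add: LK_def)
qed

lemma io_dv: assumes "h \<in> LK'" shows "dv (io h) = dk.dv h" "yb (io h) = dk.yb h"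
proof -
 obtain t j where g: "h = (t, j)" by force
 have "dv (io h) = dk.dv h \<and> yb (io h) = dk.yb h"
 proof (cases "t = 0")
  case True
  have "j \<noteq> l" using assms by (simp add: LK'_def g)
  thus ?thesis by (auto simp: g True io_0 yb_def dk.yb_def)
 next
  case False
  hence p: "0 < fst h" "0 < fst (io h)" using io(3)[OF assms] by (simp_all add: g)
  show ?thesis using io(2)[OF assms] by (simp add: rt_dv[OF p(2)] dk.rt_dv[OF p(1)])
 qed
 thus "dv (io h) = dk.dv h" "yb (io h) = dk.yb h" by auto
qed

lemma LK_lab: "g \<in> LK ==> g \<in> lab" "g \<in> LK' ==> g \<in> dk.lab"
 by (simp_all add: LK_def LK'_def)

lemma rt_l: "g \<in> LK' ==> dk.rt g l = 0"
 using kout[of g] by (auto simp: dk.rt_def LK'_def dk.yb_def)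

lemma io_cc:
 assumes "w \<in> LK'" "g \<in> LK'"
 shows "cc (io w) (io g) = dk.cc w g"
proof -
 have N: "chi (rt (io w)) (rt (io w)) = dk.chi (dk.rt w) (dk.rt w)" using dk_chi rt_l assms io(2) by simp
 have lw: "io w \<in> lab" "io g \<in> lab" "w \<in> dk.lab" "g \<in> dk.lab" using io(1) assms LK_lab by auto
 consider "fst w = 0" | "0 < fst w" "fst g = 0" | "0 < fst w" "0 < fst g" by linarith
 thus ?thesis
 proof cases
  case 1
  then obtain j where j: "w = (0, j)" "j \<noteq> l" using assms by (cases w) (auto simp: LK'_def)
  hence "int (cc (io w) (io g)) = int (dk.cc w g)"
   using fun_cong[OF io_dv(1)[OF assms(2)], of j] io_0[OF j(2)] by (simp add: dv_def dk.dv_def)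
  thus ?thesis by simp
 next
  case 2
  then obtain j where j: "g = (0, j)" "j \<noteq> l" using assms by (cases g) (auto simp: LK'_def)
  have p: "0 < fst (io w)" using io(3) assms 2 by simp
  have "chi (rt (io w)) (rt (io w)) * of_nat (cc (io w) (io g)) = chi (rt (io w)) (rt (io w)) * of_nat (dk.cc w g)"
   using rt_cc0[OF lw(1) p, of j] dk.rt_cc0[OF lw(3) 2(1), of j] N io(2)[OF assms(1)] by (simp add: j io_0)
  thus ?thesis using chi_rt[OF lw(1) p] d_pos[of "snd (io w)"] by simp
 next
  case 3
  have p: "0 < fst (io w)" "0 < fst (io g)" using io(3) assms 3 by simp_all
  have "chi (rt (io w)) (rt (io w)) * of_nat (cc (io w) (io g)) = chi (rt (io w)) (rt (io w)) * of_nat (dk.cc w g)"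
   using rt_cc(1)[OF lw(1,2) p] N dk.rt_cc(1)[OF lw(3,4) 3] dk_chi rt_l assms io(2) by simp
  thus ?thesis using chi_rt[OF lw(1) p(1)] d_pos[of "snd (io w)"] by simp
 qed
qed

lemma io_ee:
 assumes "w \<in> LK'" "g \<in> LK'" "0 < fst w" "0 < fst g"
 shows "ee (io w) (io g) = dk.ee w g"
proof -
 have N: "chi (rt (io w)) (rt (io w)) = dk.chi (dk.rt w) (dk.rt w)" using dk_chi rt_l assms io(2) by simp
 have lw: "io w \<in> lab" "io g \<in> lab" "w \<in> dk.lab" "g \<in> dk.lab" using io(1) assms LK_lab by auto
 have p: "0 < fst (io w)" "0 < fst (io g)" using io(3) assms by simp_all
 have "chi (rt (io w)) (rt (io w)) * of_nat (ee (io w) (io g)) = chi (rt (io w)) (rt (io w)) * of_nat (dk.ee w g)"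
  using rt_cc(2)[OF lw(1,2) p] N dk.rt_cc(2)[OF lw(3,4) assms(3,4)] dk_chi rt_l assms io(2) by simp
 thus ?thesis using chi_rt[OF lw(1) p(1)] d_pos[of "snd (io w)"] by simp
qed

lemma dk_cc_l_aux:
 assumes "w \<in> dk.lab" "g \<in> dk.lab" "(snd w = l) \<noteq> (snd g = l)" "fst w < fst g"
 shows "dk.cc w g = 0"
proof (cases "snd g = l")
 case True
 hence "fst g = 1" "fst w = 0" using assms(2,4) dk_rr_l by (cases g; auto simp: dk.lab_def)+
 thus ?thesis using True assms(3) by (simp add: dk.cc_def dk.D_1 dk_PP_l ev_def)
next
 case False
 have "(fst g - fst w, snd g) \<in> dk.lab" using assms(2) by (cases g) (auto simp: dk.lab_def)
 from kout[OF this] dk.dv_D[OF this] False assms(3,4) show ?thesis by (simp add: dk.cc_def)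
qed

lemma dk_cc_l:
 assumes "w \<in> dk.lab" "g \<in> dk.lab" "(snd w = l) \<noteq> (snd g = l)"
 shows "dk.cc w g = 0"
proof -
 consider "fst w < fst g" | "fst g < fst w" | "fst w = fst g" by linarith
 thus ?thesis
 proof cases
  case 1 thus ?thesis by (rule dk_cc_l_aux[OF assms])
 next
  case 2 thus ?thesis
   using dk_cc_l_aux[OF assms(2,1) assms(3)[symmetric]] dk.cc_zero_sym[of w g] by simp
 qed (simp add: dk.cc_def)
qed

text \<open>Specializing the initial variable at \<open>l\<close> to \<open>0\<close> kills the \<open>u\<close>-coordinate of \<open>(0, l)\<close> and turns
 the labels incompatible with it into \<open>1\<close>.\<close>

context
 fixes y z :: "'n => 'f::field"
 assumes gy: "gen y" and yl: "y l = 0" and yz: "\<And>j. j \<noteq> l ==> y j \<noteq> 0 \<and> z j = y j"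
  and gz: "dk.gen z" and zl: "z l \<noteq> 0"
begin

lemma ub_l: "ub y (0, l) = 0" by (simp add: ub_def leval_yb yl)

lemma ub_off: assumes "w \<in> lab" "w \<notin> LK" "w \<noteq> (0, l)" shows "ub y w = 1"
proof -
 have "cc (0, l) w \<noteq> 0" using assms by (auto simp: LK_def dv_def)
 hence "(\<Prod>h\<in>lab. ub y h ^ cc h w) = 0"
  by (intro prod_zero[OF finite_lab] bexI[of _ "(0, l)"]) (auto simp: ub_l)
 thus ?thesis using ub_rel[OF gy assms(1)] by simp
qed

lemma ub_LK: assumes "w \<in> LK" shows "ub y w \<noteq> 0"
proof (rule ub_nz[OF gy LK_lab(1)[OF assms]])
 show "fst w = 0 \<longrightarrow> y (snd w) \<noteq> 0" using assms yz[of "snd w"] by (cases w) (auto simp: LK_def)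
qed

text \<open>A candidate point for the cut diagram: \<open>ub y\<close> on the link, and at the
  isolated vertex the coordinates prescribed there by \<open>z\<close>.\<close>

definition uk :: "nat \<times> 'n => 'f" where "uk g = (if snd g = l then dk.ub z g else ub y (io g))"

lemma dk_ub_nz: "g \<in> dk.lab ==> dk.ub z g \<noteq> 0"
proof (rule dk.ub_nz[OF gz])
 show "fst g = 0 \<longrightarrow> z (snd g) \<noteq> 0" using yz[of "snd g"] zl by (cases "snd g = l") simp_all
qed

lemma dk_uok_ub: "dk.uok (dk.ub z)"
 unfolding dk.uok_def using dk_ub_nz dk.ub_rel[OF gz] by blast

lemma uok_uk: "dk.uok uk"
 unfolding dk.uok_def
proof (intro ballI conjI)
 fix h assume g: "h \<in> dk.lab"
 show "uk h \<noteq> 0" using g dk_ub_nz ub_LK io(1)[of h] by (simp add: uk_def LK'_def)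
 show "uk h + (\<Prod>w\<in>dk.lab. uk w ^ dk.cc w h) = 1"
 proof (cases "snd h = l")
  case True
  have "(\<Prod>w\<in>dk.lab. uk w ^ dk.cc w h) = (\<Prod>w\<in>dk.lab. dk.ub z w ^ dk.cc w h)"
   by (rule prod.cong) (use dk_cc_l g True in \<open>auto simp: uk_def\<close>)
  thus ?thesis using dk.ub_rel[OF gz g] True by (simp add: uk_def)
 next
  case False
  hence g': "h \<in> LK'" using g by (simp add: LK'_def)
  have l: "io h \<in> lab" "dv (io h) l = 0" using io(1)[OF g'] by (auto simp: LK_def)
  have "(\<Prod>w\<in>lab. ub y w ^ cc w (io h)) = (\<Prod>w\<in>LK. ub y w ^ cc w (io h))"
  proof (rule prod.mono_neutral_right[OF finite_lab])
   show "LK \<subseteq> lab" by (auto simp: LK_def)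
   show "\<forall>w\<in>lab - LK. ub y w ^ cc w (io h) = 1"
   proof
    fix w assume "w \<in> lab - LK"
    thus "ub y w ^ cc w (io h) = 1" using ub_off[of w] l(2) by (cases "w = (0, l)") (auto simp: dv_def)
   qed
  qed
  also have "\<dots> = (\<Prod>w\<in>LK'. ub y (io w) ^ cc (io w) (io h))"
   by (rule prod.reindex_bij_betw[OF io_bij, symmetric])
  also have "\<dots> = (\<Prod>w\<in>LK'. uk w ^ dk.cc w h)"
   by (rule prod.cong) (auto simp: io_cc[OF _ g'] uk_def LK'_def)
  also have "\<dots> = (\<Prod>w\<in>dk.lab. uk w ^ dk.cc w h)"
   by (rule prod.mono_neutral_left[OF dk.finite_lab]) (use dk_cc_l[OF _ g] False in \<open>auto simp: LK'_def\<close>)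
  finally show ?thesis using ub_rel[OF gy l(1)] False by (simp add: uk_def)
 qed
qed

text \<open>The factor at \<open>l\<close> becomes \<open>1\<close> because \<open>y l = 0\<close>;
  elsewhere both sides obey the recursion \<open>Fp_tu0_rec\<close>.\<close>

lemma tu0_eq:
 assumes "j \<noteq> l"
 shows "leval y (Fp (tu (0, j))) = leval z (dk.Fp (dk.tu (0, j)))"
 using assms
proof (induction j rule: wf_induct_rule[OF wf_E_converse])
 case (1 j)
 have one: "leval y (Fp (tu (0, l))) = 1" using Fp_tu0_rec[of y l] yl by simp
 have "(\<Prod>i | E j i. leval y (Fp (tu (0, i))) ^ wt i j) = (\<Prod>i | Ek j i. leval z (dk.Fp (dk.tu (0, i))) ^ dk.wt i j)"
 proof (rule prod.mono_neutral_cong_right)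
  show "\<forall>i\<in>{i. E j i} - {i. Ek j i}. leval y (Fp (tu (0, i))) ^ wt i j = 1"
   using 1(2) one by (auto simp: Ek_def simp del: tu.simps)
  fix i assume "i \<in> {i. Ek j i}"
  hence i: "E j i" "i \<noteq> l" by (auto simp: Ek_def)
  have "wt i j = dk.wt i j" using i 1(2) by (simp add: wt_def dk.wt_def ak_def)
  thus "leval y (Fp (tu (0, i))) ^ wt i j = leval z (dk.Fp (dk.tu (0, i))) ^ dk.wt i j"
   using 1(1)[of i] i by simp
 qed (auto simp: Ek_def)
 thus ?case
  unfolding Fp_tu0_rec[of y j] dk.Fp_tu0_rec[of z j] using yz[OF 1(2)] by simp
qed

lemma uk_eq: assumes "g \<in> dk.lab" shows "uk g = dk.ub z g"
proof (rule dk.uok_unique[OF uok_uk dk_uok_ub _ assms])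
 fix j
 show "uk (0, j) = dk.ub z (0, j)"
 proof (cases "j = l")
  case False
  \<comment> \<open>As \<open>dv (0, j) = 0\<close> and \<open>Fp (0, j) = 1\<close>, the product in
    the relation at \<open>(0, j)\<close> is the inverse of the last
    \<open>F\<close>-polynomial.\<close>
  have "ub y (0, j) = 1 - 1 / leval y (Fp (tu (0, j)))"
   using ub_rel[OF gy lab0, of j] ub_prod[OF gy lab0, of j] by (simp add: eq_diff_eq del: tu.simps)
  moreover have "dk.ub z (0, j) = 1 - 1 / leval z (dk.Fp (dk.tu (0, j)))"
   using dk.ub_rel[OF gz dk.lab0, of j] dk.ub_prod[OF gz dk.lab0, of j] by (simp add: eq_diff_eq del: dk.tu.simps)
  ultimately show ?thesis using False tu0_eq[OF False] by (simp add: uk_def io_0 del: tu.simps dk.tu.simps)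
 qed (simp add: uk_def)
qed

text \<open>\<open>F\<close>-polynomials are inverse monomials in the \<open>u\<close>-coordinates.
  Coordinates off the link are \<open>1\<close>, exponents inside it agree by \<open>io_ee\<close>,
  and those at the isolated vertex vanish.\<close>

lemma F_eq: assumes g: "h \<in> LK'" shows "leval y (Fp (io h)) = leval z (dk.Fp h)"
proof (cases "fst h = 0")
 case True
 then obtain j where "h = (0, j)" "j \<noteq> l" using g by (cases h) (auto simp: LK'_def)
 thus ?thesis by (simp add: io_0)
next
 case False
 let ?P = "{v \<in> LK. 0 < fst v}" and ?P' = "{v \<in> LK'. 0 < fst v}"
 have bij: "bij_betw io ?P' ?P"
  unfolding bij_betw_def
 proof
  show "inj_on io ?P'" by (rule inj_on_subset[OF bij_betw_imp_inj_on[OF io_bij]]) blast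
  show "io ` ?P' = ?P"
  proof
   show "io ` ?P' \<subseteq> ?P" using io(1,3) by auto
   show "?P \<subseteq> io ` ?P'"
   proof
    fix v assume w: "v \<in> ?P"
    hence "v \<in> io ` LK'" using bij_betw_imp_surj_on[OF io_bij] by simp
    then obtain q where "q \<in> LK'" "v = io q" by blast
    thus "v \<in> io ` ?P'" using w io(3)[of q] by auto
   qed
  qed
 qed
 have "(\<Prod>v\<in>{v \<in> lab. 0 < fst v}. ub y v ^ ee v (io h)) = (\<Prod>v\<in>?P. ub y v ^ ee v (io h))"
 proof (rule prod.mono_neutral_right)
  show "\<forall>v\<in>{v \<in> lab. 0 < fst v} - ?P. ub y v ^ ee v (io h) = 1"
  proof
   fix v assume "v \<in> {v \<in> lab. 0 < fst v} - ?P"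
   hence "ub y v = 1" by (intro ub_off) auto
   thus "ub y v ^ ee v (io h) = 1" by simp
  qed
 qed (use finite_lab in \<open>auto simp: LK_def\<close>)
 also have "\<dots> = (\<Prod>v\<in>?P'. ub y (io v) ^ ee (io v) (io h))"
  by (rule prod.reindex_bij_betw[OF bij, symmetric])
 also have "\<dots> = (\<Prod>v\<in>?P'. dk.ub z v ^ dk.ee v h)"
 proof (rule prod.cong[OF refl])
  fix v assume w: "v \<in> ?P'"
  hence "uk v = ub y (io v)" by (simp add: uk_def LK'_def)
  hence "ub y (io v) = dk.ub z v" using uk_eq[of v] w by (simp add: LK'_def)
  thus "ub y (io v) ^ ee (io v) (io h) = dk.ub z v ^ dk.ee v h"
   using io_ee[of v h] w g False by simp
 qed
 also have "\<dots> = (\<Prod>v\<in>{v \<in> dk.lab. 0 < fst v}. dk.ub z v ^ dk.ee v h)"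
 proof (rule prod.mono_neutral_left)
  show "\<forall>v\<in>{v \<in> dk.lab. 0 < fst v} - ?P'. dk.ub z v ^ dk.ee v h = 1"
  proof
   fix v assume w: "v \<in> {v \<in> dk.lab. 0 < fst v} - ?P'"
   then obtain t where t: "v = (Suc t, l)" "(Suc t, l) \<in> dk.lab"
    by (cases v; cases "fst v") (auto simp: LK'_def)
   hence "(t, l) \<in> dk.lab" by (simp add: dk.lab_def)
   hence "dk.cc (t, l) h = 0" by (rule dk_cc_l) (use g in \<open>auto simp: LK'_def\<close>)
   thus "dk.ub z v ^ dk.ee v h = 1" by (simp add: t(1) dk.ee_def)
  qed
 qed (use dk.finite_lab in \<open>auto simp: LK'_def\<close>)
 finally have e: "(\<Prod>v\<in>{v \<in> lab. 0 < fst v}. ub y v ^ ee v (io h)) = (\<Prod>v\<in>{v \<in> dk.lab. 0 < fst v}. dk.ub z v ^ dk.ee v h)" (is "?a = ?b") .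
 have "leval y (Fp (io h)) * ?b = 1" using Fp_ub[OF gy, of "io h"] io(1)[OF g] LK_lab unfolding e by simp
 moreover have b: "leval z (dk.Fp h) * ?b = 1" using dk.Fp_ub[OF gz] g by (simp add: LK'_def)
 ultimately have "leval y (Fp (io h)) * ?b = leval z (dk.Fp h) * ?b" by (simp only:)
 moreover have "?b \<noteq> 0" using b by (intro notI) simp
 ultimately show ?thesis using mult_right_cancel by blast
qed

end

text \<open>Specializing \<open>y_l\<close> to zero loses nothing here: by its degree, the
  \<open>F\<close>-polynomial of a label compatible with \<open>(0, l)\<close> does not contain
  \<open>y_l\<close>.\<close>

lemma Fp_io: assumes "g \<in> LK'" shows "Fp (io g) = dk.Fp g"
proof -
 let ?y = "gy(l := 0)"
 have l: "io g \<in> lab" "dv (io g) l = 0" using io(1)[OF assms] by (auto simp: LK_def)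
 have "gen ?y" unfolding gen_def using leval_gy_0 nonneg_Fp const_Fp by force
 moreover have "dk.gen gy"
  unfolding dk.gen_def using indep_gy sfree_nz[OF dk.sfree_Fp] by (auto simp: indep_def)
 ultimately have "leval ?y (Fp (io g)) = leval gy (dk.Fp g)"
  by (intro F_eq assms) (simp_all add: indep_nz[OF indep_gy])
 moreover have "leval ?y (Fp (io g)) = leval gy (Fp (io g))"
  by (rule leval_cong) (use Fp_no_var[OF l] in auto)
 ultimately have "leval gy (Fp (io g)) = leval gy (dk.Fp g)" by simp
 thus ?thesis by (rule indep_eq[OF indep_gy])
qed

lemma phz_io:
 assumes g: "h \<in> LK'" and w: "\<And>j. j \<noteq> l ==> w' j = w j"
 shows "dk.phz w' h = phz w (io h)"
proof -
 have l: "io h \<in> lab" "dv (io h) l = 0" using io(1)[OF g] by (auto simp: LK_def)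
 have "pr m (rv w') = pr m (rv w)" if "m \<in> keys (Fp (io h))" for m
  unfolding pr_rv of_int_eq_iff
 proof (rule sum.cong[OF refl])
  fix j show "lookup m j * w' j = lookup m j * w j"
   using Fp_no_var[OF l that] w[of j] by (cases "j = l") auto
 qed
 hence "(\<lambda>m. pr m (rv w')) ` keys (Fp (io h)) = (\<lambda>m. pr m (rv w)) ` keys (Fp (io h))"
  by (rule image_cong[OF refl])
 hence "trop_laurent (Fp (io h)) (rv w') = trop_laurent (Fp (io h)) (rv w)"
  unfolding trop_laurent_def pr_def by simp
 thus ?thesis by (simp add: dk.phz_def phz_def dk.Phi_def Phi_def Fp_io[OF g])
qed

end

locale jlink = jseed a E d em J + llink a E d l
 for a :: "'n::{finite,linorder} => 'n => int" and E d and em :: "'n => 'r::{finite,linorder}" and J l +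
 assumes lJ: "l \<in> J"
begin

sublocale kj: jseed ak Ek d em "J - {l}"
proof
 show "inj em" by (rule inj)
 show "i \<notin> J - {l} ==> i \<noteq> j ==> ak i j = 0" for i j using iso[of i j] by (auto simp: ak_def)
qed

text \<open>The exponents agree row by row. At the newly frozen row of \<open>l\<close> the g-vector
  coordinate has to become minus a tropical value, which is \<open>gg_phz\<close> for a vanishing
  denominator exponent.\<close>

lemma XX_io:
 fixes x :: "'r => 'f::field"
 assumes w: "\<And>k. k \<in> J ==> w (em k) = BB k" and w': "\<And>r j. j \<noteq> l ==> w' r j = w r j" and g: "h \<in> LK'"
 shows "kj.XX w' x h = XX w x (io h)"
proof -
 have l: "io h \<in> lab" "dv (io h) l = 0" "io h \<noteq> (0, l)" using io(1)[OF g] by (auto simp: LK_def)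
 have "kj.hx w' r h = hx w r (io h)" for r
 proof (cases "r \<in> frz")
  case True
  hence "r \<in> kj.frz" by (auto simp: frz_def kj.frz_def)
  thus ?thesis using True phz_io[OF g, of "w' r" "w r"] w' by (simp add: hx_def kj.hx_def)
 next
  case False
  then obtain k where k: "k \<in> J" "r = em k" by (auto simp: frz_def)
  have ik: "inv em r = k" using k inj by simp
  show ?thesis
  proof (cases "k = l")
   case True
   have "r \<in> kj.frz" using k True by (auto simp: kj.frz_def)
   moreover have "gg l (io h) + phz (w (em l)) (io h) = 0"
    using gg_phz[OF l(1), of l] l w[OF lJ] by (simp add: BB_def yb_def)
   ultimately show ?thesis using False ik True k phz_io[OF g, of "w' r" "w r"] w' by (simp add: hx_def kj.hx_def)
  next
   case kl: False
   have "r \<notin> kj.frz" using k kl by (auto simp: kj.frz_def)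
   thus ?thesis using False ik dk_UU[of "dv (io h)" k] l kl io_dv[OF g]
    by (simp add: hx_def kj.hx_def gg_def dk.gg_def)
  qed
 qed
 moreover have "leval (kj.yh w' x) (dk.Fp h) = leval (yh w x) (Fp (io h))"
  unfolding Fp_io[OF g, symmetric]
 proof (rule leval_cong)
  fix m k assume "m \<in> keys (Fp (io h))"
  thus "kj.yh w' x k = yh w x k \<or> lookup m k = 0"
   using Fp_no_var[OF l(1,2)] w'[of k] by (cases "k = l") (auto simp: kj.yh_def yh_def kj.pw_def pw_def)
 qed
 ultimately show ?thesis by (simp add: kj.XX_def XX_def pw_def kj.pw_def)
qed

end

section \<open>Reachable seeds\<close>

definition newv :: "('n => 'r::finite) => 'n => ('r, 'n, 'f::field) seed => 'f" where
 "newv em k s = ((\<Prod>r\<in>UNIV. snd s r ^ nat (fst s r k)) + (\<Prod>r\<in>UNIV. snd s r ^ nat (- fst s r k))) / snd s (em k)"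

lemma prod_pos_part: "(\<Prod>i\<in>{i. (b i :: int) > 0}. x i ^ nat (b i)) = (\<Prod>i\<in>UNIV. (x (i::'r::finite) :: 'f::field) ^ nat (b i))"
 by (rule prod.mono_neutral_left) auto

lemma mutate_eq: "mutate em k s = (mutate_matrix em k (fst s), (snd s)(em k := newv em k s))"
 unfolding mutate_def newv_def Let_def using prod_pos_part[of "snd s" "\<lambda>i. fst s i k"] prod_pos_part[of "snd s" "\<lambda>i. - fst s i k"]
 by simp

lemma mutate_matrix_inv: "mutate_matrix em k (mutate_matrix em k b) = b"
proof (intro ext)
 fix i j
 show "mutate_matrix em k (mutate_matrix em k b) i j = b i j"
  by (auto simp: mutate_matrix_def sgn_if)
qed

lemma mutate_mutate:
 assumes "fst s (em k) k = 0" "snd s (em k) \<noteq> 0" "newv em k s \<noteq> 0"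
 shows "mutate em k (mutate em k s) = s"
proof -
 let ?A = "\<Prod>r\<in>UNIV. snd s r ^ nat (fst s r k)" and ?B = "\<Prod>r\<in>UNIV. snd s r ^ nat (- fst s r k)"
 have e: "mutate_matrix em k (fst s) r k = - fst s r k" for r by (simp add: mutate_matrix_def)
 have "(\<Prod>r\<in>UNIV. ((snd s)(em k := newv em k s)) r ^ nat (- fst s r k)) = ?B"
  "(\<Prod>r\<in>UNIV. ((snd s)(em k := newv em k s)) r ^ nat (fst s r k)) = ?A"
  using assms(1) by (auto intro!: prod.cong)
 hence "newv em k (mutate em k s) = (?B + ?A) / newv em k s"
  unfolding newv_def[of em k "mutate em k s"] by (simp add: mutate_eq e)
 also have "\<dots> = snd s (em k)" using assms(2,3) by (simp add: newv_def add.commute)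
 finally show ?thesis by (simp add: mutate_eq[of em k "mutate em k s"]) (simp add: mutate_eq mutate_matrix_inv)
qed

definition sk :: "('n => real) => ('n => 'r) => 'n set => ('r => 'n => int) => bool" where
 "sk d em J b \<longleftrightarrow> (\<forall>i\<in>J. \<forall>j\<in>J. d i * of_int (b (em i) j) = - (d j * of_int (b (em j) i)))"

lemma sk_sign:
 assumes "sk d em J b" "\<And>i. d i > 0" "i \<in> J" "j \<in> J"
 shows "b (em i) j > 0 \<longleftrightarrow> b (em j) i < 0" "b (em i) j = 0 \<longleftrightarrow> b (em j) i = 0" "b (em i) i = 0"
proof -
 have e: "d i * of_int (b (em i) j) = - (d j * of_int (b (em j) i))" "d i * of_int (b (em i) i) = - (d i * of_int (b (em i) i))"
  using assms(1,3,4) unfolding sk_def by blast+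
 have p: "d i > 0" "d j > 0" using assms by auto
 have "b (em i) j > 0 \<longleftrightarrow> d i * of_int (b (em i) j) > 0" using p by (simp add: zero_less_mult_iff)
 also have "\<dots> \<longleftrightarrow> d j * of_int (b (em j) i) < 0" unfolding e(1) by simp
 finally show "b (em i) j > 0 \<longleftrightarrow> b (em j) i < 0" using p by (simp add: mult_less_0_iff)
 have "b (em i) j = 0 \<longleftrightarrow> d i * of_int (b (em i) j) = 0" using p by simp
 also have "\<dots> \<longleftrightarrow> d j * of_int (b (em j) i) = 0" unfolding e(1) by simp
 finally show "b (em i) j = 0 \<longleftrightarrow> b (em j) i = 0" using p by simp
 show "b (em i) i = 0" using e(2) p by simp
qed

lemma sk_mutate:
 assumes "sk d em J b" "\<And>i. d i > 0" "inj em" "k \<in> J"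
 shows "sk d em J (mutate_matrix em k b)"
 unfolding sk_def
proof (intro ballI)
 fix i j assume ij: "i \<in> J" "j \<in> J"
 have e: "d i * of_int (b (em i) j) = - (d j * of_int (b (em j) i))"
  "d i * of_int (b (em i) k) = - (d k * of_int (b (em k) i))"
  "d j * of_int (b (em j) k) = - (d k * of_int (b (em k) j))" using assms(1,4) ij unfolding sk_def by blast+
 note s = sk_sign[OF assms(1,2), of _ k]
 have eq: "em i = em k \<longleftrightarrow> i = k" "em j = em k \<longleftrightarrow> j = k" using assms(3) by (auto dest: injD)
 show "d i * of_int (mutate_matrix em k b (em i) j) = - (d j * of_int (mutate_matrix em k b (em j) i))"
 proof (cases "i = k \<or> j = k")
  case True
  thus ?thesis using e by (auto simp: mutate_matrix_def eq)
 next
  case False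
  have "d i * of_int (sgn (b (em i) k) * max 0 (b (em i) k * b (em k) j)) = - (d j * of_int (sgn (b (em j) k) * max 0 (b (em j) k * b (em k) i)))"
  proof -
   have si: "b (em i) k > 0 \<longleftrightarrow> b (em k) i < 0" "b (em i) k = 0 \<longleftrightarrow> b (em k) i = 0"
    and sj: "b (em j) k > 0 \<longleftrightarrow> b (em k) j < 0" "b (em j) k = 0 \<longleftrightarrow> b (em k) j = 0"
    using s(1,2)[OF ij(1) assms(4)] s(1,2)[OF ij(2) assms(4)] by auto
   have m: "d i * of_int (b (em i) k * b (em k) j) = d j * of_int (b (em j) k * b (em k) i)"
    using arg_cong[OF e(2), of "\<lambda>x. x * of_int (b (em k) j)"] arg_cong[OF e(3), of "\<lambda>x. x * of_int (b (em k) i)"]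
    by (simp add: algebra_simps)
   consider "b (em i) k = 0 \<or> b (em k) j = 0" | "b (em i) k > 0" "b (em k) j > 0" | "b (em i) k < 0" "b (em k) j < 0"
    | "b (em i) k * b (em k) j < 0" by (metis linorder_neqE_linordered_idom mult_neg_pos mult_pos_neg)
   thus ?thesis
   proof cases
    case 1
    thus ?thesis using si sj by auto
   next
    case 2
    hence "b (em j) k < 0" "b (em k) i < 0" using si sj by linarith+
    thus ?thesis using 2 m by (simp add: max_def mult_nonneg_nonneg mult_nonpos_nonpos)
   next
    case 3
    hence "b (em j) k > 0" "b (em k) i > 0" using si sj by linarith+
    thus ?thesis using 3 m by (simp add: max_def mult_nonneg_nonneg mult_nonpos_nonpos)
   next
    case 4
    hence "b (em j) k * b (em k) i < 0" using si sj by (auto simp: mult_less_0_iff)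
    thus ?thesis using 4 by (simp add: max_def)
   qed
  qed
  thus ?thesis using e(1) False by (simp add: mutate_matrix_def eq distrib_left)
 qed
qed

lemma pr_axis: "pr m (axis r 1) = of_int (lookup m r)"
 by (simp add: pr_def axis_def if_distrib cong: if_cong)

lemma leval_upd:
 assumes "\<And>m. m \<in> keys q ==> lookup m r = e" "x r \<noteq> 0" "v \<noteq> 0"
 shows "leval (x(r := v)) q = (v / x r) powi e * leval x q"
proof -
 have "mon (x(r := v)) m = (v / x r) powi e * mon x m" if "m \<in> keys q" for m
 proof -
  have "mon (x(r := v)) m = v powi e * (\<Prod>i\<in>UNIV - {r}. x i powi lookup m i)"
   unfolding mon_def by (subst prod.remove[of UNIV r]) (auto simp: assms(1)[OF that] intro!: prod.cong)
  moreover have "mon x m = x r powi e * (\<Prod>i\<in>UNIV - {r}. x i powi lookup m i)"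
   unfolding mon_def by (subst prod.remove[of UNIV r]) (auto simp: assms(1)[OF that])
  ultimately show ?thesis using assms(2) by (simp add: power_int_divide_distrib)
 qed
 thus ?thesis unfolding leval_def lsum_def by (simp add: sum_distrib_left mult_ac)
qed

definition exch :: "('r::finite => int) => ('r, int) laurent" where
 "exch b = ymon (\<lambda>r. int (nat (b r))) + ymon (\<lambda>r. int (nat (- b r)))"

lemma newv_exch: "newv em k s = leval (snd s) (exch (\<lambda>r. fst s r k)) / snd s (em k)"
 by (simp add: newv_def exch_def leval_add leval_ymon del: int_nat_eq)

lemma exch_nz: "exch b \<noteq> (0 :: ('r::{finite,linorder}, int) laurent)"
 unfolding exch_def by (intro sfree_nz sfree_add sfree_ymon)

lemma newv_nz:
 fixes s :: "('r::{finite,linorder}, 'n, 'f::field) seed"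
 assumes "indep (snd s)" shows "newv em k s \<noteq> 0"
 using assms exch_nz[of "\<lambda>r. fst s r k"] indep_nz[OF assms] by (auto simp: newv_exch indep_def)

text \<open>The two monomials come from the positive and the negative part of the column, so the
  polynomial forgets only which is which.\<close>

lemma exch_inj:
 fixes b b' :: "'r::finite => int"
 assumes "exch b = exch b'"
 shows "b' = b \<or> b' = (\<lambda>r. - b r)"
proof -
 let ?p = "\<lambda>b. Abs_poly_mapping (\<lambda>r. int (nat (b r)))" and ?q = "\<lambda>b. Abs_poly_mapping (\<lambda>r. int (nat (- b r)))"
 have e: "single (?p b) (1::int) + single (?q b) 1 = single (?p b') 1 + single (?q b') 1"
  using assms by (simp add: exch_def ymon_def)
 have l: "(if ?p b = m then 1 else 0) + (if ?q b = m then 1 else 0) = (if ?p b' = m then 1 else 0) + (if ?q b' = m then 1 else (0::int))" for m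
  using arg_cong[OF e, of "\<lambda>f. lookup f m"] unfolding lookup_add lookup_single when_def .
 have d: "b r = lookup (?p b) r - lookup (?q b) r" for b :: "'r => int" and r
  unfolding lookup_vec by simp
 consider "?p b = ?p b'" "?q b = ?q b'" | "?p b = ?q b'" "?q b = ?p b'"
  using l[of "?p b"] l[of "?q b"] by (auto split: if_splits)
 thus ?thesis
 proof cases
  case 1
  have "b' = b"
  proof
   fix r show "b' r = b r" using d[of b r] d[of b' r] 1 by metis
  qed
  thus ?thesis ..
 next
  case 2
  have "b' = (\<lambda>r. - b r)"
  proof
   fix r
   have "b' r = lookup (?q b) r - lookup (?p b) r" using d[of b' r] 2 by metis
   thus "b' r = - b r" using d[of b r] by linarith
  qed
  thus ?thesis ..
 qed
qed

lemma part_sum: "part Y c (\<Sum>i\<in>S. f i) = (\<Sum>i\<in>S. part Y c (f i))"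
proof (induction S rule: infinite_finite_induct)
 case (insert i S)
 thus ?case by (simp add: part_add)
qed (simp_all add: part_def)

text \<open>Grade by the exponent of \<open>r\<close>: the substitution multiplies the piece of degree \<open>e\<close> by a power
 of the exchange polynomial, and turns its degree into \<open>-e\<close>.\<close>

lemma indep_upd:
 fixes x :: "'r::{finite,linorder} => 'f::field"
 assumes x: "indep x" and b: "b r = 0"
 shows "indep (x(r := leval x (exch b) / x r))"
 unfolding indep_def
proof (intro allI impI)
 fix p :: "('r, int) laurent"
 let ?v = "leval x (exch b) / x r" and ?P = "exch b"
 let ?x = "x(r := ?v)"
 note nz = indep_nz[OF x]
 assume p0: "leval ?x p = 0"
 have P: "leval x ?P \<noteq> 0" using x exch_nz[of b] by (auto simp: indep_def)
 hence v: "?v \<noteq> 0" using nz by simp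
 define S where "S = (\<lambda>m. lookup m r) ` keys p"
 have fin: "finite S" by (simp add: S_def)
 obtain N where N: "\<And>e. e \<in> S ==> 0 \<le> e + int N"
 proof (cases "S = {}")
  case False
  thus ?thesis using Min_le[OF fin] by (intro that[of "nat (- Min S)"]) force
 qed (use that in auto)
 let ?q = "\<lambda>e. part (axis r 1) (of_int e) p"
 have q: "lookup m r = e" if "m \<in> keys (?q e)" for m e
  using that by (auto simp: in_keys_iff lookup_part pr_axis split: if_splits)
 have psum: "p = (\<Sum>e\<in>S. ?q e)"
 proof (rule poly_mapping_eqI)
  fix m
  have "lookup (\<Sum>e\<in>S. ?q e) m = (\<Sum>e\<in>S. if lookup m r = e then lookup p m else 0)"
   by (simp add: lookup_sum lookup_part pr_axis)
  also have "\<dots> = lookup p m" using fin by (auto simp: S_def in_keys_iff)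
  finally show "lookup p m = lookup (\<Sum>e\<in>S. ?q e) m" ..
 qed
 \<comment> \<open>Writing \<open>P\<close> for the exchange polynomial, replacing
   \<open>x_r\<close> by \<open>P / x_r\<close> turns \<open>x_r^e\<close> into
   \<open>P^e x_r^(-2e)\<close> times \<open>x_r^e\<close>. The extra power \<open>N\<close> makes
   all exponents of \<open>P\<close> nonnegative.\<close>
 let ?w = "\<lambda>e i. if i = r then - 2 * e else (0::int)"
 let ?Q = "\<lambda>e. ?P ^ nat (e + int N) * (ymon (?w e) * ?q e)"
 have deg: "lookup m r = - e" if "m \<in> keys (?Q e)" for m e
 proof -
  have k: "m \<in> keys (f * g) ==> (\<And>m. m \<in> keys f ==> lookup m r = c) ==>
    (\<And>m. m \<in> keys g ==> lookup m r = c') ==> lookup m r = c + c'" for f g :: "('r, int) laurent" and m c c'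
   using keys_mult[of f g] by (force simp: lookup_add)
  have P0: "m \<in> keys ?P ==> lookup m r = 0" for m
   using Poly_Mapping.keys_add[of "ymon (\<lambda>r. int (nat (b r)))" "ymon (\<lambda>r. int (nat (- b r)))"] b
   by (auto simp: exch_def ymon_def)
  have "m \<in> keys (?P ^ n) ==> lookup m r = 0" for m n
  proof (induction n arbitrary: m)
   case 0
   thus ?case by (simp flip: single_one)
  next
   case (Suc n)
   thus ?case using k[of m ?P "?P ^ n" 0 0] P0 by simp
  qed
  moreover have "lookup m r = - 2 * e + e" if "m \<in> keys (ymon (?w e) * ?q e)" for m
   by (rule k[OF that]) (use q in \<open>auto simp: ymon_def\<close>)
  ultimately show ?thesis using k[OF that, of 0 "- 2 * e + e"] by simp
 qed
 have lev: "leval x (?Q e) = leval x ?P ^ N * leval ?x (?q e)" if "e \<in> S" for e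
 proof -
  have w: "leval x (ymon (?w e)) = x r powi (- 2 * e)"
  proof -
   have "leval x (ymon (?w e)) = (\<Prod>i\<in>UNIV. if i = r then x i powi (- 2 * e) else 1)"
    unfolding leval_ymon by (rule prod.cong) auto
   thus ?thesis by simp
  qed
  have "leval x ?P ^ nat (e + int N) = leval x ?P powi (e + int N)"
   using N[OF that] by (simp add: power_int_def)
  also have "\<dots> = leval x ?P powi e * leval x ?P ^ N" using P by (simp add: power_int_add)
  finally have pw: "leval x ?P ^ nat (e + int N) = leval x ?P powi e * leval x ?P ^ N" .
  have "leval x (?P ^ nat (e + int N)) = leval x ?P ^ nat (e + int N)" by (rule leval_power) (use nz in blast)
  hence "leval x (?Q e) = leval x ?P ^ N * (leval x ?P powi e * x r powi (- 2 * e) * leval x (?q e))"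
   by (simp add: leval_mult'[OF nz] w pw)
  also have "leval x ?P powi e * x r powi (- 2 * e) = (?v / x r) powi e"
  proof -
   have "x r powi (- 2 * e) = (x r powi (- 2)) powi e" by (rule power_int_mult)
   also have "x r powi (- 2) = inverse (x r * x r)" by (simp add: power_int_def power2_eq_square)
   finally have "leval x ?P powi e * x r powi (- 2 * e) = (leval x ?P * inverse (x r * x r)) powi e"
    by (simp only: power_int_mult_distrib)
   also have "leval x ?P * inverse (x r * x r) = ?v / x r" by (simp add: divide_inverse mult.assoc)
   finally show ?thesis .
  qed
  also have "(?v / x r) powi e * leval x (?q e) = leval ?x (?q e)"
   by (rule leval_upd[symmetric]) (use q nz v in auto)
  finally show ?thesis .
 qed
 have "leval x (\<Sum>e\<in>S. ?Q e) = leval x ?P ^ N * leval ?x p"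
  by (subst psum) (simp add: leval_sum lev sum_distrib_left)
 hence "(\<Sum>e\<in>S. ?Q e) = 0" using p0 x by (simp add: indep_def)
 hence z: "part (axis r 1) (of_int (- e)) (\<Sum>e\<in>S. ?Q e) = 0" for e by (simp add: part_def)
 have "?q e = 0" if e: "e \<in> S" for e
 proof -
  have pq: "part (axis r 1) (of_int (- e)) (?Q e') = (if e' = e then ?Q e else 0)" for e'
  proof (rule poly_mapping_eqI)
   fix m
   have "lookup (?Q e') m = 0 \<or> lookup m r = - e'" using deg[of m e'] by (auto simp: in_keys_iff simp del: keys_eq_empty)
   thus "lookup (part (axis r 1) (of_int (- e)) (?Q e')) m = lookup (if e' = e then ?Q e else 0) m"
    unfolding lookup_part pr_axis of_int_eq_iff by (cases "e' = e") auto
  qed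
  have "?Q e = 0" using z[of e] unfolding part_sum pq using e fin by simp
  moreover have "?P ^ nat (e + int N) \<noteq> 0" "ymon (?w e) \<noteq> 0" using exch_nz sfree_nz[OF sfree_ymon] by auto
  ultimately show ?thesis by auto
 qed
 thus "p = 0" using psum by simp
qed

lemma indep_mutate:
 fixes s :: "('r::{finite,linorder}, 'n, 'f::field) seed"
 assumes "indep (snd s)" "fst s (em k) k = 0"
 shows "indep (snd (mutate em k s))"
 using indep_upd[OF assms(1), of "\<lambda>r. fst s r k" "em k"] assms(2) by (simp add: mutate_eq newv_exch)

lemma indep_inj:
 fixes x :: "'r::finite => 'f::field"
 assumes "indep x" shows "inj x"
proof (rule injI)
 fix r r' assume e: "x r = x r'"
 let ?m = "\<lambda>r :: 'r. single (single r (1::int)) (1::int)"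
 have m: "leval x (?m r) = x r" for r
 proof -
  have "mon x (single r 1) = (\<Prod>i\<in>UNIV. if i = r then x i else 1)"
   unfolding mon_def by (rule prod.cong) (auto simp: lookup_single when_def)
  thus ?thesis using leval_single[of x "single r 1" 1] by simp
 qed
 have "leval x (?m r) = leval x (?m r')" by (simp only: m e)
 hence "?m r = ?m r'" by (rule indep_eq[OF assms])
 hence "lookup (?m r) (single r 1) = lookup (?m r') (single r 1)" by (simp only:)
 hence "single r (1::int) = single r' 1" by (simp add: lookup_single when_def split: if_splits)
 hence "lookup (single r (1::int)) r = lookup (single r' (1::int)) r" by (simp only:)
 thus "r = r'" by (simp add: lookup_single when_def split: if_splits)
qed

subsection \<open>Matching seeds with the same cluster\<close>

definition rp :: "('n => 'r) => ('n => 'n) => 'r => 'r" where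
 "rp em \<sigma> r = (if r \<in> range em then em (\<sigma> (inv em r)) else r)"

lemma rp_em: "inj em ==> rp em \<sigma> (em i) = em (\<sigma> i)" by (simp add: rp_def)

lemma bij_rp: assumes "inj em" "bij \<sigma>" shows "bij (rp em \<sigma>)"
proof (rule o_bij[of "rp em (inv \<sigma>)"])
 show "rp em (inv \<sigma>) \<circ> rp em \<sigma> = id" "rp em \<sigma> \<circ> rp em (inv \<sigma>) = id"
  using assms by (auto simp: fun_eq_iff rp_def bij_is_inj bij_is_surj surj_f_inv_f)
qed

text \<open>Columns are compared up to sign because an exchange polynomial does not see the
  sign.\<close>

definition mcol :: "('n => 'r) => ('n => 'n) => ('r => 'n => int) => ('r => 'n => int) => 'n => bool" where
 "mcol em \<sigma> b b' k \<longleftrightarrow> (\<exists>e\<in>{1, -1}. \<forall>r. b' (rp em \<sigma> r) (\<sigma> k) = e * b r k)"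

lemma newv_rp:
 fixes s s' :: "('r::finite, 'n, 'f::field) seed"
 assumes "inj em" "bij \<sigma>" "\<And>r. snd s' (rp em \<sigma> r) = snd s r"
 shows "newv em (\<sigma> k) s' = ((\<Prod>r\<in>UNIV. snd s r ^ nat (fst s' (rp em \<sigma> r) (\<sigma> k))) +
  (\<Prod>r\<in>UNIV. snd s r ^ nat (- fst s' (rp em \<sigma> r) (\<sigma> k)))) / snd s (em k)"
proof -
 have "(\<Prod>r\<in>UNIV. snd s' r ^ nat (e * fst s' r (\<sigma> k))) = (\<Prod>r\<in>UNIV. snd s r ^ nat (e * fst s' (rp em \<sigma> r) (\<sigma> k)))" for e
  using prod.reindex_bij_betw[OF bij_rp[OF assms(1,2)], of "\<lambda>r. snd s' r ^ nat (e * fst s' r (\<sigma> k))"] by (simp add: assms(3))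
 from this[of 1] this[of "- 1"] show ?thesis
  using assms(3)[of "em k"] by (simp add: newv_def rp_em[OF assms(1)])
qed

lemma match_mutate:
 fixes s s' :: "('r::finite, 'n, 'f::field) seed"
 assumes "inj em" "bij \<sigma>" "\<And>r. snd s' (rp em \<sigma> r) = snd s r" "mcol em \<sigma> (fst s) (fst s') k"
 shows "newv em (\<sigma> k) s' = newv em k s" "snd (mutate em (\<sigma> k) s') (rp em \<sigma> r) = snd (mutate em k s) r"
proof -
 obtain e :: int where "e = 1 \<or> e = - 1" "\<And>r. fst s' (rp em \<sigma> r) (\<sigma> k) = e * fst s r k"
  using assms(4) unfolding mcol_def by blast
 thus n: "newv em (\<sigma> k) s' = newv em k s"
  unfolding newv_rp[OF assms(1-3), of k] by (auto simp: newv_def add.commute)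
 show "snd (mutate em (\<sigma> k) s') (rp em \<sigma> r) = snd (mutate em k s) r"
  using assms(3)[of r] n inj_eq[OF bij_is_inj[OF bij_rp[OF assms(1,2)]], of r "em k"]
  by (simp add: mutate_eq rp_em[OF assms(1)])
qed

text \<open>If the columns \<open>j\<close> and \<open>k\<close> interact, the sign pattern of a
  skew-symmetrizable matrix forces both to carry the same sign; if not, mutation at \<open>k\<close>
  leaves column \<open>j\<close> unchanged.\<close>

lemma match_col:
 assumes "inj em" "bij \<sigma>" "mcol em \<sigma> b b' k" "mcol em \<sigma> b b' j" "j \<noteq> k"
  and "b (em k) j \<noteq> 0 ==> b (em k) j * b (em j) k < 0" "b' (em (\<sigma> k)) (\<sigma> j) \<noteq> 0 ==> b' (em (\<sigma> k)) (\<sigma> j) * b' (em (\<sigma> j)) (\<sigma> k) < 0"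
 shows "mcol em \<sigma> (mutate_matrix em k b) (mutate_matrix em (\<sigma> k) b') j"
proof -
 obtain e f :: int where e: "e = 1 \<or> e = - 1" "\<And>r. b' (rp em \<sigma> r) (\<sigma> k) = e * b r k"
  and f: "f = 1 \<or> f = - 1" "\<And>r. b' (rp em \<sigma> r) (\<sigma> j) = f * b r j"
  using assms(3,4) unfolding mcol_def by blast
 have rk: "rp em \<sigma> r = em (\<sigma> k) \<longleftrightarrow> r = em k" for r
  using inj_eq[OF bij_is_inj[OF bij_rp[OF assms(1,2)]], of r "em k"] by (simp add: rp_em[OF assms(1)])
 have sj: "\<sigma> j \<noteq> \<sigma> k" using inj_eq[OF bij_is_inj[OF assms(2)], of j k] assms(5) by simp
 have kj: "b' (em (\<sigma> k)) (\<sigma> j) = f * b (em k) j" "b' (em (\<sigma> j)) (\<sigma> k) = e * b (em j) k"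
  using f(2)[of "em k"] e(2)[of "em j"] rp_em[OF assms(1)] by simp_all
 have ef: "b (em k) j = 0 \<or> e = f"
  using assms(6,7) e(1) f(1) unfolding kj by (cases "b (em k) j = 0") auto
 have "mutate_matrix em (\<sigma> k) b' (rp em \<sigma> r) (\<sigma> j) = f * mutate_matrix em k b r j" for r
 proof (cases "r = em k")
  case True
  thus ?thesis using rk f(2)[of r] by (simp add: mutate_matrix_def)
 next
  case False
  have 1: "mutate_matrix em (\<sigma> k) b' (rp em \<sigma> r) (\<sigma> j) = f * b r j + sgn (e * b r k) * max 0 (e * b r k * (f * b (em k) j))"
   using rk False sj by (simp only: mutate_matrix_def kj e(2) f(2) simp_thms if_False)
  have 2: "mutate_matrix em k b r j = b r j + sgn (b r k) * max 0 (b r k * b (em k) j)"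
   using False assms(5) by (simp only: mutate_matrix_def simp_thms if_False)
  show ?thesis
  proof (cases "b (em k) j = 0")
   case False
   hence "e = f" using ef by simp
   thus ?thesis unfolding 1 2 using f(1) by (elim disjE) (simp_all add: algebra_simps)
  qed (simp add: 1 2)
 qed
 thus ?thesis unfolding mcol_def using f(1) by auto
qed

lemma mcol_newv:
 fixes s s' :: "('r::{finite,linorder}, 'n, 'f::field) seed"
 assumes "inj em" "bij \<sigma>" "\<And>r. snd s' (rp em \<sigma> r) = snd s r" "indep (snd s)" "newv em (\<sigma> k) s' = newv em k s"
 shows "mcol em \<sigma> (fst s) (fst s') k"
proof -
 let ?b = "\<lambda>r. fst s r k" and ?b' = "\<lambda>r. fst s' (rp em \<sigma> r) (\<sigma> k)"
 have "newv em (\<sigma> k) s' = leval (snd s) (exch ?b') / snd s (em k)"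
  unfolding newv_rp[OF assms(1-3)] by (simp add: exch_def leval_add leval_ymon del: int_nat_eq)
 hence "leval (snd s) (exch ?b') = leval (snd s) (exch ?b)"
  using assms(5) indep_nz[OF assms(4), of "em k"] by (simp add: newv_exch)
 hence "exch ?b = exch ?b'" using indep_eq[OF assms(4)] by metis
 from exch_inj[OF this] show ?thesis
 proof
  assume "?b' = ?b"
  thus ?thesis unfolding mcol_def by (intro bexI[of _ 1]) (auto simp: fun_eq_iff)
 next
  assume "?b' = (\<lambda>r. - ?b r)"
  thus ?thesis unfolding mcol_def by (intro bexI[of _ "- 1"]) (auto simp: fun_eq_iff)
 qed
qed

text \<open>Mutations are restricted to \<open>J\<close>, so that the seeds reached in a link are
  reached in the whole diagram as well.\<close>

inductive_set rea :: "('n => 'r::finite) => 'n set => ('r, 'n, 'f::field) seed => ('r, 'n, 'f) seed set"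
 for em J s where
 rea_init: "s \<in> rea em J s"
| rea_step: "s' \<in> rea em J s ==> k \<in> J ==> mutate em k s' \<in> rea em J s"

lemma rea_trans: "s'' \<in> rea em J s' ==> s' \<in> rea em J s ==> s'' \<in> rea em J s"
 by (induction rule: rea.induct) (auto intro: rea_step)

lemma rea_mono: "s' \<in> rea em J s ==> J \<subseteq> J' ==> s' \<in> rea em J' s"
 by (induction rule: rea.induct) (auto intro: rea.intros)

lemma rea_fold: "set l \<subseteq> J ==> fold (mutate em) l s \<in> rea em J s"
 by (induction l rule: rev_induct) (auto intro: rea.intros)

lemma rea_frozen: "s' \<in> rea em J s ==> r \<notin> em ` J ==> snd s' r = snd s r"
 by (induction rule: rea.induct) (auto simp: mutate_eq)

lemma rea_UNIV: "rea em UNIV s = reachable_seeds em s"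
proof
 show "rea em UNIV s \<subseteq> reachable_seeds em s"
 proof
  fix s' assume "s' \<in> rea em UNIV s"
  thus "s' \<in> reachable_seeds em s" by induction (auto intro: reachable_seeds.intros)
 qed
 show "reachable_seeds em s \<subseteq> rea em UNIV s"
 proof
  fix s' assume "s' \<in> reachable_seeds em s"
  thus "s' \<in> rea em UNIV s" by induction (auto intro: rea.intros)
 qed
qed

context jseed begin

definition ok :: "('r, 'n, 'f::field) seed => bool" where "ok s \<longleftrightarrow> sk d em J (fst s) \<and> indep (snd s)"

lemma ok_mutate: assumes "ok s" "k \<in> J" shows "ok (mutate em k s)"
proof -
 have s: "sk d em J (fst s)" "indep (snd s)" using assms by (simp_all add: ok_def)
 have "fst s (em k) k = 0" by (rule sk_sign(3)[OF s(1) d_pos assms(2,2)])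
 thus ?thesis
  using sk_mutate[OF s(1) d_pos inj assms(2)] indep_mutate[OF s(2)] by (simp add: ok_def mutate_eq)
qed

lemma ok_rea: "s' \<in> rea em J s ==> ok s ==> ok s'"
 by (induction rule: rea.induct) (auto intro: ok_mutate)

lemma ok_inv: assumes "ok s" "k \<in> J" shows "mutate em k (mutate em k s) = s"
proof -
 have s: "sk d em J (fst s)" "indep (snd s)" using assms by (simp_all add: ok_def)
 show ?thesis
  by (rule mutate_mutate) (use sk_sign(3)[OF s(1) d_pos assms(2,2)] indep_nz[OF s(2)] newv_nz[OF s(2)] in auto)
qed

text \<open>A seed with the prescribed acyclic mutable part, where the separation formula can
  start.\<close>

definition base :: "('r, 'n, 'f::field) seed => bool" where "base s \<longleftrightarrow> acyc s \<and> indep (snd s)"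

lemma BB_skew: "d i * of_int (BB i j) = - (d j * of_int (BB j i))"
 using symm[of i j] E_asym[of i j] by (auto simp: BB_def exchange_matrix_def)

lemma base_ok: assumes "base s" shows "ok s"
 unfolding ok_def sk_def
proof (intro conjI ballI)
 show "indep (snd s)" using assms by (simp add: base_def)
 fix i j assume "i \<in> J" "j \<in> J"
 hence "fst s (em i) j = BB i j" "fst s (em j) i = BB j i" using assms by (auto simp: base_def acyc_def)
 thus "d i * of_int (fst s (em i) j) = - (d j * of_int (fst s (em j) i))" using BB_skew[of i j] by simp
qed

definition XS :: "('r, 'n, 'f::field) seed => nat \<times> 'n => 'f" where "XS s = XX (rowJ (fst s)) (snd s)"

definition VV :: "('r, 'n, 'f::field) seed => 'f set" where "VV s = XS s ` labJ"

definition vc :: "('r, 'n, 'f::field) seed => 'f => 'f => bool" where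
 "vc s v v' \<longleftrightarrow> (\<exists>g\<in>labJ. \<exists>g'\<in>labJ. v = XS s g \<and> v' = XS s g' \<and> cc g g' = 0)"

lemma XS_eq: "base s ==> g \<in> labJ ==> g' \<in> labJ ==> XS s g = XS s g' \<longleftrightarrow> g = g'"
 unfolding XS_def base_def using XX_inj[of "snd s" "rowJ (fst s)" g g'] rowJ_acyc by blast

lemma vc_XS: "base s ==> g \<in> labJ ==> g' \<in> labJ ==> vc s (XS s g) (XS s g') \<longleftrightarrow> cc g g' = 0"
 unfolding vc_def by (auto simp: XS_eq)

lemma vc_sym: "vc s v v' ==> vc s v' v"
 unfolding vc_def using cc_zero_sym by blast

lemma vc_VV: "vc s v v' ==> v \<in> VV s" "vc s v v' ==> v' \<in> VV s"
 unfolding vc_def VV_def by blast+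

lemma vc_refl: "v \<in> VV s ==> vc s v v"
 unfolding vc_def VV_def by force

lemma labJ_0: "j \<in> J ==> (0, j) \<in> labJ" by (simp add: labJ_def)

lemma XS_0: "j \<in> J ==> XS s (0, j) = snd s (em j)" by (simp add: XS_def XX_0)

lemma vc_init: "i \<in> J ==> j \<in> J ==> vc s (snd s (em i)) (snd s (em j))"
 unfolding vc_def by (intro bexI[of _ "(0, i)"] bexI[of _ "(0, j)"]) (auto simp: XS_0 labJ_0 cc_def)

definition jl :: "'n list" where "jl = (SOME l. topo l \<and> set l = J)"

lemma jl: "topo jl" "set jl = J" using someI_ex[OF topo_exists[of J]] by (auto simp: jl_def)

definition swp :: "('r, 'n, 'f::field) seed => ('r, 'n, 'f) seed" where "swp s = fold (mutate em) jl s"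

lemma swp_rea: "swp s \<in> rea em J s" using rea_fold[of jl J] jl by (simp add: swp_def)

lemma swp_base: assumes "base s" shows "base (swp s)"
 using ok_rea[OF swp_rea base_ok[OF assms]] sweep(1)[of s jl] jl assms by (simp add: base_def ok_def swp_def)

lemma swp_XX:
 assumes "base s" "j \<in> J" "t \<le> Suc (rr j)"
 shows "snd ((swp ^^ t) s) (em j) = XS s (lbl t j)"
 unfolding XS_def
proof (rule sweeps(4)[where S = "\<lambda>t. (swp ^^ t) s"])
 show "acyc s" "nonvan (rowJ (fst s)) (snd s)" using assms indep_nonvan by (auto simp: base_def)
 fix t show "\<exists>l. topo l \<and> set l = J \<and> (swp ^^ Suc t) s = fold (mutate em) l ((swp ^^ t) s)"
  using jl by (intro exI[of _ jl]) (simp add: swp_def)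
qed (use assms in auto)

lemma tu_labJ: "g \<in> labJ ==> tu g \<in> labJ"
 using tu_lab[of g] star_J by (cases g rule: tu.cases) (auto simp: labJ_def)

lemma ti_labJ: "g \<in> labJ ==> ti g \<in> labJ"
 using ti_lab[of g] star_J by (auto simp: labJ_def ti_def)

lemma XS_swp:
 assumes "base s" "h \<in> labJ"
 shows "XS (swp s) (tu h) = XS s h"
proof -
 obtain t j where tj: "tu h = (t, j)" by force
 have l: "(t, j) \<in> lab" "j \<in> J" "t \<le> rr j" using tu_labJ[OF assms(2)] by (auto simp: labJ_def tj lab_def)
 have "XS (swp s) (lbl t j) = snd ((swp ^^ t) (swp s)) (em j)"
  using swp_XX[OF swp_base[OF assms(1)] l(2), of t] l by simp
 also have "\<dots> = snd ((swp ^^ Suc t) s) (em j)" by (simp only: funpow_Suc_right comp_apply)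
 also have "\<dots> = XS s (lbl (Suc t) j)" using swp_XX[OF assms(1) l(2), of "Suc t"] l by simp
 finally have e: "XS (swp s) (lbl t j) = XS s (lbl (Suc t) j)" .
 have "tu (lbl (Suc t) j) = tu h" using tu_lbl[of "Suc t" j] l by (simp add: tj lbl_def)
 hence "lbl (Suc t) j = h" using tu_inj lbl_lab assms(2) by (simp add: labJ_def)
 thus ?thesis using e l by (simp add: tj lbl_def)
qed

text \<open>A sweep relabels the variables by \<open>tu\<close>, under which the compatibility
  degree is invariant.\<close>

lemma VV_swp: assumes "base s" shows "VV (swp s) = VV s" "vc (swp s) = vc s"
proof -
 have img: "labJ = tu ` labJ"
 proof
  show "labJ \<subseteq> tu ` labJ"
  proof
   fix h assume g: "h \<in> labJ"
   hence "h = tu (ti h)" using tu_ti by (simp add: labJ_def)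
   thus "h \<in> tu ` labJ" using ti_labJ[OF g] by (rule image_eqI)
  qed
 qed (use tu_labJ in blast)
 have "VV (swp s) = XS (swp s) ` tu ` labJ" using img by (simp add: VV_def)
 also have "\<dots> = (\<lambda>h. XS s h) ` labJ"
  unfolding image_image by (rule image_cong[OF refl]) (rule XS_swp[OF assms])
 finally show "VV (swp s) = VV s" by (simp add: VV_def)
 show "vc (swp s) = vc s"
 proof (intro ext)
  fix v v'
  have "vc (swp s) v v' \<longleftrightarrow> (\<exists>h\<in>tu ` labJ. \<exists>h'\<in>tu ` labJ. v = XS (swp s) h \<and> v' = XS (swp s) h' \<and> cc h h' = 0)"
   unfolding vc_def using img by simp
  also have "\<dots> \<longleftrightarrow> (\<exists>h\<in>labJ. \<exists>h'\<in>labJ. v = XS (swp s) (tu h) \<and> v' = XS (swp s) (tu h') \<and> cc (tu h) (tu h') = 0)"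
   by blast
  also have "\<dots> \<longleftrightarrow> vc s v v'"
   unfolding vc_def by (intro bex_cong refl) (simp add: XS_swp[OF assms] cc_tu labJ_def)
  finally show "vc (swp s) v v' = vc s v v'" .
 qed
qed

lemma swp_pow:
 assumes "base s"
 shows "base ((swp ^^ t) s) \<and> (swp ^^ t) s \<in> rea em J s \<and> VV ((swp ^^ t) s) = VV s \<and> vc ((swp ^^ t) s) = vc s"
proof (induction t)
 case (Suc t)
 let ?s = "(swp ^^ t) s"
 have b: "base ?s" "?s \<in> rea em J s" "VV ?s = VV s" "vc ?s = vc s" using Suc by auto
 show ?case using swp_base[OF b(1)] VV_swp[OF b(1)] rea_trans[OF swp_rea b(2)] b(3,4) by simp
qed (simp add: assms rea_init)

text \<open>Every cluster variable is initial in some swept seed, so its link is the link of an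
  initial variable. The seed is presented as \<open>swp s'\<close> because the argument in rank two
  also looks at the seed before the sweep.\<close>

lemma base_at:
 assumes "base s" "v \<in> VV s"
 obtains s' l where "base s'" "s' \<in> rea em J s" "VV s' = VV s" "vc s' = vc s" "l \<in> J" "v = snd (swp s') (em l)"
proof -
 obtain t j where g: "v = XS s (t, j)" "(t, j) \<in> labJ" using assms(2) unfolding VV_def by force
 have "\<exists>u i. u \<le> rr i \<and> i \<in> J \<and> lbl (Suc u) i = (t, j)"
 proof (cases t)
  case 0
  thus ?thesis using g(2) star_J[of j] star_star[of j]
   by (intro exI[of _ "rr (star0 j)"] exI[of _ "star0 j"]) (simp add: lbl_def labJ_def)
 next
  case (Suc u)
  thus ?thesis using g(2) by (intro exI[of _ u] exI[of _ j]) (simp add: lbl_def labJ_def lab_def)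
 qed
 then obtain u i where ui: "u \<le> rr i" "i \<in> J" "lbl (Suc u) i = (t, j)" by blast
 have "v = snd ((swp ^^ Suc u) s) (em i)" using swp_XX[OF assms(1) ui(2), of "Suc u"] ui g by simp
 thus ?thesis using swp_pow[OF assms(1), of u] ui(2) by (intro that[of "(swp ^^ u) s" i]) simp_all
qed

lemma VV_1:
 assumes "J = {k}" "base s"
 shows "VV s = {snd s (em k), newv em k s}" "snd s (em k) \<noteq> newv em k s"
proof -
 have "jseed a E d em {}"
 proof unfold_locales
  show "i \<noteq> j ==> a i j = 0" for i j using iso[of i j] iso[of j i] zero_sym[of j i] assms(1) by (cases "i = k") auto
 qed (rule inj)
 hence r: "rr k = 1" using jseed.star_iso(2) by blast
 have "labJ = {(0, k), (1, k)}" unfolding labJ_def lab_def using r assms(1) by auto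
 moreover have jk: "jl = [k]"
 proof -
  have "set jl = {k}" "distinct jl" using jl assms by (auto simp: topo_def)
  thus ?thesis by (metis distinct.simps(2) distinct_singleton list.set_intros(1) list.set_intros(2) neq_Nil_conv set_empty2 insert_not_empty singletonD)
 qed
 have "XS s (1, k) = newv em k s"
 proof -
  have "k \<in> J" by (simp add: assms(1))
  moreover have "swp s = mutate em k s" by (simp only: swp_def jk fold_simps)
  ultimately show ?thesis using swp_XX[OF assms(2), of k 1] r by (simp add: lbl_def mutate_eq)
 qed
 moreover have "XS s (0, k) = snd s (em k)" by (rule XS_0) (simp add: assms(1))
 moreover have "XS s (0, k) \<noteq> XS s (1, k)"
  using XS_eq[OF assms(2), of "(0, k)" "(1, k)"] calculation(1) by simp
 ultimately show "VV s = {snd s (em k), newv em k s}" "snd s (em k) \<noteq> newv em k s" by (simp_all add: VV_def)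
qed

lemma rt_J: assumes "g \<in> lab" shows "snd g \<in> J \<longleftrightarrow> (\<forall>i. i \<notin> J \<longrightarrow> rt g i = 0)"
proof
 assume "snd g \<in> J"
 thus "\<forall>i. i \<notin> J \<longrightarrow> rt g i = 0" using dv_outside[OF assms] by (auto simp: rt_def yb_def)
next
 assume r: "\<forall>i. i \<notin> J \<longrightarrow> rt g i = 0"
 show "snd g \<in> J"
 proof (rule ccontr)
  assume n: "snd g \<notin> J"
  hence "fst g = 0 \<or> fst g = 1" using star_iso(2)[OF n] assms by (cases g) (auto simp: lab_def)
  hence "rt g (snd g) \<noteq> 0"
   using assms by (cases g) (auto simp: rt_0 rt_pos ev_def D_1 PP_same)
  thus False using r n by blast
 qed
qed

text \<open>Compatible sets of cluster variables: almost complete ones have at most two completions (\<open>AU\<close>),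
 complete ones are reachable clusters (\<open>FR\<close>), and reachable clusters as well as their exchanges are
 compatible (\<open>TH\<close>). All three are proved by induction on \<open>card J\<close>, using the links.\<close>

definition pc :: "('r, 'n, 'f::field) seed => 'f set => bool" where
 "pc s C \<longleftrightarrow> C \<subseteq> VV s \<and> (\<forall>u\<in>C. \<forall>v\<in>C. vc s u v)"

definition AU :: "('r, 'n, 'f::field) seed => bool" where
 "AU s \<longleftrightarrow> (\<forall>C u v w. pc s C \<and> Suc (card C) = card J \<and> {u, v, w} \<subseteq> VV s - C \<and>
   (\<forall>z\<in>C. vc s z u \<and> vc s z v \<and> vc s z w) \<longrightarrow> u = v \<or> u = w \<or> v = w)"

definition FR :: "('r, 'n, 'f::field) seed => bool" where
 "FR s \<longleftrightarrow> (\<forall>C. pc s C \<and> card C = card J \<longrightarrow> (\<exists>s'\<in>rea em J s. (\<lambda>i. snd s' (em i)) ` J = C))"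

definition CL :: "('r, 'n, 'f::field) seed => ('r, 'n, 'f) seed => bool" where
 "CL s s' \<longleftrightarrow> (\<forall>i\<in>J. \<forall>j\<in>J. vc s (snd s' (em i)) (snd s' (em j)))"

definition NB :: "('r, 'n, 'f::field) seed => ('r, 'n, 'f) seed => 'n => bool" where
 "NB s s' j \<longleftrightarrow> newv em j s' \<in> VV s \<and> newv em j s' \<noteq> snd s' (em j) \<and>
   (\<forall>i\<in>J - {j}. vc s (snd s' (em i)) (newv em j s'))"

definition TH :: "('r, 'n, 'f::field) seed => bool" where
 "TH s \<longleftrightarrow> (\<forall>s'\<in>rea em J s. CL s s' \<and> (\<forall>j\<in>J. NB s s' j))"

lemma finite_VV: "finite (VV s)" using finite_lab by (simp add: VV_def labJ_def)

end

section \<open>The link of an initial variable as a seed of smaller rank\<close>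

context jlink begin

lemma k_base: "base s ==> kj.base s"
 using E_J by (auto simp: base_def kj.base_def acyc_def kj.acyc_def BB_def kj.BB_def exchange_matrix_def ak_def Ek_def)

lemma k_labJ: "kj.labJ \<subseteq> LK'" by (auto simp: kj.labJ_def LK'_def)

lemma k_XS: assumes "base s" "g \<in> kj.labJ" shows "kj.XS s g = XS s (io g)"
 unfolding kj.XS_def XS_def
proof (rule XX_io)
 show "rowJ (fst s) (em k) = BB k" if "k \<in> J" for k
  by (rule rowJ_acyc) (use assms(1) that in \<open>auto simp: base_def\<close>)
 show "kj.rowJ (fst s) r j = rowJ (fst s) r j" if "j \<noteq> l" for r j using that by (simp add: kj.rowJ_def rowJ_def)
qed (use assms k_labJ in blast)

lemma k_io: "io ` kj.labJ = labJ \<inter> LK"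
proof (intro subset_antisym subsetI)
 fix v assume "v \<in> io ` kj.labJ"
 then obtain h where g: "h \<in> kj.labJ" "v = io h" by blast
 have g': "h \<in> LK'" "h \<in> dk.lab" "snd h \<in> J - {l}" using g k_labJ by (auto simp: kj.labJ_def)
 have "\<forall>i. i \<notin> J \<longrightarrow> rt v i = 0" using kj.rt_J[OF g'(2)] g' io(2)[OF g'(1)] by (auto simp: g(2))
 thus "v \<in> labJ \<inter> LK" using rt_J[of v] io(1)[OF g'(1)] g(2) by (simp add: labJ_def LK_def)
next
 fix v assume w: "v \<in> labJ \<inter> LK"
 hence "v \<in> io ` LK'" using bij_betw_imp_surj_on[OF io_bij] by simp
 then obtain h where g: "h \<in> LK'" "v = io h" by blast
 have "\<forall>i. i \<notin> J - {l} \<longrightarrow> dk.rt h i = 0"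
  using rt_J[of v] w rt_l[OF g(1)] io(2)[OF g(1)] by (auto simp: labJ_def g(2))
 hence "h \<in> kj.labJ" using kj.rt_J[of h] g(1) by (simp add: kj.labJ_def LK'_def)
 thus "v \<in> io ` kj.labJ" using g(2) by blast
qed

text \<open>By \<open>k_io\<close> the labels of the cut diagram correspond to the labels in
  \<open>LK\<close>, and membership in \<open>LK\<close> means compatibility with
  \<open>(0, l)\<close>.\<close>

lemma k_VV: assumes "base s" shows "kj.VV s = {v \<in> VV s. v \<noteq> snd s (em l) \<and> vc s (snd s (em l)) v}"
proof -
 have "kj.VV s = XS s ` io ` kj.labJ"
  unfolding kj.VV_def image_image by (rule image_cong[OF refl]) (rule k_XS[OF assms])
 also have "\<dots> = XS s ` (labJ \<inter> LK)" by (simp only: k_io)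
 also have "\<dots> = {v \<in> VV s. v \<noteq> snd s (em l) \<and> vc s (snd s (em l)) v}"
 proof (intro subset_antisym subsetI)
  fix v assume "v \<in> XS s ` (labJ \<inter> LK)"
  then obtain h where g: "h \<in> labJ" "h \<in> LK" "v = XS s h" by blast
  thus "v \<in> {v \<in> VV s. v \<noteq> snd s (em l) \<and> vc s (snd s (em l)) v}"
   using XS_eq[OF assms g(1) labJ_0[OF lJ]] vc_XS[OF assms labJ_0[OF lJ] g(1)]
   unfolding XS_0[OF lJ] by (simp add: VV_def LK_def dv_def)
 next
  fix v assume v: "v \<in> {v \<in> VV s. v \<noteq> snd s (em l) \<and> vc s (snd s (em l)) v}"
  then obtain h where g: "h \<in> labJ" "v = XS s h" by (auto simp: VV_def)
  have "h \<in> LK"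
   using v vc_XS[OF assms labJ_0[OF lJ] g(1)] g
   unfolding XS_0[OF lJ] by (auto simp: LK_def dv_def labJ_def XS_0[OF lJ])
  thus "v \<in> XS s ` (labJ \<inter> LK)" using g by blast
 qed
 finally show ?thesis .
qed

lemma k_vc: assumes "base s" "v \<in> kj.VV s" "v' \<in> kj.VV s" shows "kj.vc s v v' \<longleftrightarrow> vc s v v'"
proof -
 obtain h h' where g: "h \<in> kj.labJ" "v = kj.XS s h" and g': "h' \<in> kj.labJ" "v' = kj.XS s h'"
  using assms(2,3) by (auto simp: kj.VV_def)
 have l: "io h \<in> labJ" "io h' \<in> labJ" using k_io g(1) g'(1) by blast+
 have "kj.vc s v v' \<longleftrightarrow> dk.cc h h' = 0" using kj.vc_XS[OF k_base[OF assms(1)] g(1) g'(1)] g g' by simp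
 also have "\<dots> \<longleftrightarrow> cc (io h) (io h') = 0" using io_cc[OF subsetD[OF k_labJ g(1)] subsetD[OF k_labJ g'(1)]] by simp
 also have "\<dots> \<longleftrightarrow> vc s v v'" using vc_XS[OF assms(1) l] k_XS[OF assms(1)] g g' by simp
 finally show ?thesis .
qed

lemma k_pc:
 assumes "base s" "pc s C" "snd s (em l) \<in> C"
 shows "kj.pc s (C - {snd s (em l)})"
proof -
 have "C - {snd s (em l)} \<subseteq> kj.VV s" unfolding k_VV[OF assms(1)] using assms(2,3) by (auto simp: pc_def)
 thus ?thesis using k_vc[OF assms(1)] assms(2) unfolding kj.pc_def pc_def by blast
qed

lemma AU_step:
 assumes b: "base s" and "kj.AU s" and C: "pc s C" "snd s (em l) \<in> C" "Suc (card C) = card J"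
  "{u, v, w} \<subseteq> VV s - C" "\<forall>z\<in>C. vc s z u \<and> vc s z v \<and> vc s z w"
 shows "u = v \<or> u = w \<or> v = w"
proof -
 let ?C = "C - {snd s (em l)}"
 have "finite C" by (rule finite_subset[OF _ finite_VV[of s]]) (use C(1) in \<open>simp add: pc_def\<close>)
 hence "Suc (card ?C) = card C" using C(2) by (rule card_Suc_Diff1)
 moreover have "Suc (card (J - {l})) = card J" using lJ by (intro card_Suc_Diff1) simp_all
 ultimately have c: "Suc (card ?C) = card (J - {l})" using C(3) by simp
 have s: "{u, v, w} \<subseteq> kj.VV s - ?C" unfolding k_VV[OF b] using C by auto
 have p: "kj.pc s ?C" by (rule k_pc[OF b C(1,2)])
 have "kj.vc s z x" if "z \<in> ?C" "x \<in> {u, v, w}" for z x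
  using k_vc[OF b, of z x] s p C(5) that unfolding kj.pc_def by blast
 thus ?thesis by (intro assms(2)[unfolded kj.AU_def, rule_format, of ?C] conjI p c s) blast
qed

lemma FR_step:
 assumes b: "base s" and "kj.FR s" and C: "pc s C" "snd s (em l) \<in> C" "card C = card J"
 shows "\<exists>s'\<in>rea em (J - {l}) s. (\<lambda>i. snd s' (em i)) ` J = C"
proof -
 let ?C = "C - {snd s (em l)}"
 have "finite C" by (rule finite_subset[OF _ finite_VV[of s]]) (use C(1) in \<open>simp add: pc_def\<close>)
 hence "card ?C = card (J - {l})" using C(2,3) lJ by (simp add: card_Diff_singleton)
 then obtain s' where s': "s' \<in> rea em (J - {l}) s" "(\<lambda>i. snd s' (em i)) ` (J - {l}) = ?C"
  using assms(2) k_pc[OF b C(1,2)] unfolding kj.FR_def by blast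
 have "snd s' (em l) = snd s (em l)" by (rule rea_frozen[OF s'(1)]) auto
 moreover have "(\<lambda>i. snd s' (em i)) ` J = insert (snd s' (em l)) ((\<lambda>i. snd s' (em i)) ` (J - {l}))"
  using lJ by blast
 ultimately have "(\<lambda>i. snd s' (em i)) ` J = C" using s'(2) C(2) by (simp add: insert_absorb)
 thus ?thesis using s'(1) by blast
qed

end

context jlink begin

lemma k_NB:
 assumes b: "base s" and n: "kj.NB s s' i" and l: "snd s' (em l) = snd s (em l)"
 shows "NB s s' i"
proof -
 have v: "newv em i s' \<in> kj.VV s" using n by (simp add: kj.NB_def)
 show ?thesis
  unfolding NB_def
 proof (intro conjI ballI)
  show "newv em i s' \<in> VV s" using v unfolding k_VV[OF b] by blast
  show "newv em i s' \<noteq> snd s' (em i)" using n by (simp add: kj.NB_def)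
  fix j assume j: "j \<in> J - {i}"
  show "vc s (snd s' (em j)) (newv em i s')"
  proof (cases "j = l")
   case True
   thus ?thesis using v l unfolding k_VV[OF b] by simp
  next
   case False
   hence "kj.vc s (snd s' (em j)) (newv em i s')" using n j by (simp add: kj.NB_def)
   thus ?thesis using k_vc[OF b kj.vc_VV(1) v] by blast
  qed
 qed
qed

end

section \<open>Exchanges in seeds with equal clusters, and the inductions on the rank\<close>

context jseed begin

lemma ok_inj: assumes "ok s" shows "inj (\<lambda>i. snd s (em i))"
 using inj_compose[OF indep_inj inj, of "snd s"] assms by (simp add: ok_def comp_def)

lemma match_perm:
 fixes s s' :: "('r, 'n, 'f::field) seed"
 assumes "ok s" "ok s'" "(\<lambda>i. snd s (em i)) ` J = (\<lambda>i. snd s' (em i)) ` J" "\<And>r. r \<notin> em ` J ==> snd s' r = snd s r"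
 obtains \<sigma> where "bij \<sigma>" "\<And>i. i \<in> J ==> \<sigma> i \<in> J" "\<And>r. snd s' (rp em \<sigma> r) = snd s r"
proof -
 let ?f = "\<lambda>i. snd s (em i)" and ?g = "\<lambda>i. snd s' (em i)"
 have inj_f: "inj ?f" by (rule ok_inj[OF assms(1)])
 define \<sigma> where "\<sigma> i = (if i \<in> J then inv_into J ?g (?f i) else i)" for i
 have s: "\<sigma> i \<in> J" "?g (\<sigma> i) = ?f i" if "i \<in> J" for i
 proof -
  have "?f i \<in> ?g ` J" using that assms(3) by blast
  from inv_into_into[OF this] f_inv_into_f[OF this] show "\<sigma> i \<in> J" "?g (\<sigma> i) = ?f i"
   using that by (simp_all add: \<sigma>_def)
 qed
 have out: "\<sigma> i = i" if "i \<notin> J" for i using that by (simp add: \<sigma>_def)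
 have "inj \<sigma>"
 proof (rule injI)
  fix i j assume e: "\<sigma> i = \<sigma> j"
  show "i = j"
  proof (cases "i \<in> J"; cases "j \<in> J")
   assume "i \<in> J" "j \<in> J"
   hence "?f i = ?f j" using s[of i] s[of j] e by simp
   thus ?thesis by (rule injD[OF inj_f])
  qed (use s out e in metis)+
 qed
 hence b: "bij \<sigma>" by (simp add: bij_def finite_UNIV_inj_surj)
 have "snd s' (rp em \<sigma> r) = snd s r" for r
 proof (cases "r \<in> em ` J")
  case True
  thus ?thesis using s(2) rp_em[OF inj] by auto
 next
  case False
  have "rp em \<sigma> r = r"
  proof (cases "r \<in> range em")
   case True
   then obtain i where "r = em i" by blast
   thus ?thesis using False out[of i] rp_em[OF inj, of \<sigma> i] by auto
  qed (simp add: rp_def)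
  thus ?thesis using assms(4)[OF False] by simp
 qed
 thus ?thesis using that b s(1) by blast
qed

lemma ok_distinct:
 assumes "ok s" "k \<in> J" "i \<noteq> k"
 shows "newv em k s \<noteq> snd s (em i)"
proof -
 have "inj (snd (mutate em k s))" by (rule indep_inj) (use ok_mutate[OF assms(1,2)] in \<open>simp add: ok_def\<close>)
 hence "snd (mutate em k s) (em k) \<noteq> snd (mutate em k s) (em i)" using assms(3) by (simp add: inj_eq)
 thus ?thesis using assms(3) by (simp add: mutate_eq)
qed

lemma ok_sign:
 assumes "ok s" "k \<in> J" "j \<in> J" "fst s (em k) j \<noteq> 0"
 shows "fst s (em k) j * fst s (em j) k < 0"
proof -
 have s: "sk d em J (fst s)" using assms(1) by (simp add: ok_def)
 note t = sk_sign[OF s d_pos]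
 show ?thesis using t(1)[OF assms(2,3)] t(1)[OF assms(3,2)] assms(4) by (auto simp: mult_less_0_iff)
qed

text \<open>By uniqueness of exchanges the columns of two seeds with the same cluster agree up to sign, so
 they continue to have the same neighbours after a mutation.\<close>

lemma NB_transfer:
 fixes s s' :: "('r, 'n, 'f::field) seed"
 assumes au: "AU s0" and cl: "CL s0 s" and o: "ok s" "ok s'"
  and \<sigma>: "bij \<sigma>" "\<And>i. i \<in> J ==> \<sigma> i \<in> J" and v: "\<And>r. snd s' (rp em \<sigma> r) = snd s r"
  and jk: "j \<in> J" "k \<in> J" "j \<noteq> k" and nb: "NB s0 s j" "NB s0 s k" "NB s0 s' (\<sigma> j)" "NB s0 s' (\<sigma> k)"
  and m: "NB s0 (mutate em (\<sigma> k) s') (\<sigma> j)"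
 shows "NB s0 (mutate em k s) j"
proof -
 let ?f = "\<lambda>i. snd s (em i)"
 have vi: "snd s' (em (\<sigma> i)) = ?f i" for i using v[of "em i"] by (simp add: rp_em[OF inj])
 have ne: "\<sigma> i \<noteq> \<sigma> i'" if "i \<noteq> i'" for i i' using that bij_is_inj[OF \<sigma>(1)] by (simp add: inj_eq)
 have inj_f: "inj ?f" by (rule ok_inj[OF o(1)])
 have mc: "mcol em \<sigma> (fst s) (fst s') c" if c: "c \<in> J" "NB s0 s c" "NB s0 s' (\<sigma> c)" for c
 proof (rule mcol_newv[OF inj \<sigma>(1) v])
  show "indep (snd s)" using o by (simp add: ok_def)
  let ?C = "?f ` (J - {c})"
  have "?f c = newv em c s \<or> ?f c = newv em (\<sigma> c) s' \<or> newv em c s = newv em (\<sigma> c) s'"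
  proof (rule au[unfolded AU_def, rule_format, of ?C], intro conjI)
   show "pc s0 ?C" using cl vc_VV unfolding pc_def CL_def by blast
   have "card ?C = card (J - {c})" by (rule card_image) (use inj_f in \<open>auto simp: inj_on_def inj_def\<close>)
   thus "Suc (card ?C) = card J" using c(1) card_Suc_Diff1[of J c] by simp
   have "?f c \<in> VV s0" using cl c(1) vc_VV unfolding CL_def by blast
   moreover have "newv em c s \<in> VV s0" "newv em (\<sigma> c) s' \<in> VV s0" using c by (auto simp: NB_def)
   moreover have "?f c \<notin> ?C" using inj_f by (auto simp: inj_def)
   moreover have "newv em c s \<notin> ?C" using ok_distinct[OF o(1) c(1)] by blast
   moreover have "newv em (\<sigma> c) s' \<notin> ?C"
   proof
    assume "newv em (\<sigma> c) s' \<in> ?C"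
    then obtain i where "i \<noteq> c" "newv em (\<sigma> c) s' = ?f i" by blast
    thus False using ok_distinct[OF o(2) \<sigma>(2)[OF c(1)] ne[of i c]] vi[of i] by simp
   qed
   ultimately show "{?f c, newv em c s, newv em (\<sigma> c) s'} \<subseteq> VV s0 - ?C"
    by (simp only: insert_subset Diff_iff empty_subsetI simp_thms)
   show "\<forall>z\<in>?C. vc s0 z (?f c) \<and> vc s0 z (newv em c s) \<and> vc s0 z (newv em (\<sigma> c) s')"
   proof
    fix z assume "z \<in> ?C"
    then obtain i where i: "i \<in> J" "i \<noteq> c" "z = ?f i" by blast
    have "vc s0 (snd s' (em (\<sigma> i))) (newv em (\<sigma> c) s')"
     using c(3) \<sigma>(2)[OF i(1)] ne[OF i(2)] by (simp add: NB_def)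
    thus "vc s0 z (?f c) \<and> vc s0 z (newv em c s) \<and> vc s0 z (newv em (\<sigma> c) s')"
     using cl c(1,2) i vi[of i] by (simp add: CL_def NB_def)
   qed
  qed
  thus "newv em (\<sigma> c) s' = newv em c s" using c(2,3) vi[of c] by (auto simp: NB_def)
 qed
 have mk: "mcol em \<sigma> (fst s) (fst s') k" and mj: "mcol em \<sigma> (fst s) (fst s') j"
  using mc jk nb by blast+
 have v': "snd (mutate em (\<sigma> k) s') (rp em \<sigma> r) = snd (mutate em k s) r" for r
  by (rule match_mutate(2)[OF inj \<sigma>(1) v mk])
 have "mcol em \<sigma> (fst (mutate em k s)) (fst (mutate em (\<sigma> k) s')) j"
  unfolding mutate_eq fst_conv
  by (rule match_col[OF inj \<sigma>(1) mk mj jk(3) ok_sign[OF o(1) jk(2,1)] ok_sign[OF o(2) \<sigma>(2)[OF jk(2)] \<sigma>(2)[OF jk(1)]]])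
 hence n: "newv em (\<sigma> j) (mutate em (\<sigma> k) s') = newv em j (mutate em k s)"
  by (rule match_mutate(1)[OF inj \<sigma>(1) v'])
 have vi': "snd (mutate em (\<sigma> k) s') (em (\<sigma> i)) = snd (mutate em k s) (em i)" for i
  using v'[of "em i"] by (simp add: rp_em[OF inj])
 show ?thesis
  unfolding NB_def
 proof (intro conjI ballI)
  show "newv em j (mutate em k s) \<in> VV s0" "newv em j (mutate em k s) \<noteq> snd (mutate em k s) (em j)"
   using m n vi'[of j] by (auto simp: NB_def)
  fix i assume i: "i \<in> J - {j}"
  hence "vc s0 (snd (mutate em (\<sigma> k) s') (em (\<sigma> i))) (newv em (\<sigma> j) (mutate em (\<sigma> k) s'))"
   using m \<sigma>(2)[of i] ne[of i j] unfolding NB_def by blast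
  thus "vc s0 (snd (mutate em k s) (em i)) (newv em j (mutate em k s))" by (simp only: n vi')
 qed
qed

lemma CL_mutate: assumes "CL s0 s" "NB s0 s k" shows "CL s0 (mutate em k s)"
 unfolding CL_def
proof (intro ballI)
 fix i j assume ij: "i \<in> J" "j \<in> J"
 have v: "vc s0 (newv em k s) (newv em k s)" by (rule vc_refl) (use assms(2) in \<open>simp add: NB_def\<close>)
 have n: "vc s0 (snd s (em i)) (newv em k s)" if "i \<in> J" "i \<noteq> k" for i using assms(2) that by (simp add: NB_def)
 show "vc s0 (snd (mutate em k s) (em i)) (snd (mutate em k s) (em j))"
  using assms(1) ij v n[of i] n[of j] vc_sym[OF n[of j]] by (simp add: mutate_eq CL_def)
qed

lemma NB_back: assumes "ok s" "CL s0 s" "NB s0 s k" "k \<in> J" shows "NB s0 (mutate em k s) k"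
proof -
 have "snd (mutate em k (mutate em k s)) (em k) = snd s (em k)" using ok_inv[OF assms(1,4)] by simp
 hence n: "newv em k (mutate em k s) = snd s (em k)" by (simp add: mutate_eq[of em k "mutate em k s"])
 show ?thesis
  unfolding NB_def n using assms(2-4) vc_VV(1)[of s0 "snd s (em k)" "snd s (em k)"] by (auto simp: CL_def NB_def mutate_eq)
qed

text \<open>In rank two the link of a variable says nothing about exchanging this variable itself.
  But leaving \<open>swp s'\<close> through \<open>m\<close> stays on the belt of sweeps: it begins
  the next sweep or undoes the last mutation of this one.\<close>

lemma NB_belt:
 fixes s' :: "('r, 'n, 'c::field) seed"
 assumes b: "base s'" and J: "J = {l, m}" "l \<noteq> m"
 shows "NB s' (mutate em m (swp s')) l"
proof -
 have lm: "l \<in> J" "m \<in> J" by (simp_all add: J)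
 have ne: "XS s (1, l) \<noteq> snd s (em l)" if "base s" for s :: "('r, 'n, 'c) seed"
  using XS_eq[OF that, of "(1, l)" "(0, l)"] lm rr_ge_1[of l] XS_0[OF lm(1), of s] by (simp add: labJ_def lab_def)
 have x1: "snd (swp s) (em l) = XS s (1, l)" if "base s" for s :: "('r, 'n, 'c) seed"
  using swp_XX[OF that lm(1), of 1] rr_ge_1[of l] by (simp add: lbl_def)
 have inV: "snd s (em i) \<in> VV s" if "i \<in> J" for s :: "('r, 'n, 'c) seed" and i using vc_VV(1)[OF vc_init[OF that that]] .
 have "set jl = {l, m}" "distinct jl" using jl J by (auto simp: topo_def)
 hence "length jl = 2" using distinct_card[of jl] J(2) by simp
 then obtain x y where "jl = [x, y]" by (auto simp: length_Suc_conv numeral_2_eq_2)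
 then consider "jl = [m, l]" | "jl = [l, m]" using \<open>set jl = {l, m}\<close> \<open>distinct jl\<close> by (auto simp: doubleton_eq_iff)
 thus ?thesis
 proof cases
  case 1
  let ?s1 = "swp s'" let ?s2 = "swp ?s1"
  have b1: "base ?s1" by (rule swp_base[OF b])
  have e: "?s2 = mutate em l (mutate em m ?s1)" unfolding swp_def[of "swp s'"] 1 by simp
  have n: "newv em l (mutate em m ?s1) = snd ?s2 (em l)" unfolding e by (simp add: mutate_eq[of em l])
  have o: "snd (mutate em m ?s1) (em m) = snd ?s2 (em m)" "snd (mutate em m ?s1) (em l) = snd ?s1 (em l)"
   unfolding e using J(2) by (simp_all add: mutate_eq)
  have V: "VV ?s2 = VV s'" "vc ?s2 = vc s'" using VV_swp[OF b1] VV_swp[OF b] by simp_all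
  show ?thesis
   unfolding NB_def n
  proof (intro conjI ballI)
   show "snd ?s2 (em l) \<in> VV s'" using inV[OF lm(1), of ?s2] V by simp
   show "snd ?s2 (em l) \<noteq> snd (mutate em m ?s1) (em l)" unfolding o x1[OF b1] by (rule ne[OF b1])
   fix i assume "i \<in> J - {l}"
   hence "i = m" by (auto simp: J)
   thus "vc s' (snd (mutate em m ?s1) (em i)) (snd ?s2 (em l))" using vc_init[OF lm(2,1), of ?s2] V o by simp
  qed
 next
  case 2
  have s1: "swp s' = mutate em m (mutate em l s')" unfolding swp_def 2 by simp
  have ol: "ok (mutate em l s')" using ok_mutate[OF base_ok[OF b] lm(1)] .
  have e: "mutate em m (swp s') = mutate em l s'" unfolding s1 by (rule ok_inv[OF ol lm(2)])
  have "snd (mutate em l (mutate em l s')) (em l) = snd s' (em l)" using ok_inv[OF base_ok[OF b] lm(1)] by simp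
  hence n: "newv em l (mutate em l s') = snd s' (em l)" by (simp add: mutate_eq[of em l "mutate em l s'"])
  have o: "snd (mutate em l s') (em m) = snd s' (em m)" using J(2) by (simp add: mutate_eq)
  have x: "snd (mutate em l s') (em l) = XS s' (1, l)"
   unfolding x1[OF b, symmetric] s1 using J(2) by (simp add: mutate_eq[of em m])
  show ?thesis
   unfolding NB_def e n
  proof (intro conjI ballI)
   show "snd s' (em l) \<in> VV s'" by (rule inV[OF lm(1)])
   show "snd s' (em l) \<noteq> snd (mutate em l s') (em l)" unfolding x using ne[OF b] by simp
   fix i assume "i \<in> J - {l}"
   hence "i = m" by (auto simp: J)
   thus "vc s' (snd (mutate em l s') (em i)) (snd s' (em l))" using vc_init[OF lm(2,1), of s'] o by simp
  qed
 qed
qed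

lemma rea_1: assumes "s' \<in> rea em {m} s" "ok s" "m \<in> J" shows "s' = s \<or> s' = mutate em m s"
 using assms(1) by induction (use ok_inv[OF assms(2,3)] in auto)

lemma jlinkI: "l \<in> J ==> jlink a E d em J l" by unfold_locales

end

text \<open>A member of \<open>C\<close> is made initial by sweeping, and its link has smaller rank.
  In rank one there are only two variables.\<close>

theorem AU_all:
 assumes "jseed a E d em J" "jseed.base a E em J s"
 shows "jseed.AU a E em J s"
 using assms
proof (induction "card J" arbitrary: a E J s rule: less_induct)
 case less
 interpret jseed a E d em J by (rule less.prems)
 show ?case
  unfolding AU_def
 proof (intro allI impI, elim conjE)
  fix C u v w
  assume C: "pc s C" "Suc (card C) = card J" "{u, v, w} \<subseteq> VV s - C" "\<forall>z\<in>C. vc s z u \<and> vc s z v \<and> vc s z w"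
  show "u = v \<or> u = w \<or> v = w"
  proof (cases "C = {}")
   case True
   then obtain k where "J = {k}" using C(2) card_1_singletonE[of J] by (metis One_nat_def card.empty)
   hence "VV s = {snd s (em k), newv em k s}" by (rule VV_1(1)[OF _ less.prems(2)])
   thus ?thesis using C(3) by auto
  next
   case False
   then obtain z where z: "z \<in> C" by blast
   hence "z \<in> VV s" using C(1) by (auto simp: pc_def)
   from base_at[OF less.prems(2) this] obtain s' l where s': "base s'" "VV s' = VV s" "vc s' = vc s" "l \<in> J" "z = snd (swp s') (em l)"
    by metis
   interpret jlink a E d em J l by (rule jlinkI[OF s'(4)])
   have b: "base (swp s')" by (rule swp_base[OF s'(1)])
   have V: "VV (swp s') = VV s" "vc (swp s') = vc s" using VV_swp[OF s'(1)] s' by simp_all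
   have "card (J - {l}) < card J" by (rule card_Diff1_less[OF finite s'(4)])
   hence "kj.AU (swp s')" by (rule less.hyps[OF _ kj.jseed_axioms k_base[OF b]])
   thus ?thesis by (rule AU_step[OF b, of C u v w]) (use C z s'(5) V in \<open>auto simp: pc_def\<close>)
  qed
 qed
qed

text \<open>Sweep until a member of \<open>C\<close> is initial; by induction the rest of
  \<open>C\<close> is reached by mutations that keep this variable.\<close>

theorem FR_all:
 assumes "jseed a E d em J" "jseed.base a E em J s"
 shows "jseed.FR a E em J s"
 using assms
proof (induction "card J" arbitrary: a E J s rule: less_induct)
 case less
 interpret jseed a E d em J by (rule less.prems)
 show ?case
  unfolding FR_def
 proof (intro allI impI, elim conjE)
  fix C assume C: "pc s C" "card C = card J"
  show "\<exists>s'\<in>rea em J s. (\<lambda>i. snd s' (em i)) ` J = C"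
  proof (cases "C = {}")
   case True
   hence "J = {}" using C(2) by simp
   thus ?thesis using True by (intro bexI[of _ s] rea_init) simp
  next
   case False
   then obtain z where z: "z \<in> C" by blast
   hence "z \<in> VV s" using C(1) by (auto simp: pc_def)
   from base_at[OF less.prems(2) this] obtain s' l where s': "base s'" "s' \<in> rea em J s" "VV s' = VV s" "vc s' = vc s" "l \<in> J" "z = snd (swp s') (em l)"
    by metis
   interpret jlink a E d em J l by (rule jlinkI[OF s'(5)])
   have b: "base (swp s')" by (rule swp_base[OF s'(1)])
   have V: "VV (swp s') = VV s" "vc (swp s') = vc s" using VV_swp[OF s'(1)] s' by simp_all
   have "card (J - {l}) < card J" by (rule card_Diff1_less[OF finite s'(5)])
   hence "kj.FR (swp s')" by (rule less.hyps[OF _ kj.jseed_axioms k_base[OF b]])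
   hence "\<exists>s''\<in>rea em (J - {l}) (swp s'). (\<lambda>i. snd s'' (em i)) ` J = C"
    by (rule FR_step[OF b]) (use C z s'(6) V in \<open>auto simp: pc_def\<close>)
   then obtain s'' where s'': "s'' \<in> rea em (J - {l}) (swp s')" "(\<lambda>i. snd s'' (em i)) ` J = C" by blast
   have "s'' \<in> rea em J s" using rea_trans[OF rea_mono[OF s''(1)] rea_trans[OF swp_rea s'(2)]] by blast
   thus ?thesis using s''(2) by blast
  qed
 qed
qed

text \<open>Along a mutation path the current seed \<open>s'\<close> is replaced by a seed
  \<open>s2\<close> with the same cluster, reached inside a link. There the exchanges are known from
  smaller rank, and \<open>NB_transfer\<close> brings them back to \<open>s'\<close>.\<close>

theorem TH_all:
 fixes s :: "('r::{finite,linorder}, 'n::{finite,linorder}, 'f::field) seed"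
 assumes "jseed a E d em J" "jseed.base a E em J s"
 shows "jseed.TH a E em J s"
 using assms
proof (induction "card J" arbitrary: a E J s rule: less_induct)
 case less
 interpret jseed a E d em J by (rule less.prems)
 note b0 = less.prems(2)
 have NB_base: "NB s1 s1 j" if b: "base s1" and j: "j \<in> J" for s1 :: "('r, 'n, 'f) seed" and j
 proof (cases "J = {j}")
  case True
  show ?thesis unfolding NB_def VV_1(1)[OF True b] using VV_1(2)[OF True b] True by auto
 next
  case False
  then obtain l where l: "l \<in> J" "l \<noteq> j" using j by blast
  interpret jlink a E d em J l by (rule jlinkI[OF l(1)])
  have "card (J - {l}) < card J" by (rule card_Diff1_less[OF finite l(1)])
  hence "kj.TH s1" by (rule less.hyps[OF _ kj.jseed_axioms k_base[OF b]])
  hence "kj.NB s1 s1 j" using j l rea_init unfolding kj.TH_def by blast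
  thus ?thesis by (rule k_NB[OF b]) simp
 qed
 have au: "AU s" by (rule AU_all[OF less.prems])
 have step: "NB s (mutate em k s') j"
  if s': "s' \<in> rea em J s" "CL s s'" "\<And>i. i \<in> J ==> NB s s' i" and jk: "j \<in> J" "k \<in> J" "j \<noteq> k" for s' j k
 proof -
  have os': "ok s'" by (rule ok_rea[OF s'(1) base_ok[OF b0]])
  \<comment> \<open>The link is taken at a variable away from both directions if there is one. With
    only two directions it has to be the link of the variable at \<open>j\<close>.\<close>
  obtain l' where l': "l' \<in> J" "l' \<noteq> k" "l' = j \<longrightarrow> J = {j, k}" using jk by blast
  have "snd s' (em l') \<in> VV s" using s'(2) l'(1) vc_VV(1) unfolding CL_def by blast
  from base_at[OF b0 this] obtain s0 l where s0: "base s0" "s0 \<in> rea em J s" "VV s0 = VV s" "vc s0 = vc s" "l \<in> J" "snd s' (em l') = snd (swp s0) (em l)"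
   by metis
  let ?s1 = "swp s0"
  interpret jlink a E d em J l by (rule jlinkI[OF s0(5)])
  have b: "base ?s1" by (rule swp_base[OF s0(1)])
  have V: "VV ?s1 = VV s" "vc ?s1 = vc s" using VV_swp[OF s0(1)] s0 by simp_all
  have r1: "?s1 \<in> rea em J s" by (rule rea_trans[OF swp_rea s0(2)])
  let ?C = "(\<lambda>i. snd s' (em i)) ` J"
  have inj_f: "inj (\<lambda>i. snd s' (em i))" by (rule ok_inj[OF os'])
  have "\<exists>s2\<in>rea em (J - {l}) ?s1. (\<lambda>i. snd s2 (em i)) ` J = ?C"
  proof (rule FR_step[OF b FR_all[OF kj.jseed_axioms k_base[OF b]]])
   show "pc ?s1 ?C" using s'(2) vc_VV unfolding pc_def CL_def V by blast
   show "snd ?s1 (em l) \<in> ?C" using s0(6) l'(1) by (metis imageI)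
   show "card ?C = card J" by (rule card_image) (use inj_f in \<open>auto simp: inj_on_def inj_def\<close>)
  qed
  then obtain s2 where s2: "s2 \<in> rea em (J - {l}) ?s1" "?C = (\<lambda>i. snd s2 (em i)) ` J" by metis
  have r2: "s2 \<in> rea em J s" using rea_trans[OF rea_mono[OF s2(1)] r1] by blast
  have os2: "ok s2" by (rule ok_rea[OF r2 base_ok[OF b0]])
  have fz: "snd s2 r = snd s' r" if "r \<notin> em ` J" for r
   using rea_frozen[OF r2 that] rea_frozen[OF s'(1) that] by simp
  obtain \<sigma> where \<sigma>: "bij \<sigma>" "\<And>i. i \<in> J ==> \<sigma> i \<in> J" "\<And>r. snd s2 (rp em \<sigma> r) = snd s' r"
   using match_perm[OF os' os2 s2(2) fz] by blast
  have l2: "snd s2 (em l) = snd ?s1 (em l)" by (rule rea_frozen[OF s2(1)]) auto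
  have "snd s2 (em (\<sigma> l')) = snd s2 (em l)"
   using \<sigma>(3)[of "em l'"] s0(6) l2 by (simp add: rp_em[OF inj])
  hence sl: "\<sigma> l' = l"
   using indep_inj[of "snd s2"] os2 by (auto simp: ok_def dest: injD)
  have ne: "\<sigma> i \<noteq> \<sigma> i'" if "i \<noteq> i'" for i i' using that bij_is_inj[OF \<sigma>(1)] by (simp add: inj_eq)
  have sk: "\<sigma> k \<in> J - {l}" using \<sigma>(2)[OF jk(2)] ne[OF l'(2)] sl by auto
  have r3: "mutate em (\<sigma> k) s2 \<in> rea em (J - {l}) ?s1" by (rule rea_step[OF s2(1) sk])
  have l3: "snd (mutate em (\<sigma> k) s2) (em l) = snd ?s1 (em l)" by (rule rea_frozen[OF r3]) auto
  have c: "NB s = NB ?s1" by (intro ext) (simp add: NB_def V)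
  have all: "NB s s2 (\<sigma> j) \<and> NB s s2 (\<sigma> k) \<and> NB s (mutate em (\<sigma> k) s2) (\<sigma> j)"
  proof (cases "l' = j")
   case False
   have sj: "\<sigma> j \<in> J - {l}" using \<sigma>(2)[OF jk(1)] ne[OF False] sl by auto
   have "card (J - {l}) < card J" by (rule card_Diff1_less[OF finite s0(5)])
   hence "kj.TH ?s1" by (rule less.hyps[OF _ kj.jseed_axioms k_base[OF b]])
   hence "kj.NB ?s1 s2 (\<sigma> j)" "kj.NB ?s1 s2 (\<sigma> k)" "kj.NB ?s1 (mutate em (\<sigma> k) s2) (\<sigma> j)"
    using s2(1) r3 sj sk unfolding kj.TH_def by blast+
   thus ?thesis unfolding c using k_NB[OF b _ l2] k_NB[OF b _ l3] by blast
  next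
   case True
   hence J: "J = {l, \<sigma> k}" "l \<noteq> \<sigma> k" "\<sigma> j = l" and m: "J - {l} = {\<sigma> k}"
    using l' sl sk s0(5) \<sigma>(2)[OF jk(2)] jk(3) ne[OF jk(3)] card_seteq[of J "{l, \<sigma> k}"] by auto
   let ?t = "mutate em (\<sigma> k) ?s1"
   have ok1: "ok ?s1" by (rule base_ok[OF b])
   have skJ: "\<sigma> k \<in> J" using sk by simp
   have n1: "NB ?s1 ?s1 l" "NB ?s1 ?s1 (\<sigma> k)" using NB_base[OF b] s0(5) skJ by blast+
   have cl1: "CL ?s1 ?s1" unfolding CL_def by (intro ballI vc_init)
   have n2: "NB ?s1 ?t (\<sigma> k)" by (rule NB_back[OF ok1 cl1 n1(2) skJ])
   have n3: "NB ?s1 ?t l" using NB_belt[OF s0(1) J(1,2)] VV_swp[OF s0(1)] by (simp add: NB_def)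
   have tt: "mutate em (\<sigma> k) ?t = ?s1" by (rule ok_inv[OF ok1 skJ])
   \<comment> \<open>The link has rank one, so only the two seeds joined by the mutation at
     \<open>\<sigma> k\<close> are reachable in it.\<close>
   have "s2 = ?s1 \<or> s2 = ?t" using rea_1[OF s2(1)[unfolded m] ok1 skJ] .
   thus ?thesis unfolding c J(3) using n1 n2 n3 tt by auto
  qed
  show ?thesis
   by (rule NB_transfer[OF au s'(2) os' os2 \<sigma>(1,2,3) jk s'(3)[OF jk(1)] s'(3)[OF jk(2)]]) (use all in blast)+
 qed
 have "CL s s' \<and> (\<forall>j\<in>J. NB s s' j)" if "s' \<in> rea em J s" for s'
  using that
 proof (induction rule: rea.induct)
  case rea_init
  have "CL s s" unfolding CL_def by (intro ballI vc_init)
  thus ?case using NB_base[OF b0] by blast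
 next
  case (rea_step s' k)
  have os': "ok s'" by (rule ok_rea[OF rea_step(1) base_ok[OF b0]])
  have cl: "CL s s'" and nb: "\<And>i. i \<in> J ==> NB s s' i" using rea_step by blast+
  have "NB s (mutate em k s') j" if "j \<in> J" for j
  proof (cases "j = k")
   case True
   thus ?thesis using NB_back[OF os' cl nb[OF rea_step(2)] rea_step(2)] by simp
  next
   case False
   thus ?thesis using step[OF rea_step(1) cl nb that rea_step(2)] by blast
  qed
  thus ?case using CL_mutate[OF cl nb[OF rea_step(2)]] by blast
 qed
 thus ?case by (simp add: TH_def)
qed

section \<open>The definitions in terms of labels\<close>

locale useed = jseed a E d em UNIV for a :: "'n::{finite,linorder} => 'n => int" and E d and em :: "'n => 'r::{finite,linorder}"
begin

text \<open>The initial segments of linear extensions.\<close>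

definition clo :: "'n list => bool" where "clo l \<longleftrightarrow> topo l \<and> (\<forall>k\<in>set l. \<forall>j. E j k \<longrightarrow> j \<in> set l)"

lemma clo_snoc: "clo l ==> k \<notin> set l ==> (\<And>j. E j k ==> j \<in> set l) ==> clo (l @ [k])"
 unfolding clo_def topo_def by (auto simp: sorted_wrt_append)

lemma source_clo:
 fixes s :: "('r, 'n, 'f::field) seed"
 assumes "acyc s" "clo l" "k \<notin> set l"
 shows "is_source em (fst (fold (mutate em) l s)) k \<longleftrightarrow> (\<forall>j. E j k \<longrightarrow> j \<in> set l)"
proof -
 obtain m where m: "topo m" "set m = - set l" using topo_exists[of "- set l"] by blast
 have "topo (l @ m)" using m assms(2) unfolding clo_def topo_def by (auto simp: sorted_wrt_append)
 hence b: "fst (fold (mutate em) l s) (em j) k = BB j k * (if j \<in> set l then -1 else 1)" for j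
  using swept[OF assms(1), of l m, unfolded swept_def, THEN conjunct1] m(2) assms(3) by auto
 have sgn: "(BB j k > 0 \<longleftrightarrow> E j k) \<and> (BB j k < 0 \<longleftrightarrow> E k j)" for j
 proof -
  consider "E j k" | "E k j" | "\<not> E j k" "\<not> E k j" by blast
  thus ?thesis
  proof cases
   case 1
   thus ?thesis using BB_eq(1)[OF 1] wt_pos_iff[of j k] E_asym[OF 1] by simp
  next
   case 2
   thus ?thesis using BB_eq(2)[OF 2] wt_pos_iff[of j k] E_asym[OF 2] by simp
  qed (simp add: BB_eq(3))
 qed
 have "\<not> E k j" if "j \<in> set l" for j using assms(2,3) that by (auto simp: clo_def)
 thus ?thesis unfolding is_source_def b using sgn by (auto split: if_splits)
qed

lemma source_sequence_clo:
 fixes s :: "('r, 'n, 'f::field) seed"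
 assumes "acyc s"
 shows "clo l ==> distinct (l @ ys) ==> source_sequence em (fold (mutate em) l s) ys \<longleftrightarrow> clo (l @ ys)"
proof (induction ys arbitrary: l)
 case (Cons k ys)
 have k: "k \<notin> set l" using Cons.prems by auto
 note src = source_clo[OF assms Cons.prems(1) k]
 show ?case
 proof (cases "\<forall>j. E j k \<longrightarrow> j \<in> set l")
  case True
  hence "clo (l @ [k])" using clo_snoc[OF Cons.prems(1) k] by blast
  thus ?thesis using Cons.IH[of "l @ [k]"] Cons.prems(2) src True by simp
 next
  case False
  then obtain j where j: "E j k" "j \<notin> set l" by blast
  have "\<not> clo (l @ k # ys)"
  proof
   assume c: "clo (l @ k # ys)"
   hence "j \<in> set ys" using j E_neq[OF j(1)] by (auto simp: clo_def)
   thus False using c j(1) by (auto simp: clo_def topo_def sorted_wrt_append)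
  qed
  thus ?thesis using src False by simp
 qed
qed simp

lemma sweep_topo:
 fixes s :: "('r, 'n, 'f::field) seed"
 assumes "acyc s"
 shows "\<exists>l. topo l \<and> set l = UNIV \<and> sweep em s = fold (mutate em) l s"
proof -
 have c: "clo []" by (simp add: clo_def topo_def)
 have e: "source_sequence em s ys \<longleftrightarrow> topo ys" if "distinct ys" "set ys = UNIV" for ys
  using source_sequence_clo[OF assms c, of ys] that by (simp add: clo_def)
 obtain l where l: "topo l" "set l = UNIV" using topo_exists by blast
 hence "\<exists>s' ys. distinct ys \<and> set ys = UNIV \<and> source_sequence em s ys \<and> s' = fold (mutate em) ys s"
  using e[of l] by (intro exI[of _ "fold (mutate em) l s"] exI[of _ l]) (simp add: topo_def)
 hence "\<exists>ys. distinct ys \<and> set ys = UNIV \<and> source_sequence em s ys \<and> sweep em s = fold (mutate em) ys s"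
  unfolding sweep_def by (rule someI_ex)
 thus ?thesis using e by blast
qed

lemma sweep_XS:
 fixes s :: "('r, 'n, 'f::field) seed"
 assumes "base s" "t \<le> Suc (rr j)"
 shows "snd ((sweep em ^^ t) s) (em j) = XS s (lbl t j)"
proof -
 have ac: "acyc ((sweep em ^^ t) s)" for t
 proof (induction t)
  case (Suc t)
  obtain l where "topo l" "set l = UNIV" "sweep em ((sweep em ^^ t) s) = fold (mutate em) l ((sweep em ^^ t) s)"
   using sweep_topo[OF Suc] by blast
  thus ?case using sweep(1)[OF Suc] by simp
 qed (use assms in \<open>simp add: base_def\<close>)
 show ?thesis
  unfolding XS_def
 proof (rule sweeps(4)[where S = "\<lambda>t. (sweep em ^^ t) s"])
  show "acyc s" "nonvan (rowJ (fst s)) (snd s)" using assms indep_nonvan by (auto simp: base_def)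
  show "\<exists>l. topo l \<and> set l = UNIV \<and> (sweep em ^^ Suc t) s = fold (mutate em) l ((sweep em ^^ t) s)" for t
   using sweep_topo[OF ac[of t]] by simp
 qed (use assms in auto)
qed

lemma XS_PX: "base s ==> XS s g = leval (snd s) (PX (fst s) g)"
 using XX_PX[of "snd s" "rowJ (fst s)" g] by (simp add: XS_def base_def rowJ_def[abs_def])

lemma labJ_UNIV: "labJ = lab" by (simp add: labJ_def)

end

lemma laurent_expansion_Fract [simp]: "laurent_expansion (Fract p 1) = p"
 unfolding laurent_expansion_def by (rule the_equality) (auto simp: Fract_1_eq)

context ldynkin begin

lemma id_seed: "useed a E d id" unfolding useed_def by (rule uu_seed)

interpretation u: useed a E d id by (rule id_seed)

abbreviation "B0 \<equiv> exchange_matrix a E"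

lemma base_initial: "u.base (initial_seed B0)"
proof -
 have "snd (initial_seed B0) = gy" by (auto simp: initial_seed_def gy_def)
 thus ?thesis using indep_gy by (simp add: u.base_def u.acyc_def u.BB_def initial_seed_def)
qed

lemma cluster_var_XS: "t \<le> Suc (rr j) ==> cluster_var B0 t j = u.XS (initial_seed B0) (lbl t j)"
 using u.sweep_XS[OF base_initial] by (simp add: cluster_var_def)

lemma cluster_var_eq:
 assumes "t \<le> Suc (rr i)" "s \<le> Suc (rr j)"
 shows "cluster_var B0 t i = cluster_var B0 s j \<longleftrightarrow> lbl t i = lbl s j"
 using u.XS_eq[OF base_initial] lbl_lab assms by (simp add: cluster_var_XS u.labJ_UNIV)

lemma return_time_eq: "return_time B0 i = Suc (rr i)"
 unfolding return_time_def
proof (rule Least_equality)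
 show "Suc (rr i) > 0 \<and> (\<exists>j. cluster_var B0 (Suc (rr i)) i = cluster_var B0 0 j)"
  using cluster_var_eq[of "Suc (rr i)" i 0 "star0 i"] by (auto simp: lbl_def)
 fix t assume t: "t > 0 \<and> (\<exists>j. cluster_var B0 t i = cluster_var B0 0 j)"
 show "Suc (rr i) \<le> t"
 proof (rule ccontr)
  assume "\<not> Suc (rr i) \<le> t"
  hence "t \<le> rr i" by simp
  thus False using t cluster_var_eq[of t i 0] by (auto simp: lbl_def)
 qed
qed

lemma r_index_eq: "r_index B0 i = rr i" by (simp add: r_index_def return_time_eq)

lemma star_eq: "star B0 i = star0 i"
 unfolding star_def return_time_eq
proof (rule the_equality)
 show "cluster_var B0 (Suc (rr i)) i = cluster_var B0 0 (star0 i)"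
  using cluster_var_eq[of "Suc (rr i)" i 0 "star0 i"] by (auto simp: lbl_def)
 show "cluster_var B0 (Suc (rr i)) i = cluster_var B0 0 j ==> j = star0 i" for j
  using cluster_var_eq[of "Suc (rr i)" i 0 j] by (auto simp: lbl_def)
qed

lemma labels_eq: "labels B0 = lab" by (simp add: labels_def lab_def r_index_eq)

lemma tau_eq: "tau B0 g = tu g"
 by (cases g rule: tu.cases) (simp_all add: r_index_eq star_eq)

lemma Min_of_int: "finite A ==> A \<noteq> {} ==> Min (real_of_int ` A) = of_int (Min A)"
 by (rule mono_Min_commute[symmetric]) (auto simp: mono_def)

lemma denominator_exponent_eq:
 assumes "g \<in> lab"
 shows "denominator_exponent k (cluster_var B0 (fst g) (snd g)) = dv g k - yb g k"
proof -
 let ?p = "u.PX B0 g"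
 have "lbl (fst g) (snd g) = g" "fst g \<le> Suc (rr (snd g))" using assms by (cases g; simp add: lbl_def lab_def)+
 hence "cluster_var B0 (fst g) (snd g) = leval gy ?p"
  using u.XS_PX[OF base_initial, of g] by (simp add: cluster_var_XS initial_seed_def gy_def[abs_def])
 hence "laurent_expansion (cluster_var B0 (fst g) (snd g)) = ?p" by (simp add: leval_gy)
 moreover have nz: "?p \<noteq> 0"
  unfolding u.PX_def using sfree_nz[OF sfree_ymon] trop_lsub(2)[OF sfree_Fp[OF assms]] by auto
 have "trop_laurent ?p (axis k 1) = of_int (Min ((\<lambda>m. lookup m k) ` keys ?p))"
 proof -
  have "trop_laurent ?p (axis k 1) = Min ((\<lambda>m. pr m (axis k 1)) ` keys ?p)"
   by (simp only: trop_laurent_def pr_def)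
  also have "(\<lambda>m. pr m (axis k 1)) ` keys ?p = real_of_int ` (\<lambda>m. lookup m k) ` keys ?p"
   by (simp only: image_image pr_axis)
  also have "Min (real_of_int ` (\<lambda>m. lookup m k) ` keys ?p) =
    of_int (Min ((\<lambda>m. lookup m k) ` keys ?p))"
   by (rule Min_of_int) (use nz in auto)
  finally show ?thesis .
 qed
 moreover have "trop_laurent ?p (axis k 1) = of_int (yb g k - dv g k)"
  using u.trop_PX[OF assms, of k B0] by (simp add: u.BB_def)
 ultimately have "laurent_expansion (cluster_var B0 (fst g) (snd g)) = ?p"
  "Min ((\<lambda>m. lookup m k) ` keys ?p) = yb g k - dv g k" by linarith+
 thus ?thesis unfolding denominator_exponent_def by simp
qed

lemma max_dv: "max 0 (dv g k - yb g k) = int (cc (0, k) g)"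
 by (cases g; cases "g = (0, k)") (auto simp: dv_def yb_def)

text \<open>Uniqueness: invariance under \<open>tu\<close> lowers the time of the first argument to
  \<open>0\<close>, where the values are prescribed by denominators.\<close>

lemma compatibility_degree_eq:
 "compatibility_degree B0 = (\<lambda>w g. if w \<in> lab \<and> g \<in> lab then cc w g else 0)"
 unfolding compatibility_degree_def labels_eq tau_eq
proof (rule the_equality)
 let ?c = "\<lambda>w g. if w \<in> lab \<and> g \<in> lab then cc w g else 0"
 show "(\<forall>w g. w \<notin> lab \<or> g \<notin> lab \<longrightarrow> ?c w g = 0) \<and> (\<forall>w\<in>lab. \<forall>g\<in>lab. ?c (tu w) (tu g) = ?c w g) \<and>
   (\<forall>i. \<forall>g\<in>lab. int (?c (0, i) g) = max 0 (denominator_exponent i (cluster_var B0 (fst g) (snd g))))"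
  using tu_lab cc_tu by (simp add: denominator_exponent_eq max_dv)
 fix c assume c: "(\<forall>w g. w \<notin> lab \<or> g \<notin> lab \<longrightarrow> c w g = 0) \<and> (\<forall>w\<in>lab. \<forall>g\<in>lab. c (tu w) (tu g) = c w g) \<and>
   (\<forall>i. \<forall>g\<in>lab. int (c (0, i) g) = max 0 (denominator_exponent i (cluster_var B0 (fst g) (snd g))))"
 have c0: "c (0, i) g = cc (0, i) g" if "g \<in> lab" for i g
 proof -
  have "int (c (0, i) g) = int (cc (0, i) g)" using c that by (simp only: denominator_exponent_eq max_dv)
  thus ?thesis by simp
 qed
 have "c (t, i) g = cc (t, i) g" if "(t, i) \<in> lab" "g \<in> lab" for t i g
  using that
 proof (induction t arbitrary: g)
  case (Suc t)
  have "c (Suc t, i) g = c (t, i) (tu g)" using c Suc.prems by (metis tu.simps(2))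
  also have "\<dots> = cc (t, i) (tu g)" using Suc.IH[of "tu g"] Suc.prems tu_lab by (simp add: lab_def)
  also have "\<dots> = cc (Suc t, i) g" using cc_tu[OF Suc.prems] by simp
  finally show ?case .
 qed (rule c0)
 thus "c = ?c" using c by (auto simp: fun_eq_iff)
qed

end

subsection \<open>Principal coefficients\<close>

text \<open>Row indices of a seed carry a linear order, so that Laurent polynomials in all variables
  form an integral domain.\<close>

instantiation sum :: (linorder, linorder) linorder
begin

fun less_eq_sum :: "'a + 'b => 'a + 'b => bool" where
 "less_eq_sum (Inl x) (Inl y) \<longleftrightarrow> x \<le> y"
| "less_eq_sum (Inr x) (Inr y) \<longleftrightarrow> x \<le> y"
| "less_eq_sum (Inl x) (Inr y) \<longleftrightarrow> True"
| "less_eq_sum (Inr x) (Inl y) \<longleftrightarrow> False"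

definition less_sum :: "'a + 'b => 'a + 'b => bool" where "less_sum x y \<longleftrightarrow> x \<le> y \<and> \<not> y \<le> x"

instance
proof
 fix x y z :: "'a + 'b"
 show "x < y \<longleftrightarrow> x \<le> y \<and> \<not> y \<le> x" by (rule less_sum_def)
 show "x \<le> x" by (cases x) auto
 show "x \<le> y ==> y \<le> z ==> x \<le> z" by (cases x; cases y; cases z) auto
 show "x \<le> y ==> y \<le> x ==> x = y" by (cases x; cases y) auto
 show "x \<le> y \<or> y \<le> x" by (cases x; cases y) auto
qed

end

definition lft :: "('n + 'n \<Rightarrow>\<^sub>0 int) => 'n::finite \<Rightarrow>\<^sub>0 int" where "lft m = Abs_poly_mapping (\<lambda>i. lookup m (Inl i))"

definition rgt :: "('n + 'n \<Rightarrow>\<^sub>0 int) => 'n::finite \<Rightarrow>\<^sub>0 int" where "rgt m = Abs_poly_mapping (\<lambda>i. lookup m (Inr i))"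

lemma lft_add: "lft (m + m') = lft m + lft m'" and rgt_add: "rgt (m + m') = rgt m + rgt m'"
 by (rule poly_mapping_eqI; simp add: lft_def rgt_def lookup_add)+

lemma lft_rgt_inj: "lft m = lft m' ==> rgt m = rgt m' ==> m = m'"
proof (rule poly_mapping_eqI)
 fix k assume e: "lft m = lft m'" "rgt m = rgt m'"
 show "lookup m k = lookup m' k"
 proof (cases k)
  case (Inl i)
  thus ?thesis using arg_cong[OF e(1), of "\<lambda>f. lookup f i"] by (simp add: lft_def)
 next
  case (Inr i)
  thus ?thesis using arg_cong[OF e(2), of "\<lambda>f. lookup f i"] by (simp add: rgt_def)
 qed
qed

text \<open>Regroups a Laurent polynomial in all variables as one in the \<open>x_i\<close> with
  coefficients in the \<open>y_i\<close>, the ring in which \<open>principal_seed\<close>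
  lives.\<close>

definition QQ :: "('n + 'n, int) laurent => ('n::finite, ('n, int) laurent) laurent" where
 "QQ = lsum (\<lambda>m c. single (lft m) (single (rgt m) c))"

lemma QQ_add: "QQ (p + q) = QQ p + QQ q"
 unfolding QQ_def by (rule lsum_add) (auto simp: single_add)

lemma QQ_mult: "QQ (p * q) = QQ p * QQ q"
 unfolding QQ_def by (rule lsum_mult) (auto simp: single_add mult_single lft_add rgt_add)

lemma QQ_single: "QQ (single m c) = single (lft m) (single (rgt m) c)"
 unfolding QQ_def by (rule lsum_single) simp

lemma lookup_QQ:
 "lookup (lookup (QQ p) (lft m)) (rgt m) = lookup p m"
proof -
 have "lookup (lookup (QQ p) (lft m)) (rgt m) =
   (\<Sum>m'\<in>keys p. if m' = m then lookup p m' else 0)"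
  unfolding QQ_def lsum_def lookup_sum
  by (rule sum.cong[OF refl]) (use lft_rgt_inj in \<open>auto simp: lookup_single when_def\<close>)
 thus ?thesis by (simp add: in_keys_iff)
qed

lemma keys_QQ:
 assumes "m \<in> keys (QQ p)" "l \<in> keys (lookup (QQ p) m)"
 shows "\<exists>k\<in>keys p. m = lft k \<and> l = rgt k"
proof (rule ccontr)
 assume n: "\<not> ?thesis"
 have "lookup (lookup (QQ p) m) l = 0"
  unfolding QQ_def lsum_def lookup_sum by (rule sum.neutral) (use n in \<open>auto simp: lookup_single when_def\<close>)
 thus False using assms(2) by (simp add: in_keys_iff)
qed

lemma leval_principal:
 fixes B :: "'n::{finite,linorder} => 'n => int"
 shows "leval (snd (principal_seed B)) p = Fract (QQ p) 1"
proof -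
 have "snd (principal_seed B) r = Fract (QQ (laurent_var r)) 1" for r
 proof (cases r)
  case (Inl i)
  have "lft (single (Inl i) 1) = (single i 1 :: 'n \<Rightarrow>\<^sub>0 int)" "rgt (single (Inl i :: 'n + 'n) 1) = 0"
   by (rule poly_mapping_eqI; simp add: lft_def rgt_def lookup_single when_def)+
  thus ?thesis using Inl by (simp add: principal_seed_def laurent_var_def QQ_single)
 next
  case (Inr i)
  have "rgt (single (Inr i) 1) = (single i 1 :: 'n \<Rightarrow>\<^sub>0 int)" "lft (single (Inr i :: 'n + 'n) 1) = 0"
   by (rule poly_mapping_eqI; simp add: lft_def rgt_def lookup_single when_def)+
  thus ?thesis using Inr by (simp add: principal_seed_def laurent_var_def laurent_const_def QQ_single)
 qed
 hence "snd (principal_seed B) = (\<lambda>r. Fract (QQ (laurent_var r)) 1)" by (rule ext)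
 moreover have "QQ (1 :: ('n + 'n, int) laurent) = 1"
 proof -
  have "lft (0 :: 'n + 'n \<Rightarrow>\<^sub>0 int) = 0" "rgt (0 :: 'n + 'n \<Rightarrow>\<^sub>0 int) = 0"
   by (rule poly_mapping_eqI; simp add: lft_def rgt_def)+
  thus ?thesis using QQ_single[of "0 :: 'n + 'n \<Rightarrow>\<^sub>0 int" 1] by (simp only: single_one)
 qed
 ultimately show ?thesis
  by (simp only:) (rule leval_hom[where \<phi> = "\<lambda>p. Fract (QQ p) 1"], simp_all add: QQ_add QQ_mult One_fract_def)
qed

lemma indep_principal: "indep (snd (principal_seed B))"
 unfolding indep_def leval_principal
proof (intro allI impI)
 fix p assume "Fract (QQ p) 1 = 0"
 hence "QQ p = 0" using Fract_1_eq[of "QQ p" 0] by (simp add: Zero_fract_def)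
 thus "p = 0" using lookup_QQ[of p] by (intro poly_mapping_eqI) simp
qed

context ldynkin begin

lemma Inl_seed: "useed a E d (Inl :: 'n => 'n + 'n)" by unfold_locales auto

interpretation q: useed a E d "Inl :: 'n => 'n + 'n" by (rule Inl_seed)

abbreviation "ps \<equiv> principal_seed (exchange_matrix a E)"

lemma base_ps: "q.base ps"
 using indep_principal by (simp add: q.base_def q.acyc_def q.BB_def principal_seed_def)

lemma XS_ps: "q.XS ps g = Fract (QQ (q.PX (fst ps) g)) 1"
 using q.XS_PX[OF base_ps] by (simp add: leval_principal)

lemma principal_cluster_var_eq:
 "(t, j) \<in> lab ==> principal_cluster_var (exchange_matrix a E) t j = q.XS ps (t, j)"
 using q.sweep_XS[OF base_ps, of t j] by (simp add: principal_cluster_var_def lab_def lbl_def)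

text \<open>The rows of the \<open>y_i\<close> are unit vectors. \<open>F\<close>-polynomials have
  constant term \<open>1\<close> and no negative powers, so the denominators of the separation
  formula are trivial.\<close>

lemma hx_ps: assumes "g \<in> lab" shows "q.hx (fst ps) (Inl k) g = gg k g" "q.hx (fst ps) (Inr k) g = 0"
proof -
 show "q.hx (fst ps) (Inl k) g = gg k g" by (simp add: q.hx_def q.frz_def)
 have "rv (fst ps (Inr k)) = axis k 1" by (auto simp: rv_def principal_seed_def vec_eq_iff axis_def)
 hence "Phi g (rv (fst ps (Inr k))) = 0"
  using trop_axis[of k "Fp g"] nonneg_Fp[OF assms] const_Fp[OF assms] by (simp add: Phi_def)
 hence "real_of_int (phz (fst ps (Inr k)) g) = 0" using phz[OF assms] by simp
 thus "q.hx (fst ps) (Inr k) g = 0" by (auto simp: q.hx_def q.frz_def)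
qed

text \<open>Each monomial has the form \<open>x^(g + B m) y^m\<close>. As \<open>y_j\<close> has
  minus column \<open>j\<close> of \<open>B\<close> as its degree, all of them have degree
  \<open>g\<close>.\<close>

lemma keys_PX_ps:
 assumes g: "c \<in> lab" and k: "k \<in> keys (q.PX (fst ps) c)"
 obtains m where "\<And>i. lookup (lft k) i = gg i c + (\<Sum>j\<in>UNIV. lookup m j * exchange_matrix a E i j)"
  "rgt k = m"
proof -
 obtain h m' where h: "h \<in> keys (ymon (\<lambda>r. q.hx (fst ps) r c))" "m' \<in> keys (lsub (fst ps) (Fp c))" "k = h + m'"
  using k keys_mult[of "ymon (\<lambda>r. q.hx (fst ps) r c)" "lsub (fst ps) (Fp c)"] unfolding q.PX_def by blast
 obtain m where m: "m' = Abs_poly_mapping (\<lambda>r. \<Sum>j\<in>UNIV. lookup m j * fst ps r j)"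
  using h(2) keys_lsub[of "fst ps" "Fp c"] by blast
 have l: "lookup k r = q.hx (fst ps) r c + (\<Sum>j\<in>UNIV. lookup m j * fst ps r j)" for r
  using h m by (simp add: ymon_def lookup_add)
 show ?thesis
 proof (rule that)
  show "lookup (lft k) i = gg i c + (\<Sum>j\<in>UNIV. lookup m j * exchange_matrix a E i j)" for i
   using hx_ps(1)[OF g] by (simp add: lft_def l) (simp add: principal_seed_def)
  show "rgt k = m"
  proof (rule poly_mapping_eqI)
   fix i
   have "(\<Sum>j\<in>UNIV. lookup m j * fst ps (Inr i) j) = (\<Sum>j\<in>UNIV. if j = i then lookup m j else 0)"
    by (rule sum.cong) (auto simp: principal_seed_def)
   thus "lookup (rgt k) i = lookup m i"
    using hx_ps(2)[OF g] by (simp add: rgt_def l)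
  qed
 qed
qed

lemma PX_ps_nz: assumes "g \<in> lab" shows "q.PX (fst ps) g \<noteq> 0"
proof -
 have "lsub (fst ps) (Fp g) \<noteq> 0" by (rule trop_lsub(2)[OF sfree_Fp[OF assms]])
 moreover have "ymon (\<lambda>r. q.hx (fst ps) r g) \<noteq> 0" by (rule sfree_nz[OF sfree_ymon])
 ultimately show ?thesis by (simp add: q.PX_def)
qed

theorem g_vector_eq:
 assumes g: "c \<in> lab"
 shows "g_vector (exchange_matrix a E) (q.XS ps c) = (\<chi> j. of_int (gg j c))"
 unfolding g_vector_def XS_ps laurent_expansion_Fract
proof (rule the_equality)
 let ?p = "q.PX (fst ps) c"
 let ?v = "(\<chi> j. of_int (gg j c)) :: (real, 'n) vec"
 show h: "homogeneous_of_degree (exchange_matrix a E) ?v (QQ ?p)"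
  unfolding homogeneous_of_degree_def
 proof (intro ballI)
  fix m l assume "m \<in> keys (QQ ?p)" "l \<in> keys (lookup (QQ ?p) m)"
  then obtain k where k: "k \<in> keys ?p" "m = lft k" "l = rgt k" using keys_QQ by blast
  obtain e where e: "\<And>i. lookup (lft k) i = gg i c + (\<Sum>j\<in>UNIV. lookup e j * exchange_matrix a E i j)" "rgt k = e"
   using keys_PX_ps[OF g k(1)] by metis
  show "monomial_degree (exchange_matrix a E) m l = ?v"
   unfolding monomial_degree_def k(2,3) e by (simp add: sum_negf)
 qed
 fix v assume v: "homogeneous_of_degree (exchange_matrix a E) v (QQ ?p)"
 obtain k where k: "lookup ?p k \<noteq> 0" using PX_ps_nz[OF g] by (metis lookup_zero poly_mapping_eqI)
 hence "lft k \<in> keys (QQ ?p)" "rgt k \<in> keys (lookup (QQ ?p) (lft k))"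
  using lookup_QQ[of ?p k] by (auto simp: in_keys_iff)
 thus "v = ?v" using h v unfolding homogeneous_of_degree_def by metis
qed

text \<open>Setting the \<open>x_i\<close> to \<open>1\<close> is the ring homomorphism
  \<open>\<psi>\<close> that forgets their exponents; it kills the monomial prefactor and turns the
  substituted \<open>F\<close>-polynomial back into itself.\<close>

theorem F_polynomial_eq:
 assumes g: "h \<in> lab"
 shows "F_polynomial (exchange_matrix a E) h = Fp h"
proof -
 let ?p = "q.PX (fst ps) h"
 define \<psi> :: "('n + 'n, int) laurent => ('n, int) laurent" where "\<psi> = lsum (\<lambda>m c. single (rgt m) c)"
 have mult: "\<psi> (p * q) = \<psi> p * \<psi> q" for p q
  unfolding \<psi>_def by (rule lsum_mult) (auto simp: single_add mult_single rgt_add)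
 have single: "\<psi> (single m c) = single (rgt m) c" for m c
  unfolding \<psi>_def by (rule lsum_single) simp
 have sum: "\<psi> (\<Sum>i\<in>S. f i) = (\<Sum>i\<in>S. \<psi> (f i))" for S and f :: "('n \<Rightarrow>\<^sub>0 int) => ('n + 'n, int) laurent"
  unfolding \<psi>_def by (rule lsum_sum) (auto simp: single_add)
 have "F_polynomial (exchange_matrix a E) h = lsum (\<lambda>m c. c) (QQ ?p)"
  using g by (cases h) (simp add: F_polynomial_def principal_cluster_var_eq XS_ps lsum_def Let_def)
 also have "\<dots> = (\<Sum>m\<in>keys ?p. lsum (\<lambda>m c. c) (single (lft m) (single (rgt m) (lookup ?p m))))"
  unfolding QQ_def lsum_def[of "\<lambda>m c. single (lft m) (single (rgt m) c)"] by (rule lsum_sum) auto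
 also have "\<dots> = \<psi> ?p" by (simp add: lsum_single \<psi>_def) (simp add: lsum_def)
 also have "\<dots> = \<psi> (ymon (\<lambda>r. q.hx (fst ps) r h)) * \<psi> (lsub (fst ps) (Fp h))" unfolding q.PX_def by (rule mult)
 also have "\<psi> (ymon (\<lambda>r. q.hx (fst ps) r h)) = 1"
 proof -
  have "rgt (Abs_poly_mapping (\<lambda>r. q.hx (fst ps) r h)) = 0"
   by (rule poly_mapping_eqI) (simp add: rgt_def hx_ps(2)[OF g])
  thus ?thesis by (simp add: ymon_def single)
 qed
 also have "\<psi> (lsub (fst ps) (Fp h)) = Fp h"
 proof -
  have r: "rgt (Abs_poly_mapping (\<lambda>r. \<Sum>j\<in>UNIV. lookup m j * fst ps r j)) = m" for m
  proof (rule poly_mapping_eqI)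
   fix i
   have "(\<Sum>j\<in>UNIV. lookup m j * fst ps (Inr i) j) = (\<Sum>j\<in>UNIV. if j = i then lookup m j else 0)"
    by (rule sum.cong) (auto simp: principal_seed_def)
   thus "lookup (rgt (Abs_poly_mapping (\<lambda>r. \<Sum>j\<in>UNIV. lookup m j * fst ps r j))) i = lookup m i"
    by (simp add: rgt_def)
  qed
  show ?thesis unfolding lsub_def lsum_def sum single r by (rule sum_monomials)
 qed
 finally show ?thesis by simp
qed

definition cset :: "(nat \<times> 'n) set => bool" where
 "cset K \<longleftrightarrow> K \<subseteq> lab \<and> (\<forall>w\<in>K. \<forall>g\<in>K. cc w g = 0)"

definition gv :: "nat \<times> 'n => (real, 'n) vec" where "gv g = (\<chi> j. of_int (gg j g))"

text \<open>Reachable clusters are compatible by \<open>TH_all\<close>, and compatible sets of full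
  size are clusters by \<open>FR_all\<close>.\<close>

theorem cluster_fan_eq:
 "cluster_fan (exchange_matrix a E) = {convex_cone hull (gv ` S) | S. \<exists>K. cset K \<and> card K = CARD('n) \<and> S \<subseteq> K}"
proof -
 have ju: "jseed a E d (Inl :: 'n => 'n + 'n) UNIV" by unfold_locales
 have inj: "inj_on (q.XS ps) lab" using q.XS_eq[OF base_ps] by (auto simp: inj_on_def q.labJ_UNIV)
 have cl: "clusters (exchange_matrix a E) = {q.XS ps ` K | K. cset K \<and> card K = CARD('n)}"
 proof (intro subset_antisym subsetI)
  fix C assume "C \<in> clusters (exchange_matrix a E)"
  then obtain s where s: "s \<in> rea Inl UNIV ps" "C = range (\<lambda>i. snd s (Inl i))"
   unfolding clusters_def rea_UNIV by blast
  have c: "q.CL ps s" using TH_all[OF ju base_ps] s(1) by (simp add: q.TH_def)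
  define K where "K = {g \<in> lab. q.XS ps g \<in> C}"
  have "C \<subseteq> q.VV ps" using c q.vc_VV(1) s(2) unfolding q.CL_def by blast
  hence C: "C = q.XS ps ` K" unfolding K_def q.VV_def q.labJ_UNIV by blast
  have "cset K"
   unfolding cset_def
  proof (intro conjI ballI)
   fix w g assume wg: "w \<in> K" "g \<in> K"
   then obtain i j where "q.XS ps w = snd s (Inl i)" "q.XS ps g = snd s (Inl j)" unfolding K_def s(2) by blast
   hence "q.vc ps (q.XS ps w) (q.XS ps g)" using c by (simp add: q.CL_def)
   thus "cc w g = 0" using q.vc_XS[OF base_ps] wg by (simp add: K_def q.labJ_UNIV)
  qed (auto simp: K_def)
  moreover have "card K = CARD('n)"
  proof -
   have "card C = CARD('n)" unfolding s(2) by (rule card_image) (rule q.ok_inj[OF q.ok_rea[OF s(1) q.base_ok[OF base_ps]]])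
   thus ?thesis unfolding C using card_image[OF inj_on_subset[OF inj, of K]] by (simp add: K_def)
  qed
  ultimately show "C \<in> {q.XS ps ` K | K. cset K \<and> card K = CARD('n)}" using C by blast
 next
  fix C assume "C \<in> {q.XS ps ` K | K. cset K \<and> card K = CARD('n)}"
  then obtain K where K: "cset K" "card K = CARD('n)" "C = q.XS ps ` K" by blast
  have Kl: "K \<subseteq> lab" using K(1) by (simp add: cset_def)
  have "q.pc ps C"
   unfolding q.pc_def K(3) q.VV_def q.labJ_UNIV using Kl K(1) q.vc_XS[OF base_ps] by (auto simp: cset_def q.labJ_UNIV subset_iff)
  moreover have "card C = CARD('n)" unfolding K(3) using card_image[OF inj_on_subset[OF inj Kl]] K(2) by simp
  ultimately obtain s where "s \<in> rea Inl UNIV ps" "range (\<lambda>i. snd s (Inl i)) = C"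
   using FR_all[OF ju base_ps] unfolding q.FR_def by blast
  thus "C \<in> clusters (exchange_matrix a E)" unfolding clusters_def rea_UNIV by blast
 qed
 have gv: "g_vector (exchange_matrix a E) ` q.XS ps ` S = gv ` S" if "S \<subseteq> lab" for S
  unfolding image_image by (rule image_cong[OF refl]) (use that g_vector_eq in \<open>auto simp: gv_def\<close>)
 show ?thesis
 proof (intro subset_antisym subsetI)
  fix G assume "G \<in> cluster_fan (exchange_matrix a E)"
  then obtain S K where S: "G = convex_cone hull (g_vector (exchange_matrix a E) ` S)" "S \<subseteq> q.XS ps ` K" and K: "cset K" "card K = CARD('n)"
   unfolding cluster_fan_def cl by blast
  obtain S' where S': "S' \<subseteq> K" "S = q.XS ps ` S'" using S(2) by (auto simp: subset_image_iff)
  have "S' \<subseteq> lab" using S' K by (auto simp: cset_def)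
  thus "G \<in> {convex_cone hull (gv ` S) | S. \<exists>K. cset K \<and> card K = CARD('n) \<and> S \<subseteq> K}"
   using gv[of S'] S S' K by auto
 next
  fix G assume "G \<in> {convex_cone hull (gv ` S) | S. \<exists>K. cset K \<and> card K = CARD('n) \<and> S \<subseteq> K}"
  then obtain S K where S: "G = convex_cone hull (gv ` S)" "cset K" "card K = CARD('n)" "S \<subseteq> K" by blast
  have "S \<subseteq> lab" using S by (auto simp: cset_def)
  hence "G = convex_cone hull (g_vector (exchange_matrix a E) ` (q.XS ps ` S))" using gv S(1) by simp
  moreover have "q.XS ps ` S \<subseteq> q.XS ps ` K" "q.XS ps ` K \<in> clusters (exchange_matrix a E)" using S cl by auto
  ultimately show "G \<in> cluster_fan (exchange_matrix a E)" unfolding cluster_fan_def by blast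
 qed
qed

end

section \<open>Positive Puiseux series\<close>

definition pv :: "puiseux => real => bool" where "pv x c \<longleftrightarrow> puiseux_lead_coeff x > 0 \<and> puiseux_val x = c"

lemma fls_lead_compose:
 fixes f :: "real fls"
 shows "k > 0 ==> fls_nth (fls_compose_power f k) (fls_subdegree (fls_compose_power f k)) = fls_nth f (fls_subdegree f)"
 by (simp add: fls_subdegree_compose_power fls_nth_compose_power)

lemma fls_lead_mult:
 fixes f g :: "real fls"
 shows "fls_nth (f * g) (fls_subdegree (f * g)) = fls_nth f (fls_subdegree f) * fls_nth g (fls_subdegree g)"
 by (cases "f = 0 \<or> g = 0") (auto simp flip: fls_times_base)

lemma lead_mult: "puiseux_lead_coeff (x * y) = puiseux_lead_coeff x * puiseux_lead_coeff y"
 by transfer (auto simp: puiseux_rel_Pair fls_lead_mult fls_lead_compose)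

lemma lead_1: "puiseux_lead_coeff 1 = 1"
 by transfer simp

lemma val_1: "puiseux_val 1 = 0"
 by transfer simp

lemma fls_val_mult:
 fixes f g :: "real fls"
 assumes "m > 0" "n > 0" "f \<noteq> 0" "g \<noteq> 0"
 shows "of_int (fls_subdegree (fls_compose_power f n * fls_compose_power g m)) / (real m * real n) =
  of_int (fls_subdegree f) / real m + of_int (fls_subdegree g) / real n"
 using assms by (simp add: fls_compose_power_eq_0_iff fls_subdegree_compose_power add_divide_distrib)

lemma val_mult: "puiseux_lead_coeff x \<noteq> 0 ==> puiseux_lead_coeff y \<noteq> 0 ==> puiseux_val (x * y) = puiseux_val x + puiseux_val y"
 by transfer (clarify, simp only: prod.case puiseux_rel_Pair, subst of_nat_mult, subst fls_val_mult, auto)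

lemma pv_mult: "pv x c ==> pv y e ==> pv (x * y) (c + e)"
 by (simp add: pv_def lead_mult val_mult)

lemma pv_1: "pv 1 0" by (simp add: pv_def lead_1 val_1)

lemma lead_0: "puiseux_lead_coeff 0 = 0"
 by transfer simp

lemma pv_nz: "pv x c ==> x \<noteq> 0"
 by (auto simp: pv_def lead_0)

lemma pv_inverse: assumes "pv x c" shows "pv (inverse x) (- c)"
proof -
 have e: "x * inverse x = 1" using pv_nz[OF assms] by simp
 have l: "puiseux_lead_coeff x * puiseux_lead_coeff (inverse x) = 1" using lead_mult[of x "inverse x"] e lead_1 by simp
 moreover have "puiseux_lead_coeff x > 0" using assms by (simp add: pv_def)
 ultimately have p: "puiseux_lead_coeff (inverse x) > 0" by (metis zero_less_mult_pos zero_less_one)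
 hence "puiseux_val x + puiseux_val (inverse x) = 0"
  using val_mult[of x "inverse x"] assms e val_1 by (simp add: pv_def)
 thus ?thesis using p assms by (simp add: pv_def)
qed

lemma pv_divide: "pv x c ==> pv y e ==> pv (x / y) (c - e)"
 using pv_mult[OF _ pv_inverse, of x c y e] by (simp add: divide_inverse)

lemma pv_power: "pv x c ==> pv (x ^ k) (of_nat k * c)"
 by (induction k) (auto simp: pv_1 algebra_simps dest: pv_mult[of x c])

lemma pv_powi: "pv x c ==> pv (x powi k) (of_int k * c)"
proof (cases k)
 case (nonneg n)
 thus "pv x c ==> ?thesis" using pv_power[of x c n] by simp
next
 case (neg n)
 have "x powi k = inverse (x ^ Suc n)" unfolding neg power_int_minus power_int_of_nat ..
 moreover have "of_int k * c = - (of_nat (Suc n) * c)" unfolding neg by (simp add: algebra_simps)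
 ultimately show "pv x c ==> ?thesis" using pv_inverse[OF pv_power[of x c "Suc n"]] by (simp only:)
qed

lemma pv_prod: "(\<And>i. i \<in> S ==> pv (f i) (c i)) ==> pv (\<Prod>i\<in>S. f i) (\<Sum>i\<in>S. c i)"
 by (induction S rule: infinite_finite_induct) (auto simp: pv_1 pv_mult)

lemma fls_add_lead:
 fixes f g :: "real fls"
 assumes "fls_nth f (fls_subdegree f) > 0" "fls_nth g (fls_subdegree g) > 0"
 shows "fls_subdegree (f + g) = min (fls_subdegree f) (fls_subdegree g)" "fls_nth (f + g) (fls_subdegree (f + g)) > 0"
proof -
 let ?k = "min (fls_subdegree f) (fls_subdegree g)"
 have p: "fls_nth (f + g) ?k > 0"
  by (cases "fls_subdegree f" "fls_subdegree g" rule: linorder_cases) (use assms in auto)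
 show s: "fls_subdegree (f + g) = ?k"
  by (rule fls_subdegree_eqI) (use p in auto)
 show "fls_nth (f + g) (fls_subdegree (f + g)) > 0" using p by (simp only: s)
qed

lemma fls_val_add:
 fixes f g :: "real fls"
 assumes "m > 0" "n > 0" "fls_nth f (fls_subdegree f) > 0" "fls_nth g (fls_subdegree g) > 0"
 defines "h \<equiv> fls_compose_power f n + fls_compose_power g m"
 shows "fls_nth h (fls_subdegree h) > 0 \<and> of_int (fls_subdegree h) / (real m * real n) =
  min (of_int (fls_subdegree f) / real m) (of_int (fls_subdegree g) / real n)"
proof -
 have "fls_nth (fls_compose_power f n) (fls_subdegree (fls_compose_power f n)) > 0"
  "fls_nth (fls_compose_power g m) (fls_subdegree (fls_compose_power g m)) > 0"
  using assms by (simp_all add: fls_lead_compose del: fls_subdegree_compose_power)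
 note fls_add_lead[OF this, folded h_def]
 moreover have "of_int (min (fls_subdegree (fls_compose_power f n)) (fls_subdegree (fls_compose_power g m))) / (real m * real n) =
   min (of_int (fls_subdegree f) / real m) (of_int (fls_subdegree g) / real n)"
  using assms(1,2) by (simp add: fls_subdegree_compose_power of_int_min min_divide_distrib_right)
 ultimately show ?thesis by simp
qed

lemma pv_add_aux:
 "puiseux_lead_coeff x > 0 ==> puiseux_lead_coeff y > 0 ==>
  puiseux_lead_coeff (x + y) > 0 \<and> puiseux_val (x + y) = min (puiseux_val x) (puiseux_val y)"
 by transfer (clarify, simp only: prod.case puiseux_rel_Pair of_nat_mult, rule fls_val_add, auto)

lemma pv_add: "pv x c ==> pv y e ==> pv (x + y) (min c e)"
 using pv_add_aux by (auto simp: pv_def)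

text \<open>The power of \<open>t\<close> with exponent \<open>p / (m + 1)\<close>; the successor
  keeps the denominator positive.\<close>

lift_definition tpow :: "nat => int => puiseux" is "\<lambda>m p. (Suc m, fls_X_intpow p)"
 by (simp add: puiseux_rel_Pair)

lemma pv_tpow: "pv (tpow m p) (of_int p / of_nat (Suc m))"
proof -
 have "fls_subdegree (fls_X_intpow p :: real fls) = p" by simp
 hence "puiseux_lead_coeff (tpow m p) = 1 \<and> puiseux_val (tpow m p) = of_int p / of_nat (Suc m)"
  by (transfer fixing: p) simp
 thus ?thesis by (simp add: pv_def)
qed

section \<open>The positive tropicalization\<close>

context ldynkin begin

text \<open>The valuations of the relations \<open>R\<^sub>g = 0\<close>.\<close>

definition TT :: "(nat \<times> 'n => real) set" where
 "TT = {v. \<forall>g. if g \<in> lab then min (v g) (\<Sum>w\<in>lab. of_nat (cc w g) * v w) = 0 else v g = 0}"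

lemma closed_TT: "closed TT"
 unfolding TT_def
proof (rule closed_Collect_all)
 fix g
 have c: "continuous_on UNIV (\<lambda>v :: nat \<times> 'n => real. v w)" for w by (rule continuous_on_product_coordinates)
 show "closed {v :: nat \<times> 'n => real. if g \<in> lab then min (v g) (\<Sum>w\<in>lab. of_nat (cc w g) * v w) = 0 else v g = 0}"
 proof (cases "g \<in> lab")
  case True
  have "continuous_on UNIV (\<lambda>v :: nat \<times> 'n => real. min (v g) (\<Sum>w\<in>lab. of_nat (cc w g) * v w))"
   by (intro continuous_on_min continuous_on_sum continuous_on_mult continuous_on_const c)
  from closed_Collect_eq[OF this continuous_on_const, of 0] show ?thesis using True by simp
 qed (use closed_Collect_eq[OF c continuous_on_const, of g 0] in simp)
qed

lemma TT_D: "v \<in> TT ==> g \<in> lab ==> min (v g) (\<Sum>w\<in>lab. of_nat (cc w g) * v w) = 0"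
 and TT_0: "v \<in> TT ==> g \<notin> lab ==> v g = 0"
 unfolding TT_def by (drule CollectD, drule spec[of _ g], simp)+

lemma ip_yb: "ip (yb (t, j)) Y = (if t = 0 then Y $ j else 0)"
proof -
 have "ip (yb (t, j)) Y = (\<Sum>i\<in>UNIV. if i = j then (if t = 0 then Y $ i else 0) else 0)"
  unfolding ip_def yb_def by (rule sum.cong) auto
 thus ?thesis by simp
qed

lemma sum_of_bool: "e \<in> lab ==> (\<Sum>h\<in>lab. of_bool (h = e) * f h) = (f e :: real)"
 using finite_lab by (simp add: of_bool_def mult_delta_left cong: if_cong)

definition tf :: "nat \<times> 'n => (real, 'n) vec => real" where "tf g Y = al g Y - Phi (tu g) Y - Phi g Y"

text \<open>The tropical form of \<open>prod_cc\<close>, obtained by applying it to exponentials of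
  real numbers.\<close>

lemma sum_cc_tf:
 assumes "g \<in> lab"
 shows "(\<Sum>w\<in>lab. of_nat (cc w g) * tf w Y) = ip (dv g) Y - Phi (tu g) Y - Phi g Y"
proof -
 have "exp (\<Sum>w\<in>lab. of_nat (cc w g) * tf w Y) = (\<Prod>w\<in>lab. (exp (ip (yb w) Y) *
   (\<Prod>i\<in>UNIV. exp (Phi (nb w i) Y) ^ wt i (snd w)) / (exp (Phi (tu w) Y) * exp (Phi w Y))) ^ cc w g)"
  unfolding exp_sum[OF finite_lab]
  by (rule prod.cong) (simp_all add: tf_def al_def exp_of_nat_mult exp_diff exp_add exp_sum)
 also have "\<dots> = (\<Prod>j\<in>UNIV. exp (ip (yb (0, j)) Y) ^ cc (0, j) g) / (exp (Phi (tu g) Y) * exp (Phi g Y))"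
  by (rule prod_cc[OF _ _ assms]) (simp_all add: ip_yb)
 also have "\<dots> = exp (ip (dv g) Y - Phi (tu g) Y - Phi g Y)"
  by (simp add: ip_yb exp_diff) (simp add: ip_def dv_def exp_sum exp_of_nat_mult)
 finally show ?thesis by simp
qed

definition tm :: "(real, 'n) vec => nat \<times> 'n => real" where "tm Y = (\<lambda>g. if g \<in> lab then tf g Y else 0)"

lemma sum_cc_tm: "g \<in> lab ==> (\<Sum>w\<in>lab. of_nat (cc w g) * tm Y w) = ip (dv g) Y - Phi (tu g) Y - Phi g Y"
 unfolding sum_cc_tf[symmetric] by (rule sum.cong) (auto simp: tm_def)

lemma tm_TT: "tm Y \<in> TT"
 unfolding TT_def
proof (clarsimp simp: sum_cc_tm, intro conjI impI)
 fix t j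
 show "(t, j) \<notin> lab ==> tm Y (t, j) = 0" by (simp add: tm_def)
 assume g: "(t, j) \<in> lab"
 show "min (tm Y (t, j)) (ip (dv (t, j)) Y - Phi (tu (t, j)) Y - Phi (t, j) Y) = 0"
  using Phi_mesh[OF g, of Y] g by (simp add: tm_def tf_def min_def split: if_splits)
qed

text \<open>On tropical points both numbers are nonnegative and one of them is zero, so the
  difference recovers them as its positive and negative parts.\<close>

definition Vf :: "(nat \<times> 'n => real) => nat \<times> 'n => real" where
 "Vf v g = v g - (\<Sum>w\<in>lab. of_nat (cc w g) * v w)"

lemma TT_Vf:
 assumes "v \<in> TT" "g \<in> lab"
 shows "v g = max (Vf v g) 0" "(\<Sum>w\<in>lab. of_nat (cc w g) * v w) = max (- Vf v g) 0"
proof -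
 have "min (v g) (\<Sum>w\<in>lab. of_nat (cc w g) * v w) = 0" by (rule TT_D[OF assms])
 thus "v g = max (Vf v g) 0" "(\<Sum>w\<in>lab. of_nat (cc w g) * v w) = max (- Vf v g) 0"
  by (auto simp: Vf_def min_def max_def split: if_splits)
qed

text \<open>The tropical counterpart of \<open>uok_mesh\<close>, a consequence of
  \<open>cc_mesh\<close>. It determines a tropical point from the values of \<open>Vf\<close> at
  time \<open>0\<close>.\<close>

lemma Vf_mesh:
 assumes v: "v \<in> TT" and g: "h \<in> lab"
 shows "Vf v h + Vf v (tu h) = - (\<Sum>i\<in>UNIV. of_nat (wt i (snd h)) * max (- Vf v (nb h i)) 0)"
proof -
 let ?S = "\<lambda>q. \<Sum>w\<in>lab. of_nat (cc w q) * v w"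
 have o: "(\<Sum>w\<in>lab. of_bool (w = e) * v w) = v e" if "e \<in> lab" for e
  using that by (rule sum_of_bool)
 have c: "real (cc w h) + real (cc w (tu h)) = of_bool (w = h) + of_bool (w = tu h) + (\<Sum>i\<in>UNIV. of_nat (wt i (snd h)) * of_nat (cc w (nb h i)))" if "w \<in> lab" for w
  using arg_cong[OF cc_mesh[OF that g], of real_of_int] by simp
 have "?S h + ?S (tu h) = (\<Sum>w\<in>lab. (real (cc w h) + real (cc w (tu h))) * v w)" by (simp add: distrib_right sum.distrib)
 also have "\<dots> = (\<Sum>w\<in>lab. of_bool (w = h) * v w + of_bool (w = tu h) * v w +
   (\<Sum>i\<in>UNIV. of_nat (wt i (snd h)) * (of_nat (cc w (nb h i)) * v w)))"
  by (rule sum.cong[OF refl]) (simp only: c distrib_right sum_distrib_right mult.assoc)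
 also have "\<dots> = v h + v (tu h) + (\<Sum>i\<in>UNIV. of_nat (wt i (snd h)) * ?S (nb h i))"
  unfolding sum.distrib o[OF g] o[OF tu_lab[OF g]] by (subst sum.swap) (simp add: sum_distrib_left)
 also have "(\<Sum>i\<in>UNIV. of_nat (wt i (snd h)) * ?S (nb h i)) = (\<Sum>i\<in>UNIV. of_nat (wt i (snd h)) * max (- Vf v (nb h i)) 0)"
  by (rule sum_nb_cong) (use TT_Vf(2)[OF v] nb_lab[OF g] in blast)
 finally show ?thesis by (simp add: Vf_def)
qed

lemma TT_inj:
 assumes "v \<in> TT" "w \<in> TT" "\<And>j. Vf v (0, j) = Vf w (0, j)"
 shows "v = w"
proof
 have V: "Vf v g = Vf w g" if "g \<in> lab" for g
  using that
 proof (induction rule: lab_induct)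
  case (Suc t j)
  have "(\<Sum>i\<in>UNIV. of_nat (wt i (snd (Suc t, j))) * max (- Vf v (nb (Suc t, j) i)) 0) = (\<Sum>i\<in>UNIV. of_nat (wt i (snd (Suc t, j))) * max (- Vf w (nb (Suc t, j) i)) 0)"
   by (rule sum_nb_cong) (use Suc(3) in simp)
  thus ?case using Vf_mesh[OF assms(1) Suc(1)] Vf_mesh[OF assms(2) Suc(1)] Suc(2) by simp
 qed (rule assms(3))
 fix g
 show "v g = w g"
 proof (cases "g \<in> lab")
  case True
  thus ?thesis using TT_Vf(1)[OF assms(1) True] TT_Vf(1)[OF assms(2) True] V by simp
 next
  case False
  thus ?thesis using TT_0[OF assms(1)] TT_0[OF assms(2)] by simp
 qed
qed

text \<open>Both the inverse of the tropical map and the map to the dual g-vector fan are of this form, for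
 \<open>P\<close> the reversed and the given orientation.\<close>

definition bq :: "('n => 'n => bool) => nat \<times> 'n => (real, 'n) vec" where
 "bq P g = (\<chi> j. of_bool (g = (0, j)) - of_nat (cc g (0, j)) + (\<Sum>i | P i j. of_nat (wt i j) * of_nat (cc g (0, i))))"

definition hq :: "('n => 'n => bool) => (nat \<times> 'n => real) => (real, 'n) vec" where
 "hq P v = (\<Sum>g\<in>lab. v g *\<^sub>R bq P g)"

text \<open>In the coordinates \<open>Vf v (0, i)\<close> the linear map becomes piecewise linear
  and triangular with respect to \<open>P\<close>.\<close>

lemma hq_TT:
 assumes "v \<in> TT"
 shows "hq P v $ j = Vf v (0, j) - (\<Sum>i | P i j. of_nat (wt i j) * min (Vf v (0, i)) 0)"
proof -
 have m: "min (Vf v (0, i)) 0 = - (\<Sum>g\<in>lab. of_nat (cc g (0, i)) * v g)" for i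
  using TT_Vf(2)[OF assms lab0, of i] by linarith
 have "hq P v $ j = (\<Sum>g\<in>lab. of_bool (g = (0, j)) * v g - of_nat (cc g (0, j)) * v g +
   (\<Sum>i | P i j. of_nat (wt i j) * (of_nat (cc g (0, i)) * v g)))"
  by (simp add: hq_def bq_def algebra_simps sum_distrib_left)
 also have "\<dots> = v (0, j) - (\<Sum>g\<in>lab. of_nat (cc g (0, j)) * v g) +
   (\<Sum>i | P i j. of_nat (wt i j) * (\<Sum>g\<in>lab. of_nat (cc g (0, i)) * v g))"
  unfolding sum.distrib sum_subtractf sum_of_bool[OF lab0] sum_distrib_left by (subst sum.swap) (rule refl)
 finally show ?thesis by (simp add: Vf_def[of v "(0, j)"] m sum_negf)
qed

lemma hq_inj:
 assumes P: "wf {(i, j). P i j}" and v: "v \<in> TT" "w \<in> TT" "hq P v = hq P w"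
 shows "v = w"
proof (rule TT_inj[OF v(1,2)])
 fix j show "Vf v (0, j) = Vf w (0, j)"
 proof (induction j rule: wf_induct_rule[OF P])
  case (1 j)
  have "hq P v $ j = hq P w $ j" using v(3) by simp
  moreover have "(\<Sum>i | P i j. of_nat (wt i j) * min (Vf v (0, i)) 0) = (\<Sum>i | P i j. of_nat (wt i j) * min (Vf w (0, i)) 0)"
   by (rule sum.cong) (use 1 in auto)
  ultimately show ?case by (simp add: hq_TT[OF v(1)] hq_TT[OF v(2)])
 qed
qed

abbreviation "Yv \<equiv> hq (\<lambda>i j. E j i)"

text \<open>The meshes at time \<open>0\<close> express \<open>Y $ j\<close> by
  \<open>al (0, j) Y\<close> and the truncations \<open>min (al (0, i) Y) 0\<close> at the
  successors of \<open>j\<close>; this is the shape of \<open>hq_TT\<close> for the reversed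
  orientation.\<close>

lemma Yv_tm: "Yv (tm Y) = Y"
proof -
 have V: "Vf (tm Y) (0, j) = al (0, j) Y" for j
  using sum_cc_tm[OF lab0, of j Y] by (simp add: Vf_def tm_def tf_def ip_def del: tu.simps)
 have P: "Phi (tu (0, i)) Y = min (al (0, i) Y) 0" for i
  using Phi_mesh[OF lab0, of i Y] by (simp add: ip_def del: tu.simps)
 have a: "al (0, j) Y = Y $ j + (\<Sum>i | E j i. of_nat (wt i j) * min (al (0, i) Y) 0)" for j
 proof -
  have "(\<Sum>i\<in>UNIV. of_nat (wt i j) * Phi (nb (0, j) i) Y) = (\<Sum>i\<in>UNIV. if E j i then of_nat (wt i j) * min (al (0, i) Y) 0 else 0)"
   by (rule sum.cong[OF refl]) (use wt_eq_0[of _ j] E_asym[of _ j] P in \<open>auto simp: nb_def simp del: tu.simps\<close>)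
  thus ?thesis by (simp add: al_def ip_yb sum.If_cases Int_def)
 qed
 have "Yv (tm Y) $ j = Y $ j" for j
 proof -
  have "Yv (tm Y) $ j = al (0, j) Y - (\<Sum>i | E j i. of_nat (wt i j) * min (al (0, i) Y) 0)" by (simp add: hq_TT[OF tm_TT] V)
  thus ?thesis using a[of j] by linarith
 qed
 thus ?thesis by (simp add: vec_eq_iff)
qed

lemma tm_Yv: "v \<in> TT ==> tm (Yv v) = v"
 by (rule hq_inj[OF wf_E_converse tm_TT]) (simp_all add: Yv_tm)

lemma range_tm: "range tm = TT"
proof
 show "range tm \<subseteq> TT" using tm_TT by blast
 show "TT \<subseteq> range tm"
 proof
  fix v assume "v \<in> TT"
  thus "v \<in> range tm" using tm_Yv[of v] rangeI[of tm "Yv v"] by simp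
 qed
qed

lemma continuous_trop:
 fixes p :: "('n, int) laurent"
 assumes "p \<noteq> 0" shows "continuous_on UNIV (\<lambda>Y. trop_laurent p Y)"
proof -
 have "continuous_on UNIV (\<lambda>Y :: (real, 'n) vec. Min ((\<lambda>m. \<Sum>i\<in>UNIV. of_int (lookup m i) * Y $ i) ` S))"
  if "finite S" "S \<noteq> {}" for S :: "('n \<Rightarrow>\<^sub>0 int) set"
  using that
 proof (induction S rule: finite_ne_induct)
  case (insert m S)
  thus ?case by (simp add: continuous_intros)
 qed (auto intro!: continuous_intros)
 thus ?thesis using assms by (simp add: trop_laurent_def)
qed

lemma continuous_tm: "continuous_on UNIV tm"
proof (rule continuous_on_coordinatewise_then_product)
 fix g
 have Ph: "continuous_on UNIV (Phi h)" if "h \<in> lab" for h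
  using continuous_trop[OF sfree_nz[OF sfree_Fp[OF that]]] by (simp add: Phi_def[abs_def])
 show "continuous_on UNIV (\<lambda>Y. tm Y g)"
 proof (cases "g \<in> lab")
  case True
  have "continuous_on UNIV (\<lambda>Y. \<Sum>i\<in>UNIV. of_nat (wt i (snd g)) * Phi (nb g i) Y)"
  proof (rule continuous_on_sum)
   fix i show "continuous_on UNIV (\<lambda>Y. of_nat (wt i (snd g)) * Phi (nb g i) Y)"
    using Ph[OF nb_lab[OF True, of i]] wt_eq_0[of i "snd g"]
    by (cases "E i (snd g) \<or> E (snd g) i") (auto intro!: continuous_intros)
  qed
  moreover have "continuous_on UNIV (\<lambda>Y. ip (yb g) Y)" unfolding ip_def by (intro continuous_intros)
  ultimately show ?thesis
   using True Ph[OF True] Ph[OF tu_lab[OF True]] by (simp add: tm_def tf_def al_def continuous_on_add continuous_on_diff)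
 qed (simp add: tm_def)
qed

lemma pv_leval_ymon:
 fixes Y :: "(real, 'n) vec"
 shows "(\<And>i. pv (y i) (Y $ i)) ==> pv (leval y (ymon x)) (ip x Y)"
 unfolding leval_ymon ip_def by (intro pv_prod pv_powi)

lemma pv_NN:
 assumes "g \<in> lab" "\<And>i. E i (snd g) \<or> E (snd g) i ==> pv (leval y (Fp (nb g i))) (Phi (nb g i) Y)"
 shows "pv (leval y (NN g)) (\<Sum>i\<in>UNIV. of_nat (wt i (snd g)) * Phi (nb g i) Y)"
 unfolding leval_NN[OF assms(1)]
proof (rule pv_prod)
 fix i show "pv (leval y (Fp (nb g i)) ^ wt i (snd g)) (of_nat (wt i (snd g)) * Phi (nb g i) Y)"
  using assms(2)[of i] wt_eq_0[of i "snd g"] pv_1 by (cases "E i (snd g) \<or> E (snd g) i") (auto intro: pv_power)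
qed

text \<open>Both summands of a mesh relation are positive, so the valuation of the sum is the
  minimum; dividing by the previous positive value continues the recursion.\<close>

lemma pv_Fp:
 fixes Y :: "(real, 'n) vec"
 assumes y: "\<And>i. pv (y i) (Y $ i)" and g: "h \<in> lab"
 shows "pv (leval y (Fp h)) (Phi h Y)"
 using g
proof (induction rule: lab_induct)
 case (Suc t j)
 let ?g = "(Suc t, j)"
 have "pv (leval y (ymon (yb ?g)) * leval y (NN ?g) + leval y (ymon (dv ?g))) (min (al ?g Y) (ip (dv ?g) Y))"
  unfolding al_def by (intro pv_add pv_mult pv_leval_ymon y pv_NN Suc) (use Suc in auto)
 hence "pv (leval y (Fp (t, j)) * leval y (Fp ?g)) (Phi (t, j) Y + Phi ?g Y)"
  using leval_mesh[OF Suc(1), of y] Phi_mesh[OF Suc(1), of Y] by simp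
 from pv_divide[OF this Suc(2)] show ?case using pv_nz[OF Suc(2)] by simp
qed (simp add: pv_1)

theorem positive_tropicalization_eq: "positive_tropicalization (exchange_matrix a E) = TT"
proof -
 let ?I = "(\<lambda>u h. if h \<in> lab then puiseux_val (u h) else 0) ` positive_puiseux_points (exchange_matrix a E)"
 have rel: "cluster_relation (exchange_matrix a E) u h = u h + (\<Prod>w\<in>lab. u w ^ cc w h) - 1" if "h \<in> lab" for u and h
  unfolding cluster_relation_def compatibility_degree_eq labels_eq using that by simp
 have sub: "?I \<subseteq> TT"
 proof
  fix v assume "v \<in> ?I"
  then obtain u where u: "u \<in> positive_puiseux_points (exchange_matrix a E)" "v = (\<lambda>h. if h \<in> lab then puiseux_val (u h) else 0)" by blast
  have p: "pv (u h) (v h)" if "h \<in> lab" for h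
   using u that by (auto simp: positive_puiseux_points_def labels_eq pv_def puiseux_positive_def)
  have "min (v h) (\<Sum>w\<in>lab. of_nat (cc w h) * v w) = 0" if g: "h \<in> lab" for h
  proof -
   have "pv (u h + (\<Prod>w\<in>lab. u w ^ cc w h)) (min (v h) (\<Sum>w\<in>lab. of_nat (cc w h) * v w))"
    by (intro pv_add pv_prod pv_power p g)
   moreover have "u h + (\<Prod>w\<in>lab. u w ^ cc w h) = 1"
    using u(1) g rel[OF g, of u] by (auto simp: positive_puiseux_points_def labels_eq)
   ultimately show ?thesis using val_1 by (simp add: pv_def)
  qed
  thus "v \<in> TT" using u(2) by (simp add: TT_def)
 qed
 \<comment> \<open>Rational points lift explicitly, with fractional powers of \<open>t\<close> as
   coefficients; density and continuity of \<open>tm\<close> supply the others.\<close>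
 have rat: "tm Y \<in> ?I" if r: "\<And>i. Y $ i \<in> \<rat>" for Y :: "(real, 'n) vec"
 proof -
  have "\<exists>x. pv x (Y $ i)" for i
  proof -
   obtain p q where "Y $ i = of_int p / of_nat q" "q > 0" using Rats_cases'[OF r[of i]] by (metis of_int_of_nat_eq zero_less_imp_eq_int of_nat_0_less_iff)
   thus ?thesis using pv_tpow[of "q - 1" p] by (intro exI[of _ "tpow (q - 1) p"]) simp
  qed
  then obtain y where y: "\<And>i. pv (y i) (Y $ i)" by metis
  note F = pv_Fp[where y = y and Y = Y, OF y]
  have g: "gen y" unfolding gen_def using pv_nz[OF F] by blast
  have u: "pv (ub y h) (tf h Y)" if "h \<in> lab" for h
  proof -
   have "pv (ub y h) (ip (yb h) Y + (\<Sum>i\<in>UNIV. of_nat (wt i (snd h)) * Phi (nb h i) Y) - (Phi (tu h) Y + Phi h Y))"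
    unfolding ub_def by (intro pv_divide pv_mult pv_leval_ymon y pv_NN F that tu_lab nb_lab)
   thus ?thesis by (simp add: tf_def al_def algebra_simps)
  qed
  have "ub y \<in> positive_puiseux_points (exchange_matrix a E)"
   unfolding positive_puiseux_points_def labels_eq using u ub_rel[OF g] rel[of _ "ub y"]
   by (auto simp: puiseux_positive_def pv_def)
  moreover have "tm Y = (\<lambda>h. if h \<in> lab then puiseux_val (ub y h) else 0)" using u by (auto simp: tm_def pv_def)
  ultimately show ?thesis by blast
 qed
 have dense: "closure {Y :: (real, 'n) vec. \<forall>i. Y $ i \<in> \<rat>} = UNIV"
 proof -
  have "Y \<in> closure {Y :: (real, 'n) vec. \<forall>i. Y $ i \<in> \<rat>}" for Y
  proof (unfold closure_approachable, intro allI impI)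
   fix e :: real assume e: "e > 0"
   let ?e = "e / (2 * CARD('n))"
   have pe: "?e > 0" using e by simp
   have "\<exists>q\<in>\<rat>. Y $ i - ?e < q \<and> q < Y $ i + ?e" for i
    using Rats_dense_in_real[of "Y $ i - ?e" "Y $ i + ?e"] pe by auto
   then obtain q where q: "\<And>i. q i \<in> \<rat> \<and> Y $ i - ?e < q i \<and> q i < Y $ i + ?e" by metis
   have "dist (\<chi> i. q i) Y \<le> (\<Sum>i\<in>UNIV. \<bar>q i - Y $ i\<bar>)"
    unfolding dist_norm using norm_le_l1_cart[of "(\<chi> i. q i) - Y"] by simp
   also have "\<dots> \<le> (\<Sum>i\<in>(UNIV :: 'n set). ?e)" by (rule sum_mono) (use q in \<open>smt (verit)\<close>)
   also have "\<dots> < e" using e by simp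
   finally show "\<exists>y\<in>{Y. \<forall>i. Y $ i \<in> \<rat>}. dist y Y < e" using q by (intro bexI[of _ "\<chi> i. q i"]) auto
  qed
  thus ?thesis by blast
 qed
 have "closure ?I = TT"
 proof
  show "closure ?I \<subseteq> TT" using sub closed_TT by (simp add: closure_minimal)
  have "tm ` closure {Y. \<forall>i. Y $ i \<in> \<rat>} \<subseteq> closure ?I"
   by (rule image_closure_subset) (use continuous_tm rat closure_subset[of ?I] in \<open>auto simp: dense\<close>)
  thus "TT \<subseteq> closure ?I" by (simp add: dense range_tm)
 qed
 thus ?thesis by (simp add: positive_tropicalization_def labels_eq)
qed

end

section \<open>The fan structure\<close>

definition orthant :: "'a set => ('a => real) set" where
 "orthant S = {v. (\<forall>g\<in>S. v g \<ge> 0) \<and> (\<forall>g. g \<notin> S \<longrightarrow> v g = 0)}"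

lemma norm_scaleR_less:
 fixes y :: "'a::real_normed_vector"
 assumes "e > 0" obtains c :: real where "c > 0" "norm (c *\<^sub>R y) < e"
proof
 let ?c = "e / (2 * (norm y + 1))"
 have n: "norm y + 1 > 0" by (simp add: add_nonneg_pos)
 show c: "?c > 0" using assms n by simp
 have "norm (?c *\<^sub>R y) = ?c * norm y" unfolding norm_scaleR using c by linarith
 also have "\<dots> \<le> ?c * (norm y + 1)" using c by (intro mult_left_mono) simp_all
 also have "\<dots> = e / 2" using n by (simp add: field_simps)
 finally show "norm (?c *\<^sub>R y) < e" using assms by linarith
qed

lemma orthant_nonneg: "v \<in> orthant S ==> v g \<ge> 0"
 by (cases "g \<in> S") (auto simp: orthant_def)

lemma orthant_0: "v \<in> orthant S ==> g \<notin> S ==> v g = 0"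
 by (simp add: orthant_def)

lemma orthant_mono: "S \<subseteq> K ==> orthant S \<subseteq> orthant K"
 using orthant_nonneg[of _ S] unfolding orthant_def by blast

lemma convex_orthant: "convex (orthant S)"
 by (rule convexI) (auto simp: orthant_def scaleR_fun_def)

text \<open>A nonempty face is determined by the coordinates that are positive somewhere on it. An
  average \<open>w\<close> of witnesses is positive in all of them, hence lies in an open segment
  from any other point of \<open>orthant S\<close> to a point of the orthant.\<close>

lemma orthant_face_of:
 assumes "finite K"
 shows "G \<noteq> {} \<and> G face_of orthant K \<longleftrightarrow> (\<exists>S\<subseteq>K. G = orthant S)"
proof
 assume "\<exists>S\<subseteq>K. G = orthant S"
 then obtain S where S: "S \<subseteq> K" "G = orthant S" by blast
 have "(0 :: 'a => real) \<in> orthant S" by (simp add: orthant_def)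
 moreover have "orthant S face_of orthant K"
  unfolding face_of_def
 proof (intro conjI ballI impI orthant_mono[OF S(1)] convex_orthant)
  fix v w x :: "'a => real"
  assume vw: "v \<in> orthant K" "w \<in> orthant K" and x: "x \<in> orthant S" "x \<in> open_segment v w"
  obtain u where u: "0 < u" "u < 1" "x = (1 - u) *\<^sub>R v + u *\<^sub>R w" using x(2) by (auto simp: in_segment)
  have "v g = 0 \<and> w g = 0" if "g \<notin> S" for g
  proof -
   have "x g = (1 - u) * v g + u * w g" unfolding u(3) by (simp add: scaleR_fun_def)
   moreover have "x g = 0" using x(1) that by (simp add: orthant_def)
   moreover have "(1 - u) * v g \<ge> 0" "u * w g \<ge> 0" using orthant_nonneg[OF vw(1)] orthant_nonneg[OF vw(2)] u by simp_all
   ultimately have "(1 - u) * v g = 0" "u * w g = 0" by linarith+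
   thus ?thesis using u by simp
  qed
  thus "v \<in> orthant S" "w \<in> orthant S"
   using orthant_nonneg[OF vw(1)] orthant_nonneg[OF vw(2)] by (auto simp: orthant_def)
 qed
 ultimately show "G \<noteq> {} \<and> G face_of orthant K" using S(2) by blast
next
 assume G: "G \<noteq> {} \<and> G face_of orthant K"
 have Gs: "G \<subseteq> orthant K" and Gc: "convex G" using G by (auto simp: face_of_def)
 define S where "S = {g \<in> K. \<exists>x\<in>G. x g > 0}"
 have fS: "finite S" using assms by (simp add: S_def)
 have sub: "G \<subseteq> orthant S"
 proof
  fix x assume x: "x \<in> G"
  hence xK: "x \<in> orthant K" using Gs by blast
  have "x g = 0" if "g \<notin> S" for g
  proof (cases "g \<in> K")
   case True
   hence "\<not> x g > 0" using that x by (auto simp: S_def)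
   thus ?thesis using orthant_nonneg[OF xK, of g] by linarith
  qed (use xK in \<open>simp add: orthant_def\<close>)
  thus "x \<in> orthant S" using orthant_nonneg[OF xK] by (simp add: orthant_def)
 qed
 have "orthant S \<subseteq> G"
 proof (cases "S = {}")
  case True
  have "orthant ({} :: 'a set) = {0}" by (auto simp: orthant_def)
  thus ?thesis using True sub G by auto
 next
  case False
  have "\<forall>g\<in>S. \<exists>x. x \<in> G \<and> x g > 0" by (auto simp: S_def)
  then obtain x where x: "\<And>g. g \<in> S ==> x g \<in> G" "\<And>g. g \<in> S ==> x g g > 0" by metis
  let ?c = "1 / real (card S)"
  have c: "?c > 0" using False fS by (simp add: card_gt_0_iff)
  define w where "w = (\<Sum>g\<in>S. ?c *\<^sub>R x g)"
  have w: "w \<in> G" unfolding w_def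
   by (rule convex_sum[OF fS Gc]) (use c x False fS in \<open>auto\<close>)
  have wv: "w g = (\<Sum>h\<in>S. ?c * x h g)" for g
  proof -
   have "(\<Sum>h\<in>T. ?c *\<^sub>R x h) g = (\<Sum>h\<in>T. ?c * x h g)" for T
    by (induction T rule: infinite_finite_induct) (simp_all add: scaleR_fun_def)
   thus ?thesis by (simp add: w_def)
  qed
  have wpos: "w g > 0" if "g \<in> S" for g
   unfolding wv
  proof (rule sum_pos2[OF fS that])
   show "0 < ?c * x g g" using c x(2)[OF that] by simp
   fix h assume "h \<in> S"
   hence "0 \<le> x h g" using orthant_nonneg[of "x h" K g] x(1) Gs by blast
   thus "0 \<le> ?c * x h g" using c by (intro mult_nonneg_nonneg) simp_all
  qed
  show ?thesis
  proof
   fix v assume v: "v \<in> orthant S"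
   \<comment> \<open>Small enough for \<open>w - u *\<^sub>R v\<close> to stay nonnegative;
     \<open>v g + 1\<close> avoids a division by zero and \<open>1 / 2\<close> keeps
     \<open>u\<close> below \<open>1\<close>.\<close>
   define u where "u = Min (insert (1 / 2) ((\<lambda>g. w g / (v g + 1)) ` S))"
   have vn: "v g \<ge> 0" for g by (rule orthant_nonneg[OF v])
   have v1: "v g + 1 > 0" for g using vn[of g] by linarith
   have u: "0 < u" "u < 1"
    unfolding u_def using fS wpos v1 by (auto simp: Min_less_iff)
   have uv: "u * v g \<le> w g" if "g \<in> S" for g
   proof -
    have "u \<le> w g / (v g + 1)" unfolding u_def by (rule Min_le) (use fS that in auto)
    hence "u * (v g + 1) \<le> w g" using v1[of g] by (simp add: pos_le_divide_eq)
    thus ?thesis using u by (simp add: distrib_left)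
   qed
   define y where "y = (1 / (1 - u)) *\<^sub>R (w - u *\<^sub>R v)"
   have "y \<in> orthant S"
    using uv u v sub w by (auto simp: y_def orthant_def scaleR_fun_def)
   hence yK: "y \<in> orthant K" and vK: "v \<in> orthant K" using orthant_mono[of S K] v by (auto simp: S_def)
   have wy: "w = (1 - u) *\<^sub>R y + u *\<^sub>R v" using u by (simp add: y_def)
   show "v \<in> G"
   proof (cases "y = v")
    case True
    hence "w = v" using wy by (simp add: algebra_simps)
    thus ?thesis using w by simp
   next
    case False
    hence "w \<in> open_segment y v" using wy u by (auto simp: in_segment)
    thus ?thesis using G yK vK w unfolding face_of_def by blast
   qed
  qed
 qed
 thus "\<exists>S\<subseteq>K. G = orthant S" using sub by (intro exI[of _ S]) (auto simp: S_def)
qed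

context ldynkin begin

lemma finite_cset: "cset K ==> finite K"
 using finite_subset[OF _ finite_lab] by (simp add: cset_def)

lemma cset_subset: "cset K ==> S \<subseteq> K ==> cset S"
 unfolding cset_def by blast

lemma orthant_TT: assumes "cset S" shows "orthant S \<subseteq> TT"
proof
 fix v assume v: "v \<in> orthant S"
 have "min (v g) (\<Sum>w\<in>lab. of_nat (cc w g) * v w) = 0" if "g \<in> lab" for g
 proof (cases "g \<in> S")
  case True
  have "(\<Sum>w\<in>lab. of_nat (cc w g) * v w) = 0"
  proof (rule sum.neutral, rule ballI)
   fix w
   have "w \<notin> S ==> v w = 0" by (rule orthant_0[OF v])
   thus "of_nat (cc w g) * v w = 0" using assms True by (cases "w \<in> S") (simp_all add: cset_def)
  qed
  thus ?thesis using orthant_nonneg[OF v, of g] by simp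
 next
  case False
  hence "v g = 0" by (rule orthant_0[OF v])
  moreover have "(\<Sum>w\<in>lab. of_nat (cc w g) * v w) \<ge> 0"
   by (intro sum_nonneg mult_nonneg_nonneg orthant_nonneg[OF v]) simp
  ultimately show ?thesis by simp
 qed
 moreover have "v g = 0" if "g \<notin> lab" for g using orthant_0[OF v, of g] that assms by (auto simp: cset_def)
 ultimately show "v \<in> TT" by (simp add: TT_def)
qed

lemma TT_nonneg: assumes "v \<in> TT" shows "v g \<ge> 0"
proof (cases "g \<in> lab")
 case True
 show ?thesis using TT_D[OF assms True] by linarith
qed (use TT_0[OF assms] in simp)

lemma TT_support:
 assumes v: "v \<in> TT"
 shows "cset {g. v g > 0}" "v \<in> orthant {g. v g > 0}"
proof -
 show "v \<in> orthant {g. v g > 0}" using TT_nonneg[OF v] by (auto simp: orthant_def intro: antisym)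
 have l: "g \<in> lab" if "v g > 0" for g using TT_0[OF v, of g] that by force
 have "cc w g = 0" if "v w > 0" "v g > 0" for w g
 proof -
  have "(\<Sum>w\<in>lab. of_nat (cc w g) * v w) = 0" using TT_D[OF v l[OF that(2)]] that(2) by linarith
  hence "of_nat (cc w g) * v w = 0"
   using sum_nonneg_eq_0_iff[OF finite_lab, of "\<lambda>w. of_nat (cc w g) * v w"] TT_nonneg[OF v] l[OF that(1)] by simp
  thus ?thesis using that(1) by simp
 qed
 thus "cset {g. v g > 0}" using l by (auto simp: cset_def)
qed

lemma linear_hq: "linear (hq P)"
 by (rule linearI) (simp_all add: hq_def scaleR_fun_def scaleR_add_left sum.distrib scaleR_sum_right)

lemma hq_orthant: assumes "cset K" "v \<in> orthant K" shows "hq P v = (\<Sum>g\<in>K. v g *\<^sub>R bq P g)"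
 unfolding hq_def by (rule sum.mono_neutral_right[OF finite_lab]) (use assms orthant_0[OF assms(2)] in \<open>auto simp: cset_def\<close>)

text \<open>Writing a combination as a difference of two points of the orthant turns injectivity of \<open>hq\<close> on
 \<open>TT\<close> into linear independence.\<close>

lemma bq_indep:
 assumes P: "wf {(i, j). P i j}" and K: "cset K" and s: "(\<Sum>h\<in>K. c h *\<^sub>R bq P h) = 0" and g: "h \<in> K"
 shows "c h = 0"
proof -
 define p where "p h = (if h \<in> K then max (c h) 0 else 0)" for h
 define m where "m h = (if h \<in> K then max (- c h) 0 else 0)" for h
 have o: "p \<in> orthant K" "m \<in> orthant K" by (simp_all add: p_def m_def orthant_def)
 hence pm: "p \<in> TT" "m \<in> TT" using orthant_TT[OF K] by blast+
 have "hq P p - hq P m = (\<Sum>h\<in>K. (p h - m h) *\<^sub>R bq P h)"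
  unfolding hq_orthant[OF K o(1)] hq_orthant[OF K o(2)] by (simp add: sum_subtractf scaleR_diff_left)
 also have "\<dots> = (\<Sum>h\<in>K. c h *\<^sub>R bq P h)"
  by (rule sum.cong) (auto simp: p_def m_def max_def)
 finally have "hq P p = hq P m" using s by simp
 hence "p = m" by (rule hq_inj[OF P pm])
 hence "p h = m h" by simp
 thus ?thesis using g by (auto simp: p_def m_def max_def split: if_splits)
qed

text \<open>The functionals are coordinates with respect to the independent vectors
  \<open>bq P g\<close>, extended linearly to the whole space.\<close>

lemma dual_basis:
 assumes P: "wf {(i, j). P i j}" and K: "cset K"
 shows "\<exists>f. (\<forall>q. linear (f q)) \<and> (\<forall>v\<in>orthant K. \<forall>q\<in>K. f q (hq P v) = v q) \<and>
   (card K = CARD('n) \<longrightarrow> (\<forall>Y. Y = (\<Sum>q\<in>K. f q Y *\<^sub>R bq P q)))"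
  and "card K \<le> CARD('n)"
proof -
 have fK: "finite K" by (rule finite_cset[OF K])
 have inj: "inj_on (bq P) K"
 proof (rule inj_onI, rule ccontr)
  fix q p assume g: "q \<in> K" "p \<in> K" "bq P q = bq P p" "q \<noteq> p"
  have "(\<Sum>z\<in>K. (of_bool (z = q) - of_bool (z = p)) *\<^sub>R bq P z) =
    (\<Sum>z\<in>K. (if z = q then bq P z else 0) - (if z = p then bq P z else 0))"
   by (rule sum.cong) auto
  also have "\<dots> = 0" using g fK by (simp add: sum_subtractf)
  finally show False using bq_indep[OF P K _ g(1)] g(4) by fastforce
 qed
 have ind: "independent (bq P ` K)"
 proof (rule independent_if_scalars_zero)
  fix c x assume c: "(\<Sum>x\<in>bq P ` K. c x *\<^sub>R x) = 0" and x: "x \<in> bq P ` K"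
  have "(\<Sum>q\<in>K. c (bq P q) *\<^sub>R bq P q) = 0" using c by (simp add: sum.reindex[OF inj])
  from bq_indep[OF P K this] show "c x = 0" using x by blast
 qed (use fK in simp)
 define f :: "nat \<times> 'n => (real, 'n) vec => real" where
  "f q = (SOME f. linear f \<and> (\<forall>x\<in>bq P ` K. f x = of_bool (x = bq P q)))" for q
 have f: "linear (f q) \<and> (\<forall>x\<in>bq P ` K. f q x = of_bool (x = bq P q))" for q
  unfolding f_def by (rule someI_ex[of "\<lambda>f. linear f \<and> (\<forall>x\<in>bq P ` K. f x = of_bool (x = bq P q))"]) (rule linear_independent_extend[OF ind])
 note fl = conjunct1[OF f]
 have fb: "f q (bq P p) = of_bool (p = q)" if "q \<in> K" "p \<in> K" for q p
  using bspec[OF conjunct2[OF f], OF imageI[OF that(2)], of q] inj_on_eq_iff[OF inj that(2,1)] by (simp only:)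
 have fs: "f q (\<Sum>p\<in>K. c p *\<^sub>R bq P p) = c q" if "q \<in> K" for q c
 proof -
  have "f q (\<Sum>p\<in>K. c p *\<^sub>R bq P p) = (\<Sum>p\<in>K. c p * of_bool (p = q))"
   unfolding linear_sum[OF fl] linear_cmul[OF fl] by (rule sum.cong) (simp_all add: fb that)
  thus ?thesis using that fK by (simp add: of_bool_def mult_delta_right cong: if_cong)
 qed
 have span: "Y = (\<Sum>q\<in>K. f q Y *\<^sub>R bq P q)" if "card K = CARD('n)" for Y
 proof -
  have "card (bq P ` K) = DIM((real, 'n) vec)" using that by (simp add: card_image[OF inj])
  hence "UNIV \<subseteq> span (bq P ` K)" using ind by (intro card_ge_dim_independent) simp_all
  hence "Y \<in> span (bq P ` K)" by blast
  then obtain u where "Y = (\<Sum>x\<in>bq P ` K. u x *\<^sub>R x)" using fK by (auto simp: span_finite)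
  hence e: "Y = (\<Sum>q\<in>K. u (bq P q) *\<^sub>R bq P q)" by (simp add: sum.reindex[OF inj])
  have "f q Y = u (bq P q)" if "q \<in> K" for q unfolding e by (rule fs[OF that])
  hence "(\<Sum>q\<in>K. f q Y *\<^sub>R bq P q) = (\<Sum>q\<in>K. u (bq P q) *\<^sub>R bq P q)" by simp
  thus ?thesis using e by simp
 qed
 have h: "f q (hq P v) = v q" if "v \<in> orthant K" "q \<in> K" for v q
  unfolding hq_orthant[OF K that(1)] by (rule fs[OF that(2)])
 have "card (bq P ` K) \<le> DIM((real, 'n) vec)" by (rule independent_card_le[OF ind])
 thus "card K \<le> CARD('n)" by (simp add: card_image[OF inj])
 show "\<exists>f. (\<forall>q. linear (f q)) \<and> (\<forall>v\<in>orthant K. \<forall>q\<in>K. f q (hq P v) = v q) \<and>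
   (card K = CARD('n) \<longrightarrow> (\<forall>Y. Y = (\<Sum>q\<in>K. f q Y *\<^sub>R bq P q)))"
  using fl h span by (intro exI[of _ f]) blast
qed

text \<open>As a linear image of an orthant it is clearly convex; by \<open>CK_iff\<close> it is
  also a preimage under \<open>tm\<close>, hence closed.\<close>

definition CK :: "(nat \<times> 'n) set => (real, 'n) vec set" where "CK K = Yv ` orthant K"

lemma CK_iff: assumes "cset K" shows "Y \<in> CK K \<longleftrightarrow> tm Y \<in> orthant K"
proof
 assume "Y \<in> CK K"
 then obtain v where "v \<in> orthant K" "Y = Yv v" by (auto simp: CK_def)
 thus "tm Y \<in> orthant K" using tm_Yv orthant_TT[OF assms] by auto
next
 assume "tm Y \<in> orthant K"
 thus "Y \<in> CK K" unfolding CK_def using Yv_tm[of Y] by force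
qed

lemma closed_orthant: "closed (orthant S :: (nat \<times> 'n => real) set)"
proof -
 have e: "(orthant S :: (nat \<times> 'n => real) set) = (\<Inter>g\<in>S. {v. 0 \<le> v g}) \<inter> (\<Inter>g\<in>-S. {v. v g = 0})"
  unfolding orthant_def by blast
 have c: "continuous_on UNIV (\<lambda>v :: nat \<times> 'n => real. v g)" for g by (rule continuous_on_product_coordinates)
 show ?thesis unfolding e
  by (intro closed_Int closed_INT ballI closed_Collect_le closed_Collect_eq continuous_on_const c)
qed

text \<open>The union of the \<open>CK K\<close> with \<open>K\<close> of full size is closed, and its complement lies in finitely
 many proper subspaces.\<close>

lemma cset_extend:
 assumes "cset S"
 shows "\<exists>K. cset K \<and> card K = CARD('n) \<and> S \<subseteq> K"
proof -
 note W = wf_E_converse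
 let ?F = "{K. cset K \<and> card K = CARD('n)}" and ?L = "{K. cset K \<and> card K < CARD('n)}"
 have fin: "finite {K. cset K}" by (rule finite_subset[of _ "Pow lab"]) (auto simp: cset_def finite_lab)
 have cl: "closed (\<Union>K\<in>?F. CK K)"
 proof (rule closed_UN)
  show "\<forall>K\<in>?F. closed (CK K)"
  proof
   fix K assume "K \<in> ?F"
   hence "CK K = tm -` orthant K" using CK_iff by auto
   thus "closed (CK K)" using closed_vimage[OF closed_orthant continuous_tm] by simp
  qed
 qed (use fin in simp)
 have ng: "negligible (\<Union>K\<in>?L. span (bq (\<lambda>i j. E j i) ` K))"
 proof (rule negligible_Union[of "(\<lambda>K. span (bq (\<lambda>i j. E j i) ` K)) ` ?L"])
  fix T assume "T \<in> (\<lambda>K. span (bq (\<lambda>i j. E j i) ` K)) ` ?L"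
  then obtain K where K: "cset K" "card K < CARD('n)" "T = span (bq (\<lambda>i j. E j i) ` K)" by blast
  have "dim T \<le> card K" unfolding K(3) dim_span
   by (rule order_trans[OF dim_le_card'] card_image_le finite_imageI finite_cset[OF K(1)])+
  thus "negligible T" using K(2) by (intro negligible_lowdim) simp
 qed (use fin in simp)
 have "- (\<Union>K\<in>?F. CK K) \<subseteq> (\<Union>K\<in>?L. span (bq (\<lambda>i j. E j i) ` K))"
 proof
  fix Y assume Y: "Y \<in> - (\<Union>K\<in>?F. CK K)"
  let ?S = "{g. tm Y g > 0}"
  note s = TT_support[OF tm_TT[of Y]]
  have "card ?S \<le> CARD('n)" by (rule dual_basis(2)[OF W s(1)])
  moreover have "card ?S \<noteq> CARD('n)" using Y s CK_iff[OF s(1)] by blast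
  moreover have "Y = (\<Sum>g\<in>?S. tm Y g *\<^sub>R bq (\<lambda>i j. E j i) g)"
   using hq_orthant[OF s, of "\<lambda>i j. E j i"] by (simp only: Yv_tm)
  hence "Y \<in> span (bq (\<lambda>i j. E j i) ` ?S)"
   by (metis (no_types, lifting) span_sum span_scale span_base imageI)
  ultimately show "Y \<in> (\<Union>K\<in>?L. span (bq (\<lambda>i j. E j i) ` K))" using s(1) by (intro UN_I[of ?S]) auto
 qed
 hence "negligible (- (\<Union>K\<in>?F. CK K))" by (rule negligible_subset[OF ng])
 hence "- (\<Union>K\<in>?F. CK K) = {}" using open_not_negligible[OF open_Compl[OF cl]] by blast
 hence all: "(\<Union>K\<in>?F. CK K) = UNIV" by blast
 define v :: "nat \<times> 'n => real" where "v g = of_bool (g \<in> S)" for g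
 have "v \<in> orthant S" by (simp add: v_def orthant_def)
 hence "tm (Yv v) = v" using tm_Yv orthant_TT[OF assms] by blast
 moreover obtain K where K: "cset K" "card K = CARD('n)" "Yv v \<in> CK K" using all by blast
 ultimately have o: "v \<in> orthant K" using CK_iff[OF K(1)] by simp
 have "S \<subseteq> K"
 proof
  fix g assume "g \<in> S"
  thus "g \<in> K" using orthant_0[OF o, of g] by (auto simp: v_def)
 qed
 thus ?thesis using K by blast
qed

lemma trop_f_eq: assumes "h \<in> lab" shows "trop_f a E h Y = tf h Y"
proof -
 obtain t j where g: "h = (t, j)" by force
 have n: "E i j ==> nb h i = (t, i)" "E j i ==> nb h i = tu (t, i)" for i
  using E_asym[of i j] unfolding nb_def g by auto
 have l: "E i j ==> (t, i) \<in> lab" "E j i ==> tu (t, i) \<in> lab" for i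
  using nb_lab[OF assms, of i] n[of i] by (simp_all add: g del: tu.simps)
 have w: "E i j \<or> E j i ==> of_int (- a i j) = real (wt i j)" for i using int_wt[of i j] by linarith
 have "(\<Sum>i\<in>{i. E i j}. of_int (- a i j) * trop_laurent (F_polynomial B0 (t, i)) Y) +
   (\<Sum>i\<in>{i. E j i}. of_int (- a i j) * trop_laurent (F_polynomial B0 (tau B0 (t, i))) Y) =
   (\<Sum>i\<in>{i. E i j}. of_nat (wt i j) * Phi (nb h i) Y) + (\<Sum>i\<in>{i. E j i}. of_nat (wt i j) * Phi (nb h i) Y)"
  by (intro arg_cong2[of _ _ _ _ "(+)"] sum.cong refl)
   (simp_all add: w n l tau_eq F_polynomial_eq Phi_def del: tu.simps of_int_minus)
 also have "\<dots> = (\<Sum>i\<in>{i. E i j} \<union> {i. E j i}. of_nat (wt i j) * Phi (nb h i) Y)"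
  by (rule sum.union_disjoint[symmetric]) (use E_asym in auto)
 also have "\<dots> = (\<Sum>i\<in>UNIV. of_nat (wt i j) * Phi (nb h i) Y)"
  by (rule sum.mono_neutral_left) (use wt_eq_0 in auto)
 finally have e: "(\<Sum>i\<in>{i. E i j}. of_int (- a i j) * trop_laurent (F_polynomial B0 (t, i)) Y) +
   (\<Sum>i\<in>{i. E j i}. of_int (- a i j) * trop_laurent (F_polynomial B0 (tau B0 (t, i))) Y) =
   (\<Sum>i\<in>UNIV. of_nat (wt i j) * Phi (nb h i) Y)" .
 have F: "trop_laurent (F_polynomial B0 (t, j)) Y = Phi h Y" "trop_laurent (F_polynomial B0 (tau B0 (t, j))) Y = Phi (tu h) Y"
  using assms tu_lab[OF assms] unfolding g by (simp_all add: tau_eq F_polynomial_eq Phi_def del: tu.simps)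
 show ?thesis
  unfolding trop_f_def g prod.case F[unfolded g] tf_def al_def snd_conv ip_yb using e unfolding g by linarith
qed

lemma trop_map_eq: "trop_map a E = tm"
 by (intro ext) (simp add: trop_map_def labels_eq tm_def trop_f_eq)

text \<open>On \<open>CK K\<close> the map \<open>tm\<close> inverts a linear map, and for
  \<open>K\<close> of full size the open set of points with positive coordinates in the basis lies
  in \<open>CK K\<close>.\<close>

lemma CK_domain:
 assumes K: "cset K" "card K = CARD('n)"
 shows "common_linearity_domain a E (CK K)"
proof -
 obtain f :: "nat \<times> 'n => (real, 'n) vec => real" where "(\<forall>h. linear (f h)) \<and> (\<forall>v\<in>orthant K. \<forall>h\<in>K. f h (Yv v) = v h) \<and>
   (card K = CARD('n) \<longrightarrow> (\<forall>Y. Y = (\<Sum>h\<in>K. f h Y *\<^sub>R bq (\<lambda>i j. E j i) h)))"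
  using dual_basis(1)[OF wf_E_converse K(1)] by (elim exE)
 hence f: "\<And>h. linear (f h)" "\<And>v h. v \<in> orthant K ==> h \<in> K ==> f h (Yv v) = v h"
  "\<And>Y. Y = (\<Sum>h\<in>K. f h Y *\<^sub>R bq (\<lambda>i j. E j i) h)" using K(2) by blast+
 have "convex (CK K)" unfolding CK_def by (intro convex_linear_image linear_hq convex_orthant)
 moreover have "interior (CK K) \<noteq> {}"
 proof -
  let ?U = "\<Inter>h\<in>K. {Y. f h Y > 0}"
  have "open ?U"
   by (intro open_INT finite_cset[OF K(1)] ballI open_Collect_less continuous_on_const linear_continuous_on linear_conv_bounded_linear[THEN iffD1] f(1))
  moreover have "?U \<subseteq> CK K"
  proof
   fix Y assume Y: "Y \<in> ?U"
   define v where "v h = (if h \<in> K then f h Y else 0)" for h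
   have v: "v \<in> orthant K" using Y by (auto simp: v_def orthant_def intro: less_imp_le)
   have "Yv v = (\<Sum>h\<in>K. f h Y *\<^sub>R bq (\<lambda>i j. E j i) h)" unfolding hq_orthant[OF K(1) v] by (simp add: v_def)
   hence "Yv v = Y" using f(3)[of Y] by simp
   thus "Y \<in> CK K" using v unfolding CK_def by blast
  qed
  moreover have "Yv (\<lambda>h. of_bool (h \<in> K)) \<in> ?U"
  proof
   fix h assume g: "h \<in> K"
   have "(\<lambda>h. of_bool (h \<in> K) :: real) \<in> orthant K" by (simp add: orthant_def)
   from f(2)[OF this g] show "Yv (\<lambda>h. of_bool (h \<in> K)) \<in> {Y. f h Y > 0}" using g by simp
  qed
  ultimately show ?thesis using interior_maximal by blast
 qed
 moreover have "\<exists>l. linear l \<and> (\<forall>Y\<in>CK K. trop_f a E h Y = l Y)" if g: "h \<in> lab" for h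
 proof (intro exI conjI ballI)
  let ?l = "if h \<in> K then f h else (\<lambda>_. 0)"
  show "linear ?l" using f(1) by (simp add: linear_zero)
  fix Y assume "Y \<in> CK K"
  then obtain v where v: "v \<in> orthant K" "Y = Yv v" by (auto simp: CK_def)
  have "tm Y = v" using v tm_Yv orthant_TT[OF K(1)] by blast
  hence "tf h Y = v h" using g by (auto simp: tm_def)
  thus "trop_f a E h Y = ?l Y" using trop_f_eq[OF g] f(2)[OF v(1)] orthant_0[OF v(1)] v(2) by simp
 qed
 ultimately show ?thesis unfolding common_linearity_domain_def labels_eq by blast
qed

text \<open>A nonnegative linear function on \<open>C\<close> that vanishes at an interior point is zero, so the
 support of \<open>tm Y\<close> at an interior point \<open>Y\<close> bounds the supports on all of \<open>C\<close>.\<close>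

lemma domain_subset:
 assumes "common_linearity_domain a E C"
 shows "\<exists>K. cset K \<and> card K = CARD('n) \<and> C \<subseteq> CK K"
proof -
 obtain Y0 where Y0: "Y0 \<in> interior C" using assms by (auto simp: common_linearity_domain_def)
 obtain e where e: "e > 0" "ball Y0 e \<subseteq> C" using Y0 by (auto simp: mem_interior)
 let ?S = "{h. tm Y0 h > 0}"
 note s = TT_support[OF tm_TT[of Y0]]
 obtain K where K: "cset K" "card K = CARD('n)" "?S \<subseteq> K" using cset_extend[OF s(1)] by blast
 have "tm Y \<in> orthant ?S" if Y: "Y \<in> C" for Y
 proof -
  have z: "tm Y h = 0" if g: "h \<notin> ?S" for h
  proof (cases "h \<in> lab")
   case True
   then obtain l where l: "linear l" "\<And>Y. Y \<in> C ==> trop_f a E h Y = l Y"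
    using assms unfolding common_linearity_domain_def labels_eq by blast
   have lt: "l Y = tm Y h" if "Y \<in> C" for Y using l(2)[OF that] trop_f_eq[OF True] True by (simp add: tm_def)
   have "Y0 \<in> C" using e by auto
   hence l0: "l Y0 = 0" using lt[of Y0] g TT_nonneg[OF tm_TT, of Y0 h] by auto
   have Yn: "l Y \<ge> 0" using lt[OF Y] TT_nonneg[OF tm_TT] by simp
   obtain c where c: "c > 0" "norm (c *\<^sub>R (Y - Y0)) < e" using norm_scaleR_less[OF e(1)] by blast
   have "Y0 - c *\<^sub>R (Y - Y0) \<in> C" using e(2) c(2) by (auto simp: dist_norm)
   hence "l (Y0 - c *\<^sub>R (Y - Y0)) \<ge> 0" using lt TT_nonneg[OF tm_TT] by simp
   hence "- (c * l Y) \<ge> 0" using l0 by (simp add: linear_diff[OF l(1)] linear_cmul[OF l(1)])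
   hence "l Y \<le> 0" using c(1) by (simp add: mult_le_0_iff)
   thus ?thesis using Yn lt[OF Y] by simp
  qed (simp add: tm_def)
  show ?thesis unfolding orthant_def using z TT_nonneg[OF tm_TT] by blast
 qed
 hence "C \<subseteq> CK K" using CK_iff[OF K(1)] orthant_mono[OF K(3)] by blast
 thus ?thesis using K by blast
qed

lemma CK_subset: assumes "cset K" "cset K'" "CK K \<subseteq> CK K'" shows "K \<subseteq> K'"
proof
 fix h assume g: "h \<in> K"
 let ?v = "\<lambda>h. of_bool (h \<in> K) :: real"
 have v: "?v \<in> orthant K" by (simp add: orthant_def)
 hence "Yv ?v \<in> CK K'" using assms(3) unfolding CK_def by blast
 hence o: "?v \<in> orthant K'" using CK_iff[OF assms(2)] tm_Yv[OF subsetD[OF orthant_TT[OF assms(1)] v]] by simp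
 show "h \<in> K'" using orthant_0[OF o, of h] g by auto
qed

text \<open>Every domain of linearity lies in some \<open>CK K\<close> by
  \<open>domain_subset\<close>, and by \<open>CK_subset\<close> such sets for \<open>K\<close> of
  full size are never properly nested.\<close>

lemma maximal_domain: "maximal_linearity_domain a E C \<longleftrightarrow> (\<exists>K. cset K \<and> card K = CARD('n) \<and> C = CK K)"
proof
 assume C: "maximal_linearity_domain a E C"
 hence cl: "common_linearity_domain a E C" and mx: "\<And>C'. common_linearity_domain a E C' ==> C \<subseteq> C' ==> C' = C"
  by (simp_all add: maximal_linearity_domain_def)
 obtain K where K: "cset K" "card K = CARD('n)" "C \<subseteq> CK K" using domain_subset[OF cl] by blast
 have "CK K = C" by (rule mx[OF CK_domain[OF K(1,2)] K(3)])
 thus "\<exists>K. cset K \<and> card K = CARD('n) \<and> C = CK K" using K by blast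
next
 assume "\<exists>K. cset K \<and> card K = CARD('n) \<and> C = CK K"
 then obtain K where K: "cset K" "card K = CARD('n)" "C = CK K" by blast
 have "C' = C" if C': "common_linearity_domain a E C'" "C \<subseteq> C'" for C'
 proof -
  obtain K' where K': "cset K'" "card K' = CARD('n)" "C' \<subseteq> CK K'" using domain_subset[OF C'(1)] by blast
  have "CK K \<subseteq> CK K'" using C'(2) K'(3) K(3) by simp
  from CK_subset[OF K(1) K'(1) this] have "K = K'" using card_subset_eq[OF finite_cset[OF K'(1)]] K(2) K'(2) by simp
  thus ?thesis using C'(2) K'(3) K(3) by simp
 qed
 thus "maximal_linearity_domain a E C" using CK_domain[OF K(1,2)] K(3) by (simp add: maximal_linearity_domain_def)
qed

lemma tropical_fan_eq: "tropical_fan a E = {orthant S | S. \<exists>K. cset K \<and> card K = CARD('n) \<and> S \<subseteq> K}"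
proof -
 have t: "tm ` CK K = orthant K" if "cset K" for K
 proof -
  have "tm (Yv v) = v" if "v \<in> orthant K" for v using tm_Yv orthant_TT[OF \<open>cset K\<close>] that by blast
  thus ?thesis unfolding CK_def image_image by simp
 qed
 show ?thesis
 proof (intro subset_antisym subsetI)
  fix G assume "G \<in> tropical_fan a E"
  then obtain C where C: "maximal_linearity_domain a E C" "G \<noteq> {}" "G face_of tm ` C"
   unfolding tropical_fan_def trop_map_eq by blast
  obtain K where K: "cset K" "card K = CARD('n)" "C = CK K" using C(1) unfolding maximal_domain by blast
  have "G \<noteq> {} \<and> G face_of orthant K" using C(2,3) unfolding K(3) t[OF K(1)] by blast
  then obtain S where "S \<subseteq> K" "G = orthant S" unfolding orthant_face_of[OF finite_cset[OF K(1)]] by blast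
  thus "G \<in> {orthant S | S. \<exists>K. cset K \<and> card K = CARD('n) \<and> S \<subseteq> K}" using K(1,2) by blast
 next
  fix G assume "G \<in> {orthant S | S. \<exists>K. cset K \<and> card K = CARD('n) \<and> S \<subseteq> K}"
  then obtain S K where S: "G = orthant S" "cset K" "card K = CARD('n)" "S \<subseteq> K" by blast
  have "G \<noteq> {} \<and> G face_of tm ` CK K"
   unfolding t[OF S(2)] orthant_face_of[OF finite_cset[OF S(2)]] using S(1,4) by blast
  moreover have "maximal_linearity_domain a E (CK K)" unfolding maximal_domain using S(2,3) by blast
  ultimately show "G \<in> tropical_fan a E" unfolding tropical_fan_def trop_map_eq by blast
 qed
qed

lemma Union_tropical_fan: "\<Union>(tropical_fan a E) = TT"
 unfolding tropical_fan_eq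
proof (intro subset_antisym subsetI)
 fix v assume v: "v \<in> TT"
 obtain K where K: "cset K" "card K = CARD('n)" "{g. v g > 0} \<subseteq> K" using cset_extend[OF TT_support(1)[OF v]] by blast
 show "v \<in> \<Union>{orthant S | S. \<exists>K. cset K \<and> card K = CARD('n) \<and> S \<subseteq> K}"
  by (rule UnionI[OF _ TT_support(2)[OF v]]) (use K in blast)
next
 fix v assume "v \<in> \<Union>{orthant S | S. \<exists>K. cset K \<and> card K = CARD('n) \<and> S \<subseteq> K}"
 then obtain S K where S: "v \<in> orthant S" "cset K" "S \<subseteq> K" by blast
 show "v \<in> TT" by (rule subsetD[OF orthant_TT[OF cset_subset[OF S(2,3)]] S(1)])
qed

text \<open>\<open>hq P \<circ> tm\<close> is injective and continuous, hence open, and it commutes with positive scalings, so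
 it is onto.\<close>

lemma hq_homeomorphism:
 assumes P: "wf {(i, j). P i j}"
 shows "\<exists>g. homeomorphism TT UNIV (hq P) g"
proof -
 let ?k = "\<lambda>Y. hq P (tm Y)"
 have ch: "continuous_on UNIV (hq P)" unfolding hq_def
  by (intro continuous_on_sum continuous_on_scaleR continuous_on_const continuous_on_product_coordinates)
 have ck: "continuous_on UNIV ?k" using continuous_on_compose2[OF ch continuous_tm] by simp
 have ik: "inj ?k"
 proof (rule injI)
  fix Y Z assume "?k Y = ?k Z"
  hence "tm Y = tm Z" by (rule hq_inj[OF P tm_TT tm_TT])
  thus "Y = Z" using Yv_tm by metis
 qed
 from invariance_of_domain_homeomorphism[OF open_UNIV ck _ ik] obtain g where g: "homeomorphism UNIV (range ?k) ?k g" by auto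
 have op: "open (range ?k)" by (rule invariance_of_domain[OF ck open_UNIV ik])
 have rk: "range ?k = hq P ` TT" unfolding range_tm[symmetric] by (rule image_image[symmetric])
 have sc: "c *\<^sub>R v \<in> TT" if "v \<in> TT" "c > 0" for v and c :: real
 proof -
  note s = TT_support[OF that(1)]
  have "c *\<^sub>R v \<in> orthant {u. v u > 0}"
   using s(2) that(2) by (auto simp: orthant_def scaleR_fun_def)
  thus ?thesis using orthant_TT[OF s(1)] by blast
 qed
 have "0 \<in> range ?k"
 proof -
  have "(0 :: nat \<times> 'n => real) \<in> orthant {}" by (simp add: orthant_def)
  hence "0 \<in> TT" using orthant_TT[of "{}"] by (auto simp: cset_def)
  thus ?thesis unfolding rk using linear_0[OF linear_hq, of P] by (metis imageI)
 qed
 then obtain e where e: "e > 0" "ball 0 e \<subseteq> range ?k" using op unfolding open_contains_ball by metis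
 have surj: "range ?k = UNIV"
 proof -
  have "Y \<in> range ?k" for Y
  proof -
   obtain c where c: "c > 0" "norm (c *\<^sub>R Y) < e" using norm_scaleR_less[OF e(1)] by blast
   hence "c *\<^sub>R Y \<in> ball 0 e" by simp
   hence "c *\<^sub>R Y \<in> hq P ` TT" using e(2) unfolding rk by blast
   then obtain v where v: "v \<in> TT" "c *\<^sub>R Y = hq P v" by blast
   have "Y = hq P ((1 / c) *\<^sub>R v)" using v(2)[symmetric] c by (simp add: linear_cmul[OF linear_hq])
   thus ?thesis unfolding rk using sc[OF v(1), of "1 / c"] c by simp
  qed
  thus ?thesis by blast
 qed
 have g': "continuous_on UNIV g" "\<And>Y. g (?k Y) = Y" "\<And>Z. ?k (g Z) = Z" using g by (auto simp: homeomorphism_def surj)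
 have "homeomorphism TT UNIV (hq P) (\<lambda>Z. tm (g Z))"
  unfolding homeomorphism_def
 proof (intro conjI ballI)
  show "continuous_on TT (hq P)" by (rule continuous_on_subset[OF ch]) simp
  show "continuous_on UNIV (\<lambda>Z. tm (g Z))" using continuous_on_compose2[OF continuous_tm g'(1)] by simp
  show h: "hq P ` TT = UNIV" using surj rk by simp
  show "hq P (tm (g Z)) = Z" for Z by (rule g'(3))
  show "tm (g (hq P v)) = v" if "v \<in> TT" for v
   by (rule hq_inj[OF P tm_TT that]) (rule g'(3))
  show "(\<lambda>Z. tm (g Z)) ` UNIV = TT"
  proof -
   have "range (\<lambda>Z. tm (g Z)) = tm ` range g" by (rule image_image[symmetric])
   also have "range g = UNIV" by (rule surjI[of g ?k, OF g'(2)])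
   finally show ?thesis by (simp add: range_tm)
  qed
 qed
 thus ?thesis by blast
qed

lemma hq_orthant_image:
 assumes "cset S"
 shows "hq P ` orthant S = convex_cone hull (bq P ` S)"
proof
 show "hq P ` orthant S \<subseteq> convex_cone hull (bq P ` S)"
 proof
  fix Y assume "Y \<in> hq P ` orthant S"
  then obtain v where v: "v \<in> orthant S" "Y = hq P v" by blast
  have "(\<Sum>h\<in>T. v h *\<^sub>R bq P h) \<in> convex_cone hull (bq P ` S)" if "T \<subseteq> S" for T
   using that
  proof (induction T rule: infinite_finite_induct)
   case (insert g T)
   have "v g *\<^sub>R bq P g \<in> convex_cone hull (bq P ` S)"
    by (intro convex_cone_hull_mul orthant_nonneg[OF v(1)] hull_inc imageI) (use insert(4) in simp)
   thus ?case unfolding sum.insert[OF insert(1,2)] by (rule convex_cone_hull_add) (use insert in simp)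
  qed (simp_all add: convex_cone_hull_contains_0)
  thus "Y \<in> convex_cone hull (bq P ` S)" unfolding v(2) hq_orthant[OF assms v(1)] by blast
 qed
 show "convex_cone hull (bq P ` S) \<subseteq> hq P ` orthant S"
 proof (rule hull_minimal)
  show "bq P ` S \<subseteq> hq P ` orthant S"
  proof (rule image_subsetI)
   fix h assume g: "h \<in> S"
   let ?v = "\<lambda>q. of_bool (q = h) :: real"
   have v: "?v \<in> orthant S" using g by (auto simp: orthant_def)
   have "hq P ?v = (\<Sum>q\<in>S. if q = h then bq P q else 0)" unfolding hq_orthant[OF assms v] by (rule sum.cong) auto
   also have "\<dots> = bq P h" using finite_cset[OF assms] g by simp
   finally show "bq P h \<in> hq P ` orthant S" using v by (metis imageI)
  qed
  have "convex_cone (orthant S :: (nat \<times> 'n => real) set)" by (auto simp: convex_cone_iff orthant_def scaleR_fun_def)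
  thus "convex_cone (hq P ` orthant S)" by (simp add: convex_cone_linear_image linear_hq)
 qed
qed

interpretation dl: ldynkin "dual_cartan a" E "\<lambda>i. 1 / d i"
 unfolding ldynkin_def by (rule dual)

text \<open>The denominators of the dual diagram are \<open>dl.cc (0, i) g = cc g (0, i)\<close>,
  and the sum over predecessors in its \<open>UU\<close> supplies the weights
  \<open>wt i j\<close>.\<close>

lemma dual_gv: "dl.gv g = bq E g"
proof -
 have "real_of_int (dl.gg j g) = of_bool (g = (0, j)) - of_nat (cc g (0, j)) + (\<Sum>i | E i j. of_nat (wt i j) * of_nat (cc g (0, i)))" for j
 proof -
  have "(\<Sum>i | E i j. of_int (dual_cartan a j i) * of_nat (dl.cc (0, i) g)) = (\<Sum>i | E i j. - (real (wt i j) * real (cc g (0, i))))"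
  proof (rule sum.cong[OF refl])
   fix i assume "i \<in> {i. E i j}"
   hence "real (wt i j) = - of_int (a i j)" using int_wt[of i j] by simp
   thus "of_int (dual_cartan a j i) * of_nat (dl.cc (0, i) g) = - (real (wt i j) * real (cc g (0, i)))"
    by (simp add: dual_cartan_def cc_swap[of g])
  qed
  thus ?thesis by (simp add: dl.gg_def dl.yb_def dl.UU_def dl.dv_def cc_swap[of g] sum_negf eq_commute[of g])
 qed
 thus ?thesis by (simp add: dl.gv_def bq_def)
qed

lemma dual_cset: "dl.cset K \<longleftrightarrow> cset K"
 unfolding cset_def dl.cset_def dual_lab cc_swap by blast

text \<open>The isomorphism is the restriction of the single linear map \<open>hq E\<close>, so
  linearity on cones is immediate; distinct cones have distinct images because the map is injective
  on \<open>TT\<close>.\<close>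

theorem fan_isomorphic_dual: "fan_isomorphic (tropical_fan a E) (cluster_fan (exchange_matrix (dual_cartan a) E))"
proof -
 let ?F = "{S. \<exists>K. cset K \<and> card K = CARD('n) \<and> S \<subseteq> K}"
 have T: "tropical_fan a E = orthant ` ?F" unfolding tropical_fan_eq by blast
 have h: "hq E ` orthant S = convex_cone hull (bq E ` S)" if "S \<in> ?F" for S
  by (rule hq_orthant_image) (use that cset_subset in blast)
 have gvE: "dl.gv = bq E" using dual_gv by blast
 have "cluster_fan (exchange_matrix (dual_cartan a) E) = (\<lambda>S. convex_cone hull (bq E ` S)) ` ?F"
  unfolding dl.cluster_fan_eq dual_cset gvE by blast
 also have "\<dots> = (\<lambda>S. hq E ` orthant S) ` ?F" using h by (intro image_cong) simp_all
 finally have C: "cluster_fan (exchange_matrix (dual_cartan a) E) = (\<lambda>C. hq E ` C) ` tropical_fan a E"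
  unfolding T by (simp add: image_image)
 obtain g where g: "homeomorphism TT UNIV (hq E) g" using hq_homeomorphism[OF wf_E] by blast
 have U: "\<Union>((\<lambda>C. hq E ` C) ` tropical_fan a E) = UNIV"
  using Union_tropical_fan homeomorphism_image1[OF g] by (metis image_Union)
 have sub: "C \<subseteq> TT" if "C \<in> tropical_fan a E" for C using that Union_tropical_fan by blast
 have inj: "inj_on (hq E) TT" using hq_inj[OF wf_E] by (auto intro: inj_onI)
 have "bij_betw (\<lambda>C. hq E ` C) (tropical_fan a E) (cluster_fan (exchange_matrix (dual_cartan a) E))"
  unfolding bij_betw_def C using inj_on_image_eq_iff[OF inj] sub by (auto intro: inj_onI)
 thus ?thesis
  unfolding fan_isomorphic_def C U Union_tropical_fan using g linear_hq by blast
qed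

end

theorem theorem9p2:
  fixes a :: "'n::{finite, linorder} \<Rightarrow> 'n \<Rightarrow> int"
    and E :: "'n \<Rightarrow> 'n \<Rightarrow> bool"
  assumes "finite_type_cartan a"
    and "connected_diagram a"
    and "orientation a E"
  shows "\<Union>(tropical_fan a E) = positive_tropicalization (exchange_matrix a E) \<and>
         fan_isomorphic (tropical_fan a E) (cluster_fan (exchange_matrix (dual_cartan a) E))"
proof -
 note ft = assms(1)[unfolded finite_type_cartan_def]
 have ax: "\<And>i. a i i = 2" "\<And>i j. i \<noteq> j ==> a i j \<le> 0" "\<And>i j. a i j = 0 ==> a j i = 0" using ft by simp_all
 from ft[THEN conjunct2, THEN conjunct2, THEN conjunct2] obtain d :: "'n => real" where
  d: "(\<forall>i. d i > 0) \<and> (\<forall>i j. d i * of_int (a i j) = d j * of_int (a j i)) \<and>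
    (\<forall>v :: (real, 'n) vec. v \<noteq> 0 \<longrightarrow> (\<Sum>i\<in>UNIV. \<Sum>j\<in>UNIV. d i * of_int (a i j) * v $ i * v $ j) > 0)"
  by (elim exE)
 interpret ldynkin a E d
  unfolding ldynkin_def by (rule dynkin.intro) (use ax d assms(3) in simp_all)
 show ?thesis using Union_tropical_fan positive_tropicalization_eq fan_isomorphic_dual by simp
qed

end
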